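(* Suppose the basic assumptions (1)–(5) hold in the template matching model $Y_i = f(X_i-\theta^* )+Z_i$. Suppose that $L$ has a bounded and almost everywhere continuous second derivative. Assume that $f$ is discontinuous and piecewise $\alpha$-Hölder with $\alpha>1/2$, and that $\lambda$ is bounded and continuous at the points of discontinuity of $f(\cdot-\theta^* )$, and strictly positive at one or more of these locations. Let $\mathcal{D}$ denote the discontinuity set of $f(\cdot-\theta^* )$ and, for $d\in\mathcal{D}$, let $\delta_d:=f(d^+-\theta^* )-f(d^--\theta^* )$. Let $W=\sum_{d\in\mathcal{D}}W_d$, where the $W_d$'s are independent with $W_d$ being the double-sided marked Poisson process on $\mathbb{R}$ with intensity $\lambda(d)$ and mark distribution that of $L(Z+\delta_d)-L(Z)$, and let $[\underline t,\overline t]$ be the closure of the set of minimum points of $W$. Then $n(\hat\theta_n-\theta^* )$ asymptotically (stochastically) dominates $\underline t$ and is dominated by $\overline t$, that is, for every $x\in\mathbb{R}$, $$\mathbb{P}(\overline t\le x)\le\liminf_{n\to\infty}\mathbb{P}\big(n(\hat\theta_n-\theta^* )\le x\big)\le\limsup_{n\to\infty}\mathbb{P}\big(n(\hat\theta_n-\theta^* )\le x\big)\le\mathbb{P}(\underline t\le x).$$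
   Context: Model. We observe $(X_1,Y_1),\dots,(X_n,Y_n)$ with $Y_i = f(X_i-\theta^* )+Z_i$, where $f:\mathbb{R}\to\mathbb{R}$ is a known function (the template) and $\theta^*\in\mathbb{R}$ is the unknown shift. The design points $X_i$ are iid with density $\lambda$; the noise variables $Z_i$ are iid with density $\phi$ and independent of the design points. $(X,Y)$ and $Z$ denote a generic observation and noise variable; $\mathbb{E}$ is expectation under the true shift $\theta^*$. M-estimator. Given a loss function $L:\mathbb{R}\to\mathbb{R}$, let $m_\theta(x,y) := L(y-f(x-\theta))$, $\widehat M_n(\theta) := \frac1n\sum_{i=1}^n m_\theta(X_i,Y_i)$, $M(\theta) := \mathbb{E}[m_\theta(X,Y)]$, and let $\hat\theta_n$ be a minimizer of $\widehat M_n$ over $\theta$. If $A$ is such that $f$ and $\lambda$ are both supported on $[-A,A]$, the model is $Y_i=Z_i$ for every $\theta$ outside $[-2A,2A]$, so the parameter is effectively restricted to the compact interval $[-2A,2A]$. Basic assumptions. (1) $f$ is compactly supported and càdlàg with none or finitely many discontinuities (in particular bounded); and for any $\theta\neq\theta^*$, $\int (f(x-\theta^* )-f(x-\theta))^2\lambda(x)\,dx>0$. (2) $\lambda$ is compactly supported. (3) $\phi$ is even. (4) $L$ is non-negative, even, non-decreasing away from the origin (i.e., on $[0,\infty)$), non-constant, and either Lipschitz or has a Lipschitz derivative. (5) $M$ is well-defined (finite); $\theta^*$ is the unique minimizer of $M$; and $\inf\{M(\theta):|\theta-\theta^*|\ge\delta\}>M(\theta^* )$ for every $\delta>0$. $f$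 is piecewise $\alpha$-Hölder ($0<\alpha\le1$) if, for some finite $H$, $|f(x_1)-f(x_2)|\le H|x_1-x_2|^\alpha$ whenever $f$ has no discontinuity between $x_1$ and $x_2$. Double-sided marked Poisson process with intensity $\kappa$ and a given mark distribution: take a homogeneous Poisson point process on $\mathbb{R}$ with rate $\kappa$ and attach to its points iid marks from the mark distribution, independent of the points; the process equals $0$ at $t=0$, at $t>0$ it is the sum of the marks of the points between $0$ and $t$, and at $t<0$ it is the sum of the marks of the points between $t$ and $0$. The values taken at the discontinuity points of $W$ are irrelevant. *)

theory Defs
  imports "HOL-Probability.Probability"
begin

definition discontinuities :: "(real \<Rightarrow> real) \<Rightarrow> real set" where
  "discontinuities g = {x. \<not> isCont g x}"

definition cadlag :: "(real \<Rightarrow> real) \<Rightarrow> bool" where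
  "cadlag g \<longleftrightarrow> (\<forall>x. (g \<longlongrightarrow> g x) (at_right x) \<and> (\<exists>l. (g \<longlongrightarrow> l) (at_left x)))"

definition compactly_supported :: "(real \<Rightarrow> real) \<Rightarrow> bool" where
  "compactly_supported g \<longleftrightarrow> compact (closure {x. g x \<noteq> 0})"

definition jump :: "(real \<Rightarrow> real) \<Rightarrow> real \<Rightarrow> real" where
  "jump g d = Lim (at_right d) g - Lim (at_left d) g"

text \<open>
  The interval free of discontinuities is taken closed. With an open interval the condition could
  not hold across the left side of a jump of a right-continuous function.
\<close>
definition piecewise_Holder :: "real \<Rightarrow> (real \<Rightarrow> real) \<Rightarrow> bool" where
  "piecewise_Holder \<alpha> g \<longleftrightarrow>
     (\<exists>H. \<forall>x1 x2. x1 \<le> x2 \<longrightarrow> {x1..x2} \<inter> discontinuities g = {} \<longrightarrow>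
        \<bar>g x1 - g x2\<bar> \<le> H * \<bar>x1 - x2\<bar> powr \<alpha>)"

definition has_Lipschitz_derivative :: "(real \<Rightarrow> real) \<Rightarrow> bool" where
  "has_Lipschitz_derivative L \<longleftrightarrow>
     (\<exists>L' C. (\<forall>z. (L has_real_derivative L' z) (at z)) \<and> C-lipschitz_on UNIV L')"

text \<open>
  \<open>L''\<close> may fail to exist on a null set, as for the Huber loss, provided that \<open>L'\<close> is Lipschitz.
  If \<open>L''\<close> exists everywhere and is bounded, this proviso holds automatically; without it, an
  almost everywhere second derivative would not determine \<open>L'\<close>.
\<close>
definition bounded_ae_continuous_second_derivative :: "(real \<Rightarrow> real) \<Rightarrow> bool" where
  "bounded_ae_continuous_second_derivative L \<longleftrightarrow>
     (\<exists>L' L'' C. (\<forall>z. (L has_real_derivative L' z) (at z)) \<and>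
        C-lipschitz_on UNIV L' \<and>
        (AE z in lborel. (L' has_real_derivative L'' z) (at z)) \<and>
        bounded (range L'') \<and>
        (AE z in lborel. isCont L'' z))"

definition m_loss :: "(real \<Rightarrow> real) \<Rightarrow> (real \<Rightarrow> real) \<Rightarrow> real \<Rightarrow> real \<Rightarrow> real \<Rightarrow> real" where
  "m_loss L f \<theta> x y = L (y - f (x - \<theta>))"

definition emp_risk ::
  "(real \<Rightarrow> real) \<Rightarrow> (real \<Rightarrow> real) \<Rightarrow> (nat \<Rightarrow> 'a \<Rightarrow> real) \<Rightarrow> (nat \<Rightarrow> 'a \<Rightarrow> real) \<Rightarrow> nat \<Rightarrow> 'a \<Rightarrow> real \<Rightarrow> real"
  where
  "emp_risk L f X Y n \<omega> \<theta> = (1 / real n) * (\<Sum>i<n. m_loss L f \<theta> (X i \<omega>) (Y i \<omega>))"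

definition pop_risk ::
  "'a measure \<Rightarrow> (real \<Rightarrow> real) \<Rightarrow> (real \<Rightarrow> real) \<Rightarrow> ('a \<Rightarrow> real) \<Rightarrow> ('a \<Rightarrow> real) \<Rightarrow> real \<Rightarrow> real"
  where
  "pop_risk P L f X Y \<theta> = (\<integral>\<omega>. m_loss L f \<theta> (X \<omega>) (Y \<omega>) \<partial>P)"

definition minimum_points :: "(real \<Rightarrow> real) \<Rightarrow> real set" where
  "minimum_points g = {t. \<forall>s. g t \<le> g s}"

definition bounded_borel :: "real set set" where
  "bounded_borel = {B \<in> sets borel. bounded B}"

text \<open>
  A point process is a random locally finite set \<open>S\<close>, observed through its counts on bounded Borel
  sets. Independence over finite disjoint families is included in the one for sequences, by
  padding with empty sets.
\<close>
definition (in prob_space) homogeneous_Poisson_process :: "real \<Rightarrow> ('a \<Rightarrow> real set) \<Rightarrow> bool" where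
  "homogeneous_Poisson_process \<kappa> S \<longleftrightarrow>
     (\<forall>\<omega>\<in>space M. \<forall>a b. finite (S \<omega> \<inter> {a..b})) \<and>
     (\<forall>B\<in>bounded_borel.
        random_variable (count_space UNIV) (\<lambda>\<omega>. card (S \<omega> \<inter> B)) \<and>
        distr M (count_space UNIV) (\<lambda>\<omega>. card (S \<omega> \<inter> B)) =
          measure_pmf (poisson_pmf (\<kappa> * measure lborel B))) \<and>
     (\<forall>B::nat \<Rightarrow> real set. range B \<subseteq> bounded_borel \<longrightarrow> disjoint_family B \<longrightarrow>
        indep_vars (\<lambda>_. count_space UNIV) (\<lambda>i \<omega>. card (S \<omega> \<inter> B i)) UNIV)"

text \<open>
  The marks are attached by enumerating the points outwards from the origin: for \<open>k \<ge> 1\<close>, the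
  \<open>k\<close>-th point to the right of \<open>0\<close> carries the mark \<open>\<xi> k\<close> and the \<open>k\<close>-th point to the left of \<open>0\<close>
  carries \<open>\<xi> (- k)\<close>; \<open>\<xi> 0\<close> is unused. A negative time adds the marks, just as a positive one does.
\<close>
definition (in prob_space) double_sided_marked_Poisson_process ::
  "real \<Rightarrow> real measure \<Rightarrow> ('a \<Rightarrow> real \<Rightarrow> real) \<Rightarrow> bool" where
  "double_sided_marked_Poisson_process \<kappa> \<mu> W \<longleftrightarrow>
     (\<exists>(S :: 'a \<Rightarrow> real set) (\<xi> :: int \<Rightarrow> 'a \<Rightarrow> real).
        homogeneous_Poisson_process \<kappa> S \<and>
        indep_vars (\<lambda>_. borel) \<xi> UNIV \<and>
        (\<forall>k. distr M borel (\<xi> k) = \<mu>) \<and>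
        indep_set
          (sets (vimage_algebra (space M) (\<lambda>\<omega>. \<lambda>B\<in>bounded_borel. card (S \<omega> \<inter> B))
             (\<Pi>\<^sub>M B\<in>bounded_borel. count_space UNIV)))
          (sets (vimage_algebra (space M) (\<lambda>\<omega> k. \<xi> k \<omega>) (\<Pi>\<^sub>M k\<in>UNIV. borel))) \<and>
        (\<forall>\<omega>\<in>space M. \<forall>t. W \<omega> t =
           (if 0 \<le> t then (\<Sum>k=1..card (S \<omega> \<inter> {0<..t}). \<xi> (int k) \<omega>)
            else (\<Sum>k=1..card (S \<omega> \<inter> {t..<0}). \<xi> (- int k) \<omega>))))"

end

theory Submission
  imports Defs "HOL-Combinatorics.Multiset_Permutations"
begin

text \<open>
  Rescaled by \<open>1/n\<close> around the true shift, the risk increment is a sum over the sample. Its smooth part has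
  square-root fluctuations of order \<open>n powr (1/2 - \<alpha>)\<close> on bounded windows, which vanish since \<open>\<alpha> > 1/2\<close>; what
  remains is one mark \<open>L (Z \<plusminus> \<delta> d) - L Z\<close> for every design point within the window at a jump \<open>d\<close>, and by
  symmetry of \<open>Z\<close> and \<open>L\<close> the sign is immaterial. On a grid of time cells the multinomial counts of design points
  become independent Poisson counts, so the cell sums converge to the increments of \<open>W\<close> on every measurable
  set, with no condition on the mark law. Up to the rare event of two design points in one cell the risk takes only
  grid values. Hence a minimizer in a half-line makes the grid restriction of \<open>W\<close> nearly minimal there;
  refining the mesh and then enlarging the window turns this into a true minimum point of \<open>W\<close> in the
  half-line, because paths of \<open>W\<close> take finitely many values on bounded intervals.

  Tightness rests on a linear lower bound for the risk: chaining controls the fluctuations, and the drift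
  \<open>\<Sum>d. lam d * E (L (Z + \<delta> d) - L Z)\<close> is positive, since otherwise \<open>W\<close> would oscillate or tend to minus
  infinity and could not have a nonempty bounded set of minimum points.
\<close>

section \<open>Piecewise Hoelder functions and losses with Lipschitz derivative\<close>

text \<open>The argmin is not continuous at paths with flat stretches, which \<open>W\<close> has,
  so the law of the rescaled estimator can only be squeezed between two laws. The tractable events
  are closed half-lines: asymptotically the estimator lies in one with at most the probability that
  \<open>W\<close> has a minimum point there. For \<open>{..x}\<close> this gives the bound by
  \<open>tlow \<le> x\<close>. For \<open>{x..}\<close> it gives the strict
  \<open>x < thigh\<close>, since \<open>W\<close> is almost surely constant just to the right of a
  fixed \<open>x\<close>. Evenness of \<open>L\<close> and \<open>\<phi>\<close> centres
  \<open>L' Z\<close>, so the smooth part has no drift. Nonnegativity of \<open>L\<close> yields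
  \<open>(L' z)\<^sup>2 \<le> 4 * C * L z\<close>, so integrability of the loss supplies the second
  moments. Given the cell counts, cell sums of the sample and increments of \<open>W\<close> have
  the same law, so only multinomial weights have to converge. The grid unit \<open>u\<close> is
  \<open>|x|\<close>, which makes \<open>x\<close> a grid time for every mesh \<open>u / m\<close>.
  On a window of \<open>N\<close> units collisions have probability of order \<open>N / m\<close>,
  which is small when \<open>m\<close> grows for fixed \<open>N\<close>.\<close>

lemma isCont_shift_iff: "isCont (\<lambda>x. g (x - c)) x \<longleftrightarrow> isCont g (x - (c::real))" for g :: "real \<Rightarrow> real"
proof -
  have "isCont (\<lambda>x. g (x - c)) x" if "isCont g (x - c)" for g :: "real \<Rightarrow> real" and x c
    using that by (intro isCont_o2[of x "\<lambda>x. x - c" g]) auto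
  from this[where g=g and x=x and c=c] this[where g="\<lambda>x. g (x - c)" and x="x - c" and c="- c"] show ?thesis by auto
qed

lemma discontinuities_shift: "discontinuities (\<lambda>x. g (x - c)) = (\<lambda>x. x + c) ` discontinuities g"
proof -
  have "x \<in> (\<lambda>x. x + c) ` {x. \<not> isCont g x}" if "\<not> isCont g (x - c)" for x
    using that by (intro image_eqI[of _ _ "x - c"]) auto
  then show ?thesis
    unfolding discontinuities_def isCont_shift_iff by auto
qed

lemma cadlag_shift: "cadlag g \<Longrightarrow> cadlag (\<lambda>x. g (x - c))"
  unfolding cadlag_def
proof (intro allI conjI)
  fix x :: real
  assume *: "\<forall>x. (g \<longlongrightarrow> g x) (at_right x) \<and> (\<exists>l. (g \<longlongrightarrow> l) (at_left x))"
  have "filterlim (\<lambda>x. x - c) (at_right (x - c)) (at_right x)"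
    by (auto simp: filterlim_at eventually_at_filter intro!: tendsto_intros)
  then show "((\<lambda>x. g (x - c)) \<longlongrightarrow> g (x - c)) (at_right x)"
    using * filterlim_compose by blast
  obtain l where l: "(g \<longlongrightarrow> l) (at_left (x - c))" using * by blast
  have "filterlim (\<lambda>x. x - c) (at_left (x - c)) (at_left x)"
    by (auto simp: filterlim_at eventually_at_filter intro!: tendsto_intros)
  then show "\<exists>l. ((\<lambda>x. g (x - c)) \<longlongrightarrow> l) (at_left x)"
    using filterlim_compose l by blast
qed

lemma piecewise_Holder_shift:
  assumes "piecewise_Holder \<alpha> g" shows "piecewise_Holder \<alpha> (\<lambda>x. g (x - c))"
proof -
  obtain H where H: "\<And>x y. x \<le> y \<Longrightarrow> {x..y} \<inter> discontinuities g = {} \<Longrightarrow> \<bar>g x - g y\<bar> \<le> H * \<bar>x - y\<bar> powr \<alpha>"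
    using assms unfolding piecewise_Holder_def by blast
  have "\<bar>g (x - c) - g (y - c)\<bar> \<le> H * \<bar>x - y\<bar> powr \<alpha>"
    if "x \<le> y" "{x..y} \<inter> discontinuities (\<lambda>x. g (x - c)) = {}" for x y
  proof -
    have "{x - c..y - c} \<inter> discontinuities g = {}"
      proof (intro equals0I)
      fix z assume "z \<in> {x - c..y - c} \<inter> discontinuities g"
      then have "z + c \<in> {x..y} \<inter> (\<lambda>x. x + c) ` discontinuities g" by auto
      then show False using that(2) unfolding discontinuities_shift by blast
    qed
    then show ?thesis using H[of "x - c" "y - c"] that(1) by simp
  qed
  then show ?thesis unfolding piecewise_Holder_def by blast
qed

lemma cadlag_at_right: "cadlag g \<Longrightarrow> (g \<longlongrightarrow> g x) (at_right x)"
  by (simp add: cadlag_def)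

lemma cadlag_at_left: "cadlag g \<Longrightarrow> (g \<longlongrightarrow> g x - jump g x) (at_left x)"
proof -
  assume g: "cadlag g"
  then obtain l where l: "(g \<longlongrightarrow> l) (at_left x)" by (auto simp: cadlag_def)
  have "Lim (at_right x) g = g x" "Lim (at_left x) g = l"
    using l cadlag_at_right[OF g, of x] by (auto intro!: tendsto_Lim)
  then show ?thesis using l by (simp add: jump_def)
qed

text \<open>Subtracting the step function of the jumps leaves a continuous function. Continuity
  extends the Hoelder bound from closed to open intervals without discontinuities, and induction on
  the number of discontinuities between two points chains it across them, each one adding a copy of
  the constant.\<close>

lemma piecewise_Holder_continuous_part:
  fixes F :: "real \<Rightarrow> real"
  assumes cad: "cadlag F" and fin: "finite (discontinuities F)" and hol: "piecewise_Holder \<alpha> F"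
    and \<alpha>: "0 < \<alpha>"
  obtains H where "0 < H"
    "\<And>x y. \<bar>(F x - (\<Sum>d\<in>discontinuities F. jump F d * indicator {d..} x))
           - (F y - (\<Sum>d\<in>discontinuities F. jump F d * indicator {d..} y))\<bar> \<le> H * \<bar>x - y\<bar> powr \<alpha>"
proof -
  define D where "D = discontinuities F"
  define G where "G x = F x - (\<Sum>d\<in>D. jump F d * indicator {d..} x)" for x
  obtain H where H: "\<And>x y. x \<le> y \<Longrightarrow> {x..y} \<inter> D = {} \<Longrightarrow> \<bar>F x - F y\<bar> \<le> H * \<bar>x - y\<bar> powr \<alpha>"
    using hol unfolding piecewise_Holder_def D_def by blast
  \<comment> \<open>The definition allows a nonpositive \<open>H\<close>, while a positive constant
    is promised.\<close>
  define K where "K = max H 1"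
  have K: "0 < K" "H \<le> K" by (auto simp: K_def)
  have finD: "finite D" using fin D_def by simp
  have right: "(G \<longlongrightarrow> G x) (at_right x)" for x
  proof -
    have "((\<lambda>y. indicator {d..} y :: real) \<longlongrightarrow> indicator {d..} x) (at_right x)" for d :: real
    proof (rule tendsto_eventually)
      show "\<forall>\<^sub>F y in at_right x. (indicator {d..} y :: real) = indicator {d..} x"
        using eventually_at_right_less[of x]
      proof (cases "d \<le> x")
        case False
        then have "\<forall>\<^sub>F y in at_right x. y < d"
          by (auto simp: eventually_at_right_field intro!: exI[of _ d])
        then show ?thesis using False by (auto elim!: eventually_mono)
      qed (auto elim!: eventually_mono)
    qed
    then show ?thesis unfolding G_def
      using cadlag_at_right[OF cad]
      by (intro tendsto_diff tendsto_sum tendsto_mult tendsto_const)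
  qed
  have left: "(G \<longlongrightarrow> G x) (at_left x)" for x
  proof -
    have ind: "((\<lambda>y. indicator {d..} y :: real) \<longlongrightarrow> indicator {d<..} x) (at_left x)" for d :: real
    proof (rule tendsto_eventually)
      show "\<forall>\<^sub>F y in at_left x. (indicator {d..} y :: real) = indicator {d<..} x"
      proof (cases "d < x")
        case True
        then have "\<forall>\<^sub>F y in at_left x. d < y"
          by (auto simp: eventually_at_left_field intro!: exI[of _ d])
        then show ?thesis using True by (auto elim!: eventually_mono)
      next
        case False
        have "\<forall>\<^sub>F y in at_left x. y < x" by (simp add: eventually_at_filter)
        then show ?thesis using False by (auto elim!: eventually_mono)
      qed
    qed
    have "(G \<longlongrightarrow> (F x - jump F x) - (\<Sum>d\<in>D. jump F d * indicator {d<..} x)) (at_left x)"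
      unfolding G_def
      using cadlag_at_left[OF cad] ind
      by (intro tendsto_diff tendsto_sum tendsto_mult tendsto_const)
    also have "(\<Sum>d\<in>D. jump F d * indicator {d<..} x) = 
       (\<Sum>d\<in>D. jump F d * indicator {d..} x - (if d = x then jump F d else 0))"
      by (intro sum.cong) (auto simp: indicator_def)
    also have "\<dots> = (\<Sum>d\<in>D. jump F d * indicator {d..} x) - (if x \<in> D then jump F x else 0)"
      using finD by (simp add: sum_subtractf)
    \<comment> \<open>At a point of continuity the jump is zero, so one formula for the left limit
      serves both cases.\<close>
    also have "(if x \<in> D then jump F x else 0) = jump F x"
    proof (cases "x \<in> D")
      case False
      then have "isCont F x" by (simp add: D_def discontinuities_def)
      then have "(F \<longlongrightarrow> F x) (at_left x)"
        by (simp add: isCont_def filterlim_at_split)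
      from tendsto_unique[OF _ this cadlag_at_left[OF cad, of x]] show ?thesis using False by simp
    qed simp
    finally show ?thesis by (simp add: G_def[abs_def])
  qed
  have contG: "isCont G x" for x
    using left[of x] right[of x] by (simp add: isCont_def filterlim_at_split)
  have closed: "\<bar>G x - G y\<bar> \<le> K * \<bar>x - y\<bar> powr \<alpha>" if "x \<le> y" "{x..y} \<inter> D = {}" for x y
  proof -
    have "indicator {d..} x = (indicator {d..} y :: real)" if "d \<in> D" for d
    proof -
      have "d \<notin> {x..y}" using that \<open>{x..y} \<inter> D = {}\<close> by blast
      then show ?thesis using \<open>x \<le> y\<close> by (auto simp: indicator_def)
    qed
    then have "G x - G y = F x - F y" by (simp add: G_def)
    then have "\<bar>G x - G y\<bar> \<le> H * \<bar>x - y\<bar> powr \<alpha>" using H[OF that] by simp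
    also have "\<dots> \<le> K * \<bar>x - y\<bar> powr \<alpha>" using K by (intro mult_right_mono) auto
    finally show ?thesis .
  qed
  \<comment> \<open>The closed bound is applied on \<open>{x + e..y - e}\<close> and
    \<open>e\<close> tends to zero, which lets discontinuities sit at the endpoints.\<close>
  have op: "\<bar>G x - G y\<bar> \<le> K * \<bar>x - y\<bar> powr \<alpha>" if "x < y" "{x<..<y} \<inter> D = {}" for x y
  proof -
    have "((\<lambda>e. \<bar>G (x + e) - G (y - e)\<bar>) \<longlongrightarrow> \<bar>G (x + 0) - G (y - 0)\<bar>) (at_right 0)"
      using contG by (intro tendsto_intros isCont_tendsto_compose[of _ G]) auto
    moreover have "((\<lambda>e. K * \<bar>(x + e) - (y - e)\<bar> powr \<alpha>) \<longlongrightarrow> K * \<bar>(x + 0) - (y - 0)\<bar> powr \<alpha>) (at_right 0)"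
      using \<open>x < y\<close> by (intro tendsto_intros) auto
    moreover have "\<forall>\<^sub>F e in at_right 0. \<bar>G (x + e) - G (y - e)\<bar> \<le> K * \<bar>(x + e) - (y - e)\<bar> powr \<alpha>"
      unfolding eventually_at_right_field
    proof (intro exI[of _ "(y - x)/2"] conjI allI impI)
      fix e assume "0 < e" "e < (y - x) / 2"
      have "{x + e..y - e} \<inter> D \<subseteq> {x<..<y} \<inter> D" using \<open>0 < e\<close> by auto
      then show "\<bar>G (x + e) - G (y - e)\<bar> \<le> K * \<bar>(x + e) - (y - e)\<bar> powr \<alpha>"
        using that(2) \<open>e < (y - x) / 2\<close> by (intro closed) (auto simp: field_simps)
    qed (use \<open>x < y\<close> in auto)
    ultimately show ?thesis
      using tendsto_le[of "at_right (0::real)"] by fastforce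
  qed
  have main: "x < y \<Longrightarrow> \<bar>G x - G y\<bar> \<le> K * (1 + card ({x<..<y} \<inter> D)) * \<bar>x - y\<bar> powr \<alpha>" for x y
  proof (induction "card ({x<..<y} \<inter> D)" arbitrary: x y rule: less_induct)
    case less
    show ?case
    proof (cases "{x<..<y} \<inter> D = {}")
      case True
      then show ?thesis using op[OF less.prems] by simp
    next
      case False
      then obtain d where d: "d \<in> D" "x < d" "d < y" by auto
      have sub: "{x<..<y} \<inter> D = insert d (({x<..<d} \<inter> D) \<union> ({d<..<y} \<inter> D))"
        using d by auto
      have c: "card ({x<..<y} \<inter> D) = Suc (card ({x<..<d} \<inter> D) + card ({d<..<y} \<inter> D))"
        unfolding sub using finD by (subst card_insert_disjoint) (auto intro!: card_Un_disjoint)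
      have "\<bar>G x - G y\<bar> \<le> \<bar>G x - G d\<bar> + \<bar>G d - G y\<bar>" by simp
      also have "\<dots> \<le> K * (1 + card ({x<..<d} \<inter> D)) * \<bar>x - d\<bar> powr \<alpha> +
                      K * (1 + card ({d<..<y} \<inter> D)) * \<bar>d - y\<bar> powr \<alpha>"
        using c d by (intro add_mono less.hyps) auto
      also have "\<dots> \<le> K * (1 + card ({x<..<d} \<inter> D)) * \<bar>x - y\<bar> powr \<alpha> +
                      K * (1 + card ({d<..<y} \<inter> D)) * \<bar>x - y\<bar> powr \<alpha>"
        using d K \<alpha> by (intro add_mono mult_left_mono powr_mono2) auto
      also have "\<dots> = K * (1 + card ({x<..<y} \<inter> D)) * \<bar>x - y\<bar> powr \<alpha>"
        by (simp add: c algebra_simps)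
      finally show ?thesis .
    qed
  qed
  have le: "\<bar>G x - G y\<bar> \<le> K * (1 + card D) * \<bar>x - y\<bar> powr \<alpha>" if "x < y" for x y
  proof -
    have "K * (1 + card ({x<..<y} \<inter> D)) * \<bar>x - y\<bar> powr \<alpha> \<le> K * (1 + card D) * \<bar>x - y\<bar> powr \<alpha>"
      using K finD by (intro mult_right_mono mult_left_mono) (auto intro!: card_mono)
    then show ?thesis using main[OF that] by linarith
  qed
  show thesis
  proof (rule that[of "K * (1 + card D)"])
    show "0 < K * real (1 + card D)" using K by simp
    fix x y
    have "\<bar>G x - G y\<bar> \<le> K * (1 + card D) * \<bar>x - y\<bar> powr \<alpha>"
      using le[of x y] le[of y x] by (cases x y rule: linorder_cases) (auto simp: abs_minus_commute)
    then show "\<bar>(F x - (\<Sum>d\<in>discontinuities F. jump F d * indicator {d..} x))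
           - (F y - (\<Sum>d\<in>discontinuities F. jump F d * indicator {d..} y))\<bar> \<le> K * real (1 + card D) * \<bar>x - y\<bar> powr \<alpha>"
      by (simp add: G_def D_def)
  qed
qed

text \<open>By the mean value theorem the remainder is \<open>w\<close> times a difference of
  \<open>L'\<close> at points at most \<open>|w|\<close> apart; the cruder constant \<open>C\<close>
  instead of \<open>C / 2\<close> is enough.\<close>

lemma lipschitz_derivative_linearization:
  fixes L L' :: "real \<Rightarrow> real"
  assumes der: "\<And>z. (L has_real_derivative L' z) (at z)" and lip: "\<And>x y. \<bar>L' x - L' y\<bar> \<le> C * \<bar>x - y\<bar>"
  shows "\<bar>L (z + w) - L z - L' z * w\<bar> \<le> C * w\<^sup>2"
proof -
  have "\<exists>u. \<bar>u\<bar> \<le> \<bar>w\<bar> \<and> L (z + w) - L z = w * L' (z + u)"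
  proof (cases w "0::real" rule: linorder_cases)
    case less
    from MVT2[of "z + w" z L L'] less der obtain y where "z + w < y" "y < z" "L z - L (z + w) = (z - (z + w)) * L' y"
      by auto
    then show ?thesis by (intro exI[of _ "y - z"]) (auto simp: algebra_simps)
  next
    case greater
    from MVT2[of z "z + w" L L'] greater der obtain y where "z < y" "y < z + w" "L (z + w) - L z = ((z + w) - z) * L' y"
      by auto
    then show ?thesis by (intro exI[of _ "y - z"]) auto
  qed auto
  then obtain u where u: "\<bar>u\<bar> \<le> \<bar>w\<bar>" "L (z + w) - L z = w * L' (z + u)" by blast
  have C: "0 \<le> C" using lip[of 1 0] by simp
  have "\<bar>L (z + w) - L z - L' z * w\<bar> = \<bar>w\<bar> * \<bar>L' (z + u) - L' z\<bar>"
    unfolding u(2) by (simp add: abs_mult[symmetric] algebra_simps)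
  also have "\<dots> \<le> \<bar>w\<bar> * (C * \<bar>w\<bar>)"
    using lip[of "z + u" z] u(1) C
    by (intro mult_left_mono) (auto intro: order_trans mult_left_mono)
  finally show ?thesis by (simp add: power2_eq_square algebra_simps abs_mult_self_eq)
qed

text \<open>The quadratic majorant of \<open>L\<close> at \<open>z\<close> must stay nonnegative at
  its own minimum. The bound turns integrability of \<open>L Z\<close> into square integrability of
  \<open>L' Z\<close>, which feeds all variance estimates.\<close>

lemma lipschitz_derivative_square_le:
  fixes L L' :: "real \<Rightarrow> real"
  assumes der: "\<And>z. (L has_real_derivative L' z) (at z)" and lip: "\<And>x y. \<bar>L' x - L' y\<bar> \<le> C * \<bar>x - y\<bar>"
    and C: "0 < C" and nn: "\<And>z. 0 \<le> L z"
  shows "(L' z)\<^sup>2 \<le> 4 * C * L z"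
proof -
  \<comment> \<open>Minimizer of \<open>L z + L' z * w + C * w\<^sup>2\<close>.\<close>
  define w where "w = - L' z / (2 * C)"
  have "0 \<le> L z + L' z * w + C * w\<^sup>2"
    using lipschitz_derivative_linearization[OF der lip, of z w] nn[of "z + w"] by linarith
  also have "\<dots> = L z - (L' z)\<^sup>2 / (4 * C)"
    using C by (simp add: w_def field_simps power2_eq_square)
  finally show ?thesis using C by (simp add: field_simps)
qed

lemma derivative_of_even_is_odd:
  fixes L L' :: "real \<Rightarrow> real"
  assumes der: "\<And>z. (L has_real_derivative L' z) (at z)" and even: "\<And>z. L (- z) = L z"
  shows "L' (- z) = - L' z"
proof -
  have "((\<lambda>z. L (- z)) has_real_derivative L' (- (- z)) * (- 1)) (at (- z))"
    by (rule DERIV_chain2[OF der]) (auto intro!: derivative_eq_intros)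
  then have "(L has_real_derivative - L' z) (at (- z))" by (simp add: even)
  with der[of "- z"] show ?thesis by (rule DERIV_unique)
qed

section \<open>Compound Poisson laws and their approximation\<close>

definition iid_sum :: "real measure \<Rightarrow> nat \<Rightarrow> real measure" where
  "iid_sum \<mu> k = distr (\<Pi>\<^sub>M i\<in>(UNIV::nat set). \<mu>) borel (\<lambda>x. \<Sum>i<k. x i)"

text \<open>The library constrains \<open>poisson_pmf\<close> only for positive rates.\<close>
definition Poisson :: "real \<Rightarrow> nat pmf" where
  "Poisson \<kappa> = (if \<kappa> = 0 then return_pmf 0 else poisson_pmf \<kappa>)"

text \<open>Count and summands are independent coordinates of one product space, so conditioning on
  the count is Fubini's theorem.\<close>

definition compound_Poisson :: "real \<Rightarrow> real measure \<Rightarrow> real measure" where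
  "compound_Poisson \<kappa> \<mu> =
     distr (measure_pmf (Poisson \<kappa>) \<Otimes>\<^sub>M (\<Pi>\<^sub>M i\<in>(UNIV::nat set). \<mu>)) borel (\<lambda>(k, x). \<Sum>i<k. x i)"

lemma pmf_Poisson: "0 \<le> \<kappa> \<Longrightarrow> pmf (Poisson \<kappa>) k = \<kappa> ^ k / fact k * exp (- \<kappa>)"
  by (auto simp: Poisson_def indicator_def power_0_left)

lemma indep_vars_PiM_component:
  assumes M: "\<And>i. i \<in> I \<Longrightarrow> prob_space (M i)" and "I \<noteq> {}"
  shows "prob_space.indep_vars (PiM I M) M (\<lambda>i x. x i) I"
proof -
  interpret prob_space "PiM I M" by (rule prob_space_PiM[OF M])
  have "distr (PiM I M) (PiM I M) (\<lambda>x. \<lambda>i\<in>I. x i) = distr (PiM I M) (PiM I M) (\<lambda>x. x)"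
    by (rule distr_cong) (auto simp: space_PiM PiE_restrict)
  also have "\<dots> = PiM I M" by (rule distr_id)
  also have "\<dots> = PiM I (\<lambda>i. distr (PiM I M) (M i) (\<lambda>x. x i))"
    by (rule PiM_cong) (auto simp: distr_PiM_component M)
  finally show ?thesis using assms
    by (subst indep_vars_iff_distr_eq_PiM') auto
qed

context prob_space begin

text \<open>The finite family is a reindexed piece of the infinite product on which
  \<open>iid_sum\<close> lives, so only the number of summands matters.\<close>

lemma distr_iid_sum:
  assumes ind: "indep_vars (\<lambda>_. borel) U B" and fin: "finite B"
    and \<mu>: "\<And>i. i \<in> B \<Longrightarrow> distr M borel (U i) = \<mu>" and ps: "prob_space \<mu>" "sets \<mu> = sets borel"
  shows "distr M borel (\<lambda>\<omega>. \<Sum>i\<in>B. U i \<omega> :: real) = iid_sum \<mu> (card B)"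
proof (cases "B = {}")
  case True
  interpret \<mu>: prob_space "\<Pi>\<^sub>M i\<in>(UNIV::nat set). \<mu>" by (rule prob_space_PiM[OF ps(1)])
  show ?thesis unfolding True iid_sum_def by (simp add: distr_const \<mu>.distr_const)
next
  case False
  have rv[measurable]: "i \<in> B \<Longrightarrow> random_variable borel (U i)" for i
    using ind by (auto simp: indep_vars_def2)
  interpret P: prob_space "\<Pi>\<^sub>M i\<in>(UNIV::nat set). \<mu>" by (rule prob_space_PiM[OF ps(1)])
  obtain h where h: "bij_betw h {..<card B} B"
    using ex_bij_betw_nat_finite[OF fin] by (auto simp: atLeast0LessThan)
  have h_inj: "inj_on h B'" if "B' \<subseteq> {..<card B}" for B' using h that by (meson bij_betw_def inj_on_subset)
  define g where "g = the_inv_into {..<card B} h"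
  have g: "bij_betw g B {..<card B}" unfolding g_def by (rule bij_betw_the_inv_into[OF h])
  have "distr M (PiM B (\<lambda>_. borel)) (\<lambda>\<omega>. \<lambda>i\<in>B. U i \<omega>) = PiM B (\<lambda>i. distr M borel (U i))"
    using ind False by (subst (asm) indep_vars_iff_distr_eq_PiM') auto
  also have "\<dots> = PiM B (\<lambda>i. \<mu>)" by (rule PiM_cong) (auto simp: \<mu>)
  also have "\<dots> = distr (\<Pi>\<^sub>M i\<in>UNIV. \<mu>) (PiM B (\<lambda>_. \<mu>)) (\<lambda>x. \<lambda>i\<in>B. x (g i))"
    using g by (intro distr_PiM_reindex[symmetric, where M="\<lambda>_. \<mu>"]) (auto simp: ps bij_betw_def)
  finally have eq: "distr M (PiM B (\<lambda>_. borel)) (\<lambda>\<omega>. \<lambda>i\<in>B. U i \<omega>) =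
      distr (\<Pi>\<^sub>M i\<in>UNIV. \<mu>) (PiM B (\<lambda>_. \<mu>)) (\<lambda>x. \<lambda>i\<in>B. x (g i))" .
  have [measurable_cong]: "sets (PiM B (\<lambda>_. \<mu>)) = sets (PiM B (\<lambda>_. borel))"
    by (rule sets_PiM_cong) (auto simp: ps)
  have [measurable_cong]: "sets (PiM (UNIV::nat set) (\<lambda>_. \<mu>)) = sets (PiM UNIV (\<lambda>_. borel))"
    by (rule sets_PiM_cong) (auto simp: ps)
  have "distr M borel (\<lambda>\<omega>. \<Sum>i\<in>B. U i \<omega>) =
      distr (distr M (PiM B (\<lambda>_. borel)) (\<lambda>\<omega>. \<lambda>i\<in>B. U i \<omega>)) borel (\<lambda>x. \<Sum>i\<in>B. x i)"
    by (subst distr_distr) (auto simp: comp_def intro!: distr_cong)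
  also have "\<dots> = distr (\<Pi>\<^sub>M i\<in>UNIV. \<mu>) borel (\<lambda>x. \<Sum>i\<in>B. x (g i))"
    unfolding eq by (subst distr_distr) (auto simp: comp_def intro!: distr_cong)
  also have "\<dots> = iid_sum \<mu> (card B)"
    unfolding iid_sum_def using sum.reindex_bij_betw[OF g] by (intro distr_cong) auto
  finally show ?thesis .
qed

text \<open>Both the marks of sample points sorted by cell and the marks of a Poisson process sorted
  by time cell are block sums of an independent family. Reducing their law to the block sizes makes
  the two sides comparable through counts alone.\<close>

lemma distr_block_sums:
  assumes ind: "indep_vars (\<lambda>_. borel) U I" and C: "C \<noteq> {}"
    and disj: "disjoint_family_on B C"
    and B: "\<And>c. c \<in> C \<Longrightarrow> finite (B c)" "\<And>c. c \<in> C \<Longrightarrow> B c \<subseteq> I"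
    and \<mu>: "\<And>c i. c \<in> C \<Longrightarrow> i \<in> B c \<Longrightarrow> distr M borel (U i) = \<mu> c"
    and ps: "\<And>c. c \<in> C \<Longrightarrow> prob_space (\<mu> c)" "\<And>c. c \<in> C \<Longrightarrow> sets (\<mu> c) = sets borel"
  shows "distr M (PiM C (\<lambda>_. borel)) (\<lambda>\<omega>. \<lambda>c\<in>C. \<Sum>i\<in>B c. U i \<omega> :: real) =
    PiM C (\<lambda>c. iid_sum (\<mu> c) (card (B c)))"
proof -
  have rv[measurable]: "i \<in> I \<Longrightarrow> random_variable borel (U i)" for i
    using ind by (auto simp: indep_vars_def2)
  have "indep_vars (\<lambda>c. PiM (B c) (\<lambda>_. borel)) (\<lambda>c \<omega>. restrict (\<lambda>i. U i \<omega>) (B c)) C"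
    by (rule indep_vars_restrict[OF ind B(2) disj])
  then have "indep_vars (\<lambda>c. borel) (\<lambda>c \<omega>. (\<lambda>x. \<Sum>i\<in>B c. x i) (restrict (\<lambda>i. U i \<omega>) (B c))) C"
    by (rule indep_vars_compose2) auto
  then have "indep_vars (\<lambda>c. borel) (\<lambda>c \<omega>. \<Sum>i\<in>B c. U i \<omega>) C" by simp
  then have "distr M (PiM C (\<lambda>_. borel)) (\<lambda>\<omega>. \<lambda>c\<in>C. \<Sum>i\<in>B c. U i \<omega>) =
      PiM C (\<lambda>c. distr M borel (\<lambda>\<omega>. \<Sum>i\<in>B c. U i \<omega>))"
    using C B(2) by (subst (asm) indep_vars_iff_distr_eq_PiM') (auto intro!: borel_measurable_sum rv)
  also have "\<dots> = PiM C (\<lambda>c. iid_sum (\<mu> c) (card (B c)))"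
    using B \<mu> ps by (intro PiM_cong refl distr_iid_sum indep_vars_subset[OF ind]) auto
  finally show ?thesis .
qed

end

locale mark_distribution = prob_space \<mu> for \<mu> :: "real measure" +
  assumes sets_mark[measurable_cong, simp]: "sets \<mu> = sets borel"
begin

lemma prob_space_iid_sum: "prob_space (iid_sum \<mu> k)"
proof -
  interpret P: prob_space "\<Pi>\<^sub>M i\<in>(UNIV::nat set). \<mu>" by (rule prob_space_PiM) (rule prob_space_axioms)
  show ?thesis unfolding iid_sum_def by (rule P.prob_space_distr) simp
qed

lemma sets_iid_sum[simp]: "sets (iid_sum \<mu> k) = sets borel"
  by (simp add: iid_sum_def)

lemma measurable_random_sum[measurable]:
  "(\<lambda>(k, x). \<Sum>i<k. x i :: real) \<in> borel_measurable (measure_pmf (p :: nat pmf) \<Otimes>\<^sub>M (\<Pi>\<^sub>M i\<in>(UNIV::nat set). \<mu>))"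
proof -
  have "(\<lambda>(k, x). \<Sum>i<k. x i :: real) \<in> borel_measurable (count_space (UNIV :: nat set) \<Otimes>\<^sub>M (\<Pi>\<^sub>M i\<in>(UNIV::nat set). \<mu>))"
    by (rule measurable_pair_measure_countable1) auto
  then show ?thesis
    by (subst measurable_cong_sets[OF sets_pair_measure_cong[OF sets_measure_pmf_count_space refl] refl])
qed

lemma prob_space_compound_Poisson: "prob_space (compound_Poisson \<kappa> \<mu>)"
proof -
  interpret P: prob_space "\<Pi>\<^sub>M i\<in>(UNIV::nat set). \<mu>" by (rule prob_space_PiM) (rule prob_space_axioms)
  interpret PP: pair_prob_space "measure_pmf (Poisson \<kappa>)" "\<Pi>\<^sub>M i\<in>(UNIV::nat set). \<mu>" ..
  show ?thesis unfolding compound_Poisson_def by (rule PP.prob_space_distr) simp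
qed

lemma sets_compound_Poisson[simp]: "sets (compound_Poisson \<kappa> \<mu>) = sets borel"
  by (simp add: compound_Poisson_def)

lemma emeasure_compound_Poisson:
  assumes [measurable]: "A \<in> sets borel"
  shows "emeasure (compound_Poisson \<kappa> \<mu>) A = (\<integral>\<^sup>+k. emeasure (iid_sum \<mu> k) A \<partial>Poisson \<kappa>)"
proof -
  interpret P: prob_space "\<Pi>\<^sub>M i\<in>(UNIV::nat set). \<mu>" by (rule prob_space_PiM) (rule prob_space_axioms)
  show ?thesis
    unfolding compound_Poisson_def
    apply (subst emeasure_distr, measurable)
    apply (subst P.emeasure_pair_measure_alt, measurable)
    apply (rule nn_integral_cong)
    apply (auto simp: iid_sum_def emeasure_distr space_pair_measure intro!: arg_cong2[where f=emeasure])
    done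
qed

end

text \<open>The count vector is drawn first and the summands afterwards; the mixture is built as an
  explicit random vector and identified with the product on rectangles. What matters later is that
  the mixture formula then holds for every measurable \<open>E\<close>.\<close>

lemma PiM_compound_Poisson:
  assumes C: "finite C" "C \<noteq> {}" and \<mu>: "\<And>c. c \<in> C \<Longrightarrow> mark_distribution (\<mu> c)"
    and E: "E \<in> sets (PiM C (\<lambda>_. borel))"
  shows "emeasure (PiM C (\<lambda>c. compound_Poisson (\<kappa> c) (\<mu> c))) E =
    (\<integral>\<^sup>+n. emeasure (PiM C (\<lambda>c. iid_sum (\<mu> c) (n c))) E \<partial>Pi_pmf C 0 (\<lambda>c. Poisson (\<kappa> c)))"
proof -
  \<comment> \<open>Padding with a point mass outside \<open>C\<close> lets the locale be
    interpreted at every index.\<close>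
  define \<mu>' where "\<mu>' c = (if c \<in> C then \<mu> c else return borel 0)" for c
  have \<mu>': "mark_distribution (\<mu>' c)" for c
    using \<mu>[of c] by (auto simp: \<mu>'_def mark_distribution_def mark_distribution_axioms_def prob_space_return)
  interpret mark_distribution "\<mu>' c" for c by (rule \<mu>')
  have eq: "c \<in> C \<Longrightarrow> \<mu>' c = \<mu> c" for c by (simp add: \<mu>'_def)
  let ?p = "Pi_pmf C 0 (\<lambda>c. Poisson (\<kappa> c))"
  let ?S = "PiM (C \<times> (UNIV::nat set)) (\<lambda>(c, i). \<mu>' c)"
  let ?B = "PiM C (\<lambda>_. borel :: real measure)"
  have setsS[measurable_cong]: "sets ?S = sets (PiM (C \<times> (UNIV::nat set)) (\<lambda>_. borel))"
    by (rule sets_PiM_cong) auto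
  interpret S: prob_space ?S
    by (rule prob_space_PiM) (auto intro: prob_space_axioms)
  interpret PS: pair_prob_space "measure_pmf ?p" ?S ..
  let ?V = "\<lambda>\<omega> :: (_ \<Rightarrow> nat) \<times> (_ \<Rightarrow> real). \<lambda>c\<in>C. \<Sum>i<fst \<omega> c. snd \<omega> (c, i)"
  have V[measurable]: "?V \<in> measurable (measure_pmf ?p \<Otimes>\<^sub>M ?S) ?B"
  proof (rule measurable_restrict)
    fix c assume c: "c \<in> C"
    have "(\<lambda>x. (case x of (k, y) \<Rightarrow> (\<Sum>i<k. (y (c, i) :: real)))) \<in> borel_measurable (count_space (UNIV :: nat set) \<Otimes>\<^sub>M ?S)"
      using c by (intro measurable_pair_measure_countable1) auto
    moreover have "(\<lambda>x. (fst x c, snd x)) \<in> measurable (measure_pmf ?p \<Otimes>\<^sub>M ?S) (count_space (UNIV :: nat set) \<Otimes>\<^sub>M ?S)"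
      by (intro measurable_Pair measurable_compose[OF measurable_fst]) auto
    ultimately have "(\<lambda>x. case (fst x c, snd x) of (k, y) \<Rightarrow> (\<Sum>i<k. (y (c, i) :: real))) \<in> borel_measurable (measure_pmf ?p \<Otimes>\<^sub>M ?S)"
      by (rule measurable_compose[rotated])
    then show "(\<lambda>x. \<Sum>i<fst x c. snd x (c, i)) \<in> borel_measurable (measure_pmf ?p \<Otimes>\<^sub>M ?S)" by simp
  qed
  have comp: "distr ?S ?B (\<lambda>x. \<lambda>c\<in>C. \<Sum>i<n c. x (c, i)) = PiM C (\<lambda>c. iid_sum (\<mu>' c) (n c))" for n :: "_ \<Rightarrow> nat"
  proof -
    have ind: "S.indep_vars (\<lambda>_. borel) (\<lambda>i x. x i) (C \<times> UNIV)"
      using S.indep_vars_compose2[OF indep_vars_PiM_component[of "C \<times> (UNIV :: nat set)" "\<lambda>(c, i). \<mu>' c"], of "\<lambda>_ x. x" "\<lambda>_. borel"] C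
      by (auto intro: prob_space_axioms simp: split_beta)
    have "distr ?S ?B (\<lambda>x. \<lambda>c\<in>C. \<Sum>i\<in>(\<lambda>i. (c, i)) ` {..<n c}. x i) =
        PiM C (\<lambda>c. iid_sum (\<mu>' c) (card ((\<lambda>i. (c, i)) ` {..<n c})))"
    proof (rule S.distr_block_sums[OF ind C(2)])
      fix c i assume "c \<in> C" "i \<in> (\<lambda>i. (c, i)) ` {..<n c}"
      then obtain j where [simp]: "i = (c, j)" and "c \<in> C" by auto
      have "distr ?S (\<mu>' c) (\<lambda>x. x (c, j)) = \<mu>' c"
        using distr_PiM_component[of "C \<times> (UNIV :: nat set)" "\<lambda>(c, i). \<mu>' c" "(c, j)"] \<open>c \<in> C\<close>
        by (auto intro: prob_space_axioms)
      then show "distr ?S borel (\<lambda>x. x i) = \<mu>' c"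
        using distr_cong[of ?S ?S "\<mu>' c" borel "\<lambda>x. x (c, j)" "\<lambda>x. x (c, j)"] by simp
    qed (auto simp: disjoint_family_on_def intro: prob_space_axioms)
    then show ?thesis by (simp add: sum.reindex card_image inj_on_def)
  qed
  have mix: "emeasure (distr (measure_pmf ?p \<Otimes>\<^sub>M ?S) ?B ?V) E =
     (\<integral>\<^sup>+n. emeasure (PiM C (\<lambda>c. iid_sum (\<mu>' c) (n c))) E \<partial>?p)" if [measurable]: "E \<in> sets ?B" for E
  proof -
    have "emeasure (distr (measure_pmf ?p \<Otimes>\<^sub>M ?S) ?B ?V) E =
      (\<integral>\<^sup>+n. emeasure ?S (Pair n -` (?V -` E \<inter> space (measure_pmf ?p \<Otimes>\<^sub>M ?S))) \<partial>?p)"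
      by (subst emeasure_distr, measurable, subst S.emeasure_pair_measure_alt, measurable)
    also have "\<dots> = (\<integral>\<^sup>+n. emeasure (distr ?S ?B (\<lambda>x. \<lambda>c\<in>C. \<Sum>i<n c. x (c, i))) E \<partial>?p)"
    proof (rule nn_integral_cong)
      fix n :: "_ \<Rightarrow> nat"
      have "(\<lambda>x. \<lambda>c\<in>C. \<Sum>i<n c. x (c, i)) \<in> measurable ?S ?B"
        by (rule measurable_restrict) auto
      then show "emeasure ?S (Pair n -` (?V -` E \<inter> space (measure_pmf ?p \<Otimes>\<^sub>M ?S))) =
        emeasure (distr ?S ?B (\<lambda>x. \<lambda>c\<in>C. \<Sum>i<n c. x (c, i))) E"
        by (subst emeasure_distr) (auto simp: space_pair_measure intro!: arg_cong2[where f=emeasure])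
    qed
    finally show ?thesis unfolding comp .
  qed
  interpret CP: product_prob_space "\<lambda>c. compound_Poisson (\<kappa> c) (\<mu>' c)" C
    by (auto simp: product_prob_space_def product_prob_space_axioms_def product_sigma_finite_def
        intro: prob_space_compound_Poisson prob_space_imp_sigma_finite)
  interpret IS: product_prob_space "\<lambda>c. iid_sum (\<mu>' c) (n c)" C for n :: "_ \<Rightarrow> nat"
    by (auto simp: product_prob_space_def product_prob_space_axioms_def product_sigma_finite_def
        intro: prob_space_iid_sum prob_space_imp_sigma_finite)
  have "distr (measure_pmf ?p \<Otimes>\<^sub>M ?S) ?B ?V = PiM C (\<lambda>c. compound_Poisson (\<kappa> c) (\<mu>' c))"
  proof (rule CP.PiM_eqI[OF C(1)])
    show "sets (distr (measure_pmf ?p \<Otimes>\<^sub>M ?S) ?B ?V) = sets (PiM C (\<lambda>c. compound_Poisson (\<kappa> c) (\<mu>' c)))"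
      by (simp, rule sets_PiM_cong) auto
    fix A assume A: "\<And>i. i \<in> C \<Longrightarrow> A i \<in> sets (compound_Poisson (\<kappa> i) (\<mu>' i))"
    then have "PiE C A \<in> sets ?B" using C(1) by (intro sets_PiM_I_finite) auto
    then have "emeasure (distr (measure_pmf ?p \<Otimes>\<^sub>M ?S) ?B ?V) (PiE C A) =
      (\<integral>\<^sup>+n. emeasure (PiM C (\<lambda>c. iid_sum (\<mu>' c) (n c))) (PiE C A) \<partial>?p)"
      by (rule mix)
    also have "\<dots> = (\<integral>\<^sup>+n. (\<Prod>c\<in>C. emeasure (iid_sum (\<mu>' c) (n c)) (A c)) \<partial>?p)"
      using A C(1) by (intro nn_integral_cong IS.emeasure_PiM) auto
    also have "\<dots> = (\<Prod>c\<in>C. \<integral>\<^sup>+k. emeasure (iid_sum (\<mu>' c) k) (A c) \<partial>Poisson (\<kappa> c))"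
      by (rule nn_integral_prod_Pi_pmf[OF C(1)])
    also have "\<dots> = (\<Prod>c\<in>C. emeasure (compound_Poisson (\<kappa> c) (\<mu>' c)) (A c))"
      using A by (intro prod.cong refl emeasure_compound_Poisson[symmetric]) auto
    finally show "emeasure (distr (measure_pmf ?p \<Otimes>\<^sub>M ?S) ?B ?V) (PiE C A) =
      (\<Prod>c\<in>C. emeasure (compound_Poisson (\<kappa> c) (\<mu>' c)) (A c))" .
  qed
  then have "emeasure (PiM C (\<lambda>c. compound_Poisson (\<kappa> c) (\<mu>' c))) E =
     (\<integral>\<^sup>+n. emeasure (PiM C (\<lambda>c. iid_sum (\<mu>' c) (n c))) E \<partial>?p)"
    using mix[OF E] by simp
  also have "PiM C (\<lambda>c. compound_Poisson (\<kappa> c) (\<mu>' c)) = PiM C (\<lambda>c. compound_Poisson (\<kappa> c) (\<mu> c))"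
    by (rule PiM_cong) (auto simp: eq)
  also have "(\<lambda>n. PiM C (\<lambda>c. iid_sum (\<mu>' c) (n c))) = (\<lambda>n. PiM C (\<lambda>c. iid_sum (\<mu> c) (n c)))"
    by (intro ext PiM_cong) (auto simp: eq)
  finally show ?thesis .
qed

section \<open>Poisson limit of multinomial counts\<close>

lemma tendsto_falling_factorial_ratio:
  "(\<lambda>n. fact n / (fact (n - k) * real n ^ k)) \<longlonglongrightarrow> 1"
proof (induction k)
  case (Suc k)
  have "(\<lambda>n. fact n / (fact (n - k) * real n ^ k) * (1 - real k * (1 / real n))) \<longlonglongrightarrow> 1 * (1 - real k * 0)"
    by (intro tendsto_mult tendsto_diff tendsto_const lim_1_over_n Suc.IH)
  moreover have "\<forall>\<^sub>F n in sequentially. fact n / (fact (n - k) * real n ^ k) * (1 - real k * (1 / real n)) =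
      fact n / (fact (n - Suc k) * real n ^ Suc k)"
    using eventually_gt_at_top[of k]
  proof eventually_elim
    case (elim n)
    have "(fact (n - k) :: real) = real (n - k) * fact (n - Suc k)"
    proof -
      have "n - k = Suc (n - Suc k)" using elim by simp
      then show ?thesis by (simp only: fact_Suc of_nat_mult)
    qed
    moreover have "real (n - k) = real n - real k" "real n \<noteq> real k" "real n \<noteq> 0" using elim by auto
    ultimately show ?case by (simp add: divide_simps) 
  qed
  ultimately show ?case by (auto intro: Lim_transform_eventually)
qed (auto intro!: tendsto_eventually eventually_sequentiallyI[of 0])

text \<open>The power is compared with \<open>(1 - x / n) ^ n\<close>: for bases of modulus at most
  one, \<open>n\<close>-th powers differ by at most \<open>n\<close> times the difference of the
  bases, here \<open>|n * a n - x|\<close>.\<close>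

lemma tendsto_one_minus_power:
  fixes a :: "nat \<Rightarrow> real"
  assumes lim: "(\<lambda>n. real n * a n) \<longlonglongrightarrow> x" and a: "\<And>n. 0 \<le> a n" "\<And>n. a n \<le> 1"
  shows "(\<lambda>n. (1 - a n) ^ n) \<longlonglongrightarrow> exp (- x)"
proof -
  have x: "0 \<le> x" using lim by (rule tendsto_lowerbound) (auto simp: a)
  have "\<forall>\<^sub>F n in sequentially. norm ((1 - a n) ^ n - (1 + (- x) / real n) ^ n) \<le> \<bar>real n * a n - x\<bar>"
    using eventually_ge_at_top[of "nat \<lceil>x\<rceil>"] eventually_gt_at_top[of 0]
  proof eventually_elim
    case (elim n)
    then have "x / n \<le> 1" by (simp add: nat_le_iff ceiling_le_iff)
    then have "norm ((1 - a n) ^ n - (1 + (- x) / real n) ^ n) \<le> n * norm ((1 - a n) - (1 + (- x) / real n))"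
      using a[of n] x by (intro norm_power_diff) (auto simp: abs_le_iff)
    also have "\<dots> = \<bar>real n * ((1 - a n) - (1 + (- x) / real n))\<bar>" by (simp add: abs_mult)
    also have "real n * ((1 - a n) - (1 + (- x) / real n)) = - (real n * a n - x)"
      using elim by (simp add: field_simps)
    also have "\<bar>\<dots>\<bar> = \<bar>real n * a n - x\<bar>" by (rule abs_minus_cancel)
    finally show ?case .
  qed
  moreover have "(\<lambda>n. \<bar>real n * a n - x\<bar>) \<longlonglongrightarrow> \<bar>x - x\<bar>" by (intro tendsto_intros lim)
  then have "(\<lambda>n. \<bar>real n * a n - x\<bar>) \<longlonglongrightarrow> 0" by simp
  ultimately have "(\<lambda>n. (1 - a n) ^ n - (1 + (- x) / real n) ^ n) \<longlonglongrightarrow> 0"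
    by (rule Lim_null_comparison)
  from tendsto_add[OF this tendsto_exp_limit_sequentially[of "- x"]] show ?thesis by simp
qed

lemma tendsto_one_minus_power_diff:
  fixes a :: "nat \<Rightarrow> real"
  assumes lim: "(\<lambda>n. real n * a n) \<longlonglongrightarrow> x" and a: "\<And>n. 0 \<le> a n" "\<And>n. a n \<le> 1"
  shows "(\<lambda>n. (1 - a n) ^ (n - k)) \<longlonglongrightarrow> exp (- x)"
proof -
  have "(\<lambda>n. real n * a n * (1 / real n)) \<longlonglongrightarrow> x * 0"
    by (intro tendsto_mult lim lim_1_over_n)
  then have "(\<lambda>n. real n * a n * (1 / real n)) \<longlonglongrightarrow> 0" by simp
  then have a0: "a \<longlonglongrightarrow> 0"
    by (rule Lim_transform_eventually) (rule eventually_mono[OF eventually_gt_at_top[of 0]], simp)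
  have "(\<lambda>n. (1 - a n) ^ n / (1 - a n) ^ k) \<longlonglongrightarrow> exp (- x) / (1 - 0) ^ k"
    by (intro tendsto_intros tendsto_one_minus_power assms a0) auto
  moreover have "\<forall>\<^sub>F n in sequentially. (1 - a n) ^ n / (1 - a n) ^ k = (1 - a n) ^ (n - k)"
    using eventually_ge_at_top[of k] order_tendstoD(2)[OF a0 zero_less_one]
    by eventually_elim (simp add: power_diff)
  ultimately show ?thesis by (auto intro: Lim_transform_eventually)
qed

context prob_space begin

lemma indep_vars_Inl: "indep_vars (\<lambda>_. N) (case_sum X Z) UNIV \<Longrightarrow> indep_vars (\<lambda>_. N) X UNIV"
  and indep_vars_Inr: "indep_vars (\<lambda>_. N) (case_sum X Z) UNIV \<Longrightarrow> indep_vars (\<lambda>_. N) Z UNIV"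
proof -
  assume ind: "indep_vars (\<lambda>_. N) (case_sum X Z) UNIV"
  have "indep_vars (\<lambda>i. PiM {Inl i} (\<lambda>_. N)) (\<lambda>i \<omega>. restrict (\<lambda>i. case_sum X Z i \<omega>) {Inl i}) UNIV"
    by (rule indep_vars_restrict[OF ind]) (auto simp: disjoint_family_on_def)
  then have "indep_vars (\<lambda>_. N) (\<lambda>i \<omega>. (\<lambda>y. y (Inl i)) (restrict (\<lambda>i. case_sum X Z i \<omega>) {Inl i})) UNIV"
    by (rule indep_vars_compose2) auto
  then show "indep_vars (\<lambda>_. N) X UNIV" by simp
  have "indep_vars (\<lambda>i. PiM {Inr i} (\<lambda>_. N)) (\<lambda>i \<omega>. restrict (\<lambda>i. case_sum X Z i \<omega>) {Inr i}) UNIV"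
    by (rule indep_vars_restrict[OF ind]) (auto simp: disjoint_family_on_def)
  then have "indep_vars (\<lambda>_. N) (\<lambda>i \<omega>. (\<lambda>y. y (Inr i)) (restrict (\<lambda>i. case_sum X Z i \<omega>) {Inr i})) UNIV"
    by (rule indep_vars_compose2) auto
  then show "indep_vars (\<lambda>_. N) Z UNIV" by simp
qed

text \<open>Once the word of labels is fixed to \<open>xs\<close>, each cell sum runs over a fixed
  set of indices and depends on the noise alone. Independence of design and noise then splits the
  probability, and the noise factor sees \<open>xs\<close> only through its counts.\<close>

lemma prob_labels_and_block_sums:
  fixes X Z :: "nat \<Rightarrow> 'a \<Rightarrow> real" and lb :: "real \<Rightarrow> 'c option" and q :: "'c \<Rightarrow> real \<Rightarrow> real"
  assumes ind: "indep_vars (\<lambda>_. borel) (case_sum X Z) UNIV"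
    and C: "finite C" "C \<noteq> {}"
    and lb[measurable]: "lb \<in> measurable borel (count_space UNIV)"
    and q[measurable]: "\<And>c. q c \<in> borel_measurable borel"
    and \<mu>: "\<And>i c. c \<in> C \<Longrightarrow> distr M borel (\<lambda>\<omega>. q c (Z i \<omega>)) = \<mu> c"
    and p: "\<And>i z. prob {\<omega>\<in>space M. lb (X i \<omega>) = z} = p z"
    and E: "E \<in> sets (PiM C (\<lambda>_. borel))"
  shows "prob {\<omega>\<in>space M. map (\<lambda>i. lb (X i \<omega>)) [0..<length xs] = xs \<and>
      (\<lambda>c\<in>C. \<Sum>i<length xs. if lb (X i \<omega>) = Some c then q c (Z i \<omega>) else 0) \<in> E} =
    (\<Prod>z\<in>#mset xs. p z) * measure (PiM C (\<lambda>c. iid_sum (\<mu> c) (count (mset xs) (Some c)))) E"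
proof -
  let ?n = "length xs"
  have [measurable]: "X i \<in> borel_measurable M" "Z i \<in> borel_measurable M" for i
    using indep_vars_Inl[OF ind] indep_vars_Inr[OF ind] by (auto simp: indep_vars_def2)
  define R where "R z = (\<lambda>c\<in>C. \<Sum>i\<in>{i\<in>{..<?n}. xs ! i = Some c}. q c (z i))" for z :: "nat \<Rightarrow> real"
  have Rm: "(\<lambda>y. R (\<lambda>i. y (Inr i))) \<in> measurable (PiM (Inr ` {..<?n} :: (nat + nat) set) (\<lambda>_. borel)) (PiM C (\<lambda>_. borel))"
    unfolding R_def by (intro measurable_restrict borel_measurable_sum) auto
  define A where "A = {y\<in>space (PiM (Inl ` {..<?n} :: (nat + nat) set) (\<lambda>_. borel)). \<forall>i\<in>{..<?n}. lb (y (Inl i)) = xs ! i}"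
  define B where "B = (\<lambda>y. R (\<lambda>i. y (Inr i))) -` E \<inter> space (PiM (Inr ` {..<?n} :: (nat + nat) set) (\<lambda>_. borel))"
  let ?X = "\<lambda>\<omega>. restrict (\<lambda>i. case_sum X Z i \<omega>) (Inl ` {..<?n})"
  let ?Z = "\<lambda>\<omega>. restrict (\<lambda>i. case_sum X Z i \<omega>) (Inr ` {..<?n})"
  have iv: "indep_var (PiM (Inl ` {..<?n}) (\<lambda>_. borel)) ?X (PiM (Inr ` {..<?n}) (\<lambda>_. borel)) ?Z"
    by (rule indep_var_restrict[OF ind]) auto
  have A: "A \<in> sets (PiM (Inl ` {..<?n}) (\<lambda>_. borel))"
    unfolding A_def by measurable
  have B: "B \<in> sets (PiM (Inr ` {..<?n}) (\<lambda>_. borel))"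
    unfolding B_def by (rule measurable_sets[OF Rm E])
  have spX: "?X \<omega> \<in> space (PiM (Inl ` {..<?n}) (\<lambda>_. borel))" for \<omega> by (auto simp: space_PiM)
  have spZ: "?Z \<omega> \<in> space (PiM (Inr ` {..<?n}) (\<lambda>_. borel))" for \<omega> by (auto simp: space_PiM)
  have RZ: "R (\<lambda>i. ?Z \<omega> (Inr i)) = R (\<lambda>i. Z i \<omega>)" for \<omega>
    by (auto simp: R_def intro!: sum.cong restrict_ext)
  have memA: "?X \<omega> \<in> A \<longleftrightarrow> (\<forall>i<?n. lb (X i \<omega>) = xs ! i)" for \<omega>
    using spX[of \<omega>] by (auto simp: A_def)
  have memB: "?Z \<omega> \<in> B \<longleftrightarrow> R (\<lambda>i. Z i \<omega>) \<in> E" for \<omega>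
    by (simp only: B_def vimage_eq Int_iff spZ RZ simp_thms)
  have map_eq: "map (\<lambda>i. lb (X i \<omega>)) [0..<?n] = xs \<longleftrightarrow> (\<forall>i<?n. lb (X i \<omega>) = xs ! i)" for \<omega>
    by (subst list_eq_iff_nth_eq) auto
  have sum_eq: "(\<lambda>c\<in>C. \<Sum>i<?n. if lb (X i \<omega>) = Some c then q c (Z i \<omega>) else 0) = R (\<lambda>i. Z i \<omega>)"
    if "\<forall>i<?n. lb (X i \<omega>) = xs ! i" for \<omega>
    unfolding R_def using that by (intro restrict_ext, subst sum.inter_filter) (auto intro!: sum.cong)
  have XA: "?X -` A \<inter> space M = {\<omega>\<in>space M. \<forall>i<?n. lb (X i \<omega>) = xs ! i}"
    by (rule set_eqI) (simp only: vimage_eq Int_iff mem_Collect_eq memA conj_ac)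
  have "{\<omega>\<in>space M. map (\<lambda>i. lb (X i \<omega>)) [0..<?n] = xs \<and>
      (\<lambda>c\<in>C. \<Sum>i<?n. if lb (X i \<omega>) = Some c then q c (Z i \<omega>) else 0) \<in> E} =
    {\<omega>\<in>space M. (\<forall>i<?n. lb (X i \<omega>) = xs ! i) \<and> R (\<lambda>i. Z i \<omega>) \<in> E}"
    unfolding map_eq using sum_eq by auto
  also have "\<dots> = (\<lambda>\<omega>. (?X \<omega>, ?Z \<omega>)) -` (A \<times> B) \<inter> space M"
    by (rule set_eqI) (simp only: vimage_eq Int_iff mem_Collect_eq mem_Times_iff fst_conv snd_conv memA memB conj_ac)
  also have "prob \<dots> = prob (?X -` A \<inter> space M) * prob (?Z -` B \<inter> space M)"
    by (rule indep_varD[OF iv A B])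
  also have "prob (?X -` A \<inter> space M) = (\<Prod>z\<in>#mset xs. p z)"
  proof (cases "?n = 0")
    case True
    then show ?thesis unfolding XA by (simp add: prob_space)
  next
    case False
    note XA
    also have "{\<omega>\<in>space M. \<forall>i<?n. lb (X i \<omega>) = xs ! i} = (\<Inter>i\<in>{..<?n}. X i -` (lb -` {xs ! i} \<inter> space borel) \<inter> space M)"
      using False by auto
    also have "prob \<dots> = (\<Prod>i<?n. prob (X i -` (lb -` {xs ! i} \<inter> space borel) \<inter> space M))"
      using False by (intro indep_varsD[OF indep_vars_Inl[OF ind]] measurable_sets[OF lb]) auto
    also have "\<dots> = (\<Prod>i<?n. p (xs ! i))"
      by (intro prod.cong refl) (simp add: p vimage_def Int_def conj_commute)
    also have "\<dots> = prod_list (map p xs)" by (simp add: prod.list_conv_set_nth atLeast0LessThan)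
    also have "\<dots> = (\<Prod>z\<in>#mset xs. p z)" by (simp add: prod_mset_prod_list flip: mset_map)
    finally show ?thesis .
  qed
  also have "prob (?Z -` B \<inter> space M) = measure (distr M (PiM C (\<lambda>_. borel)) (\<lambda>\<omega>. R (\<lambda>i. Z i \<omega>))) E"
  proof -
    have "(\<lambda>\<omega>. R (\<lambda>i. Z i \<omega>)) \<in> measurable M (PiM C (\<lambda>_. borel))"
      unfolding R_def by (intro measurable_restrict) auto
    moreover have "?Z -` B \<inter> space M = (\<lambda>\<omega>. R (\<lambda>i. Z i \<omega>)) -` E \<inter> space M"
      by (rule set_eqI) (simp only: vimage_eq Int_iff memB)
    ultimately show ?thesis using E by (subst measure_distr) auto
  qed
  also have "distr M (PiM C (\<lambda>_. borel)) (\<lambda>\<omega>. R (\<lambda>i. Z i \<omega>)) =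
      PiM C (\<lambda>c. iid_sum (\<mu> c) (card {i\<in>{..<?n}. xs ! i = Some c}))"
  proof -
    define U where "U i \<omega> = q (the (xs ! i)) (Z i \<omega>)" for i \<omega>
    have U: "indep_vars (\<lambda>_. borel) U UNIV"
      unfolding U_def by (rule indep_vars_compose2[OF indep_vars_Inr[OF ind]]) auto
    have "distr M (PiM C (\<lambda>_. borel)) (\<lambda>\<omega>. \<lambda>c\<in>C. \<Sum>i\<in>{i\<in>{..<?n}. xs ! i = Some c}. U i \<omega>) =
      PiM C (\<lambda>c. iid_sum (\<mu> c) (card {i\<in>{..<?n}. xs ! i = Some c}))"
    proof (rule distr_block_sums[OF U C(2)])
      fix c assume c: "c \<in> C"
      show "prob_space (\<mu> c)" unfolding \<mu>[OF c, of 0, symmetric] by (rule prob_space_distr) simp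
      show "sets (\<mu> c) = sets borel" unfolding \<mu>[OF c, of 0, symmetric] by simp
    qed (auto simp: disjoint_family_on_def U_def[abs_def] \<mu>)
    also have "(\<lambda>\<omega>. \<lambda>c\<in>C. \<Sum>i\<in>{i\<in>{..<?n}. xs ! i = Some c}. U i \<omega>) = (\<lambda>\<omega>. R (\<lambda>i. Z i \<omega>))"
      unfolding R_def by (intro ext restrict_ext) (auto simp: U_def intro!: sum.cong)
    finally show ?thesis .
  qed
  also have "(\<lambda>c. card {i\<in>{..<?n}. xs ! i = Some c}) = (\<lambda>c. count (mset xs) (Some c))"
    by (simp add: count_mset count_list_eq_length_filter length_filter_conv_card) (auto intro!: ext arg_cong[where f=card])
  finally show ?thesis by (simp only:)
qed

end

lemma prod_mset_image_mset_sum: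
  fixes f :: "'c \<Rightarrow> 'b :: comm_monoid_mult"
  shows "finite C \<Longrightarrow> prod_mset (image_mset f (\<Sum>c\<in>C. A c)) = (\<Prod>c\<in>C. prod_mset (image_mset f (A c)))"
  by (induction C rule: finite_induct) auto

text \<open>The labels of a sample of size \<open>n\<close> with \<open>k c\<close> points in cell
  \<open>c\<close>; \<open>None\<close> labels the points in no cell. The truncated subtraction is
  harmless as long as \<open>sum k C \<le> n\<close>.\<close>

definition count_mset_of :: "'c set \<Rightarrow> ('c \<Rightarrow> nat) \<Rightarrow> nat \<Rightarrow> 'c option multiset" where
  "count_mset_of C k n = (\<Sum>c\<in>C. replicate_mset (k c) (Some c)) + replicate_mset (n - sum k C) None"

lemma count_count_mset_of:
  assumes "finite C"
  shows "count (count_mset_of C k n) None = n - sum k C"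
    "count (count_mset_of C k n) (Some c) = (if c \<in> C then k c else 0)"
proof -
  show "count (count_mset_of C k n) None = n - sum k C"
    unfolding count_mset_of_def using assms by (simp add: count_sum)
  have "(\<Sum>d\<in>C. count (replicate_mset (k d) (Some d)) (Some c)) = (\<Sum>d\<in>C. if d = c then k d else 0)"
    by (intro sum.cong) auto
  then show "count (count_mset_of C k n) (Some c) = (if c \<in> C then k c else 0)"
    unfolding count_mset_of_def using assms by (simp add: count_sum)
qed

lemma size_count_mset_of: "sum k C \<le> n \<Longrightarrow> size (count_mset_of C k n) = n"
proof -
  have "size (\<Sum>c\<in>C. replicate_mset (k c) (Some c)) = sum k C"
    by (induction C rule: infinite_finite_induct) auto
  then show "sum k C \<le> n \<Longrightarrow> size (count_mset_of C k n) = n" by (simp add: count_mset_of_def)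
qed

lemma card_permutations_count_mset_of:
  assumes C: "finite C" and n: "sum k C \<le> n"
  shows "real (card (permutations_of_multiset (count_mset_of C k n))) =
    fact n / ((\<Prod>c\<in>C. fact (k c)) * fact (n - sum k C))"
proof -
  let ?A = "count_mset_of C k n"
  have "set_mset ?A \<subseteq> insert None (Some ` C)"
  proof
    fix x assume "x \<in> set_mset ?A"
    then have "count ?A x \<noteq> 0" by simp
    then show "x \<in> insert None (Some ` C)"
      by (cases x) (auto simp: count_count_mset_of[OF C] split: if_splits)
  qed
  then have "(\<Prod>x\<in>set_mset ?A. fact (count ?A x) :: nat) = (\<Prod>x\<in>insert None (Some ` C). fact (count ?A x))"
    using C by (intro prod.mono_neutral_left) (auto simp: not_in_iff)
  also have "\<dots> = fact (n - sum k C) * (\<Prod>c\<in>C. fact (k c))"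
    using C by (simp add: prod.reindex count_count_mset_of[OF C])
  finally have *: "(\<Prod>x\<in>set_mset ?A. fact (count ?A x) :: nat) = fact (n - sum k C) * (\<Prod>c\<in>C. fact (k c))" .
  have "real (card (permutations_of_multiset ?A)) = real (fact n) / real (fact (n - sum k C) * (\<Prod>c\<in>C. fact (k c)))"
    using card_permutations_of_multiset(2)[of ?A]
    by (subst card_permutations_of_multiset(1)) (simp add: real_of_nat_div * size_count_mset_of[OF n])
  then show ?thesis by (simp add: mult.commute)
qed

text \<open>The weight splits into three factors with limits \<open>1\<close>, the product of the
  \<open>\<kappa> c ^ k c / fact (k c)\<close>, and \<open>exp (- sum \<kappa> C)\<close>; together
  they form a product of Poisson masses. Vanishing of \<open>k\<close> off \<open>C\<close> matches
  the default value of \<open>Pi_pmf\<close>.\<close>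

lemma tendsto_multinomial_weight:
  fixes p :: "nat \<Rightarrow> 'c \<Rightarrow> real"
  assumes C: "finite C"
    and p: "\<And>n c. c \<in> C \<Longrightarrow> 0 \<le> p n c" "\<And>n. sum (p n) C \<le> 1"
    and lim: "\<And>c. c \<in> C \<Longrightarrow> (\<lambda>n. real n * p n c) \<longlonglongrightarrow> \<kappa> c"
    and k: "\<And>c. c \<notin> C \<Longrightarrow> k c = 0"
  shows "(\<lambda>n. real (card (permutations_of_multiset (count_mset_of C k n))) *
      (\<Prod>z\<in>#count_mset_of C k n. case z of None \<Rightarrow> 1 - sum (p n) C | Some c \<Rightarrow> p n c))
    \<longlonglongrightarrow> pmf (Pi_pmf C 0 (\<lambda>c. Poisson (\<kappa> c))) k"
proof -
  let ?K = "sum k C"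
  have \<kappa>: "0 \<le> \<kappa> c" if "c \<in> C" for c
    using lim[OF that] by (rule tendsto_lowerbound) (auto simp: p that)
  have sum0: "0 \<le> sum (p n) C" for n by (rule sum_nonneg) (simp add: p)
  have lim_sum: "(\<lambda>n. real n * sum (p n) C) \<longlonglongrightarrow> sum \<kappa> C"
    unfolding sum_distrib_left by (rule tendsto_sum) (rule lim)
  have "(\<lambda>n. (fact n / (fact (n - ?K) * real n ^ ?K)) * (\<Prod>c\<in>C. (real n * p n c) ^ k c / fact (k c)) *
         (1 - sum (p n) C) ^ (n - ?K))
      \<longlonglongrightarrow> 1 * (\<Prod>c\<in>C. \<kappa> c ^ k c / fact (k c)) * exp (- sum \<kappa> C)"
    by (intro tendsto_mult tendsto_falling_factorial_ratio tendsto_prod tendsto_divide tendsto_power lim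
        tendsto_const tendsto_one_minus_power_diff lim_sum sum0 p) auto
  also have "1 * (\<Prod>c\<in>C. \<kappa> c ^ k c / fact (k c)) * exp (- sum \<kappa> C) =
      (\<Prod>c\<in>C. \<kappa> c ^ k c / fact (k c) * exp (- \<kappa> c))"
    unfolding sum_negf[symmetric] exp_sum[OF C] by (simp only: prod.distrib mult_1_left)
  also have "\<dots> = pmf (Pi_pmf C 0 (\<lambda>c. Poisson (\<kappa> c))) k"
    using k by (subst pmf_Pi') (auto simp: C pmf_Poisson \<kappa> intro!: prod.cong)
  finally have L: "(\<lambda>n. (fact n / (fact (n - ?K) * real n ^ ?K)) * (\<Prod>c\<in>C. (real n * p n c) ^ k c / fact (k c)) *
         (1 - sum (p n) C) ^ (n - ?K)) \<longlonglongrightarrow> pmf (Pi_pmf C 0 (\<lambda>c. Poisson (\<kappa> c))) k" .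
  show ?thesis
  proof (rule Lim_transform_eventually[OF L])
    show "\<forall>\<^sub>F n in sequentially. (fact n / (fact (n - ?K) * real n ^ ?K)) * (\<Prod>c\<in>C. (real n * p n c) ^ k c / fact (k c)) *
         (1 - sum (p n) C) ^ (n - ?K) = real (card (permutations_of_multiset (count_mset_of C k n))) *
      (\<Prod>z\<in>#count_mset_of C k n. case z of None \<Rightarrow> 1 - sum (p n) C | Some c \<Rightarrow> p n c)"
      using eventually_ge_at_top[of ?K] eventually_gt_at_top[of 0]
    proof eventually_elim
      case (elim n)
      have "(\<Prod>z\<in>#count_mset_of C k n. case z of None \<Rightarrow> 1 - sum (p n) C | Some c \<Rightarrow> p n c) =
        (\<Prod>c\<in>C. p n c ^ k c) * (1 - sum (p n) C) ^ (n - ?K)"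
        unfolding count_mset_of_def by (simp add: prod_mset_image_mset_sum[OF C])
      moreover have "(\<Prod>c\<in>C. (real n * p n c) ^ k c / fact (k c)) =
          real n ^ ?K * (\<Prod>c\<in>C. p n c ^ k c) / (\<Prod>c\<in>C. fact (k c))"
        by (simp add: prod_dividef power_mult_distrib prod.distrib power_sum)
      ultimately show ?case
        using elim by (simp add: card_permutations_count_mset_of[OF C] field_simps)
    qed
  qed
qed

lemma measure_PiM_compound_Poisson:
  assumes C: "finite C" "C \<noteq> {}" and \<mu>: "\<And>c. c \<in> C \<Longrightarrow> mark_distribution (\<mu> c)"
    and E: "E \<in> sets (PiM C (\<lambda>_. borel))"
  shows "measure (PiM C (\<lambda>c. compound_Poisson (\<kappa> c) (\<mu> c))) E =
    (\<integral>n. measure (PiM C (\<lambda>c. iid_sum (\<mu> c) (n c))) E \<partial>Pi_pmf C 0 (\<lambda>c. Poisson (\<kappa> c)))"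
proof -
  have "prob_space (PiM C (\<lambda>c. iid_sum (\<mu> c) (n c)))" for n
    by (rule prob_space_PiM) (rule mark_distribution.prob_space_iid_sum[OF \<mu>])
  then have *: "emeasure (PiM C (\<lambda>c. iid_sum (\<mu> c) (n c))) E = ennreal (measure (PiM C (\<lambda>c. iid_sum (\<mu> c) (n c))) E)" for n
    by (simp add: finite_measure.emeasure_eq_measure prob_space.finite_measure)
  have "emeasure (PiM C (\<lambda>c. compound_Poisson (\<kappa> c) (\<mu> c))) E =
    (\<integral>\<^sup>+n. ennreal (measure (PiM C (\<lambda>c. iid_sum (\<mu> c) (n c))) E) \<partial>Pi_pmf C 0 (\<lambda>c. Poisson (\<kappa> c)))"
    unfolding *[symmetric] by (rule PiM_compound_Poisson[OF assms])
  then show ?thesis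
    by (subst integral_eq_nn_integral) (auto simp: measure_def)
qed

text \<open>The boxes of count vectors bounded by \<open>N\<close> exhaust the support, so one of
  them has nearly full mass. Limits over all count vectors are thereby reduced to finite
  sums.\<close>

lemma Pi_pmf_finite_approx:
  fixes p :: "'c \<Rightarrow> nat pmf"
  assumes C: "finite C" and e: "0 < e"
  obtains F where "finite F" "\<And>k c. k \<in> F \<Longrightarrow> c \<notin> C \<Longrightarrow> k c = 0" "1 - e < measure (Pi_pmf C 0 p) F"
proof -
  define F where "F N = PiE_dflt C (0::nat) (\<lambda>_. {..N})" for N
  have inc: "incseq F" unfolding F_def incseq_def PiE_dflt_def by fastforce
  have "(\<lambda>N. measure (Pi_pmf C 0 p) (F N)) \<longlonglongrightarrow> measure (Pi_pmf C 0 p) (\<Union>N. F N)"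
    by (rule measure_pmf.finite_Lim_measure_incseq) (use inc in auto)
  also have "measure (Pi_pmf C 0 p) (\<Union>N. F N) = 1"
  proof (rule measure_pmf.prob_eq_1[THEN iffD2])
    show "AE x in measure_pmf (Pi_pmf C 0 p). x \<in> (\<Union>N. F N)"
    proof (rule AE_pmfI)
      fix k assume "k \<in> set_pmf (Pi_pmf C 0 p)"
      with set_Pi_pmf_subset[OF C, of 0 p] have "\<forall>c. c \<notin> C \<longrightarrow> k c = 0" by auto
      then have "k \<in> F (sum k C)" unfolding F_def PiE_dflt_def using C by (auto intro: member_le_sum)
      then show "k \<in> (\<Union>N. F N)" by blast
    qed
  qed auto
  finally have "(\<lambda>N. measure (Pi_pmf C 0 p) (F N)) \<longlonglongrightarrow> 1" .
  from order_tendstoD(1)[OF this, of "1 - e"] e obtain N where "1 - e < measure (Pi_pmf C 0 p) (F N)"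
    by (auto simp: eventually_sequentially)
  moreover have "finite (F N)" unfolding F_def using C by (intro finite_PiE_dflt) auto
  moreover have "\<And>k c. k \<in> F N \<Longrightarrow> c \<notin> C \<Longrightarrow> k c = 0" unfolding F_def PiE_dflt_def by auto
  ultimately show thesis by (rule that[rotated 2])
qed

context prob_space begin

text \<open>Given the numbers of sample points in the cells, the cell sums have the same conditional law as
  for the compound Poisson vector, so only the multinomial counts have to be compared.\<close>
lemma cell_sums_liminf:
  fixes X Z :: "nat \<Rightarrow> 'a \<Rightarrow> real" and lb :: "nat \<Rightarrow> real \<Rightarrow> 'c option" and q :: "'c \<Rightarrow> real \<Rightarrow> real"
  assumes ind: "indep_vars (\<lambda>_. borel) (case_sum X Z) UNIV"
    and C: "finite C" "C \<noteq> {}"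
    and lb[measurable]: "\<And>n. lb n \<in> measurable borel (count_space UNIV)"
    and lbC: "\<And>n x c. lb n x = Some c \<Longrightarrow> c \<in> C"
    and q[measurable]: "\<And>c. q c \<in> borel_measurable borel"
    and \<mu>: "\<And>i c. c \<in> C \<Longrightarrow> distr M borel (\<lambda>\<omega>. q c (Z i \<omega>)) = \<mu> c"
    and p: "\<And>n i c. c \<in> C \<Longrightarrow> prob {\<omega>\<in>space M. lb n (X i \<omega>) = Some c} = p n c"
    and lim: "\<And>c. c \<in> C \<Longrightarrow> (\<lambda>n. real n * p n c) \<longlonglongrightarrow> \<kappa> c"
    and E[measurable]: "E \<in> sets (PiM C (\<lambda>_. borel))"
    and e: "0 < e"
  shows "\<forall>\<^sub>F n in sequentially. measure (PiM C (\<lambda>c. compound_Poisson (\<kappa> c) (\<mu> c))) E - e \<le>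
     prob {\<omega>\<in>space M. (\<lambda>c\<in>C. \<Sum>i<n. if lb n (X i \<omega>) = Some c then q c (Z i \<omega>) else 0) \<in> E}"
proof -
  have [measurable]: "X i \<in> borel_measurable M" "Z i \<in> borel_measurable M" for i
    using indep_vars_Inl[OF ind] indep_vars_Inr[OF ind] by (auto simp: indep_vars_def2)
  have \<mu>': "mark_distribution (\<mu> c)" if "c \<in> C" for c
    unfolding \<mu>[OF that, of 0, symmetric] mark_distribution_def mark_distribution_axioms_def
    by (auto intro: prob_space_distr)
  define P where "P n z = (case z of None \<Rightarrow> 1 - sum (p n) C | Some c \<Rightarrow> if c \<in> C then p n c else 0)" for n z
  define \<pi> where "\<pi> k = measure (PiM C (\<lambda>c. iid_sum (\<mu> c) (k c))) E" for k
  define V where "V n \<omega> = (\<lambda>c\<in>C. \<Sum>i<n. if lb n (X i \<omega>) = Some c then q c (Z i \<omega>) else 0)" for n \<omega>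
  have V[measurable]: "V n \<in> measurable M (PiM C (\<lambda>_. borel))" for n
    unfolding V_def by (rule measurable_restrict) measurable
  have \<pi>: "0 \<le> \<pi> k" "\<pi> k \<le> 1" for k
    using prob_space.prob_le_1[OF prob_space_PiM[of C "\<lambda>c. iid_sum (\<mu> c) (k c)"]]
      mark_distribution.prob_space_iid_sum[OF \<mu>'] by (auto simp: \<pi>_def)
  have disj: "prob {\<omega>\<in>space M. \<exists>c\<in>C. lb n (X i \<omega>) = Some c} = sum (p n) C" for n i
  proof -
    have "{\<omega>\<in>space M. \<exists>c\<in>C. lb n (X i \<omega>) = Some c} = (\<Union>c\<in>C. {\<omega>\<in>space M. lb n (X i \<omega>) = Some c})" by auto
    also have "prob \<dots> = (\<Sum>c\<in>C. prob {\<omega>\<in>space M. lb n (X i \<omega>) = Some c})"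
      by (rule finite_measure_finite_Union) (auto simp: C disjoint_family_on_def)
    finally show ?thesis by (simp add: p)
  qed
  have p0: "0 \<le> p n c" if "c \<in> C" for n c using p[OF that, of n 0, symmetric] by simp
  have p1: "sum (p n) C \<le> 1" for n using disj[of n 0, symmetric] by simp
  have P: "prob {\<omega>\<in>space M. lb n (X i \<omega>) = z} = P n z" for n i z
  proof (cases z)
    case None
    have "{\<omega>\<in>space M. lb n (X i \<omega>) = None} = space M - {\<omega>\<in>space M. \<exists>c\<in>C. lb n (X i \<omega>) = Some c}"
    proof (intro set_eqI iffI)
      fix \<omega> assume "\<omega> \<in> space M - {\<omega>\<in>space M. \<exists>c\<in>C. lb n (X i \<omega>) = Some c}"
      then show "\<omega> \<in> {\<omega>\<in>space M. lb n (X i \<omega>) = None}"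
        using lbC[of n "X i \<omega>"] by (cases "lb n (X i \<omega>)") auto
    qed auto
    then show ?thesis using None C by (simp add: prob_compl disj P_def)
  next
    case (Some c)
    have "{\<omega>\<in>space M. lb n (X i \<omega>) = Some c} = {}" if "c \<notin> C" using that lbC by blast
    then show ?thesis using p Some by (cases "c \<in> C") (simp_all add: P_def del: Collect_empty_eq)
  qed
  \<comment> \<open>Half of the tolerance pays for count vectors outside \<open>F\<close>, the other
    half for the convergence of the finitely many weights.\<close>
  obtain F where F: "finite F" "\<And>k c. k \<in> F \<Longrightarrow> c \<notin> C \<Longrightarrow> k c = 0"
      "1 - e / 2 < measure (Pi_pmf C 0 (\<lambda>c. Poisson (\<kappa> c))) F"
    using Pi_pmf_finite_approx[OF C(1), of "e / 2"] e by auto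
  let ?w = "\<lambda>n k. real (card (permutations_of_multiset (count_mset_of C k n))) * (\<Prod>z\<in>#count_mset_of C k n. P n z)"
  \<comment> \<open>The event of a given multiset of labels is the disjoint union over its words,
    all equally likely, whence the multinomial coefficient.\<close>
  have one: "prob {\<omega>\<in>space M. mset (map (\<lambda>i. lb n (X i \<omega>)) [0..<n]) = count_mset_of C k n \<and> V n \<omega> \<in> E} = ?w n k * \<pi> k"
    if n: "sum k C \<le> n" and k: "\<And>c. c \<notin> C \<Longrightarrow> k c = 0" for n k
  proof -
    let ?B = "\<lambda>xs. {\<omega>\<in>space M. map (\<lambda>i. lb n (X i \<omega>)) [0..<n] = xs \<and> V n \<omega> \<in> E}"
    have meas: "?B xs \<in> events" if "length xs = n" for xs
    proof -
      have "?B xs = {\<omega>\<in>space M. (\<forall>i\<in>{..<n}. lb n (X i \<omega>) = xs ! i) \<and> V n \<omega> \<in> E}"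
        using that by (auto simp: list_eq_iff_nth_eq[of _ xs])
      then show ?thesis by simp
    qed
    have len: "length xs = n" if "xs \<in> permutations_of_multiset (count_mset_of C k n)" for xs
      using that size_count_mset_of[OF n] by (metis permutations_of_multisetD size_mset)
    have "{\<omega>\<in>space M. mset (map (\<lambda>i. lb n (X i \<omega>)) [0..<n]) = count_mset_of C k n \<and> V n \<omega> \<in> E} =
       (\<Union>xs\<in>permutations_of_multiset (count_mset_of C k n). ?B xs)"
      by (auto simp: permutations_of_multiset_def)
    also have "prob \<dots> = (\<Sum>xs\<in>permutations_of_multiset (count_mset_of C k n). prob (?B xs))"
      using meas len by (intro finite_measure_finite_Union) (auto simp: disjoint_family_on_def)
    also have "\<dots> = (\<Sum>xs\<in>permutations_of_multiset (count_mset_of C k n). (\<Prod>z\<in>#count_mset_of C k n. P n z) * \<pi> k)"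
    proof (rule sum.cong[OF refl])
      fix xs assume xs: "xs \<in> permutations_of_multiset (count_mset_of C k n)"
      then have ms: "mset xs = count_mset_of C k n" by (rule permutations_of_multisetD)
      have "prob (?B xs) = (\<Prod>z\<in>#mset xs. P n z) * measure (PiM C (\<lambda>c. iid_sum (\<mu> c) (count (mset xs) (Some c)))) E"
        using prob_labels_and_block_sums[where xs=xs, OF ind C lb[of n] q \<mu> P E] len[OF xs] by (simp add: V_def)
      also have "PiM C (\<lambda>c. iid_sum (\<mu> c) (count (mset xs) (Some c))) = PiM C (\<lambda>c. iid_sum (\<mu> c) (k c))"
        by (rule PiM_cong) (auto simp: ms count_count_mset_of[OF C(1)])
      finally show "prob (?B xs) = (\<Prod>z\<in>#count_mset_of C k n. P n z) * \<pi> k" by (simp add: ms \<pi>_def)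
    qed
    finally show ?thesis by simp
  qed
  \<comment> \<open>Dropping all counts outside \<open>F\<close> only loses probability, which is
    why this argument yields a lower bound.\<close>
  have lower: "(\<Sum>k\<in>F. ?w n k * \<pi> k) \<le> prob {\<omega>\<in>space M. V n \<omega> \<in> E}" if n: "\<And>k. k \<in> F \<Longrightarrow> sum k C \<le> n" for n
  proof -
    let ?B = "\<lambda>k. {\<omega>\<in>space M. mset (map (\<lambda>i. lb n (X i \<omega>)) [0..<n]) = count_mset_of C k n \<and> V n \<omega> \<in> E}"
    have meas: "?B k \<in> events" if "k \<in> F" for k
    proof -
      have "?B k = (\<Union>xs\<in>permutations_of_multiset (count_mset_of C k n). {\<omega>\<in>space M. (\<forall>i\<in>{..<n}. lb n (X i \<omega>) = xs ! i) \<and> V n \<omega> \<in> E})"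
      proof -
        have len: "length xs = n" if "xs \<in> permutations_of_multiset (count_mset_of C k n)" for xs
          using that size_count_mset_of[OF n[OF \<open>k \<in> F\<close>]] by (metis permutations_of_multisetD size_mset)
        have map_eq: "map (\<lambda>i. lb n (X i \<omega>)) [0..<n] = xs \<longleftrightarrow> (\<forall>i\<in>{..<n}. lb n (X i \<omega>) = xs ! i)"
          if "length xs = n" for xs \<omega>
          using that by (subst list_eq_iff_nth_eq) auto
        have "mset (map (\<lambda>i. lb n (X i \<omega>)) [0..<n]) = count_mset_of C k n \<longleftrightarrow>
           (\<exists>xs\<in>permutations_of_multiset (count_mset_of C k n). map (\<lambda>i. lb n (X i \<omega>)) [0..<n] = xs)" for \<omega>
          by (simp add: permutations_of_multiset_def)
        also have "\<dots> \<omega> \<longleftrightarrow> (\<exists>xs\<in>permutations_of_multiset (count_mset_of C k n). \<forall>i\<in>{..<n}. lb n (X i \<omega>) = xs ! i)" for \<omega>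
          using len map_eq by (intro bex_cong) auto
        finally show ?thesis by blast
      qed
      also have "\<dots> \<in> events" by (intro sets.finite_UN) auto
      finally show ?thesis .
    qed
    have dis: "disjoint_family_on ?B F"
      unfolding disjoint_family_on_def
    proof (intro ballI impI equals0I)
      fix k l \<omega> assume kl: "k \<in> F" "l \<in> F" "k \<noteq> l" "\<omega> \<in> ?B k \<inter> ?B l"
      then have eq: "count_mset_of C k n = count_mset_of C l n" by auto
      have "k c = l c" for c
        using count_count_mset_of(2)[OF C(1), of k n c] count_count_mset_of(2)[OF C(1), of l n c] eq F(2)[OF kl(1), of c] F(2)[OF kl(2), of c]
        by (cases "c \<in> C") auto
      then show False using kl by auto
    qed
    have "(\<Sum>k\<in>F. ?w n k * \<pi> k) = (\<Sum>k\<in>F. prob (?B k))"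
      by (intro sum.cong refl one[symmetric] n F) auto
    also have "\<dots> = prob (\<Union>k\<in>F. ?B k)"
      using meas F dis by (intro finite_measure_finite_Union[symmetric]) auto
    also have "\<dots> \<le> prob {\<omega>\<in>space M. V n \<omega> \<in> E}"
      by (intro finite_measure_mono) auto
    finally show ?thesis .
  qed
  have "(\<lambda>n. \<Sum>k\<in>F. ?w n k * \<pi> k) \<longlonglongrightarrow> (\<Sum>k\<in>F. pmf (Pi_pmf C 0 (\<lambda>c. Poisson (\<kappa> c))) k * \<pi> k)"
  proof (intro tendsto_sum tendsto_mult tendsto_const)
    fix k assume k: "k \<in> F"
    have "(\<Prod>z\<in>#count_mset_of C k n. P n z) =
       (\<Prod>z\<in>#count_mset_of C k n. case z of None \<Rightarrow> 1 - sum (p n) C | Some c \<Rightarrow> p n c)" for n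
    proof (intro arg_cong[where f=prod_mset] image_mset_cong)
      fix z assume "z \<in># count_mset_of C k n"
      then have "count (count_mset_of C k n) z \<noteq> 0" by simp
      then show "P n z = (case z of None \<Rightarrow> 1 - sum (p n) C | Some c \<Rightarrow> p n c)"
        by (cases z) (auto simp: P_def count_count_mset_of[OF C(1)] split: if_splits)
    qed
    then show "(\<lambda>n. ?w n k) \<longlonglongrightarrow> pmf (Pi_pmf C 0 (\<lambda>c. Poisson (\<kappa> c))) k"
      using tendsto_multinomial_weight[OF C(1) p0 p1 lim F(2)[OF k]] by simp
  qed
  moreover have "measure (PiM C (\<lambda>c. compound_Poisson (\<kappa> c) (\<mu> c))) E - e / 2 <
      (\<Sum>k\<in>F. pmf (Pi_pmf C 0 (\<lambda>c. Poisson (\<kappa> c))) k * \<pi> k)"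
  proof -
    let ?p = "Pi_pmf C 0 (\<lambda>c. Poisson (\<kappa> c))"
    have int: "integrable (measure_pmf ?p) \<pi>" "integrable (measure_pmf ?p) (\<lambda>k. \<pi> k * indicator F k)"
      using \<pi> by (auto intro!: measure_pmf.integrable_const_bound[where B=1] simp: indicator_def)
    have "measure (PiM C (\<lambda>c. compound_Poisson (\<kappa> c) (\<mu> c))) E = (\<integral>k. \<pi> k \<partial>?p)"
      using measure_PiM_compound_Poisson[OF C \<mu>' E] by (simp add: \<pi>_def)
    also have "\<dots> \<le> (\<integral>k. \<pi> k * indicator F k + indicator (- F) k \<partial>?p)"
    proof (rule integral_mono)
      show "integrable (measure_pmf ?p) (\<lambda>k. \<pi> k * indicator F k + indicator (- F) k)"
        by (intro Bochner_Integration.integrable_add int measure_pmf.integrable_const_bound[where B=1])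
          (auto simp: indicator_def)
    qed (use int \<pi> in \<open>auto simp: indicator_def\<close>)
    also have "\<dots> = (\<integral>k. \<pi> k * indicator F k \<partial>?p) + measure ?p (- F)"
      using int by (subst Bochner_Integration.integral_add)
        (auto intro!: measure_pmf.integrable_const_bound[where B=1] simp: indicator_def[of "- F"])
    also have "(\<integral>k. \<pi> k * indicator F k \<partial>?p) = (\<Sum>k\<in>F. \<pi> k * indicator F k * pmf ?p k)"
      by (rule integral_measure_pmf_real) (auto simp: F indicator_def)
    also have "measure ?p (- F) = 1 - measure ?p F"
      using measure_pmf.prob_compl[of F ?p] by (simp add: Compl_eq_Diff_UNIV)
    also have "(\<Sum>k\<in>F. \<pi> k * indicator F k * pmf ?p k) = (\<Sum>k\<in>F. pmf ?p k * \<pi> k)"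
      by (intro sum.cong) auto
    finally show ?thesis using F(3) by simp
  qed
  ultimately have "\<forall>\<^sub>F n in sequentially. measure (PiM C (\<lambda>c. compound_Poisson (\<kappa> c) (\<mu> c))) E - e / 2 <
      (\<Sum>k\<in>F. ?w n k * \<pi> k)"
    by (rule order_tendstoD)
  moreover have "\<forall>\<^sub>F n in sequentially. \<forall>k\<in>F. sum k C \<le> n"
    using F(1) by (auto simp: eventually_ball_finite_distrib eventually_ge_at_top)
  ultimately show ?thesis
  proof eventually_elim
    case (elim n)
    have "(\<Sum>k\<in>F. ?w n k * \<pi> k) \<le> prob {\<omega>\<in>space M. V n \<omega> \<in> E}" using elim by (intro lower) auto
    then show ?case using elim e by (simp add: V_def)
  qed
qed

text \<open>The lower bound is applied to the complement of \<open>E\<close>; both laws are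
  probability measures, so it turns into an upper bound.\<close>

lemma cell_sums_limsup:
  fixes X Z :: "nat \<Rightarrow> 'a \<Rightarrow> real" and lb :: "nat \<Rightarrow> real \<Rightarrow> 'c option" and q :: "'c \<Rightarrow> real \<Rightarrow> real"
  assumes ind: "indep_vars (\<lambda>_. borel) (case_sum X Z) UNIV"
    and C: "finite C" "C \<noteq> {}"
    and lb[measurable]: "\<And>n. lb n \<in> measurable borel (count_space UNIV)"
    and lbC: "\<And>n x c. lb n x = Some c \<Longrightarrow> c \<in> C"
    and q[measurable]: "\<And>c. q c \<in> borel_measurable borel"
    and \<mu>: "\<And>i c. c \<in> C \<Longrightarrow> distr M borel (\<lambda>\<omega>. q c (Z i \<omega>)) = \<mu> c"
    and p: "\<And>n i c. c \<in> C \<Longrightarrow> prob {\<omega>\<in>space M. lb n (X i \<omega>) = Some c} = p n c"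
    and lim: "\<And>c. c \<in> C \<Longrightarrow> (\<lambda>n. real n * p n c) \<longlonglongrightarrow> \<kappa> c"
    and E[measurable]: "E \<in> sets (PiM C (\<lambda>_. borel))"
    and e: "0 < e"
  shows "\<forall>\<^sub>F n in sequentially.
     prob {\<omega>\<in>space M. (\<lambda>c\<in>C. \<Sum>i<n. if lb n (X i \<omega>) = Some c then q c (Z i \<omega>) else 0) \<in> E} \<le>
     measure (PiM C (\<lambda>c. compound_Poisson (\<kappa> c) (\<mu> c))) E + e"
proof -
  let ?B = "PiM C (\<lambda>_. borel) :: ('c \<Rightarrow> real) measure"
  have [measurable]: "X i \<in> borel_measurable M" "Z i \<in> borel_measurable M" for i
    using indep_vars_Inl[OF ind] indep_vars_Inr[OF ind] by (auto simp: indep_vars_def2)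
  have \<mu>': "mark_distribution (\<mu> c)" if "c \<in> C" for c
    unfolding \<mu>[OF that, of 0, symmetric] mark_distribution_def mark_distribution_axioms_def
    by (auto intro: prob_space_distr)
  define V where "V n \<omega> = (\<lambda>c\<in>C. \<Sum>i<n. if lb n (X i \<omega>) = Some c then q c (Z i \<omega>) else 0)" for n \<omega>
  have V[measurable]: "V n \<in> measurable M ?B" for n
    unfolding V_def by (rule measurable_restrict) measurable
  interpret CP: prob_space "PiM C (\<lambda>c. compound_Poisson (\<kappa> c) (\<mu> c))"
    by (rule prob_space_PiM) (rule mark_distribution.prob_space_compound_Poisson[OF \<mu>'])
  have s: "sets (PiM C (\<lambda>c. compound_Poisson (\<kappa> c) (\<mu> c))) = sets ?B"
    by (rule sets_PiM_cong) (auto simp: mark_distribution.sets_compound_Poisson[OF \<mu>'])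
  have sp: "space (PiM C (\<lambda>c. compound_Poisson (\<kappa> c) (\<mu> c))) = space ?B"
    by (rule sets_eq_imp_space_eq[OF s])
  have "\<forall>\<^sub>F n in sequentially. measure (PiM C (\<lambda>c. compound_Poisson (\<kappa> c) (\<mu> c))) (space ?B - E) - e \<le>
     prob {\<omega>\<in>space M. V n \<omega> \<in> space ?B - E}"
    unfolding V_def by (rule cell_sums_liminf[OF ind C lb lbC q \<mu> p lim _ e]) auto
  then show ?thesis
  proof eventually_elim
    case (elim n)
    have "{\<omega>\<in>space M. V n \<omega> \<in> space ?B - E} = space M - {\<omega>\<in>space M. V n \<omega> \<in> E}"
      using measurable_space[OF V] by auto
    then have "prob {\<omega>\<in>space M. V n \<omega> \<in> space ?B - E} = 1 - prob {\<omega>\<in>space M. V n \<omega> \<in> E}"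
      by (simp add: prob_compl)
    moreover have "measure (PiM C (\<lambda>c. compound_Poisson (\<kappa> c) (\<mu> c))) (space ?B - E) =
        1 - measure (PiM C (\<lambda>c. compound_Poisson (\<kappa> c) (\<mu> c))) E"
      using CP.prob_compl[of E] by (simp add: sp s)
    ultimately show ?case using elim by (simp add: V_def)
  qed
qed

end

section \<open>Increments of marked Poisson processes\<close>

text \<open>Cells are numbered from left to right by \<open>i < 2 * J\<close>, with \<open>J\<close> the first one to the right of \<open>0\<close>.\<close>
definition cell_left :: "real \<Rightarrow> nat \<Rightarrow> nat \<Rightarrow> real" where
  "cell_left \<eta> J i = (real i - real J) * \<eta>"

text \<open>Half-open on the side that lets the cells left of \<open>0\<close> tile sets
  \<open>{t..<0}\<close> and the others sets \<open>{0<..t}\<close>, the two kinds of sets in which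
  the marked process counts its points.\<close>

definition time_cell :: "real \<Rightarrow> nat \<Rightarrow> nat \<Rightarrow> real set" where
  "time_cell \<eta> J i = (if i < J then {cell_left \<eta> J i..<cell_left \<eta> J (Suc i)}
     else {cell_left \<eta> J i<..cell_left \<eta> J (Suc i)})"

text \<open>Differences are oriented away from the origin, because the process adds marks in both
  directions. Each one is then the plain sum of the marks in its time cell.\<close>

definition cell_increment :: "real \<Rightarrow> nat \<Rightarrow> (real \<Rightarrow> real) \<Rightarrow> nat \<Rightarrow> real" where
  "cell_increment \<eta> J w i = (if i < J then w (cell_left \<eta> J i) - w (cell_left \<eta> J (Suc i))
     else w (cell_left \<eta> J (Suc i)) - w (cell_left \<eta> J i))"

lemma cell_left_mono: "0 < \<eta> \<Longrightarrow> i \<le> j \<Longrightarrow> cell_left \<eta> J i \<le> cell_left \<eta> J j"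
  by (simp add: cell_left_def mult_right_mono)

lemma cell_left_Suc: "cell_left \<eta> J (Suc i) = cell_left \<eta> J i + \<eta>"
  by (simp add: cell_left_def algebra_simps)

lemma cell_left_self[simp]: "cell_left \<eta> J J = 0"
  by (simp add: cell_left_def)

lemma cell_left_neg_iff: "0 < \<eta> \<Longrightarrow> cell_left \<eta> J i < 0 \<longleftrightarrow> i < J"
  by (auto simp: cell_left_def mult_less_0_iff)

lemma time_cell_disjoint: "0 < \<eta> \<Longrightarrow> disjoint_family (time_cell \<eta> J)"
  unfolding disjoint_family_on_def
proof (intro ballI impI)
  fix i j :: nat assume \<eta>: "0 < \<eta>" and "i \<noteq> j"
  have *: "time_cell \<eta> J i \<inter> time_cell \<eta> J j = {}" if "i < j" for i j
    using cell_left_mono[OF \<eta>, of "Suc i" j J] that cell_left_neg_iff[OF \<eta>, of J "Suc i"]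
      cell_left_neg_iff[OF \<eta>, of J "i"] cell_left_neg_iff[OF \<eta>, of J "j"]
    by (fastforce simp: time_cell_def)
  show "time_cell \<eta> J i \<inter> time_cell \<eta> J j = {}"
    using *[of i j] *[of j i] \<open>i \<noteq> j\<close> by (cases "i < j") auto
qed

lemma time_cell_bounded_borel: "time_cell \<eta> J i \<in> bounded_borel"
  by (auto simp: time_cell_def bounded_borel_def)

lemma measure_time_cell: "0 < \<eta> \<Longrightarrow> measure lborel (time_cell \<eta> J i) = \<eta>"
  by (simp add: time_cell_def cell_left_Suc)

context prob_space begin

lemma homogeneous_Poisson_process_finite:
  "homogeneous_Poisson_process \<kappa> S \<Longrightarrow> \<omega> \<in> space M \<Longrightarrow> bounded B \<Longrightarrow> finite (S \<omega> \<inter> B)"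
proof -
  assume S: "homogeneous_Poisson_process \<kappa> S" "\<omega> \<in> space M" "bounded B"
  obtain a where "\<And>x. x \<in> B \<Longrightarrow> \<bar>x\<bar> \<le> a" using S(3) by (auto simp: bounded_real)
  then have "B \<subseteq> {-a..a}" by (force simp: abs_le_iff)
  then have "S \<omega> \<inter> B \<subseteq> S \<omega> \<inter> {-a..a}" by auto
  then show ?thesis using S(1,2) unfolding homogeneous_Poisson_process_def by (meson finite_subset)
qed

lemma homogeneous_Poisson_process_count:
  assumes S: "homogeneous_Poisson_process \<kappa> S" and B: "B \<in> bounded_borel"
  shows "(\<lambda>\<omega>. card (S \<omega> \<inter> B)) \<in> measurable M (count_space UNIV)"
    "distr M (count_space UNIV) (\<lambda>\<omega>. card (S \<omega> \<inter> B)) = measure_pmf (Poisson (\<kappa> * measure lborel B))"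
proof -
  show "(\<lambda>\<omega>. card (S \<omega> \<inter> B)) \<in> measurable M (count_space UNIV)"
    using assms unfolding homogeneous_Poisson_process_def by blast
  have d: "distr M (count_space UNIV) (\<lambda>\<omega>. card (S \<omega> \<inter> B)) = measure_pmf (poisson_pmf (\<kappa> * measure lborel B))"
    if "B \<in> bounded_borel" for B
    using S that unfolding homogeneous_Poisson_process_def by blast
  \<comment> \<open>The empty set has count \<open>0\<close>, so the process itself forces
    \<open>poisson_pmf 0\<close> to be the point mass at \<open>0\<close>, in agreement with
    \<open>Poisson\<close>.\<close>
  have "{} \<in> bounded_borel" by (simp add: bounded_borel_def)
  from d[OF this] have "measure_pmf (poisson_pmf 0) = return (count_space UNIV) 0"
    by (simp add: distr_const)
  then have "measure_pmf (poisson_pmf 0) = measure_pmf (return_pmf 0)" by (simp add: return_pmf.rep_eq)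
  then show "distr M (count_space UNIV) (\<lambda>\<omega>. card (S \<omega> \<inter> B)) = measure_pmf (Poisson (\<kappa> * measure lborel B))"
    using d[OF B] by (auto simp: Poisson_def)
qed

lemma homogeneous_Poisson_process_null:
  assumes S: "homogeneous_Poisson_process \<kappa> S" and B: "B \<in> bounded_borel" and null: "\<kappa> * measure lborel B = 0"
  shows "AE \<omega> in M. S \<omega> \<inter> B = {}"
proof -
  note [measurable] = homogeneous_Poisson_process_count(1)[OF S B]
  have "AE k in distr M (count_space UNIV) (\<lambda>\<omega>. card (S \<omega> \<inter> B)). k = 0"
    unfolding homogeneous_Poisson_process_count(2)[OF S B] null by (auto simp: AE_measure_pmf_iff Poisson_def)
  then have "AE \<omega> in M. card (S \<omega> \<inter> B) = 0" by (subst (asm) AE_distr_iff) auto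
  moreover have "bounded B" using B by (simp add: bounded_borel_def)
  ultimately show ?thesis
    using homogeneous_Poisson_process_finite[OF S] by (auto elim!: AE_mp intro!: AE_I2)
qed

text \<open>Marks are numbered outwards from the origin, so a time cell uses a run of consecutive
  marks whose position is fixed by the counts of the cells between it and \<open>0\<close>. Given
  the counts, the increments are sums over disjoint runs of iid marks, and the counts are
  independent Poisson variables.\<close>

lemma marked_Poisson_increments:
  assumes W: "double_sided_marked_Poisson_process \<kappa> \<mu> W" and \<kappa>: "0 \<le> \<kappa>" and \<mu>: "mark_distribution \<mu>"
    and \<eta>: "0 < \<eta>" and J: "0 < J"
    and W_meas: "W \<in> measurable M (\<Pi>\<^sub>M t\<in>UNIV. borel)"
  shows "distr M (\<Pi>\<^sub>M i\<in>{..<2*J}. borel) (\<lambda>\<omega>. \<lambda>i\<in>{..<2*J}. cell_increment \<eta> J (W \<omega>) i) =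
    (\<Pi>\<^sub>M i\<in>{..<2*J}. compound_Poisson (\<kappa> * \<eta>) \<mu>)"
proof -
  interpret \<mu>: mark_distribution \<mu> by fact
  obtain S \<xi> where S: "homogeneous_Poisson_process \<kappa> S"
    and \<xi>_ind: "indep_vars (\<lambda>_. borel) \<xi> UNIV" and \<xi>: "\<And>k. distr M borel (\<xi> k) = \<mu>"
    and ind: "indep_set
          (sets (vimage_algebra (space M) (\<lambda>\<omega>. \<lambda>B\<in>bounded_borel. card (S \<omega> \<inter> B))
             (\<Pi>\<^sub>M B\<in>bounded_borel. count_space UNIV)))
          (sets (vimage_algebra (space M) (\<lambda>\<omega> k. \<xi> k \<omega>) (\<Pi>\<^sub>M k\<in>UNIV. borel)))"
    and W_eq: "\<And>\<omega> t. \<omega> \<in> space M \<Longrightarrow> W \<omega> t =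
           (if 0 \<le> t then (\<Sum>k=1..card (S \<omega> \<inter> {0<..t}). \<xi> (int k) \<omega>)
            else (\<Sum>k=1..card (S \<omega> \<inter> {t..<0}). \<xi> (- int k) \<omega>))"
    using W unfolding double_sided_marked_Poisson_process_def by metis
  let ?C = "{..<2*J}"
  let ?B = "\<Pi>\<^sub>M i\<in>?C. borel :: real measure"
  let ?P = "Pi_pmf ?C 0 (\<lambda>_. Poisson (\<kappa> * \<eta>))"
  define A where "A = time_cell \<eta> J"
  define N where "N \<omega> i = card (S \<omega> \<inter> A i)" for \<omega> i
  define V where "V \<omega> = (\<lambda>i\<in>?C. cell_increment \<eta> J (W \<omega>) i)" for \<omega>
  \<comment> \<open>Indices of the marks used in cell \<open>i\<close> when the counts are
    \<open>c\<close>; the bounds are the number of points nearer to the origin than the cell and the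
    number up to its far end.\<close>
  define Bl where "Bl c i = (if i < J then (\<lambda>k. - int k) ` {sum c {Suc i..<J}<..sum c {i..<J}}
      else int ` {sum c {J..<i}<..sum c {J..<Suc i}})" for c :: "nat \<Rightarrow> nat" and i
  \<comment> \<open>Count vectors padded by \<open>0\<close>, the default value of
    \<open>Pi_pmf\<close>; countability permits a decomposition over all of them.\<close>
  define K where "K = {c :: nat \<Rightarrow> nat. \<forall>i. i \<notin> ?C \<longrightarrow> c i = 0}"
  have [measurable]: "\<xi> k \<in> borel_measurable M" for k using \<xi>_ind by (auto simp: indep_vars_def2)
  have Wt[measurable]: "(\<lambda>\<omega>. W \<omega> t) \<in> borel_measurable M" for t
    using measurable_compose[OF W_meas measurable_component_singleton[of t UNIV]] by simp
  have V[measurable]: "V \<in> measurable M ?B"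
    unfolding V_def cell_increment_def by (rule measurable_restrict) measurable
  have A_bb: "A i \<in> bounded_borel" for i unfolding A_def by (rule time_cell_bounded_borel)
  have N_meas[measurable]: "(\<lambda>\<omega>. N \<omega> i) \<in> measurable M (count_space UNIV)" for i
    unfolding N_def by (rule homogeneous_Poisson_process_count(1)[OF S A_bb])
  have fin: "finite (S \<omega> \<inter> A i)" if "\<omega> \<in> space M" for \<omega> i
    using homogeneous_Poisson_process_finite[OF S that] A_bb by (auto simp: bounded_borel_def)
  have right: "card (S \<omega> \<inter> {0<..cell_left \<eta> J i}) = sum (N \<omega>) {J..<i}" if "\<omega> \<in> space M" "J \<le> i" for \<omega> i
    using that(2)
  proof (induction i rule: dec_induct)
    case (step i)
    have "0 \<le> cell_left \<eta> J i" using cell_left_neg_iff[OF \<eta>, of J i] step by linarith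
    moreover have "cell_left \<eta> J i \<le> cell_left \<eta> J (Suc i)" by (rule cell_left_mono[OF \<eta>]) simp
    ultimately have eq: "S \<omega> \<inter> {0<..cell_left \<eta> J (Suc i)} = (S \<omega> \<inter> {0<..cell_left \<eta> J i}) \<union> (S \<omega> \<inter> A i)"
      using step(1) by (auto simp: A_def time_cell_def)
    have "finite (S \<omega> \<inter> {0<..cell_left \<eta> J i})"
      by (rule homogeneous_Poisson_process_finite[OF S that(1)]) simp
    then show ?case
      unfolding eq using fin[OF that(1), of i] step
      by (subst card_Un_disjoint) (auto simp: A_def time_cell_def N_def)
  qed simp
  have left: "card (S \<omega> \<inter> {cell_left \<eta> J i..<0}) = sum (N \<omega>) {i..<J}" if "\<omega> \<in> space M" "i \<le> J" for \<omega> i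
    using that(2)
  proof (induction i rule: inc_induct)
    case (step i)
    have "cell_left \<eta> J (Suc i) \<le> 0" using cell_left_mono[OF \<eta>, of "Suc i" J J] step by simp
    moreover have "cell_left \<eta> J i \<le> cell_left \<eta> J (Suc i)" by (rule cell_left_mono[OF \<eta>]) simp
    ultimately have eq: "S \<omega> \<inter> {cell_left \<eta> J i..<0} = (S \<omega> \<inter> A i) \<union> (S \<omega> \<inter> {cell_left \<eta> J (Suc i)..<0})"
      using step(2) by (auto simp: A_def time_cell_def)
    have "finite (S \<omega> \<inter> {cell_left \<eta> J (Suc i)..<0})"
      by (rule homogeneous_Poisson_process_finite[OF S that(1)]) simp
    then show ?case
      unfolding eq using fin[OF that(1), of i] step
      by (subst card_Un_disjoint) (auto simp: A_def time_cell_def N_def sum.atLeast_Suc_lessThan)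
  qed simp
  have diff: "(\<Sum>k=1..b. g k) - (\<Sum>k=1..a. g k) = (\<Sum>k\<in>{a<..b}. g k)" if "a \<le> b" for a b :: nat and g :: "nat \<Rightarrow> real"
  proof -
    have "{1..b} = {1..a} \<union> {a<..b}" using that by auto
    then show ?thesis by (subst \<open>{1..b} = _\<close>, subst sum.union_disjoint) auto
  qed
  have incr: "cell_increment \<eta> J (W \<omega>) i = (\<Sum>k\<in>Bl (N \<omega>) i. \<xi> k \<omega>)" if \<omega>: "\<omega> \<in> space M" for \<omega> i
  proof (cases "i < J")
    case True
    have *: "W \<omega> (cell_left \<eta> J j) = (\<Sum>k=1..sum (N \<omega>) {j..<J}. \<xi> (- int k) \<omega>)" if "j \<le> J" for j
    proof (cases "j = J")
      case False
      then show ?thesis using that cell_left_neg_iff[OF \<eta>, of J j] by (simp add: W_eq[OF \<omega>] left[OF \<omega>])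
    qed (simp add: W_eq[OF \<omega>])
    have "sum (N \<omega>) {Suc i..<J} \<le> sum (N \<omega>) {i..<J}" by (rule sum_mono2) auto
    then show ?thesis using True
      by (simp add: cell_increment_def * Bl_def diff sum.reindex inj_on_def del: One_nat_def)
  next
    case False
    have *: "W \<omega> (cell_left \<eta> J j) = (\<Sum>k=1..sum (N \<omega>) {J..<j}. \<xi> (int k) \<omega>)" if "J \<le> j" for j
      using that cell_left_neg_iff[OF \<eta>, of J j] by (simp add: W_eq[OF \<omega>] right[OF \<omega>] not_less[symmetric])
    have "sum (N \<omega>) {J..<i} \<le> sum (N \<omega>) {J..<Suc i}" by (rule sum_mono2) auto
    then show ?thesis using False
      by (simp only: cell_increment_def if_False * Bl_def) (simp add: * diff sum.reindex del: One_nat_def)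
  qed
  have card_Bl: "card (Bl c i) = c i" for c i
  proof (cases "i < J")
    case True
    then have "sum c {i..<J} = c i + sum c {Suc i..<J}" by (rule sum.atLeast_Suc_lessThan)
    then show ?thesis using True by (simp add: Bl_def card_image inj_on_def)
  qed (simp add: Bl_def card_image)
  have Bl_disj: "disjoint_family_on (Bl c) ?C" for c
    unfolding disjoint_family_on_def
  proof (intro ballI impI)
    have *: "Bl c i \<inter> Bl c j = {}" if "i < j" for i j
    proof (cases "j < J")
      case True
      have "sum c {j..<J} \<le> sum c {Suc i..<J}" using that by (intro sum_mono2) auto
      then show ?thesis using True that by (auto simp: Bl_def)
    next
      case False
      show ?thesis
      proof (cases "i < J")
        case False
        have "sum c {J..<Suc i} \<le> sum c {J..<j}" using that by (intro sum_mono2) auto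
        then show ?thesis using False that by (auto simp: Bl_def)
      qed (use False in \<open>auto simp: Bl_def\<close>)
    qed
    fix i j assume "i \<in> ?C" "j \<in> ?C" "i \<noteq> j"
    then show "Bl c i \<inter> Bl c j = {}" using *[of i j] *[of j i] by (cases "i < j") auto
  qed
  have blocks: "distr M ?B (\<lambda>\<omega>. \<lambda>i\<in>?C. \<Sum>k\<in>Bl c i. \<xi> k \<omega>) = (\<Pi>\<^sub>M i\<in>?C. iid_sum \<mu> (c i))" for c
  proof -
    have "finite (Bl c i)" for i by (simp add: Bl_def)
    then show ?thesis
      using distr_block_sums[OF \<xi>_ind, of ?C "Bl c" "\<lambda>_. \<mu>"] J Bl_disj[of c]
      by (simp add: card_Bl \<xi> \<mu>.prob_space_axioms lessThan_empty_iff)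
  qed
  have N_ind: "indep_vars (\<lambda>_. count_space UNIV) (\<lambda>i \<omega>. N \<omega> i) UNIV"
    using S time_cell_disjoint[OF \<eta>, of J] A_bb unfolding homogeneous_Poisson_process_def N_def A_def
    by (auto simp: image_subset_iff)
  have N_pmf: "prob {\<omega>\<in>space M. \<forall>i\<in>?C. N \<omega> i = c i} = pmf ?P c" if "c \<in> K" for c
  proof -
    have "{\<omega>\<in>space M. \<forall>i\<in>?C. N \<omega> i = c i} = (\<Inter>i\<in>?C. (\<lambda>\<omega>. N \<omega> i) -` {c i} \<inter> space M)"
      using J by (auto simp: lessThan_empty_iff)
    also have "prob \<dots> = (\<Prod>i\<in>?C. prob ((\<lambda>\<omega>. N \<omega> i) -` {c i} \<inter> space M))"
      using J by (intro indep_varsD[OF N_ind]) (auto simp: lessThan_empty_iff)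
    also have "\<dots> = (\<Prod>i\<in>?C. pmf (Poisson (\<kappa> * \<eta>)) (c i))"
    proof (rule prod.cong[OF refl])
      fix i
      have "prob ((\<lambda>\<omega>. N \<omega> i) -` {c i} \<inter> space M) = measure (distr M (count_space UNIV) (\<lambda>\<omega>. N \<omega> i)) {c i}"
        by (subst measure_distr) auto
      also have "\<dots> = pmf (Poisson (\<kappa> * \<eta>)) (c i)"
        using homogeneous_Poisson_process_count(2)[OF S A_bb, of i]
        by (simp add: N_def A_def measure_time_cell[OF \<eta>] measure_pmf_single)
      finally show "prob ((\<lambda>\<omega>. N \<omega> i) -` {c i} \<inter> space M) = pmf (Poisson (\<kappa> * \<eta>)) (c i)" .
    qed
    also have "\<dots> = pmf ?P c" using that by (subst pmf_Pi') (auto simp: K_def)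
    finally show ?thesis .
  qed
  have K_count: "countable K"
  proof -
    have "K = (\<lambda>h i. if i \<in> ?C then h i else 0) ` (PiE ?C (\<lambda>_. UNIV))"
      unfolding dflt_image_PiE by (auto simp: K_def PiE_dflt_def)
    moreover have "countable (PiE ?C (\<lambda>_. UNIV :: nat set))" by (intro countable_PiE) auto
    ultimately show ?thesis by simp
  qed
  have key: "emeasure M (V -` E \<inter> space M) = (\<integral>\<^sup>+c. emeasure (\<Pi>\<^sub>M i\<in>?C. iid_sum \<mu> (c i)) E \<partial>?P)"
    if E[measurable]: "E \<in> sets ?B" for E
  proof -
    let ?X = "\<lambda>c. {\<omega>\<in>space M. (\<forall>i\<in>?C. N \<omega> i = c i) \<and> V \<omega> \<in> E}"
    have "V -` E \<inter> space M = (\<Union>c\<in>K. ?X c)"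
    proof (intro set_eqI iffI)
      fix \<omega> assume "\<omega> \<in> V -` E \<inter> space M"
      then show "\<omega> \<in> (\<Union>c\<in>K. ?X c)"
        by (intro UN_I[of "\<lambda>i. if i \<in> ?C then N \<omega> i else 0"]) (auto simp: K_def)
    qed auto
    moreover have "disjoint_family_on ?X K"
      unfolding disjoint_family_on_def
    proof (intro ballI impI equals0I)
      fix c d \<omega> assume "c \<in> K" "d \<in> K" "c \<noteq> d" and \<omega>: "\<omega> \<in> ?X c \<inter> ?X d"
      have "c i = d i" for i
      proof (cases "i \<in> ?C")
        case True
        then have "N \<omega> i = c i" "N \<omega> i = d i" using \<omega> by blast+
        then show ?thesis by simp
      next
        case False
        then show ?thesis using \<open>c \<in> K\<close> \<open>d \<in> K\<close> unfolding K_def by simp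
      qed
      then show False using \<open>c \<noteq> d\<close> by auto
    qed
    ultimately have "emeasure M (V -` E \<inter> space M) = (\<integral>\<^sup>+c. emeasure M (?X c) \<partial>count_space K)"
      using K_count by (simp only:) (rule emeasure_UN_countable, measurable)
    also have "\<dots> = (\<integral>\<^sup>+c. ennreal (pmf ?P c) * emeasure (\<Pi>\<^sub>M i\<in>?C. iid_sum \<mu> (c i)) E \<partial>count_space K)"
    proof (rule nn_integral_cong)
      fix c assume "c \<in> space (count_space K)"
      then have c: "c \<in> K" by simp
      let ?D = "\<lambda>\<omega>. \<lambda>i\<in>?C. \<Sum>k\<in>Bl c i. \<xi> k \<omega>"
      have D[measurable]: "?D \<in> measurable M ?B" by (rule measurable_restrict) auto
      \<comment> \<open>With the counts frozen the runs are deterministic, so the increments become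
        functions of the marks alone and independence from the points applies.\<close>
      have "Bl (N \<omega>) i = Bl c i" if "\<forall>i\<in>?C. N \<omega> i = c i" "i \<in> ?C" for \<omega> i
      proof -
        have seq: "sum (N \<omega>) {a..<b} = sum c {a..<b}" if "b \<le> 2 * J" for a b
          using that \<open>\<forall>i\<in>?C. N \<omega> i = c i\<close> by (intro sum.cong) auto
        have i: "Suc i \<le> 2 * J" "i \<le> 2 * J" "J \<le> 2 * J" using \<open>i \<in> ?C\<close> by auto
        have "sum (N \<omega>) {Suc i..<J} = sum c {Suc i..<J}" "sum (N \<omega>) {i..<J} = sum c {i..<J}"
          "sum (N \<omega>) {J..<i} = sum c {J..<i}" "sum (N \<omega>) {J..<Suc i} = sum c {J..<Suc i}"
          by (rule seq[OF i(3)] seq[OF i(2)] seq[OF i(1)])+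
        then show ?thesis by (simp only: Bl_def)
      qed
      then have X_Int: "?X c = {\<omega>\<in>space M. \<forall>i\<in>?C. N \<omega> i = c i} \<inter> {\<omega>\<in>space M. ?D \<omega> \<in> E}"
        using incr by (auto simp: V_def cong: restrict_cong)
      have X_eq: "prob (?X c) = prob {\<omega>\<in>space M. \<forall>i\<in>?C. N \<omega> i = c i} * prob {\<omega>\<in>space M. ?D \<omega> \<in> E}"
        unfolding X_Int
      proof (rule indep_setD[OF ind])
        have "(\<lambda>\<omega>. \<lambda>B\<in>bounded_borel. card (S \<omega> \<inter> B)) \<in> space M \<rightarrow> space (\<Pi>\<^sub>M B\<in>bounded_borel. count_space UNIV)"
          by (auto simp: space_PiM)
        moreover have "{y \<in> space (\<Pi>\<^sub>M B\<in>bounded_borel. count_space (UNIV::nat set)). \<forall>i\<in>?C. y (A i) = c i} \<in>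
            sets (\<Pi>\<^sub>M B\<in>bounded_borel. count_space UNIV)"
          using A_bb by measurable
        ultimately show "{\<omega>\<in>space M. \<forall>i\<in>?C. N \<omega> i = c i} \<in> sets (vimage_algebra (space M) (\<lambda>\<omega>. \<lambda>B\<in>bounded_borel. card (S \<omega> \<inter> B))
             (\<Pi>\<^sub>M B\<in>bounded_borel. count_space UNIV))"
          unfolding sets_vimage_algebra2[OF \<open>_ \<in> space M \<rightarrow> _\<close>]
          using A_bb by (intro CollectI exI[of _ "{y \<in> space (\<Pi>\<^sub>M B\<in>bounded_borel. count_space (UNIV::nat set)). \<forall>i\<in>?C. y (A i) = c i}"])
            (auto simp: N_def space_PiM)
        have sp: "(\<lambda>\<omega> k. \<xi> k \<omega>) \<in> space M \<rightarrow> space (\<Pi>\<^sub>M k\<in>UNIV. borel)" by (auto simp: space_PiM)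
        have "(\<lambda>x. \<lambda>i\<in>?C. \<Sum>k\<in>Bl c i. x k) \<in> measurable (\<Pi>\<^sub>M k\<in>(UNIV :: int set). borel) ?B"
          by (rule measurable_restrict) auto
        from measurable_sets[OF this E] show "{\<omega>\<in>space M. ?D \<omega> \<in> E} \<in> sets (vimage_algebra (space M) (\<lambda>\<omega> k. \<xi> k \<omega>) (\<Pi>\<^sub>M k\<in>UNIV. borel))"
          unfolding sets_vimage_algebra2[OF sp]
          by (intro CollectI exI[of _ "(\<lambda>x. \<lambda>i\<in>?C. \<Sum>k\<in>Bl c i. x k) -` E \<inter> space (\<Pi>\<^sub>M k\<in>(UNIV :: int set). borel)"])
            (auto simp: space_PiM)
      qed
      have "{\<omega>\<in>space M. ?D \<omega> \<in> E} = ?D -` E \<inter> space M" by blast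
      then have "prob {\<omega>\<in>space M. ?D \<omega> \<in> E} = measure (distr M ?B ?D) E"
        using D E by (simp only: measure_distr)
      then have *: "prob (?X c) = pmf ?P c * measure (\<Pi>\<^sub>M i\<in>?C. iid_sum \<mu> (c i)) E"
        unfolding X_eq N_pmf[OF c] by (simp only: blocks)
      have "prob_space (\<Pi>\<^sub>M i\<in>?C. iid_sum \<mu> (c i))" by (rule prob_space_PiM) (rule \<mu>.prob_space_iid_sum)
      then have "emeasure (\<Pi>\<^sub>M i\<in>?C. iid_sum \<mu> (c i)) E = ennreal (measure (\<Pi>\<^sub>M i\<in>?C. iid_sum \<mu> (c i)) E)"
        by (simp add: finite_measure.emeasure_eq_measure prob_space.finite_measure)
      then show "emeasure M (?X c) = ennreal (pmf ?P c) * emeasure (\<Pi>\<^sub>M i\<in>?C. iid_sum \<mu> (c i)) E"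
        by (simp only: emeasure_eq_measure * ennreal_mult'[OF pmf_nonneg])
    qed
    also have "\<dots> = (\<integral>\<^sup>+c. ennreal (pmf ?P c) * emeasure (\<Pi>\<^sub>M i\<in>?C. iid_sum \<mu> (c i)) E * indicator K c \<partial>count_space UNIV)"
      by (subst nn_integral_count_space_indicator) auto
    also have "\<dots> = (\<integral>\<^sup>+c. ennreal (pmf ?P c) * emeasure (\<Pi>\<^sub>M i\<in>?C. iid_sum \<mu> (c i)) E \<partial>count_space UNIV)"
    proof (rule nn_integral_cong)
      fix c
      have "pmf ?P c = 0" if "c \<notin> K" using that by (intro pmf_Pi_outside) (auto simp: K_def)
      then show "ennreal (pmf ?P c) * emeasure (\<Pi>\<^sub>M i\<in>?C. iid_sum \<mu> (c i)) E * indicator K c =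
          ennreal (pmf ?P c) * emeasure (\<Pi>\<^sub>M i\<in>?C. iid_sum \<mu> (c i)) E"
        by (auto simp: indicator_def)
    qed
    also have "\<dots> = (\<integral>\<^sup>+c. emeasure (\<Pi>\<^sub>M i\<in>?C. iid_sum \<mu> (c i)) E \<partial>?P)"
      by (rule nn_integral_measure_pmf[symmetric])
    finally show ?thesis .
  qed
  show ?thesis
  proof (rule measure_eqI)
    have s: "sets (\<Pi>\<^sub>M i\<in>?C. compound_Poisson (\<kappa> * \<eta>) \<mu>) = sets ?B"
      by (rule sets_PiM_cong) auto
    then show "sets (distr M ?B (\<lambda>\<omega>. \<lambda>i\<in>?C. cell_increment \<eta> J (W \<omega>) i)) = sets (\<Pi>\<^sub>M i\<in>?C. compound_Poisson (\<kappa> * \<eta>) \<mu>)"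
      by simp
    fix E assume "E \<in> sets (distr M ?B (\<lambda>\<omega>. \<lambda>i\<in>?C. cell_increment \<eta> J (W \<omega>) i))"
    then have E: "E \<in> sets ?B" by simp
    have "emeasure (distr M ?B V) E = (\<integral>\<^sup>+c. emeasure (\<Pi>\<^sub>M i\<in>?C. iid_sum \<mu> (c i)) E \<partial>?P)"
      using key[OF E] E by (simp add: emeasure_distr)
    also have "\<dots> = emeasure (\<Pi>\<^sub>M i\<in>?C. compound_Poisson (\<kappa> * \<eta>) \<mu>) E"
      using J by (intro PiM_compound_Poisson[symmetric] E \<mu>) (auto simp: lessThan_empty_iff)
    finally show "emeasure (distr M ?B (\<lambda>\<omega>. \<lambda>i\<in>?C. cell_increment \<eta> J (W \<omega>) i)) E =
        emeasure (\<Pi>\<^sub>M i\<in>?C. compound_Poisson (\<kappa> * \<eta>) \<mu>) E" by (simp add: V_def[abs_def])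
  qed
qed

end

context prob_space begin

text \<open>Independence across jumps comes from \<open>ind\<close>, independence across cells from
  the single processes; the two are merged by comparing measures of rectangles.\<close>

lemma superposed_increments:
  assumes D: "finite D" "D \<noteq> {}"
    and ind: "indep_vars (\<lambda>_. \<Pi>\<^sub>M t\<in>UNIV. borel) Wd D"
    and W: "\<And>d. d \<in> D \<Longrightarrow> double_sided_marked_Poisson_process (\<kappa> d) (\<mu> d) (Wd d)"
    and \<kappa>: "\<And>d. d \<in> D \<Longrightarrow> 0 \<le> \<kappa> d" and \<mu>: "\<And>d. d \<in> D \<Longrightarrow> mark_distribution (\<mu> d)"
    and \<eta>: "0 < \<eta>" and J: "0 < J"
  shows "distr M (\<Pi>\<^sub>M c\<in>D \<times> {..<2*J}. borel)
      (\<lambda>\<omega>. \<lambda>c\<in>D \<times> {..<2*J}. cell_increment \<eta> J (Wd (fst c) \<omega>) (snd c)) =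
    (\<Pi>\<^sub>M c\<in>D \<times> {..<2*J}. compound_Poisson (\<kappa> (fst c) * \<eta>) (\<mu> (fst c)))"
proof -
  let ?C = "D \<times> {..<2*J}"
  let ?I = "\<Pi>\<^sub>M i\<in>{..<2*J}. borel :: real measure"
  define \<mu>' where "\<mu>' d = (if d \<in> D then \<mu> d else return borel 0)" for d
  have \<mu>': "mark_distribution (\<mu>' d)" for d
    using \<mu>[of d] by (auto simp: \<mu>'_def mark_distribution_def mark_distribution_axioms_def prob_space_return)
  interpret m: mark_distribution "\<mu>' d" for d by (rule \<mu>')
  interpret CP: product_prob_space "\<lambda>c. compound_Poisson (\<kappa> (fst c) * \<eta>) (\<mu>' (fst c))" ?C
    by (auto simp: product_prob_space_def product_prob_space_axioms_def product_sigma_finite_def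
        intro: m.prob_space_compound_Poisson prob_space_imp_sigma_finite)
  interpret CP1: product_prob_space "\<lambda>i. compound_Poisson (\<kappa> d * \<eta>) (\<mu>' d)" "{..<2*J}" for d
    by (auto simp: product_prob_space_def product_prob_space_axioms_def product_sigma_finite_def
        intro: m.prob_space_compound_Poisson prob_space_imp_sigma_finite)
  have Wm[measurable]: "Wd d \<in> measurable M (\<Pi>\<^sub>M t\<in>UNIV. borel)" if "d \<in> D" for d
    using ind that by (auto simp: indep_vars_def2)
  define inc where "inc w = (\<lambda>i\<in>{..<2*J}. cell_increment \<eta> J w i)" for w
  have inc[measurable]: "inc \<in> measurable (\<Pi>\<^sub>M t\<in>UNIV. borel) ?I"
    unfolding inc_def cell_increment_def
    by (rule measurable_restrict) (auto intro!: borel_measurable_diff measurable_component_singleton split: if_splits)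
  have law: "distr M ?I (\<lambda>\<omega>. inc (Wd d \<omega>)) = (\<Pi>\<^sub>M i\<in>{..<2*J}. compound_Poisson (\<kappa> d * \<eta>) (\<mu>' d))" if "d \<in> D" for d
    unfolding inc_def using marked_Poisson_increments[OF W[OF that] \<kappa>[OF that] \<mu>[OF that] \<eta> J Wm[OF that]] that
    by (simp add: \<mu>'_def)
  have ind': "indep_vars (\<lambda>_. ?I) (\<lambda>d \<omega>. inc (Wd d \<omega>)) D"
    by (rule indep_vars_compose2[OF ind]) (rule inc)
  let ?V = "\<lambda>\<omega>. \<lambda>c\<in>?C. cell_increment \<eta> J (Wd (fst c) \<omega>) (snd c)"
  have V_alt: "?V = (\<lambda>\<omega>. \<lambda>c\<in>?C. inc (Wd (fst c) \<omega>) (snd c))"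
    by (auto simp: inc_def fun_eq_iff)
  have V[measurable]: "?V \<in> measurable M (\<Pi>\<^sub>M c\<in>?C. borel)"
    unfolding V_alt
  proof (rule measurable_restrict)
    fix c assume "c \<in> ?C"
    then show "(\<lambda>\<omega>. inc (Wd (fst c) \<omega>) (snd c)) \<in> borel_measurable M"
      using measurable_compose[OF measurable_compose[OF Wm inc] measurable_component_singleton] by auto
  qed
  have "distr M (\<Pi>\<^sub>M c\<in>?C. borel) ?V = (\<Pi>\<^sub>M c\<in>?C. compound_Poisson (\<kappa> (fst c) * \<eta>) (\<mu>' (fst c)))"
  proof (rule CP.PiM_eqI)
    show "finite ?C" using D by simp
    show "sets (distr M (\<Pi>\<^sub>M c\<in>?C. borel) ?V) = sets (\<Pi>\<^sub>M c\<in>?C. compound_Poisson (\<kappa> (fst c) * \<eta>) (\<mu>' (fst c)))"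
      by (simp, rule sets_PiM_cong) auto
    fix A assume A: "\<And>c. c \<in> ?C \<Longrightarrow> A c \<in> sets (compound_Poisson (\<kappa> (fst c) * \<eta>) (\<mu>' (fst c)))"
    then have A': "A (d, i) \<in> sets borel" if "d \<in> D" "i < 2 * J" for d i using that by force
    let ?R = "\<lambda>d. PiE {..<2*J} (\<lambda>i. A (d, i))"
    have R: "?R d \<in> sets ?I" if "d \<in> D" for d using A' that by (intro sets_PiM_I_finite) auto
    have AC: "PiE ?C A \<in> sets (\<Pi>\<^sub>M c\<in>?C. borel)" using A D by (intro sets_PiM_I_finite) auto
    have "?V -` PiE ?C A \<inter> space M = (\<Inter>d\<in>D. (\<lambda>\<omega>. inc (Wd d \<omega>)) -` ?R d \<inter> space M)"
      using D(2) by (auto simp: inc_def PiE_iff)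
    then have "emeasure (distr M (\<Pi>\<^sub>M c\<in>?C. borel) ?V) (PiE ?C A) =
        prob (\<Inter>d\<in>D. (\<lambda>\<omega>. inc (Wd d \<omega>)) -` ?R d \<inter> space M)"
      using AC by (simp only: emeasure_distr[OF V] emeasure_eq_measure)
    also have "prob (\<Inter>d\<in>D. (\<lambda>\<omega>. inc (Wd d \<omega>)) -` ?R d \<inter> space M) =
        (\<Prod>d\<in>D. prob ((\<lambda>\<omega>. inc (Wd d \<omega>)) -` ?R d \<inter> space M))"
      using D R by (intro indep_varsD_finite[OF ind']) auto
    also have "ennreal \<dots> = (\<Prod>d\<in>D. ennreal (prob ((\<lambda>\<omega>. inc (Wd d \<omega>)) -` ?R d \<inter> space M)))"
      by (rule prod_ennreal[symmetric]) simp
    also have "\<dots> = (\<Prod>d\<in>D. \<Prod>i\<in>{..<2*J}. emeasure (compound_Poisson (\<kappa> d * \<eta>) (\<mu>' d)) (A (d, i)))"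
    proof (rule prod.cong[OF refl])
      fix d assume d: "d \<in> D"
      have "ennreal (prob ((\<lambda>\<omega>. inc (Wd d \<omega>)) -` ?R d \<inter> space M)) = emeasure (distr M ?I (\<lambda>\<omega>. inc (Wd d \<omega>))) (?R d)"
        using R[OF d] d by (subst emeasure_distr) (auto simp: emeasure_eq_measure)
      also have "\<dots> = (\<Prod>i\<in>{..<2*J}. emeasure (compound_Poisson (\<kappa> d * \<eta>) (\<mu>' d)) (A (d, i)))"
        unfolding law[OF d] using A'[OF d] by (intro CP1.emeasure_PiM) auto
      finally show "ennreal (prob ((\<lambda>\<omega>. inc (Wd d \<omega>)) -` ?R d \<inter> space M)) =
          (\<Prod>i\<in>{..<2*J}. emeasure (compound_Poisson (\<kappa> d * \<eta>) (\<mu>' d)) (A (d, i)))" .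
    qed
    also have "\<dots> = (\<Prod>c\<in>?C. emeasure (compound_Poisson (\<kappa> (fst c) * \<eta>) (\<mu>' (fst c))) (A c))"
      by (simp add: prod.cartesian_product split_beta)
    finally show "emeasure (distr M (\<Pi>\<^sub>M c\<in>?C. borel) ?V) (PiE ?C A) =
        (\<Prod>c\<in>?C. emeasure (compound_Poisson (\<kappa> (fst c) * \<eta>) (\<mu>' (fst c))) (A c))" .
  qed
  also have "\<dots> = (\<Pi>\<^sub>M c\<in>?C. compound_Poisson (\<kappa> (fst c) * \<eta>) (\<mu> (fst c)))"
    by (rule PiM_cong) (auto simp: \<mu>'_def)
  finally show ?thesis .
qed

text \<open>Continuity from above along the decreasing tail unions. It upgrades a lower bound on
  single probabilities to one for infinitely many occurrences along the same path.\<close>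

lemma prob_infinitely_often_ge:
  assumes A[measurable]: "\<And>n. A n \<in> events" and c: "\<forall>\<^sub>F n in sequentially. c \<le> prob (A n)"
  shows "c \<le> prob (\<Inter>N. \<Union>n\<in>{N..}. A n)"
proof -
  have "(\<lambda>N. prob (\<Union>n\<in>{N..}. A n)) \<longlonglongrightarrow> prob (\<Inter>N. \<Union>n\<in>{N..}. A n)"
    by (rule finite_Lim_measure_decseq) (fastforce simp: decseq_def)+
  moreover have "\<forall>\<^sub>F N in sequentially. c \<le> prob (\<Union>n\<in>{N..}. A n)"
    using c
  proof eventually_elim
    case (elim N)
    have "prob (A N) \<le> prob (\<Union>n\<in>{N..}. A n)" by (rule finite_measure_mono) auto
    then show ?case using elim by simp
  qed
  ultimately show ?thesis by (rule tendsto_lowerbound) simp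
qed

end

section \<open>Characteristic functions of compound Poisson laws\<close>

lemma integral_Poisson_power:
  fixes z :: complex
  assumes \<kappa>: "0 \<le> \<kappa>"
  shows "(\<integral>k. z ^ k \<partial>measure_pmf (Poisson \<kappa>)) = exp (complex_of_real \<kappa> * (z - 1))"
proof -
  let ?f = "\<lambda>k. pmf (Poisson \<kappa>) k *\<^sub>R z ^ k"
  have f: "?f k = exp (- complex_of_real \<kappa>) * ((complex_of_real \<kappa> * z) ^ k /\<^sub>R fact k)" for k
    by (simp add: pmf_Poisson[OF \<kappa>] scaleR_conv_of_real exp_of_real power_mult_distrib field_simps exp_minus)
  have sums: "?f sums (exp (- complex_of_real \<kappa>) * exp (complex_of_real \<kappa> * z))"
    unfolding f by (intro sums_mult exp_converges)
  have "summable (\<lambda>k. norm (?f k))"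
  proof -
    have "norm (?f k) = exp (- \<kappa>) * (norm ((complex_of_real \<kappa> * z) ^ k /\<^sub>R fact k))" for k
      unfolding f by (simp only: norm_mult) (simp add: exp_of_real[symmetric] norm_mult flip: of_real_minus)
    then show ?thesis by (simp only:) (intro summable_mult summable_norm_exp)
  qed
  then have int: "integrable (count_space UNIV) ?f"
    by (simp add: integrable_count_space_nat_iff)
  have "(\<integral>k. z ^ k \<partial>measure_pmf (Poisson \<kappa>)) = (\<integral>k. ?f k \<partial>count_space UNIV)"
    unfolding measure_pmf_eq_density by (subst integral_density) auto
  also have "\<dots> = (\<Sum>k. ?f k)" by (rule integral_count_space_nat[OF int])
  also have "\<dots> = exp (- complex_of_real \<kappa>) * exp (complex_of_real \<kappa> * z)" using sums by (rule sums_unique[symmetric])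
  also have "\<dots> = exp (complex_of_real \<kappa> * (z - 1))" by (simp add: mult_exp_exp algebra_simps)
  finally show ?thesis .
qed

context mark_distribution begin

lemma real_distribution_mark: "real_distribution \<mu>"
  unfolding real_distribution_def real_distribution_axioms_def
  by (auto intro: prob_space_axioms sets_eq_imp_space_eq[OF sets_mark, simplified])

lemma char_iid_sum: "char (iid_sum \<mu> k) t = char \<mu> t ^ k"
proof -
  let ?S = "\<Pi>\<^sub>M i\<in>(UNIV::nat set). \<mu>"
  interpret P: prob_space ?S by (rule prob_space_PiM) (rule prob_space_axioms)
  have ind: "P.indep_vars (\<lambda>_. borel) (\<lambda>i x. x i) (UNIV :: nat set)"
    using P.indep_vars_compose2[OF indep_vars_PiM_component[of "UNIV :: nat set" "\<lambda>_. \<mu>"], of "\<lambda>_ x. x" "\<lambda>_. borel"]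
    by (auto intro: prob_space_axioms)
  have "char (iid_sum \<mu> k) t = (\<Prod>i<k. char (distr ?S borel (\<lambda>x. x i)) t)"
    unfolding iid_sum_def by (rule P.char_distr_sum) (rule P.indep_vars_subset[OF ind], simp)
  also have "\<dots> = (\<Prod>i<k. char \<mu> t)"
  proof (intro prod.cong refl arg_cong[where f="\<lambda>m. char m t"])
    fix i
    have "distr ?S \<mu> (\<lambda>x. x i) = \<mu>" by (rule distr_PiM_component) (auto intro: prob_space_axioms)
    then show "distr ?S borel (\<lambda>x. x i) = \<mu>"
      using distr_cong[of ?S ?S \<mu> borel "\<lambda>x. x i" "\<lambda>x. x i"] by simp
  qed
  finally show ?thesis by simp
qed

lemma char_compound_Poisson:
  assumes \<kappa>: "0 \<le> \<kappa>"
  shows "char (compound_Poisson \<kappa> \<mu>) t = exp (complex_of_real \<kappa> * (char \<mu> t - 1))"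
proof -
  let ?S = "\<Pi>\<^sub>M i\<in>(UNIV::nat set). \<mu>"
  interpret P: prob_space ?S by (rule prob_space_PiM) (rule prob_space_axioms)
  interpret PP: pair_prob_space "measure_pmf (Poisson \<kappa>)" ?S ..
  have [measurable]: "(\<lambda>x. iexp (t * (case x of (k, x) \<Rightarrow> \<Sum>i<k. x i))) \<in> borel_measurable (measure_pmf (Poisson \<kappa>) \<Otimes>\<^sub>M ?S)"
    by (rule measurable_compose[OF measurable_random_sum]) measurable
  have "char (compound_Poisson \<kappa> \<mu>) t =
      (CLINT x|measure_pmf (Poisson \<kappa>) \<Otimes>\<^sub>M ?S. iexp (t * (case x of (k, x) \<Rightarrow> \<Sum>i<k. x i)))"
    unfolding char_def compound_Poisson_def by (subst integral_distr) auto
  also have "\<dots> = (\<integral>k. (\<integral>x. iexp (t * (\<Sum>i<k. x i)) \<partial>?S) \<partial>measure_pmf (Poisson \<kappa>))"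
    using PP.integral_fst'[of "\<lambda>x. iexp (t * (case x of (k, x) \<Rightarrow> \<Sum>i<k. x i))"]
    by (subst PP.integral_fst'[symmetric]) (auto intro!: PP.integrable_const_bound[where B=1])
  also have "\<dots> = (\<integral>k. char \<mu> t ^ k \<partial>measure_pmf (Poisson \<kappa>))"
  proof (rule Bochner_Integration.integral_cong[OF refl])
    fix k
    have "(\<integral>x. iexp (t * (\<Sum>i<k. x i)) \<partial>?S) = char (iid_sum \<mu> k) t"
      unfolding char_def iid_sum_def by (subst integral_distr) auto
    then show "(\<integral>x. iexp (t * (\<Sum>i<k. x i)) \<partial>?S) = char \<mu> t ^ k" by (simp add: char_iid_sum)
  qed
  finally show ?thesis by (simp add: integral_Poisson_power[OF \<kappa>])
qed

text \<open>The error of the second-order expansion is bounded by the mean of a minimum of a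
  quadratic and a cubic term. The quadratic one dominates and the cubic one vanishes with
  \<open>u\<close>, so two moments are enough for an error \<open>o(1 / n)\<close> while
  \<open>n * (u n)\<^sup>2\<close> stays bounded.\<close>

lemma char_second_order:
  assumes sq: "integrable \<mu> (\<lambda>x. x\<^sup>2)" and u: "\<And>n. real n * (u n)\<^sup>2 \<le> B" and u0: "u \<longlonglongrightarrow> 0"
  shows "(\<lambda>n. complex_of_real (real n) * (char \<mu> (u n) - 1 - \<i> * complex_of_real (u n * expectation (\<lambda>x. x))
      + complex_of_real ((u n)\<^sup>2 / 2 * expectation (\<lambda>x. x\<^sup>2)))) \<longlonglongrightarrow> 0"
proof -
  interpret real_distribution \<mu> by (rule real_distribution_mark)
  have B: "0 \<le> B" using u[of 0] by simp
  have int1: "integrable \<mu> (\<lambda>x. x)" by (rule square_integrable_imp_integrable[OF _ sq]) simp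
  have mom: "integrable \<mu> (\<lambda>x. x ^ k)" if "k \<le> 2" for k
  proof -
    consider "k = 0" | "k = 1" | "k = 2" using \<open>k \<le> 2\<close> by linarith
    then show ?thesis by cases (use int1 sq in simp_all)
  qed
  define g where "g n = expectation (\<lambda>x. min (6 * x\<^sup>2) (\<bar>u n\<bar> * \<bar>x\<bar> ^ 3))" for n
  have "g \<longlonglongrightarrow> expectation (\<lambda>x. 0)"
    unfolding g_def
  proof (rule integral_dominated_convergence[where w="\<lambda>x. 6 * x\<^sup>2"])
    show "AE x in \<mu>. (\<lambda>n. min (6 * x\<^sup>2) (\<bar>u n\<bar> * \<bar>x\<bar> ^ 3)) \<longlonglongrightarrow> 0"
    proof (rule AE_I2)
      fix x
      have "(\<lambda>n. min (6 * x\<^sup>2) (\<bar>u n\<bar> * \<bar>x\<bar> ^ 3)) \<longlonglongrightarrow> min (6 * x\<^sup>2) (\<bar>0\<bar> * \<bar>x\<bar> ^ 3)"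
        by (intro tendsto_intros u0)
      then show "(\<lambda>n. min (6 * x\<^sup>2) (\<bar>u n\<bar> * \<bar>x\<bar> ^ 3)) \<longlonglongrightarrow> 0" by simp
    qed
  qed (use sq in auto)
  then have g0: "(\<lambda>n. B / 6 * g n) \<longlonglongrightarrow> 0" by (auto intro: tendsto_mult_right_zero)
  have gnn: "0 \<le> g n" for n unfolding g_def by (rule Bochner_Integration.integral_nonneg) auto
  show ?thesis
  proof (rule Lim_null_comparison[OF always_eventually g0], rule allI)
    fix n
    have "cmod (char \<mu> (u n) - (\<Sum>k \<le> 2. ((\<i> * u n)^k / fact k) * expectation (\<lambda>x. x^k))) \<le>
        (\<bar>u n\<bar>^2 / fact (Suc 2)) * expectation (\<lambda>x. min (2 * \<bar>x\<bar>^2 * Suc 2) (\<bar>u n\<bar> * \<bar>x\<bar>^Suc 2))"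
      by (rule char_approx2) (rule mom)
    also have "(\<lambda>x::real. min (2 * \<bar>x\<bar>^2 * Suc 2) (\<bar>u n\<bar> * \<bar>x\<bar>^Suc 2)) = (\<lambda>x. min (6 * x\<^sup>2) (\<bar>u n\<bar> * \<bar>x\<bar> ^ 3))"
      by (auto simp: fun_eq_iff power3_eq_cube power2_eq_square)
    also have "expectation \<dots> = g n" by (simp add: g_def)
    also have "(\<Sum>k \<le> 2. ((\<i> * u n)^k / fact k) * complex_of_real (expectation (\<lambda>x. x^k))) =
        1 + \<i> * complex_of_real (u n * expectation (\<lambda>x. x)) - complex_of_real ((u n)\<^sup>2 / 2 * expectation (\<lambda>x. x\<^sup>2))"
      using prob_space by (simp add: numeral_2_eq_2 power2_eq_square algebra_simps)
    finally have "cmod (char \<mu> (u n) - 1 - \<i> * complex_of_real (u n * expectation (\<lambda>x. x))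
      + complex_of_real ((u n)\<^sup>2 / 2 * expectation (\<lambda>x. x\<^sup>2))) \<le> (u n)\<^sup>2 / 6 * g n"
      by (simp add: algebra_simps fact_numeral)
    then have "real n * cmod (char \<mu> (u n) - 1 - \<i> * complex_of_real (u n * expectation (\<lambda>x. x))
      + complex_of_real ((u n)\<^sup>2 / 2 * expectation (\<lambda>x. x\<^sup>2))) \<le> real n * ((u n)\<^sup>2 / 6 * g n)"
      by (intro mult_left_mono) auto
    also have "\<dots> = (real n * (u n)\<^sup>2) * (g n / 6)" by simp
    also have "\<dots> \<le> B * (g n / 6)" using u[of n] gnn[of n] by (intro mult_right_mono) auto
    finally show "norm (complex_of_real (real n) * (char \<mu> (u n) - 1 - \<i> * complex_of_real (u n * expectation (\<lambda>x. x))
      + complex_of_real ((u n)\<^sup>2 / 2 * expectation (\<lambda>x. x\<^sup>2)))) \<le> B / 6 * g n"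
      by (simp add: norm_mult)
  qed
qed

end

section \<open>Positivity of the drift\<close>

context prob_space begin

text \<open>The exponent of the characteristic function of \<open>Y n\<close> is \<open>n\<close>
  times a fixed function. Its linear term is cancelled by the centring \<open>n * m\<close>, its
  quadratic term gives \<open>- t\<^sup>2 / 2\<close>, and the rest vanishes by
  \<open>char_second_order\<close>.\<close>

lemma compound_Poisson_CLT:
  fixes Y :: "nat \<Rightarrow> 'a \<Rightarrow> real"
  assumes Y[measurable]: "\<And>n. Y n \<in> borel_measurable M"
    and \<mu>: "\<And>d. d \<in> D \<Longrightarrow> mark_distribution (\<mu> d)"
    and sq: "\<And>d. d \<in> D \<Longrightarrow> integrable (\<mu> d) (\<lambda>x. x\<^sup>2)"
    and char_Y: "\<And>n t. 0 < n \<Longrightarrow> char (distr M borel (Y n)) t =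
        (\<Prod>d\<in>D. exp (complex_of_real (\<kappa> d * real n) * (char (\<mu> d) t - 1)))"
    and fin: "finite D"
    and m: "m = (\<Sum>d\<in>D. \<kappa> d * (\<integral>x. x \<partial>\<mu> d))"
    and v: "v = (\<Sum>d\<in>D. \<kappa> d * (\<integral>x. x\<^sup>2 \<partial>\<mu> d))" and v_pos: "0 < v"
  shows "weak_conv_m (\<lambda>n. distr M borel (\<lambda>\<omega>. (Y n \<omega> - real n * m) / sqrt (real n * v))) std_normal_distribution"
proof (rule levy_continuity)
  show "real_distribution (distr M borel (\<lambda>\<omega>. (Y n \<omega> - real n * m) / sqrt (real n * v)))" for n
    by (rule real_distribution_distr) measurable
  show "real_distribution std_normal_distribution" by (rule real_dist_normal_dist)
  fix t
  \<comment> \<open>The frequency at which the characteristic function of \<open>Y n\<close> is read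
    after normalization.\<close>
  define u where "u n = t / sqrt (real n * v)" for n :: nat
  have u_sq: "real n * (u n)\<^sup>2 = t\<^sup>2 / v" if "0 < n" for n
    using v_pos that by (simp add: u_def power_divide)
  have u_le: "real n * (u n)\<^sup>2 \<le> t\<^sup>2 / v" for n
    using u_sq[of n] v_pos by (cases "n = 0") auto
  have u0: "u \<longlonglongrightarrow> 0"
    unfolding u_def using v_pos
    by (intro tendsto_divide_0[OF tendsto_const] filterlim_at_top_imp_at_infinity
        filterlim_compose[OF sqrt_at_top] filterlim_at_top_mult_tendsto_pos[OF tendsto_const] filterlim_real_sequentially) auto
  define R where "R d n = complex_of_real (real n) * (char (\<mu> d) (u n) - 1 - \<i> * complex_of_real (u n * (\<integral>x. x \<partial>\<mu> d))
      + complex_of_real ((u n)\<^sup>2 / 2 * (\<integral>x. x\<^sup>2 \<partial>\<mu> d)))" for d n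
  have "(\<lambda>n. exp ((\<Sum>d\<in>D. complex_of_real (\<kappa> d) * R d n) - complex_of_real (t\<^sup>2 / 2))) \<longlonglongrightarrow>
      exp ((\<Sum>d\<in>D. complex_of_real (\<kappa> d) * 0) - complex_of_real (t\<^sup>2 / 2))"
    unfolding R_def by (intro tendsto_intros mark_distribution.char_second_order[OF \<mu> sq u_le u0])
  moreover have "exp ((\<Sum>d\<in>D. complex_of_real (\<kappa> d) * 0) - complex_of_real (t\<^sup>2 / 2)) = char std_normal_distribution t"
    by (simp add: char_std_normal_distribution exp_of_real[symmetric])
  moreover have "\<forall>\<^sub>F n in sequentially. exp ((\<Sum>d\<in>D. complex_of_real (\<kappa> d) * R d n) - complex_of_real (t\<^sup>2 / 2)) =
      char (distr M borel (\<lambda>\<omega>. (Y n \<omega> - real n * m) / sqrt (real n * v))) t"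
    using eventually_gt_at_top[of 0]
  proof eventually_elim
    case (elim n)
    have "char (distr M borel (\<lambda>\<omega>. (Y n \<omega> - real n * m) / sqrt (real n * v))) t =
        (CLINT \<omega>|M. iexp (t * ((Y n \<omega> - real n * m) / sqrt (real n * v))))"
      unfolding char_def by (subst integral_distr) auto
    also have "\<dots> = (CLINT \<omega>|M. iexp (- (u n * real n * m)) * iexp (u n * Y n \<omega>))"
      by (intro Bochner_Integration.integral_cong refl)
        (simp add: exp_add[symmetric] u_def diff_divide_distrib algebra_simps)
    also have "\<dots> = iexp (- (u n * real n * m)) * (CLINT \<omega>|M. iexp (u n * Y n \<omega>))"
      by (intro integral_mult_right_zero)
    also have "(CLINT \<omega>|M. iexp (u n * Y n \<omega>)) = char (distr M borel (Y n)) (u n)"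
      unfolding char_def by (subst integral_distr) auto
    also have "\<dots> = exp (\<Sum>d\<in>D. complex_of_real (\<kappa> d * real n) * (char (\<mu> d) (u n) - 1))"
      unfolding char_Y[OF elim] by (rule exp_sum[OF fin, symmetric])
    also have "iexp (- (u n * real n * m)) * \<dots> =
        exp (\<i> * complex_of_real (- (u n * real n * m)) + (\<Sum>d\<in>D. complex_of_real (\<kappa> d * real n) * (char (\<mu> d) (u n) - 1)))"
      by (rule mult_exp_exp)
    also have "\<i> * complex_of_real (- (u n * real n * m)) + (\<Sum>d\<in>D. complex_of_real (\<kappa> d * real n) * (char (\<mu> d) (u n) - 1)) =
        (\<Sum>d\<in>D. complex_of_real (\<kappa> d) * R d n) - complex_of_real (t\<^sup>2 / 2)"
    proof -
      have "t\<^sup>2 / 2 = real n * (u n)\<^sup>2 / 2 * v" using u_sq[OF elim] v_pos by simp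
      also have "\<dots> = (\<Sum>d\<in>D. \<kappa> d * (real n * ((u n)\<^sup>2 / 2 * (\<integral>x. x\<^sup>2 \<partial>\<mu> d))))"
        unfolding v sum_distrib_left by (intro sum.cong) auto
      finally have t: "t\<^sup>2 / 2 = (\<Sum>d\<in>D. \<kappa> d * (real n * ((u n)\<^sup>2 / 2 * (\<integral>x. x\<^sup>2 \<partial>\<mu> d))))" .
      have "\<i> * complex_of_real (- (u n * real n * m)) =
          (\<Sum>d\<in>D. - (complex_of_real (\<kappa> d) * (complex_of_real (real n) * (\<i> * complex_of_real (u n * (\<integral>x. x \<partial>\<mu> d))))))"
        unfolding m of_real_minus of_real_mult of_real_sum sum_distrib_left sum_negf[symmetric] mult_minus_right
        by (intro sum.cong) auto
      then show ?thesis unfolding t of_real_sum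
        by (simp add: sum.distrib[symmetric] sum_subtractf[symmetric] R_def)
          (intro sum.cong, auto simp: algebra_simps)
    qed
    finally show ?case by simp
  qed
  ultimately show "(\<lambda>n. char (distr M borel (\<lambda>\<omega>. (Y n \<omega> - real n * m) / sqrt (real n * v))) t) \<longlonglongrightarrow> char std_normal_distribution t"
    by (auto intro: Lim_transform_eventually)
qed

end

text \<open>Continuity turns weak convergence into convergence of the distribution functions at each
  point; positivity keeps the probability of a deep negative excursion away from zero.\<close>

lemma std_normal_cdf: "isCont (cdf std_normal_distribution) x" "0 < cdf std_normal_distribution x"
proof -
  interpret N: real_distribution std_normal_distribution by (rule real_dist_normal_dist)
  have "emeasure std_normal_distribution {x} = (\<integral>\<^sup>+y. ennreal (std_normal_density y) * indicator {x} y \<partial>lborel)"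
    by (subst emeasure_density) auto
  also have "\<dots> = (\<integral>\<^sup>+y. 0 \<partial>(lborel :: real measure))"
  proof (rule nn_integral_cong_AE)
    show "AE y in lborel. ennreal (std_normal_density y) * indicator {x} y = 0"
      using AE_lborel_singleton[of x] by eventually_elim simp
  qed
  finally show "isCont (cdf std_normal_distribution) x" by (simp add: N.isCont_cdf measure_def)
  have "emeasure std_normal_distribution {..x} \<noteq> 0"
  proof
    assume "emeasure std_normal_distribution {..x} = 0"
    then have "(\<integral>\<^sup>+y. ennreal (std_normal_density y) * indicator {..x} y \<partial>lborel) = 0"
      by (subst (asm) emeasure_density) auto
    then have "AE y in lborel. ennreal (std_normal_density y) * indicator {..x} y = 0"
      by (subst (asm) nn_integral_0_iff_AE) auto
    then have "AE y in lborel. y \<notin> {..x}"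
    proof (rule AE_mp, intro AE_I2 impI)
      fix y assume "ennreal (std_normal_density y) * indicator {..x} y = 0"
      moreover have "0 < std_normal_density y" by (simp add: normal_density_pos)
      ultimately show "y \<notin> {..x}" by (auto simp: indicator_def)
    qed
    then have "AE y in lborel. y \<notin> {x - 1..x}" by eventually_elim auto
    then have "emeasure lborel {x - 1..x} = 0"
      by (subst (asm) AE_iff_measurable[of "{x - 1..x}"]) auto
    then show False by simp
  qed
  then show "0 < cdf std_normal_distribution x"
    by (simp add: cdf_def N.emeasure_eq_measure zero_less_measure_iff)
qed

context prob_space begin

lemma marked_Poisson_zero: "double_sided_marked_Poisson_process \<kappa> \<mu> W \<Longrightarrow> \<omega> \<in> space M \<Longrightarrow> W \<omega> 0 = 0"
  unfolding double_sided_marked_Poisson_process_def by auto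

text \<open>Covers the degenerate case of zero total variance in the drift argument, where
  normalization by the standard deviation is impossible.\<close>

lemma marked_Poisson_trivial:
  assumes W: "double_sided_marked_Poisson_process \<kappa> \<mu> W" and triv: "\<kappa> = 0 \<or> (AE x in \<mu>. x = 0)"
  shows "AE \<omega> in M. \<forall>t. W \<omega> t = 0"
proof -
  obtain S \<xi> where S: "homogeneous_Poisson_process \<kappa> S"
    and \<xi>_ind: "indep_vars (\<lambda>_. borel) \<xi> UNIV" and \<xi>: "\<And>k. distr M borel (\<xi> k) = \<mu>"
    and W_eq: "\<And>\<omega> t. \<omega> \<in> space M \<Longrightarrow> W \<omega> t =
           (if 0 \<le> t then (\<Sum>k=1..card (S \<omega> \<inter> {0<..t}). \<xi> (int k) \<omega>)
            else (\<Sum>k=1..card (S \<omega> \<inter> {t..<0}). \<xi> (- int k) \<omega>))"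
    using W unfolding double_sided_marked_Poisson_process_def by metis
  have \<xi>m[measurable]: "\<xi> k \<in> borel_measurable M" for k using \<xi>_ind by (auto simp: indep_vars_def2)
  from triv show ?thesis
  proof
    assume "\<kappa> = 0"
    have "AE \<omega> in M. \<forall>N::nat. S \<omega> \<inter> {- real N..real N} = {}"
      unfolding AE_all_countable
      by (intro allI homogeneous_Poisson_process_null[OF S]) (auto simp: \<open>\<kappa> = 0\<close> bounded_borel_def)
    then show ?thesis
    proof (rule AE_mp, intro AE_I2 impI allI)
      fix \<omega> t assume \<omega>: "\<omega> \<in> space M" and S0: "\<forall>N::nat. S \<omega> \<inter> {- real N..real N} = {}"
      have "S \<omega> = {}"
      proof (rule equals0I)
        fix x assume "x \<in> S \<omega>"
        moreover obtain N :: nat where "\<bar>x\<bar> \<le> real N" using real_arch_simple by blast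
        ultimately have "x \<in> S \<omega> \<inter> {- real N..real N}" by (auto simp: abs_le_iff)
        then show False using S0 by blast
      qed
      then show "W \<omega> t = 0" by (simp add: W_eq[OF \<omega>])
    qed
  next
    assume z: "AE x in \<mu>. x = 0"
    have "AE \<omega> in M. \<forall>k. \<xi> k \<omega> = 0"
      unfolding AE_all_countable
    proof
      fix k
      have "AE x in distr M borel (\<xi> k). x = 0" unfolding \<xi> by (rule z)
      then show "AE \<omega> in M. \<xi> k \<omega> = 0" by (subst (asm) AE_distr_iff) auto
    qed
    then show ?thesis
      by (rule AE_mp) (intro AE_I2 impI allI, simp add: W_eq)
  qed
qed

text \<open>A superposition of compound Poisson processes with drift at most zero oscillates or tends to minus infinity,
  so it cannot have a nonempty bounded set of minimum points.\<close>
lemma drift_positive: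
  assumes D: "finite D" "D \<noteq> {}"
    and ind: "indep_vars (\<lambda>_. \<Pi>\<^sub>M t\<in>UNIV. borel) Wd D"
    and W: "\<And>d. d \<in> D \<Longrightarrow> double_sided_marked_Poisson_process (\<kappa> d) (\<mu> d) (Wd d)"
    and \<kappa>: "\<And>d. d \<in> D \<Longrightarrow> 0 \<le> \<kappa> d" and \<mu>: "\<And>d. d \<in> D \<Longrightarrow> mark_distribution (\<mu> d)"
    and sq: "\<And>d. d \<in> D \<Longrightarrow> integrable (\<mu> d) (\<lambda>x. x\<^sup>2)"
    and bdd: "AE \<omega> in M. minimum_points (\<lambda>t. \<Sum>d\<in>D. Wd d \<omega> t) \<noteq> {} \<and> bounded (minimum_points (\<lambda>t. \<Sum>d\<in>D. Wd d \<omega> t))"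
  shows "0 < (\<Sum>d\<in>D. \<kappa> d * (\<integral>x. x \<partial>\<mu> d))"
proof (rule ccontr)
  define m where "m = (\<Sum>d\<in>D. \<kappa> d * (\<integral>x. x \<partial>\<mu> d))"
  define v where "v = (\<Sum>d\<in>D. \<kappa> d * (\<integral>x. x\<^sup>2 \<partial>\<mu> d))"
  assume "\<not> 0 < (\<Sum>d\<in>D. \<kappa> d * (\<integral>x. x \<partial>\<mu> d))"
  then have m: "m \<le> 0" by (simp add: m_def)
  have term_nn: "0 \<le> \<kappa> d * (\<integral>x. x\<^sup>2 \<partial>\<mu> d)" if "d \<in> D" for d using \<kappa>[OF that] by simp
  have "0 \<le> v" unfolding v_def by (rule sum_nonneg) (rule term_nn)
  then consider "v = 0" | "0 < v" by linarith
  then show False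
  proof cases
    \<comment> \<open>Without variance every component is null, so the whole line is minimal and
      boundedness fails.\<close>
    case 1
    have "AE \<omega> in M. \<forall>t. Wd d \<omega> t = 0" if d: "d \<in> D" for d
    proof (rule marked_Poisson_trivial[OF W[OF d]])
      have "\<kappa> d * (\<integral>x. x\<^sup>2 \<partial>\<mu> d) = 0"
        using 1 term_nn d D(1) unfolding v_def by (subst (asm) sum_nonneg_eq_0_iff) auto
      moreover have "(AE x in \<mu> d. x = 0)" if "(\<integral>x. x\<^sup>2 \<partial>\<mu> d) = 0"
        using that sq[OF d] by (subst (asm) integral_nonneg_eq_0_iff_AE) auto
      ultimately show "\<kappa> d = 0 \<or> (AE x in \<mu> d. x = 0)" by auto
    qed
    then have "AE \<omega> in M. \<forall>d\<in>D. \<forall>t. Wd d \<omega> t = 0" using D(1) by (simp add: AE_finite_all)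
    then have "AE \<omega> in M. False"
      using bdd
    proof eventually_elim
      case (elim \<omega>)
      then have "(\<lambda>t. \<Sum>d\<in>D. Wd d \<omega> t) = (\<lambda>_. 0)" by (intro ext sum.neutral) auto
      then have "minimum_points (\<lambda>t. \<Sum>d\<in>D. Wd d \<omega> t) = (UNIV :: real set)" by (simp add: minimum_points_def)
      then show ?case using elim not_bounded_UNIV[where 'a=real] by simp
    qed
    then show False by simp
  next
    case v: 2
    have Wm: "Wd d \<in> measurable M (\<Pi>\<^sub>M t\<in>UNIV. borel)" if "d \<in> D" for d
      using ind that by (auto simp: indep_vars_def2)
    have Wt[measurable]: "(\<lambda>\<omega>. Wd d \<omega> t) \<in> borel_measurable M" if "d \<in> D" for d t
      using measurable_compose[OF Wm[OF that] measurable_component_singleton[of t UNIV]] by simp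
    define Y where "Y n \<omega> = (\<Sum>d\<in>D. Wd d \<omega> (real n))" for n \<omega>
    have Y[measurable]: "Y n \<in> borel_measurable M" for n
      unfolding Y_def by (rule borel_measurable_sum) (rule Wt)
    have law: "distr M borel (\<lambda>\<omega>. Wd d \<omega> (real n)) = compound_Poisson (\<kappa> d * real n) (\<mu> d)" if d: "d \<in> D" and n: "0 < n" for d n
    proof -
      interpret md: mark_distribution "\<mu> d" by (rule \<mu>[OF d])
      \<comment> \<open>A single cell of width \<open>n\<close> on each side suffices: cell
        \<open>1\<close> is the time interval from \<open>0\<close> to \<open>n\<close>.\<close>
      let ?I = "\<Pi>\<^sub>M i\<in>{..<2*1::nat}. borel :: real measure"
      let ?V = "\<lambda>\<omega>. \<lambda>i\<in>{..<2*1}. cell_increment (real n) 1 (Wd d \<omega>) i"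
      have V: "?V \<in> measurable M ?I"
        unfolding cell_increment_def using d by (intro measurable_restrict) auto
      have "distr M borel (\<lambda>\<omega>. Wd d \<omega> (real n)) = distr M borel (\<lambda>\<omega>. ?V \<omega> 1)"
        using marked_Poisson_zero[OF W[OF d]]
        by (intro distr_cong) (auto simp: cell_increment_def cell_left_def)
      also have "\<dots> = distr (distr M ?I ?V) borel (\<lambda>x. x 1)"
        using V by (subst distr_distr) (auto simp: comp_def)
      also have "distr M ?I ?V = (\<Pi>\<^sub>M i\<in>{..<2*1}. compound_Poisson (\<kappa> d * real n) (\<mu> d))"
        using n by (intro marked_Poisson_increments[OF W[OF d] \<kappa>[OF d] \<mu>[OF d] _ _ Wm[OF d]]) auto
      also have "distr \<dots> borel (\<lambda>x. x 1) = distr \<dots> (compound_Poisson (\<kappa> d * real n) (\<mu> d)) (\<lambda>x. x 1)"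
        by (intro distr_cong) auto
      also have "\<dots> = compound_Poisson (\<kappa> d * real n) (\<mu> d)"
        by (rule distr_PiM_component) (auto intro: md.prob_space_compound_Poisson)
      finally show ?thesis .
    qed
    have char_Y: "char (distr M borel (Y n)) t = (\<Prod>d\<in>D. exp (complex_of_real (\<kappa> d * real n) * (char (\<mu> d) t - 1)))"
      if n: "0 < n" for n t
    proof -
      have "indep_vars (\<lambda>_. borel) (\<lambda>d \<omega>. Wd d \<omega> (real n)) D"
        by (rule indep_vars_compose2[OF ind]) auto
      then have "char (distr M borel (Y n)) t = (\<Prod>d\<in>D. char (distr M borel (\<lambda>\<omega>. Wd d \<omega> (real n))) t)"
        unfolding Y_def by (rule char_distr_sum)
      also have "\<dots> = (\<Prod>d\<in>D. exp (complex_of_real (\<kappa> d * real n) * (char (\<mu> d) t - 1)))"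
        using n \<kappa> by (intro prod.cong refl) (simp add: law mark_distribution.char_compound_Poisson[OF \<mu>])
      finally show ?thesis .
    qed
    let ?N = "\<lambda>n. distr M borel (\<lambda>\<omega>. (Y n \<omega> - real n * m) / sqrt (real n * v))"
    have "weak_conv_m ?N std_normal_distribution"
      by (rule compound_Poisson_CLT[OF Y \<mu> sq char_Y D(1) m_def v_def v])
    then have "(\<lambda>n. cdf (?N n) (- 1)) \<longlonglongrightarrow> cdf std_normal_distribution (- 1)"
      using std_normal_cdf(1)[of "- 1"] by (simp add: weak_conv_m_def weak_conv_def)
    \<comment> \<open>A positive number strictly below the limit, which the converging probabilities
      therefore exceed eventually.\<close>
    define c where "c = cdf std_normal_distribution (- 1) / 2"
    have c: "0 < c" "c < cdf std_normal_distribution (- 1)"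
      using std_normal_cdf(2)[of "- 1"] by (auto simp: c_def)
    \<comment> \<open>Because the centring \<open>n * m\<close> is at most zero, a normalized value
      below \<open>- 1\<close> places the outcome in \<open>A n\<close>.\<close>
    define A where "A n = {\<omega>\<in>space M. Y n \<omega> \<le> - sqrt (real n * v)}" for n
    have [measurable]: "A n \<in> events" for n unfolding A_def by measurable
    have "\<forall>\<^sub>F n in sequentially. c \<le> prob (A n)"
      using order_tendstoD(1)[OF \<open>_ \<longlonglongrightarrow> _\<close> c(2)] eventually_gt_at_top[of 0]
    proof eventually_elim
      case (elim n)
      have "cdf (?N n) (- 1) = prob {\<omega>\<in>space M. (Y n \<omega> - real n * m) / sqrt (real n * v) \<le> - 1}"
        unfolding cdf_def by (subst measure_distr) (auto intro!: arg_cong[where f=prob])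
      also have "\<dots> \<le> prob (A n)"
      proof (rule finite_measure_mono)
        show "{\<omega>\<in>space M. (Y n \<omega> - real n * m) / sqrt (real n * v) \<le> - 1} \<subseteq> A n"
        proof safe
          fix \<omega> assume "\<omega> \<in> space M" "(Y n \<omega> - real n * m) / sqrt (real n * v) \<le> - 1"
          moreover have "0 < sqrt (real n * v)" using elim v by simp
          ultimately have "Y n \<omega> - real n * m \<le> - sqrt (real n * v)" by (simp add: divide_le_eq)
          moreover have "real n * m \<le> 0" using m by (simp add: mult_nonneg_nonpos)
          ultimately show "\<omega> \<in> A n" using \<open>\<omega> \<in> space M\<close> by (auto simp: A_def)
        qed
      qed auto
      finally show ?case using elim by simp
    qed
    then have io: "c \<le> prob (\<Inter>N. \<Union>n\<in>{N..}. A n)" by (intro prob_infinitely_often_ge) auto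
    \<comment> \<open>A path with a minimum is bounded below, so it can meet the sets
      \<open>A n\<close> only finitely often.\<close>
    have "AE \<omega> in M. \<omega> \<notin> (\<Inter>N. \<Union>n\<in>{N..}. A n)"
      using bdd
    proof eventually_elim
      case (elim \<omega>)
      then obtain t0 where t0: "\<And>s. (\<Sum>d\<in>D. Wd d \<omega> t0) \<le> (\<Sum>d\<in>D. Wd d \<omega> s)"
        unfolding minimum_points_def by auto
      have lim: "filterlim (\<lambda>n. sqrt (real n * v)) at_top sequentially"
        using v by (intro filterlim_compose[OF sqrt_at_top] filterlim_at_top_mult_tendsto_pos[OF tendsto_const] filterlim_real_sequentially)
      then obtain N where N: "\<And>n. N \<le> n \<Longrightarrow> - (\<Sum>d\<in>D. Wd d \<omega> t0) + 1 \<le> sqrt (real n * v)"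
        unfolding filterlim_at_top eventually_sequentially by blast
      have "\<omega> \<notin> A n" if "N \<le> n" for n
        using N[OF that] t0[of "real n"] by (auto simp: A_def Y_def)
      then show ?case by auto
    qed
    then have "prob (\<Inter>N. \<Union>n\<in>{N..}. A n) = 0"
      by (subst prob_eq_0) auto
    then show False using io c by simp
  qed
qed

end

section \<open>Moment inequalities and chaining\<close>

lemma ex_power_between:
  fixes b x :: real
  assumes "1 < b" "1 \<le> x"
  obtains k :: nat where "b ^ k \<le> x" "x < b ^ Suc k"
proof -
  obtain m where m: "x < b ^ m" using real_arch_pow[OF \<open>1 < b\<close>] by blast
  define k where "k = (LEAST k. x < b ^ Suc k)"
  have ex: "x < b ^ Suc m" using m assms by (smt (verit) power_Suc mult_le_cancel_right1 one_le_power)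
  have 1: "x < b ^ Suc k" unfolding k_def by (rule LeastI[of "\<lambda>k. x < b ^ Suc k", OF ex])
  have "b ^ k \<le> x"
  proof (cases k)
    case (Suc j)
    then have "\<not> x < b ^ Suc j" using not_less_Least[of j "\<lambda>k. x < b ^ Suc k"] by (simp add: k_def)
    then show ?thesis using Suc by simp
  qed (use assms in simp)
  then show thesis using 1 that by blast
qed

context prob_space begin

lemma second_moment_iid_sum:
  fixes h :: "nat \<Rightarrow> 'a \<Rightarrow> real"
  assumes ind: "indep_vars (\<lambda>_. borel) h UNIV"
    and int: "\<And>i. integrable M (\<lambda>\<omega>. (h i \<omega>)\<^sup>2)"
    and mean: "\<And>i. expectation (h i) = 0" and sq: "\<And>i. expectation (\<lambda>\<omega>. (h i \<omega>)\<^sup>2) \<le> v"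
  shows "integrable M (\<lambda>\<omega>. (\<Sum>i<n. h i \<omega>)\<^sup>2)" "expectation (\<lambda>\<omega>. (\<Sum>i<n. h i \<omega>)\<^sup>2) \<le> real n * v"
proof -
  have hm[measurable]: "h i \<in> borel_measurable M" for i using ind by (auto simp: indep_vars_def2)
  have int1: "integrable M (h i)" for i by (rule square_integrable_imp_integrable[OF hm int])
  have "integrable M (\<lambda>\<omega>. (\<Sum>i<n. h i \<omega>)\<^sup>2) \<and> expectation (\<lambda>\<omega>. (\<Sum>i<n. h i \<omega>)\<^sup>2) \<le> real n * v"
  proof (induction n)
    case (Suc n)
    let ?S = "\<lambda>\<omega>. \<Sum>i<n. h i \<omega>"
    have S1: "integrable M ?S" using int1 by auto
    have iv: "indep_var borel (h n) borel ?S"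
      by (rule indep_vars_sum) (auto intro: indep_vars_subset[OF ind])
    have prod: "integrable M (\<lambda>\<omega>. h n \<omega> * ?S \<omega>)" by (rule indep_var_integrable[OF iv int1 S1])
    have E0: "expectation (\<lambda>\<omega>. h n \<omega> * ?S \<omega>) = 0"
      using indep_var_lebesgue_integral[OF iv int1 S1] mean by simp
    have eq: "(\<lambda>\<omega>. (\<Sum>i<Suc n. h i \<omega>)\<^sup>2) = (\<lambda>\<omega>. (?S \<omega>)\<^sup>2 + 2 * (h n \<omega> * ?S \<omega>) + (h n \<omega>)\<^sup>2)"
      by (auto simp: fun_eq_iff power2_sum algebra_simps)
    show ?case
      unfolding eq using Suc prod int[of n] E0 sq[of n]
      by (auto simp: algebra_simps)
  qed simp
  then show "integrable M (\<lambda>\<omega>. (\<Sum>i<n. h i \<omega>)\<^sup>2)" "expectation (\<lambda>\<omega>. (\<Sum>i<n. h i \<omega>)\<^sup>2) \<le> real n * v" by auto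
qed

lemma Chebyshev_second_moment:
  fixes g :: "'a \<Rightarrow> real"
  assumes [measurable]: "g \<in> borel_measurable M" and int: "integrable M (\<lambda>\<omega>. (g \<omega>)\<^sup>2)" and e: "0 < e"
  shows "prob {\<omega>\<in>space M. e \<le> \<bar>g \<omega>\<bar>} \<le> expectation (\<lambda>\<omega>. (g \<omega>)\<^sup>2) / e\<^sup>2"
proof -
  have "prob {\<omega>\<in>space M. e\<^sup>2 \<le> (g \<omega>)\<^sup>2} \<le> expectation (\<lambda>\<omega>. (g \<omega>)\<^sup>2) / e\<^sup>2"
    using e by (intro integral_Markov_inequality_measure[OF int]) auto
  moreover have "{\<omega>\<in>space M. e\<^sup>2 \<le> (g \<omega>)\<^sup>2} = {\<omega>\<in>space M. e \<le> \<bar>g \<omega>\<bar>}"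
    using e abs_le_square_iff[of e] by auto
  ultimately show ?thesis by simp
qed

text \<open>The variance is at most the raw second moment, and the latter is what can be controlled
  for window indicators.\<close>

lemma Chebyshev_iid:
  fixes h :: "nat \<Rightarrow> 'a \<Rightarrow> real"
  assumes ind: "indep_vars (\<lambda>_. borel) h UNIV"
    and int: "\<And>i. integrable M (\<lambda>\<omega>. (h i \<omega>)\<^sup>2)"
    and mean: "\<And>i. expectation (h i) = m" and sq: "\<And>i. expectation (\<lambda>\<omega>. (h i \<omega>)\<^sup>2) \<le> v" and e: "0 < e"
  shows "prob {\<omega>\<in>space M. e \<le> \<bar>(\<Sum>i<n. h i \<omega>) - real n * m\<bar>} \<le> real n * v / e\<^sup>2"
proof -
  have hm[measurable]: "h i \<in> borel_measurable M" for i using ind by (auto simp: indep_vars_def2)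
  have int1: "integrable M (h i)" for i by (rule square_integrable_imp_integrable[OF hm int])
  have ind': "indep_vars (\<lambda>_. borel) (\<lambda>i \<omega>. h i \<omega> - m) UNIV"
    by (rule indep_vars_compose2[OF ind]) auto
  have sq_eq: "(\<lambda>\<omega>. (h i \<omega> - m)\<^sup>2) = (\<lambda>\<omega>. (h i \<omega>)\<^sup>2 - 2 * m * h i \<omega> + m\<^sup>2)" for i
    by (auto simp: power2_diff algebra_simps)
  have i2: "integrable M (\<lambda>\<omega>. (h i \<omega> - m)\<^sup>2)" for i unfolding sq_eq using int int1 by auto
  have m2: "expectation (\<lambda>\<omega>. h i \<omega> - m) = 0" for i using int1 mean by (simp add: prob_space)
  have v2: "expectation (\<lambda>\<omega>. (h i \<omega> - m)\<^sup>2) \<le> v" for i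
  proof -
    have "expectation (\<lambda>\<omega>. (h i \<omega> - m)\<^sup>2) = expectation (\<lambda>\<omega>. (h i \<omega>)\<^sup>2) - m\<^sup>2"
      unfolding sq_eq using int[of i] int1[of i] mean by (simp add: prob_space power2_eq_square)
    then show ?thesis using sq[of i] by (smt (verit) zero_le_power2)
  qed
  note S = second_moment_iid_sum[OF ind' i2 m2 v2, of n]
  have "prob {\<omega>\<in>space M. e \<le> \<bar>\<Sum>i<n. h i \<omega> - m\<bar>} \<le> expectation (\<lambda>\<omega>. (\<Sum>i<n. h i \<omega> - m)\<^sup>2) / e\<^sup>2"
    by (rule Chebyshev_second_moment[OF _ S(1) e]) measurable
  also have "\<dots> \<le> real n * v / e\<^sup>2" using S(2) by (intro divide_right_mono) auto
  finally show ?thesis by (simp add: sum_subtractf)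
qed

lemma prob_countable_union_le:
  fixes A :: "nat \<Rightarrow> 'a set"
  assumes "\<And>k. A k \<in> events" "\<And>k. prob (A k) \<le> p k" "p sums s"
  shows "prob (\<Union>k. A k) \<le> s"
proof -
  have sum: "summable (\<lambda>k. prob (A k))"
    by (rule summable_comparison_test[OF _ sums_summable[OF assms(3)]]) (auto simp: assms(2))
  have "prob (\<Union>k. A k) \<le> (\<Sum>k. prob (A k))"
    using assms(1) sum by (intro finite_measure_subadditive_countably) auto
  also have "\<dots> \<le> suminf p" by (rule suminf_le[OF assms(2) sum sums_summable[OF assms(3)]])
  also have "\<dots> = s" using assms(3) by (simp add: sums_iff)
  finally show ?thesis .
qed

text \<open>Dyadic chaining. Second moments suffice because the exponent \<open>2 * \<alpha>\<close> exceeds one.\<close>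
lemma chaining:
  fixes U :: "'a \<Rightarrow> real \<Rightarrow> real"
  assumes \<alpha>: "1/2 < \<alpha>"
  obtains K where "0 < K"
    "\<And>U T A e. (\<And>s. (\<lambda>\<omega>. U \<omega> s) \<in> borel_measurable M) \<Longrightarrow> (\<And>\<omega>. \<omega> \<in> space M \<Longrightarrow> U \<omega> 0 = 0) \<Longrightarrow>
      (\<And>\<omega>. \<omega> \<in> space M \<Longrightarrow> continuous_on UNIV (U \<omega>)) \<Longrightarrow>
      (\<And>s t. integrable M (\<lambda>\<omega>. (U \<omega> s - U \<omega> t)\<^sup>2)) \<Longrightarrow>
      (\<And>s t. expectation (\<lambda>\<omega>. (U \<omega> s - U \<omega> t)\<^sup>2) \<le> A * \<bar>s - t\<bar> powr (2 * \<alpha>)) \<Longrightarrow>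
      0 < T \<Longrightarrow> 0 < e \<Longrightarrow> 0 \<le> A \<Longrightarrow>
      \<exists>B\<in>events. prob B \<le> K * A * T powr (2 * \<alpha>) / e\<^sup>2 \<and> (\<forall>\<omega>\<in>space M - B. \<forall>s\<in>{0..T}. \<bar>U \<omega> s\<bar> \<le> e)"
proof -
  \<comment> \<open>The surplus \<open>\<alpha> - 1/2\<close> is split: half of it lets the allowed
    increments shrink geometrically like \<open>b ^ k\<close>, the other half makes the exceptional
    probabilities of the levels summable with ratio \<open>r\<close>.\<close>
  define \<beta> where "\<beta> = (\<alpha> - 1/2) / 2"
  have \<beta>: "0 < \<beta>" using \<alpha> by (simp add: \<beta>_def)
  define b :: real where "b = 2 powr (- \<beta>)"
  have b: "0 < b" "b < 1" using \<beta> by (auto simp: b_def powr_less_one)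
  define r where "r = b\<^sup>2"
  have r: "0 < r" "r < 1" using b by (auto simp: r_def abs_square_less_1)
  define K where "K = 1 / ((1 - b)\<^sup>2 * (1 - r))"
  have K: "0 < K" using b r by (simp add: K_def)
  \<comment> \<open>Shares of the tolerance \<open>e\<close> for the dyadic levels, adding up to
    one.\<close>
  define c where "c k = (1 - b) * b ^ k" for k
  have c: "0 < c k" for k using b by (simp add: c_def)
  have c_sums: "c sums 1" unfolding c_def using geometric_sums[of b] b sums_mult[of "\<lambda>k. b ^ k" "1 / (1 - b)" "1 - b"] by auto
  have c_le: "(\<Sum>l\<le>k. c l) \<le> 1" for k
    using sum_le_suminf[OF sums_summable[OF c_sums], of "{..k}"] c c_sums by (auto simp: sums_iff less_imp_le)
  show thesis
  proof (rule that[OF K])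
    fix U :: "'a \<Rightarrow> real \<Rightarrow> real" and T A e :: real
    assume Um[measurable]: "\<And>s. (\<lambda>\<omega>. U \<omega> s) \<in> borel_measurable M"
      and U0: "\<And>\<omega>. \<omega> \<in> space M \<Longrightarrow> U \<omega> 0 = 0" and Uc: "\<And>\<omega>. \<omega> \<in> space M \<Longrightarrow> continuous_on UNIV (U \<omega>)"
      and Ui: "\<And>s t. integrable M (\<lambda>\<omega>. (U \<omega> s - U \<omega> t)\<^sup>2)"
      and Ue: "\<And>s t. expectation (\<lambda>\<omega>. (U \<omega> s - U \<omega> t)\<^sup>2) \<le> A * \<bar>s - t\<bar> powr (2 * \<alpha>)"
      and T: "0 < T" and e: "0 < e" and A: "0 \<le> A"
    define g where "g k j = T * real j / 2 ^ k" for k j :: nat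
    define B1 where "B1 k j = {\<omega>\<in>space M. e * c k \<le> \<bar>U \<omega> (g k (Suc j)) - U \<omega> (g k j)\<bar>}" for k j
    define B where "B k = (\<Union>j\<in>{..<2 ^ k}. B1 k j)" for k
    have B1m[measurable]: "B1 k j \<in> events" for k j unfolding B1_def by measurable
    have Bm[measurable]: "B k \<in> events" for k unfolding B_def by measurable
    have B1p: "prob (B1 k j) \<le> A * (T / 2 ^ k) powr (2 * \<alpha>) / (e * c k)\<^sup>2" for k j
    proof -
      have "prob (B1 k j) \<le> expectation (\<lambda>\<omega>. (U \<omega> (g k (Suc j)) - U \<omega> (g k j))\<^sup>2) / (e * c k)\<^sup>2"
        unfolding B1_def using c[of k] e by (intro Chebyshev_second_moment Ui) auto
      also have "\<dots> \<le> A * \<bar>g k (Suc j) - g k j\<bar> powr (2 * \<alpha>) / (e * c k)\<^sup>2"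
        by (intro divide_right_mono Ue) auto
      also have "\<bar>g k (Suc j) - g k j\<bar> = T / 2 ^ k" using T by (simp add: g_def field_simps)
      finally show ?thesis .
    qed
    have pow: "2 ^ k * (A * (T / 2 ^ k) powr (2 * \<alpha>) / (e * c k)\<^sup>2) = (A * T powr (2 * \<alpha>) / e\<^sup>2 / (1 - b)\<^sup>2) * r ^ k" for k :: nat
    proof -
      have 1: "(T / 2 ^ k) powr (2 * \<alpha>) = T powr (2 * \<alpha>) * 2 powr (- (2 * \<alpha> * real k))"
        using T by (simp add: powr_divide powr_minus_divide powr_powr powr_realpow[symmetric] mult.commute mult.left_commute)
      have 2: "(2::real) ^ k = 2 powr real k" by (simp add: powr_realpow)
      have 3: "(b ^ k)\<^sup>2 = 2 powr (- (2 * \<beta> * real k))"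
        by (simp add: b_def powr_powr powr_realpow[symmetric] powr_power mult.commute mult.left_commute flip: power_mult)
      have "(2::real) ^ k * 2 powr (- (2 * \<alpha> * real k)) / (b ^ k)\<^sup>2 = 2 powr (real k - 2 * \<alpha> * real k + 2 * \<beta> * real k)"
        unfolding 2 3 by (simp add: powr_add powr_diff powr_minus field_simps)
      also have "real k - 2 * \<alpha> * real k + 2 * \<beta> * real k = - (2 * \<beta> * real k)" by (simp add: \<beta>_def field_simps)
      also have "2 powr \<dots> = r ^ k" unfolding r_def 3[symmetric] by (simp add: power_mult[symmetric] mult.commute)
      finally have 4: "(2::real) ^ k * 2 powr (- (2 * \<alpha> * real k)) / (b ^ k)\<^sup>2 = r ^ k" .
      have "2 ^ k * (A * (T / 2 ^ k) powr (2 * \<alpha>) / (e * c k)\<^sup>2) =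
        (A * T powr (2 * \<alpha>) / e\<^sup>2 / (1 - b)\<^sup>2) * (2 ^ k * 2 powr (- (2 * \<alpha> * real k)) / (b ^ k)\<^sup>2)"
        unfolding 1 by (simp add: c_def power_mult_distrib mult_ac)
      then show ?thesis by (simp only: 4)
    qed
    have Bp: "prob (B k) \<le> (A * T powr (2 * \<alpha>) / e\<^sup>2 / (1 - b)\<^sup>2) * r ^ k" for k
    proof -
      have "prob (B k) \<le> (\<Sum>j<2 ^ k. prob (B1 k j))"
        unfolding B_def by (rule finite_measure_subadditive_finite) auto
      also have "\<dots> \<le> (\<Sum>j<(2::nat) ^ k. A * (T / 2 ^ k) powr (2 * \<alpha>) / (e * c k)\<^sup>2)" by (rule sum_mono) (rule B1p)
      also have "\<dots> = 2 ^ k * (A * (T / 2 ^ k) powr (2 * \<alpha>) / (e * c k)\<^sup>2)" by simp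
      finally show ?thesis unfolding pow .
    qed
    have "(\<lambda>k. (A * T powr (2 * \<alpha>) / e\<^sup>2 / (1 - b)\<^sup>2) * r ^ k) sums ((A * T powr (2 * \<alpha>) / e\<^sup>2 / (1 - b)\<^sup>2) * (1 / (1 - r)))"
      using r by (intro sums_mult geometric_sums) auto
    from prob_countable_union_le[OF Bm Bp this]
    have PB: "prob (\<Union>k. B k) \<le> K * A * T powr (2 * \<alpha>) / e\<^sup>2" by (simp add: K_def field_simps)
    have "\<bar>U \<omega> s\<bar> \<le> e" if \<omega>: "\<omega> \<in> space M" "\<omega> \<notin> (\<Union>k. B k)" and s: "s \<in> {0..T}" for \<omega> s
    proof -
      have inc: "\<bar>U \<omega> (g k (Suc j)) - U \<omega> (g k j)\<bar> \<le> e * c k" if "j < 2 ^ k" for k j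
        using \<omega> that by (force simp: B_def B1_def)
      \<comment> \<open>A point of level \<open>Suc k\<close> is of level \<open>k\<close> or one
        step to the right of such a point, so each level adds at most its share.\<close>
      have dy: "\<bar>U \<omega> (g k j)\<bar> \<le> e * (\<Sum>l\<le>k. c l)" if "j \<le> 2 ^ k" for k j
        using that
      proof (induction k arbitrary: j)
        case 0
        then consider "j = 0" | "j = 1" by fastforce
        then show ?case
        proof cases
          case 1 then show ?thesis using U0[OF \<omega>(1)] e c[of 0] by (simp add: g_def)
        next
          case 2 then show ?thesis using inc[of 0 0] U0[OF \<omega>(1)] by (simp add: g_def)
        qed
      next
        case (Suc k)
        obtain i where i: "j = 2 * i \<or> j = Suc (2 * i)" by (metis oddE evenE Suc_eq_plus1)
        have gi: "g (Suc k) (2 * i) = g k i" by (simp add: g_def)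
        have i_le: "i \<le> 2 ^ k" using i Suc.prems by auto
        have IH: "\<bar>U \<omega> (g (Suc k) (2 * i))\<bar> \<le> e * (\<Sum>l\<le>k. c l)" unfolding gi by (rule Suc.IH[OF i_le])
        from i show ?case
        proof
          assume "j = 2 * i"
          then show ?thesis using IH e c[of "Suc k"] by (simp add: distrib_left) (smt (verit) mult_nonneg_nonneg)
        next
          assume j: "j = Suc (2 * i)"
          then have "2 * i < 2 ^ Suc k" using Suc.prems by simp
          from inc[OF this] show ?thesis using IH unfolding j by (simp add: distrib_left)
        qed
      qed
      have dy': "\<bar>U \<omega> (g k j)\<bar> \<le> e" if "j \<le> 2 ^ k" for k j
        using dy[OF that] c_le[of k] e by (smt (verit) mult_left_le)
      \<comment> \<open>Dyadic points converging to \<open>s\<close> from below; continuity of the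
        path carries the bound over.\<close>
      define j where "j k = nat \<lfloor>s / T * 2 ^ k\<rfloor>" for k
      have sT: "0 \<le> s / T" "s / T \<le> 1" using s T by auto
      have jle: "j k \<le> 2 ^ k" for k
      proof -
        have "s / T * 2 ^ k \<le> 1 * 2 ^ k" using sT by (intro mult_right_mono) auto
        then have "\<lfloor>s / T * 2 ^ k\<rfloor> \<le> 2 ^ k" by (simp add: floor_le_iff)
        then show ?thesis by (simp add: j_def nat_le_iff)
      qed
      have conv: "(\<lambda>k. g k (j k)) \<longlonglongrightarrow> s"
      proof (rule LIMSEQ_I)
        fix d :: real assume "0 < d"
        obtain N where N: "T / d < 2 ^ N" using real_arch_pow[of 2 "T / d"] by auto
        show "\<exists>N. \<forall>k\<ge>N. norm (g k (j k) - s) < d"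
        proof (intro exI allI impI)
          fix k assume "N \<le> k"
          have "real (j k) = of_int \<lfloor>s / T * 2 ^ k\<rfloor>"
          proof -
            have "0 \<le> s / T * 2 ^ k" using sT by (intro mult_nonneg_nonneg) auto
            then have "0 \<le> \<lfloor>s / T * 2 ^ k\<rfloor>" by (simp only: zero_le_floor)
            then show ?thesis by (simp only: j_def of_nat_nat)
          qed
          then have "real (j k) \<le> s / T * 2 ^ k" "s / T * 2 ^ k < real (j k) + 1" by linarith+
          then have "g k (j k) \<le> s" "s < g k (j k) + T / 2 ^ k" using T by (simp_all add: g_def field_simps)
          moreover have "T / 2 ^ k \<le> T / 2 ^ N" using T \<open>N \<le> k\<close> by (intro divide_left_mono) auto
          moreover have "T / 2 ^ N < d" using N \<open>0 < d\<close> by (simp add: field_simps)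
          ultimately show "norm (g k (j k) - s) < d" by simp
        qed
      qed
      have "(\<lambda>k. U \<omega> (g k (j k))) \<longlonglongrightarrow> U \<omega> s"
        using Uc[OF \<omega>(1)] conv by (intro isCont_tendsto_compose[OF _ conv]) (simp add: continuous_on_eq_continuous_at)
      then have "(\<lambda>k. \<bar>U \<omega> (g k (j k))\<bar>) \<longlonglongrightarrow> \<bar>U \<omega> s\<bar>" by (rule tendsto_rabs)
      then show ?thesis by (rule LIMSEQ_le_const2) (use dy' jle in auto)
    qed
    then show "\<exists>B\<in>events. prob B \<le> K * A * T powr (2 * \<alpha>) / e\<^sup>2 \<and> (\<forall>\<omega>\<in>space M - B. \<forall>s\<in>{0..T}. \<bar>U \<omega> s\<bar> \<le> e)"
      using PB by (intro bexI[of _ "\<Union>k. B k"]) auto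
  qed
qed

end

section \<open>The localized risk\<close>

text \<open>The sample is recentred at the true shift: \<open>F\<close> is the template already
  moved to the true position, later arguments \<open>s\<close> are deviations from the true shift,
  and \<open>G\<close> is the continuous part of \<open>F\<close> left when its jumps
  \<open>\<delta>\<close> at \<open>D\<close> are removed.\<close>

locale template_sample = prob_space M for M :: "'a measure" +
  fixes X Z :: "nat \<Rightarrow> 'a \<Rightarrow> real" and lam F G L L' :: "real \<Rightarrow> real"
    and D :: "real set" and \<delta> :: "real \<Rightarrow> real" and C H B \<alpha> :: real
  assumes XZ_indep: "indep_vars (\<lambda>_. borel) (case_sum X Z) UNIV"
    and X_dist: "\<And>i. distributed M lborel (X i) (\<lambda>x. ennreal (lam x))"
    and lam_nonneg: "\<And>x. 0 \<le> lam x"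
    and Z_ident: "\<And>i. distr M borel (Z i) = distr M borel (Z 0)"
    and Z_sym: "distr M borel (\<lambda>\<omega>. - Z 0 \<omega>) = distr M borel (Z 0)"
    and L_der: "\<And>z. (L has_real_derivative L' z) (at z)"
    and L'_lip: "\<And>x y. \<bar>L' x - L' y\<bar> \<le> C * \<bar>x - y\<bar>" and C_pos: "0 < C"
    and L_nonneg: "\<And>z. 0 \<le> L z" and L_even: "\<And>z. L (- z) = L z"
    and L_int: "integrable M (\<lambda>\<omega>. L (Z 0 \<omega>))"
    and F_eq: "\<And>x. F x = G x + (\<Sum>d\<in>D. \<delta> d * indicator {d..} x)"
    and G_Holder: "\<And>x y. \<bar>G x - G y\<bar> \<le> H * \<bar>x - y\<bar> powr \<alpha>" and H_pos: "0 < H"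
    and alpha: "1/2 < \<alpha>" "\<alpha> \<le> 1"
    and D_fin: "finite D" and D_ne: "D \<noteq> {}"
    and F_bdd: "\<And>x. \<bar>F x\<bar> \<le> B"
    and lam_cont: "\<And>d. d \<in> D \<Longrightarrow> isCont lam d"
begin

text \<open>The design points that a shift by \<open>s\<close> carries across the jump at
  \<open>d\<close>. The half-open side follows from right-continuity of
  \<open>indicator {d..}\<close>.\<close>

definition win :: "real \<Rightarrow> real \<Rightarrow> real set" where
  "win d s = {d + min 0 s..<d + max 0 s}"

definition mark :: "real \<Rightarrow> real \<Rightarrow> real \<Rightarrow> real" where
  "mark d \<sigma> z = L (z + \<sigma> * \<delta> d) - L z"

text \<open>This is \<open>n\<close> times the increase of the empirical risk when the true shift is
  changed by \<open>s\<close>, written in terms of the noise instead of the observations.\<close>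

definition risk :: "nat \<Rightarrow> 'a \<Rightarrow> real \<Rightarrow> real" where
  "risk n \<omega> s = (\<Sum>i<n. L (Z i \<omega> + (F (X i \<omega>) - F (X i \<omega> - s))) - L (Z i \<omega>))"

definition jump_part :: "nat \<Rightarrow> 'a \<Rightarrow> real \<Rightarrow> real" where
  "jump_part n \<omega> s = (\<Sum>i<n. \<Sum>d\<in>D. indicator (win d s) (X i \<omega>) * mark d (sgn s) (Z i \<omega>))"

text \<open>First-order effect of the continuous part, with the derivative taken at the noise itself
  so that symmetry centres it.\<close>

definition smooth_part :: "nat \<Rightarrow> 'a \<Rightarrow> real \<Rightarrow> real" where
  "smooth_part n \<omega> s = (\<Sum>i<n. L' (Z i \<omega>) * (G (X i \<omega>) - G (X i \<omega> - s)))"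

definition hits :: "nat \<Rightarrow> 'a \<Rightarrow> real \<Rightarrow> real" where
  "hits n \<omega> s = (\<Sum>i<n. \<Sum>d\<in>D. indicator (win d s) (X i \<omega>))"

lemma X_meas[measurable]: "X i \<in> borel_measurable M" and Z_meas[measurable]: "Z i \<in> borel_measurable M"
  using indep_vars_Inl[OF XZ_indep] indep_vars_Inr[OF XZ_indep] by (auto simp: indep_vars_def2)

lemma win_sets[measurable]: "win d s \<in> sets borel" by (simp add: win_def)

lemma win_mono: "0 \<le> r \<Longrightarrow> r \<le> r' \<Longrightarrow> \<sigma> = 1 \<or> \<sigma> = -1 \<Longrightarrow> win d (\<sigma> * r) \<subseteq> win d (\<sigma> * r')"
  by (auto simp: win_def)

lemma win_indicator:
  "(indicator {d..} x - indicator {d..} (x - s) :: real) = sgn s * indicator (win d s) x"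
  by (cases s "0::real" rule: linorder_cases) (auto simp: win_def indicator_def)

lemma alpha_pos: "0 < \<alpha>" using alpha by simp

lemma G_cont: "isCont G x"
proof -
  have "((\<lambda>y. H * \<bar>y - x\<bar> powr \<alpha>) \<longlongrightarrow> H * \<bar>x - x\<bar> powr \<alpha>) (at x)"
    using alpha_pos by (intro tendsto_intros) auto
  then have "((\<lambda>y. H * \<bar>y - x\<bar> powr \<alpha>) \<longlongrightarrow> 0) (at x)" by simp
  then have "((\<lambda>y. G y - G x) \<longlongrightarrow> 0) (at x)"
    by (rule Lim_null_comparison[rotated]) (simp add: G_Holder)
  then show ?thesis by (simp add: isCont_def LIM_zero_iff)
qed

lemma G_meas[measurable]: "G \<in> borel_measurable borel"
  using G_cont by (intro borel_measurable_continuous_onI continuous_at_imp_continuous_on) auto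

lemma F_meas[measurable]: "F \<in> borel_measurable borel"
proof -
  have "(\<lambda>x. G x + (\<Sum>d\<in>D. \<delta> d * indicator {d..} x)) \<in> borel_measurable borel" by measurable
  then show ?thesis by (simp add: F_eq[symmetric])
qed

lemma L_meas[measurable]: "L \<in> borel_measurable borel"
  using L_der by (intro borel_measurable_continuous_onI continuous_at_imp_continuous_on) (auto intro: DERIV_isCont)

lemma L'_meas[measurable]: "L' \<in> borel_measurable borel"
proof -
  have "isCont L' x" for x
  proof -
    have "((\<lambda>y. C * \<bar>y - x\<bar>) \<longlongrightarrow> C * \<bar>x - x\<bar>) (at x)" by (intro tendsto_intros)
    then have "((\<lambda>y. C * \<bar>y - x\<bar>) \<longlongrightarrow> 0) (at x)" by simp
    then have "((\<lambda>y. L' y - L' x) \<longlongrightarrow> 0) (at x)"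
      by (rule Lim_null_comparison[rotated]) (simp add: L'_lip)
    then show ?thesis by (simp add: isCont_def LIM_zero_iff)
  qed
  then show ?thesis by (intro borel_measurable_continuous_onI continuous_at_imp_continuous_on) auto
qed

lemma mark_meas[measurable]: "mark d \<sigma> \<in> borel_measurable borel"
  unfolding mark_def[abs_def] by measurable

text \<open>For small \<open>s\<close> the windows of different jumps are disjoint, so an
  observation crosses at most one jump. Linearizing at the noise moved by that jump leaves a
  quadratic remainder, and returning the derivative to \<open>L' z\<close> costs a multiple of the
  increment of \<open>G\<close>, but only for observations that hit a window.\<close>

lemma sample_approximation:
  obtains s0 K1 K2 where "0 < s0" "0 \<le> K1" "0 \<le> K2"
    "\<And>n \<omega> s. \<bar>s\<bar> < s0 \<Longrightarrow> \<bar>risk n \<omega> s - jump_part n \<omega> s - smooth_part n \<omega> s\<bar> \<le>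
       K1 * \<bar>s\<bar> powr \<alpha> * hits n \<omega> s + K2 * real n * \<bar>s\<bar> powr (2 * \<alpha>)"
proof -
  define \<delta>m where "\<delta>m = (\<Sum>d\<in>D. \<bar>\<delta> d\<bar>)"
  have \<delta>m: "\<bar>\<delta> d\<bar> \<le> \<delta>m" if "d \<in> D" for d unfolding \<delta>m_def using that D_fin by (intro member_le_sum) auto
  have \<delta>m0: "0 \<le> \<delta>m" unfolding \<delta>m_def by (rule sum_nonneg) auto
  \<comment> \<open>Half the smallest gap between jumps; the inserted \<open>1\<close> covers a
    single jump, where there is no gap.\<close>
  define s0 where "s0 = Min (insert 1 ((\<lambda>(d, d'). \<bar>d - d'\<bar>) ` {(d, d') \<in> D \<times> D. d \<noteq> d'})) / 2"
  have fin: "finite ((\<lambda>(d, d'). \<bar>d - d'\<bar>) ` {(d, d') \<in> D \<times> D. d \<noteq> d'})"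
    by (rule finite_imageI, rule finite_subset[of _ "D \<times> D"]) (use D_fin in auto)
  have s0: "0 < s0" unfolding s0_def using fin by (auto simp: Min_gr_iff)
  have sep: "2 * s0 \<le> \<bar>d - d'\<bar>" if "d \<in> D" "d' \<in> D" "d \<noteq> d'" for d d'
  proof -
    have "Min (insert 1 ((\<lambda>(d, d'). \<bar>d - d'\<bar>) ` {(d, d') \<in> D \<times> D. d \<noteq> d'})) \<le> \<bar>d - d'\<bar>"
      using fin that by (intro Min_le) (auto intro!: image_eqI[of _ _ "(d, d')"])
    then show ?thesis by (simp add: s0_def)
  qed
  have one: "\<bar>L (z + (F x - F (x - s))) - L z - (\<Sum>d\<in>D. indicator (win d s) x * mark d (sgn s) z) - L' z * (G x - G (x - s))\<bar>
     \<le> C * \<delta>m * H * \<bar>s\<bar> powr \<alpha> * (\<Sum>d\<in>D. indicator (win d s) x) + C * H\<^sup>2 * \<bar>s\<bar> powr (2 * \<alpha>)"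
    if s: "\<bar>s\<bar> < s0" for x z s
  proof -
    define w where "w = G x - G (x - s)"
    define b where "b = (\<Sum>d\<in>D. sgn s * \<delta> d * indicator (win d s) x)"
    have w: "\<bar>w\<bar> \<le> H * \<bar>s\<bar> powr \<alpha>" using G_Holder[of x "x - s"] by (simp add: w_def)
    have FF: "F x - F (x - s) = w + b"
      unfolding F_eq w_def b_def using win_indicator[of _ x s]
      by (simp add: sum_subtractf[symmetric] right_diff_distrib[symmetric] mult_ac)
    have marks: "(\<Sum>d\<in>D. indicator (win d s) x * mark d (sgn s) z) = L (z + b) - L z \<and> \<bar>b\<bar> \<le> \<delta>m * (\<Sum>d\<in>D. indicator (win d s) x)"
    proof (cases "\<exists>d\<in>D. x \<in> win d s")
      case True
      then obtain d where d: "d \<in> D" "x \<in> win d s" by blast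
      have other: "indicator (win e s) x = (0::real)" if "e \<in> D - {d}" for e
      proof -
        have "2 * s0 \<le> \<bar>d - e\<bar>" using sep[of d e] d that by auto
        then have "x \<notin> win e s" using d(2) s by (auto simp: win_def min_def max_def abs_if split: if_splits)
        then show ?thesis by simp
      qed
      have single: "(\<Sum>e\<in>D. f e * indicator (win e s) x) = f d" for f :: "real \<Rightarrow> real"
      proof -
        have "(\<Sum>e\<in>D - {d}. f e * indicator (win e s) x) = 0" by (rule sum.neutral) (simp add: other)
        then show ?thesis using d D_fin by (subst sum.remove[of D d]) auto
      qed
      have b: "b = sgn s * \<delta> d" unfolding b_def by (rule single)
      have "(\<Sum>e\<in>D. indicator (win e s) x) = (1::real)" using single[of "\<lambda>_. 1"] by simp
      moreover have "(\<Sum>e\<in>D. indicator (win e s) x * mark e (sgn s) z) = mark d (sgn s) z"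
        using single[of "\<lambda>e. mark e (sgn s) z"] by (simp add: mult.commute)
      ultimately show ?thesis using \<delta>m[OF d(1)] by (auto simp: b mark_def abs_mult sgn_if \<delta>m0)
    next
      case False
      then have z: "indicator (win d s) x = (0::real)" if "d \<in> D" for d using that by auto
      then show ?thesis by (simp add: b_def)
    qed
    have 1: "\<bar>L (z + b + w) - L (z + b) - L' (z + b) * w\<bar> \<le> C * w\<^sup>2"
      by (rule lipschitz_derivative_linearization[OF L_der L'_lip])
    have 2: "\<bar>(L' (z + b) - L' z) * w\<bar> \<le> C * \<bar>b\<bar> * \<bar>w\<bar>"
      unfolding abs_mult using L'_lip[of "z + b" z] by (intro mult_right_mono) auto
    have w2: "w\<^sup>2 \<le> H\<^sup>2 * \<bar>s\<bar> powr (2 * \<alpha>)"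
    proof -
      have "\<bar>w\<bar>\<^sup>2 \<le> (H * \<bar>s\<bar> powr \<alpha>)\<^sup>2" by (rule power_mono[OF w]) simp
      also have "\<dots> = H\<^sup>2 * \<bar>s\<bar> powr (2 * \<alpha>)"
        by (cases "s = 0") (simp_all add: power_mult_distrib powr_power mult.commute)
      finally show ?thesis by simp
    qed
    have "C * \<bar>b\<bar> * \<bar>w\<bar> \<le> C * (\<delta>m * (\<Sum>d\<in>D. indicator (win d s) x)) * (H * \<bar>s\<bar> powr \<alpha>)"
      using marks w C_pos by (intro mult_mono) (auto intro!: mult_nonneg_nonneg \<delta>m0 sum_nonneg)
    moreover have "C * w\<^sup>2 \<le> C * (H\<^sup>2 * \<bar>s\<bar> powr (2 * \<alpha>))" using w2 C_pos by (intro mult_left_mono) auto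
    moreover have "L (z + (F x - F (x - s))) - L z - (L (z + b) - L z) - L' z * w =
      (L (z + b + w) - L (z + b) - L' (z + b) * w) + (L' (z + b) - L' z) * w"
      unfolding FF by (simp add: algebra_simps)
    ultimately have "\<bar>L (z + (F x - F (x - s))) - L z - (L (z + b) - L z) - L' z * w\<bar> \<le>
      C * (H\<^sup>2 * \<bar>s\<bar> powr (2 * \<alpha>)) + C * (\<delta>m * (\<Sum>d\<in>D. indicator (win d s) x)) * (H * \<bar>s\<bar> powr \<alpha>)"
      using 1 2 by linarith
    then show ?thesis using marks by (simp add: w_def mult_ac)
  qed
  show thesis
  proof (rule that[OF s0])
    show "0 \<le> C * \<delta>m * H" "0 \<le> C * H\<^sup>2" using C_pos H_pos \<delta>m0 by auto
    fix n \<omega> s assume s: "\<bar>s\<bar> < s0"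
    have "\<bar>risk n \<omega> s - jump_part n \<omega> s - smooth_part n \<omega> s\<bar> =
      \<bar>\<Sum>i<n. L (Z i \<omega> + (F (X i \<omega>) - F (X i \<omega> - s))) - L (Z i \<omega>) - (\<Sum>d\<in>D. indicator (win d s) (X i \<omega>) * mark d (sgn s) (Z i \<omega>))
         - L' (Z i \<omega>) * (G (X i \<omega>) - G (X i \<omega> - s))\<bar>"
      by (simp only: risk_def jump_part_def smooth_part_def sum_subtractf)
    also have "\<dots> \<le> (\<Sum>i<n. C * \<delta>m * H * \<bar>s\<bar> powr \<alpha> * (\<Sum>d\<in>D. indicator (win d s) (X i \<omega>)) + C * H\<^sup>2 * \<bar>s\<bar> powr (2 * \<alpha>))"
      by (rule order_trans[OF sum_abs]) (intro sum_mono one s)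
    also have "\<dots> = C * \<delta>m * H * \<bar>s\<bar> powr \<alpha> * hits n \<omega> s + C * H\<^sup>2 * real n * \<bar>s\<bar> powr (2 * \<alpha>)"
      by (simp add: sum.distrib hits_def sum_distrib_left)
    finally show "\<bar>risk n \<omega> s - jump_part n \<omega> s - smooth_part n \<omega> s\<bar> \<le>
       C * \<delta>m * H * \<bar>s\<bar> powr \<alpha> * hits n \<omega> s + C * H\<^sup>2 * real n * \<bar>s\<bar> powr (2 * \<alpha>)" .
  qed
qed

lemma Z_expectation: "w \<in> borel_measurable borel \<Longrightarrow> expectation (\<lambda>\<omega>. w (Z i \<omega>) :: real) = expectation (\<lambda>\<omega>. w (Z 0 \<omega>))"
  using Z_ident[of i] integral_distr[of "Z i" M borel w] integral_distr[of "Z 0" M borel w] by simp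

lemma Z_integrable: "w \<in> borel_measurable borel \<Longrightarrow> integrable M (\<lambda>\<omega>. w (Z i \<omega>) :: real) \<longleftrightarrow> integrable M (\<lambda>\<omega>. w (Z 0 \<omega>))"
  using Z_ident[of i] integrable_distr_eq[of "Z i" M borel w] integrable_distr_eq[of "Z 0" M borel w] by simp

lemma L'_square_integrable: "integrable M (\<lambda>\<omega>. (L' (Z i \<omega>))\<^sup>2)"
proof -
  have "integrable M (\<lambda>\<omega>. (L' (Z 0 \<omega>))\<^sup>2)"
  proof (rule Bochner_Integration.integrable_bound)
    show "integrable M (\<lambda>\<omega>. 4 * C * L (Z 0 \<omega>))" using L_int by simp
    show "AE \<omega> in M. norm ((L' (Z 0 \<omega>))\<^sup>2) \<le> norm (4 * C * L (Z 0 \<omega>))"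
      using lipschitz_derivative_square_le[OF L_der L'_lip C_pos L_nonneg] L_nonneg C_pos by (auto simp: abs_mult)
  qed measurable
  then show ?thesis using Z_integrable[of "\<lambda>z. (L' z)\<^sup>2" i] by simp
qed

lemma L'_integrable: "integrable M (\<lambda>\<omega>. L' (Z i \<omega>))"
  by (rule square_integrable_imp_integrable[OF _ L'_square_integrable]) measurable

lemma Z_sym_distr: "w \<in> measurable borel N \<Longrightarrow> distr M N (\<lambda>\<omega>. w (- Z i \<omega>)) = distr M N (\<lambda>\<omega>. w (Z i \<omega>))"
proof -
  assume w[measurable]: "w \<in> measurable borel N"
  have "distr M N (\<lambda>\<omega>. w (- Z i \<omega>)) = distr (distr M borel (Z i)) N (\<lambda>z. w (- z))"
    by (subst distr_distr) (auto simp: comp_def)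
  also have "\<dots> = distr (distr M borel (\<lambda>\<omega>. - Z 0 \<omega>)) N w"
    unfolding Z_ident[of i] by (subst (1 2) distr_distr) (auto simp: comp_def)
  also have "\<dots> = distr (distr M borel (Z i)) N w" unfolding Z_sym Z_ident[of i] ..
  also have "\<dots> = distr M N (\<lambda>\<omega>. w (Z i \<omega>))" by (subst distr_distr) (auto simp: comp_def)
  finally show ?thesis .
qed

text \<open>An odd function of a symmetric variable. It removes the drift of the smooth part, so the
  jumps alone decide the slope of the risk.\<close>

lemma L'_mean: "expectation (\<lambda>\<omega>. L' (Z i \<omega>)) = 0"
proof -
  have "expectation (\<lambda>\<omega>. L' (- Z i \<omega>)) = (\<integral>x. x \<partial>distr M borel (\<lambda>\<omega>. L' (- Z i \<omega>)))"
    by (subst integral_distr) auto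
  also have "\<dots> = (\<integral>x. x \<partial>distr M borel (\<lambda>\<omega>. L' (Z i \<omega>)))" by (simp only: Z_sym_distr[OF L'_meas])
  also have "\<dots> = expectation (\<lambda>\<omega>. L' (Z i \<omega>))" by (subst integral_distr) auto
  finally show ?thesis by (simp add: derivative_of_even_is_odd[OF L_der L_even])
qed

text \<open>Reflecting the noise turns a downward jump into an upward one because \<open>L\<close>
  is even. Both sides of the true shift thus share one mark law, as the limit process
  requires.\<close>

lemma mark_sym_distr: "\<sigma> = 1 \<or> \<sigma> = -1 \<Longrightarrow> distr M borel (\<lambda>\<omega>. mark d \<sigma> (Z i \<omega>)) = distr M borel (\<lambda>\<omega>. L (Z 0 \<omega> + \<delta> d) - L (Z 0 \<omega>))"
proof -
  have "distr M borel (\<lambda>\<omega>. mark d 1 (Z j \<omega>)) = distr (distr M borel (Z j)) borel (mark d 1)" for j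
    by (subst distr_distr) (auto simp: comp_def)
  then have 1: "distr M borel (\<lambda>\<omega>. mark d 1 (Z i \<omega>)) = distr M borel (\<lambda>\<omega>. mark d 1 (Z 0 \<omega>))"
    by (simp only: Z_ident[of i])
  have "mark d (- 1) (Z i \<omega>) = mark d 1 (- Z i \<omega>)" for \<omega>
    using L_even[of "Z i \<omega> - \<delta> d"] L_even[of "Z i \<omega>"] by (simp add: mark_def)
  then have "distr M borel (\<lambda>\<omega>. mark d (- 1) (Z i \<omega>)) = distr M borel (\<lambda>\<omega>. mark d 1 (Z i \<omega>))"
    using Z_sym_distr[of "mark d 1" borel i] by simp
  then show "\<sigma> = 1 \<or> \<sigma> = -1 \<Longrightarrow> distr M borel (\<lambda>\<omega>. mark d \<sigma> (Z i \<omega>)) = distr M borel (\<lambda>\<omega>. L (Z 0 \<omega> + \<delta> d) - L (Z 0 \<omega>))"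
    using 1 by (auto simp: mark_def)
qed

lemma increment_le: "\<bar>L (z + b) - L z\<bar> \<le> \<bar>L' z\<bar> * \<bar>b\<bar> + C * b\<^sup>2"
  using lipschitz_derivative_linearization[OF L_der L'_lip, of z b] by (simp add: abs_mult[symmetric]) 

lemma increment_square_integrable: "integrable M (\<lambda>\<omega>. (L (Z i \<omega> + b) - L (Z i \<omega>))\<^sup>2)"
proof (rule Bochner_Integration.integrable_bound)
  show "integrable M (\<lambda>\<omega>. 2 * b\<^sup>2 * (L' (Z i \<omega>))\<^sup>2 + 2 * (C * b\<^sup>2)\<^sup>2)" using L'_square_integrable by simp
  have "(L (z + b) - L z)\<^sup>2 \<le> 2 * b\<^sup>2 * (L' z)\<^sup>2 + 2 * (C * b\<^sup>2)\<^sup>2" for z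
  proof -
    have "\<bar>L (z + b) - L z\<bar>\<^sup>2 \<le> (\<bar>L' z\<bar> * \<bar>b\<bar> + C * b\<^sup>2)\<^sup>2" by (rule power_mono[OF increment_le]) simp
    also have "\<dots> \<le> 2 * (\<bar>L' z\<bar> * \<bar>b\<bar>)\<^sup>2 + 2 * (C * b\<^sup>2)\<^sup>2"
      using sum_squares_bound[of "\<bar>L' z\<bar> * \<bar>b\<bar>" "C * b\<^sup>2"] by (simp add: power2_sum)
    also have "\<dots> = 2 * b\<^sup>2 * (L' z)\<^sup>2 + 2 * (C * b\<^sup>2)\<^sup>2" by (simp add: power_mult_distrib)
    finally show ?thesis by simp
  qed
  then show "AE \<omega> in M. norm ((L (Z i \<omega> + b) - L (Z i \<omega>))\<^sup>2) \<le> norm (2 * b\<^sup>2 * (L' (Z i \<omega>))\<^sup>2 + 2 * (C * b\<^sup>2)\<^sup>2)"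
    by (intro AE_I2) (smt (verit) real_norm_def zero_le_power2)
qed measurable

lemma XZ_pair: "indep_var borel (X i) borel (Z i)"
proof -
  have "indep_var (PiM {Inl i} (\<lambda>_. borel)) (\<lambda>\<omega>. restrict (\<lambda>j. case_sum X Z j \<omega>) {Inl i})
      (PiM {Inr i} (\<lambda>_. borel)) (\<lambda>\<omega>. restrict (\<lambda>j. case_sum X Z j \<omega>) {Inr i})"
    by (rule indep_var_restrict[OF XZ_indep]) auto
  from indep_var_compose[OF this, of "\<lambda>y. y (Inl i)" borel "\<lambda>y. y (Inr i)" borel]
  show ?thesis by (simp add: comp_def)
qed

lemma XZ_functions_indep:
  assumes h: "case_prod h \<in> borel_measurable (borel \<Otimes>\<^sub>M borel)"
  shows "indep_vars (\<lambda>_. borel) (\<lambda>i \<omega>. h (X i \<omega>) (Z i \<omega>) :: real) UNIV"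
proof -
  have "indep_vars (\<lambda>i. PiM {Inl i, Inr i} (\<lambda>_. borel)) (\<lambda>i \<omega>. restrict (\<lambda>j. case_sum X Z j \<omega>) {Inl i, Inr i}) UNIV"
    by (rule indep_vars_restrict[OF XZ_indep]) (auto simp: disjoint_family_on_def)
  then have "indep_vars (\<lambda>_. borel) (\<lambda>i \<omega>. (\<lambda>y. case_prod h (y (Inl i), y (Inr i))) (restrict (\<lambda>j. case_sum X Z j \<omega>) {Inl i, Inr i})) UNIV"
    by (rule indep_vars_compose2) (rule measurable_compose[OF _ h], measurable)
  then show ?thesis by simp
qed

text \<open>Continuity of \<open>lam\<close> at \<open>d\<close> makes the mass of any short
  interval near \<open>d\<close> proportional to its length up to \<open>e\<close>. Intervals that
  do not touch \<open>d\<close> are included, since grid cells lie beside the jump.\<close>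

lemma window_probability:
  assumes "0 < e"
  obtains s1 where "0 < s1"
    "\<And>d a b i. d \<in> D \<Longrightarrow> d - s1 \<le> a \<Longrightarrow> a \<le> b \<Longrightarrow> b \<le> d + s1 \<Longrightarrow>
      \<bar>prob {\<omega>\<in>space M. X i \<omega> \<in> {a..<b}} - lam d * (b - a)\<bar> \<le> e * (b - a)"
proof -
  have "\<forall>d\<in>D. \<exists>s>0. \<forall>x. \<bar>x - d\<bar> < s \<longrightarrow> \<bar>lam x - lam d\<bar> < e"
    using lam_cont assms unfolding continuous_at_eps_delta by (auto simp: dist_real_def)
  then obtain sd where sd: "\<And>d. d \<in> D \<Longrightarrow> 0 < sd d" "\<And>d x. d \<in> D \<Longrightarrow> \<bar>x - d\<bar> < sd d \<Longrightarrow> \<bar>lam x - lam d\<bar> < e"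
    by metis
  define s1 where "s1 = Min (sd ` D) / 2"
  have s1: "0 < s1" unfolding s1_def using D_fin D_ne sd(1) by (auto simp: Min_gr_iff)
  have s1d: "s1 < sd d" if "d \<in> D" for d
  proof -
    have "Min (sd ` D) \<le> sd d" using D_fin that by simp
    then show ?thesis using s1 unfolding s1_def by linarith
  qed
  show thesis
  proof (rule that[OF s1])
    fix d a b i assume d: "d \<in> D" and ab: "d - s1 \<le> a" "a \<le> b" "b \<le> d + s1"
    let ?p = "prob {\<omega>\<in>space M. X i \<omega> \<in> {a..<b}}"
    have p: "ennreal ?p = (\<integral>\<^sup>+x. ennreal (lam x) * indicator {a..<b} x \<partial>lborel)"
      using distributed_emeasure[OF X_dist[of i], of "{a..<b}"]
      by (simp add: emeasure_eq_measure vimage_def Int_def conj_commute)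
    have near: "\<bar>lam x - lam d\<bar> < e" if "x \<in> {a..<b}" for x
    proof -
      have "\<bar>x - d\<bar> \<le> s1" using that ab by (auto simp: abs_le_iff)
      then show ?thesis using s1d[OF d] by (intro sd(2)[OF d]) linarith
    qed
    have const: "(\<integral>\<^sup>+x. ennreal c * indicator {a..<b} x \<partial>lborel) = ennreal (c * (b - a))" if "0 \<le> c" for c
      using ab that by (simp add: nn_integral_cmult_indicator ennreal_mult)
    have "(\<integral>\<^sup>+x. ennreal (lam x) * indicator {a..<b} x \<partial>lborel) \<le> (\<integral>\<^sup>+x. ennreal (lam d + e) * indicator {a..<b} x \<partial>lborel)"
      using near by (intro nn_integral_mono) (fastforce simp: indicator_def intro!: ennreal_leI)
    then have "ennreal ?p \<le> ennreal ((lam d + e) * (b - a))"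
      unfolding p using lam_nonneg[of d] assms by (subst (asm) const) auto
    then have up: "?p \<le> (lam d + e) * (b - a)" using lam_nonneg[of d] assms ab by (subst (asm) ennreal_le_iff) auto
    have "(\<integral>\<^sup>+x. ennreal (max 0 (lam d - e)) * indicator {a..<b} x \<partial>lborel) \<le> (\<integral>\<^sup>+x. ennreal (lam x) * indicator {a..<b} x \<partial>lborel)"
      using near lam_nonneg by (intro nn_integral_mono) (fastforce simp: indicator_def intro!: ennreal_leI)
    then have "ennreal (max 0 (lam d - e) * (b - a)) \<le> ennreal ?p" by (simp only: p const max.cobounded1)
    then have "max 0 (lam d - e) * (b - a) \<le> ?p" by (subst (asm) ennreal_le_iff) auto
    moreover have "(lam d - e) * (b - a) \<le> max 0 (lam d - e) * (b - a)" using ab by (intro mult_right_mono) auto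
    ultimately show "\<bar>?p - lam d * (b - a)\<bar> \<le> e * (b - a)" using up by (simp add: abs_le_iff algebra_simps)
  qed
qed

end

context template_sample begin

lemma window_weight_moments:
  assumes A[measurable]: "A \<in> sets borel" and w[measurable]: "w \<in> borel_measurable borel"
    and sq: "integrable M (\<lambda>\<omega>. (w (Z 0 \<omega>))\<^sup>2)"
  shows "integrable M (\<lambda>\<omega>. (indicator A (X i \<omega>) * w (Z i \<omega>))\<^sup>2)"
    "expectation (\<lambda>\<omega>. indicator A (X i \<omega>) * w (Z i \<omega>)) = prob {\<omega>\<in>space M. X i \<omega> \<in> A} * expectation (\<lambda>\<omega>. w (Z 0 \<omega>))"
    "expectation (\<lambda>\<omega>. (indicator A (X i \<omega>) * w (Z i \<omega>))\<^sup>2) = prob {\<omega>\<in>space M. X i \<omega> \<in> A} * expectation (\<lambda>\<omega>. (w (Z 0 \<omega>))\<^sup>2)"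
proof -
  have sqi: "integrable M (\<lambda>\<omega>. (w (Z i \<omega>))\<^sup>2)" using sq Z_integrable[of "\<lambda>z. (w z)\<^sup>2" i] by simp
  have int: "integrable M (\<lambda>\<omega>. w (Z i \<omega>))" by (rule square_integrable_imp_integrable[OF _ sqi]) measurable
  have prodE: "integrable M (\<lambda>\<omega>. indicator A (X i \<omega>) * g (Z i \<omega>)) \<and>
      expectation (\<lambda>\<omega>. indicator A (X i \<omega>) * g (Z i \<omega>)) = prob {\<omega>\<in>space M. X i \<omega> \<in> A} * expectation (\<lambda>\<omega>. g (Z 0 \<omega>))"
    if [measurable]: "g \<in> borel_measurable borel" and gi: "integrable M (\<lambda>\<omega>. g (Z i \<omega>))" for g :: "real \<Rightarrow> real"
  proof -
    have iv: "indep_var borel (\<lambda>\<omega>. indicator A (X i \<omega>) :: real) borel (\<lambda>\<omega>. g (Z i \<omega>))"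
      using indep_var_compose[OF XZ_pair[of i], of "indicator A" borel g borel] by (simp add: comp_def)
    have ii: "integrable M (\<lambda>\<omega>. indicator A (X i \<omega>) :: real)"
      by (rule integrable_const_bound[where B=1]) (auto simp: indicator_def)
    have "expectation (\<lambda>\<omega>. indicator A (X i \<omega>) :: real) = expectation (indicator {\<omega>\<in>space M. X i \<omega> \<in> A})"
      by (rule Bochner_Integration.integral_cong) (auto simp: indicator_def)
    also have "\<dots> = prob {\<omega>\<in>space M. X i \<omega> \<in> A}"
      by (simp add: Int_absorb2 subset_eq)
    finally show ?thesis
      using indep_var_lebesgue_integral[OF iv ii gi] indep_var_integrable[OF iv ii gi] Z_expectation[of g i] by simp
  qed
  have sq_eq: "(\<lambda>\<omega>. (indicator A (X i \<omega>) * w (Z i \<omega>))\<^sup>2) = (\<lambda>\<omega>. indicator A (X i \<omega>) * (w (Z i \<omega>))\<^sup>2)"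
    by (auto simp: fun_eq_iff indicator_def)
  show "integrable M (\<lambda>\<omega>. (indicator A (X i \<omega>) * w (Z i \<omega>))\<^sup>2)"
    "expectation (\<lambda>\<omega>. (indicator A (X i \<omega>) * w (Z i \<omega>))\<^sup>2) = prob {\<omega>\<in>space M. X i \<omega> \<in> A} * expectation (\<lambda>\<omega>. (w (Z 0 \<omega>))\<^sup>2)"
    unfolding sq_eq using prodE[of "\<lambda>z. (w z)\<^sup>2"] sqi by auto
  show "expectation (\<lambda>\<omega>. indicator A (X i \<omega>) * w (Z i \<omega>)) = prob {\<omega>\<in>space M. X i \<omega> \<in> A} * expectation (\<lambda>\<omega>. w (Z 0 \<omega>))"
    using prodE[of w] int by auto
qed

text \<open>For nonnegative weights the window sums are monotone in the width, so control along a geometric sequence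
  of widths suffices.\<close>
lemma window_sum_uniform_LLN:
  assumes d: "d \<in> D" and \<sigma>: "\<sigma> = 1 \<or> \<sigma> = -1" and w[measurable]: "w \<in> borel_measurable borel"
    and w_nn: "\<And>z. 0 \<le> w z" and sq: "integrable M (\<lambda>\<omega>. (w (Z 0 \<omega>))\<^sup>2)" and \<rho>: "0 < \<rho>"
  obtains s1 where "0 < s1"
    "\<And>p. 0 < p \<Longrightarrow> \<exists>K>0. \<forall>n>0. \<exists>A\<in>events. prob A \<le> p \<and> (\<forall>\<omega>\<in>space M - A. \<forall>r. K / real n \<le> r \<longrightarrow> r \<le> s1 \<longrightarrow>
       \<bar>(\<Sum>i<n. indicator (win d (\<sigma> * r)) (X i \<omega>) * w (Z i \<omega>)) - real n * r * (lam d * expectation (\<lambda>\<omega>. w (Z 0 \<omega>)))\<bar> \<le> \<rho> * (real n * r))"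
proof -
  define Ew where "Ew = expectation (\<lambda>\<omega>. w (Z 0 \<omega>))"
  define Ew2 where "Ew2 = expectation (\<lambda>\<omega>. (w (Z 0 \<omega>))\<^sup>2)"
  define c where "c = lam d * Ew"
  have Ew: "0 \<le> Ew" "0 \<le> Ew2" unfolding Ew_def Ew2_def by (auto intro!: Bochner_Integration.integral_nonneg w_nn)
  have c: "0 \<le> c" using Ew lam_nonneg by (simp add: c_def)
  \<comment> \<open>Chosen so that replacing the window probability by \<open>lam d * r\<close>
    costs at most \<open>\<rho> / 8\<close> per unit of \<open>n * r\<close>.\<close>
  define \<epsilon> where "\<epsilon> = \<rho> / (8 * (Ew + 1))"
  have \<epsilon>: "0 < \<epsilon>" "\<epsilon> * Ew \<le> \<rho> / 8" using \<rho> Ew by (auto simp: \<epsilon>_def field_simps)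
  \<comment> \<open>Ratio of neighbouring widths minus one, so small that passing to the next width
    changes even the enlarged slope \<open>c + \<rho>\<close> by only
    \<open>\<rho> / 2\<close>.\<close>
  define \<gamma> where "\<gamma> = \<rho> / (2 * (c + \<rho>))"
  have \<gamma>: "0 < \<gamma>" "\<gamma> * (c + \<rho>) = \<rho> / 2" using \<rho> c by (auto simp: \<gamma>_def field_simps)
  obtain s where s: "0 < s" and prob_win: "\<And>d a b i. d \<in> D \<Longrightarrow> d - s \<le> a \<Longrightarrow> a \<le> b \<Longrightarrow> b \<le> d + s \<Longrightarrow>
      \<bar>prob {\<omega>\<in>space M. X i \<omega> \<in> {a..<b}} - lam d * (b - a)\<bar> \<le> \<epsilon> * (b - a)"
    using window_probability[OF \<epsilon>(1)] by blast
  define \<Lambda> where "\<Lambda> = lam d + \<epsilon>"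
  have \<Lambda>: "0 < \<Lambda>" using lam_nonneg[of d] \<epsilon> by (simp add: \<Lambda>_def)
  have pw: "\<bar>prob {\<omega>\<in>space M. X i \<omega> \<in> win d (\<sigma> * r)} - lam d * r\<bar> \<le> \<epsilon> * r" if "0 \<le> r" "r \<le> s" for r i
  proof (cases "\<sigma> = 1")
    case True
    then show ?thesis using prob_win[OF d, of d "d + r" i] that s by (simp add: win_def)
  next
    case False
    then show ?thesis using prob_win[OF d, of "d - r" d i] that s \<sigma> by (simp add: win_def)
  qed
  define A where "A n \<omega> r = (\<Sum>i<n. indicator (win d (\<sigma> * r)) (X i \<omega>) * w (Z i \<omega>))" for n \<omega> r
  have A_mono: "A n \<omega> r \<le> A n \<omega> r'" if "0 \<le> r" "r \<le> r'" for n \<omega> r r'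
    unfolding A_def using win_mono[OF that \<sigma>, of d] w_nn
    by (intro sum_mono mult_right_mono) (auto simp: indicator_def)
  have A_meas[measurable]: "(\<lambda>\<omega>. A n \<omega> r) \<in> borel_measurable M" for n r unfolding A_def by measurable
  have cheb: "prob {\<omega>\<in>space M. \<rho> / 8 * (real n * r) \<le> \<bar>A n \<omega> r - real n * (prob {\<omega>\<in>space M. X 0 \<omega> \<in> win d (\<sigma> * r)} * Ew)\<bar>}
      \<le> 64 * \<Lambda> * Ew2 / \<rho>\<^sup>2 / (real n * r)" if r: "0 < r" "r \<le> s" and n: "0 < n" for n r
  proof -
    have pX: "prob {\<omega>\<in>space M. X i \<omega> \<in> win d (\<sigma> * r)} = prob {\<omega>\<in>space M. X 0 \<omega> \<in> win d (\<sigma> * r)}" for i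
    proof -
      have "emeasure M {\<omega>\<in>space M. X i \<omega> \<in> win d (\<sigma> * r)} = emeasure M {\<omega>\<in>space M. X 0 \<omega> \<in> win d (\<sigma> * r)}"
        using distributed_emeasure[OF X_dist[of i], of "win d (\<sigma> * r)"] distributed_emeasure[OF X_dist[of 0], of "win d (\<sigma> * r)"]
        by (simp add: vimage_def Int_def conj_commute)
      then show ?thesis by (simp add: measure_def)
    qed
    have ind: "indep_vars (\<lambda>_. borel) (\<lambda>i \<omega>. indicator (win d (\<sigma> * r)) (X i \<omega>) * w (Z i \<omega>)) UNIV"
      by (rule XZ_functions_indep) measurable
    have "prob {\<omega>\<in>space M. \<rho> / 8 * (real n * r) \<le> \<bar>A n \<omega> r - real n * (prob {\<omega>\<in>space M. X 0 \<omega> \<in> win d (\<sigma> * r)} * Ew)\<bar>}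
      \<le> real n * (\<Lambda> * r * Ew2) / (\<rho> / 8 * (real n * r))\<^sup>2"
      unfolding A_def
    proof (rule Chebyshev_iid[OF ind])
      fix i
      show "integrable M (\<lambda>\<omega>. (indicator (win d (\<sigma> * r)) (X i \<omega>) * w (Z i \<omega>))\<^sup>2)"
        by (rule window_weight_moments(1)[OF _ w sq]) measurable
      show "expectation (\<lambda>\<omega>. indicator (win d (\<sigma> * r)) (X i \<omega>) * w (Z i \<omega>)) = prob {\<omega>\<in>space M. X 0 \<omega> \<in> win d (\<sigma> * r)} * Ew"
        unfolding pX[of i, symmetric] Ew_def by (rule window_weight_moments(2)[OF _ w sq]) measurable
      have "expectation (\<lambda>\<omega>. (indicator (win d (\<sigma> * r)) (X i \<omega>) * w (Z i \<omega>))\<^sup>2) = prob {\<omega>\<in>space M. X i \<omega> \<in> win d (\<sigma> * r)} * Ew2"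
        unfolding Ew2_def by (rule window_weight_moments(3)[OF _ w sq]) measurable
      also have "\<dots> \<le> \<Lambda> * r * Ew2"
        using pw[of r i] r Ew by (intro mult_right_mono) (auto simp: \<Lambda>_def algebra_simps)
      finally show "expectation (\<lambda>\<omega>. (indicator (win d (\<sigma> * r)) (X i \<omega>) * w (Z i \<omega>))\<^sup>2) \<le> \<Lambda> * r * Ew2" .
    qed (use r n \<rho> in auto)
    also have "\<dots> = 64 * \<Lambda> * Ew2 / \<rho>\<^sup>2 / (real n * r)"
      using r n \<rho> by (simp add: field_simps power2_eq_square)
    finally show ?thesis .
  qed
  \<comment> \<open>The width just above \<open>r\<close> can be as large as
    \<open>(1 + \<gamma>) * r\<close> and has to stay within \<open>s\<close>.\<close>
  define s1 where "s1 = s / (1 + \<gamma>)"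
  show thesis
  proof (rule that[of s1])
    show "0 < s1" using s \<gamma> by (simp add: s1_def)
    fix p :: real assume p: "0 < p"
    \<comment> \<open>The Chebyshev bounds along the widths
      \<open>K / n * (1 + \<gamma>) ^ k\<close> decay geometrically and sum to \<open>Q / K\<close>,
      so a large \<open>K\<close> brings them below \<open>p\<close> for every \<open>n\<close> at
      once.\<close>
    define Q where "Q = (64 * \<Lambda> * Ew2 / \<rho>\<^sup>2) * ((1 + \<gamma>) / \<gamma>)"
    have Q: "0 \<le> Q" using \<Lambda> Ew \<gamma> \<rho> by (simp add: Q_def)
    define K where "K = (Q + 1) / p"
    have K: "0 < K" "Q / K \<le> p" using Q p by (auto simp: K_def field_simps)
    show "\<exists>K>0. \<forall>n>0. \<exists>B\<in>events. prob B \<le> p \<and> (\<forall>\<omega>\<in>space M - B. \<forall>r. K / real n \<le> r \<longrightarrow> r \<le> s1 \<longrightarrow>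
       \<bar>(\<Sum>i<n. indicator (win d (\<sigma> * r)) (X i \<omega>) * w (Z i \<omega>)) - real n * r * (lam d * expectation (\<lambda>\<omega>. w (Z 0 \<omega>)))\<bar> \<le> \<rho> * (real n * r))"
    proof (intro exI[of _ K] conjI allI impI)
      fix n :: nat assume n: "0 < n"
      define g where "g k = K / real n * (1 + \<gamma>) ^ k" for k :: nat
      have g: "0 < g k" for k using K n \<gamma> by (simp add: g_def)
      define Bk where "Bk k = (if g k \<le> s then {\<omega>\<in>space M. \<rho> / 8 * (real n * g k) \<le>
          \<bar>A n \<omega> (g k) - real n * (prob {\<omega>\<in>space M. X 0 \<omega> \<in> win d (\<sigma> * g k)} * Ew)\<bar>} else {})" for k
      have Bm[measurable]: "Bk k \<in> events" for k unfolding Bk_def by simp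
      have Bp: "prob (Bk k) \<le> (64 * \<Lambda> * Ew2 / \<rho>\<^sup>2 / K) * (1 / (1 + \<gamma>)) ^ k" for k
      proof (cases "g k \<le> s")
        case True
        have "prob (Bk k) \<le> 64 * \<Lambda> * Ew2 / \<rho>\<^sup>2 / (real n * g k)" using cheb[OF g True n] True by (simp add: Bk_def)
        also have "real n * g k = K * (1 + \<gamma>) ^ k" using n by (simp add: g_def)
        finally show ?thesis by (simp add: power_divide)
      next
        case False then show ?thesis using \<Lambda> Ew K \<gamma> by (simp add: Bk_def)
      qed
      have "(\<lambda>k. (64 * \<Lambda> * Ew2 / \<rho>\<^sup>2 / K) * (1 / (1 + \<gamma>)) ^ k) sums ((64 * \<Lambda> * Ew2 / \<rho>\<^sup>2 / K) * (1 / (1 - 1 / (1 + \<gamma>))))"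
        using \<gamma> by (intro sums_mult geometric_sums) auto
      also have "1 / (1 - 1 / (1 + \<gamma>)) = (1 + \<gamma>) / \<gamma>" using \<gamma> by (simp add: field_simps)
      also have "(64 * \<Lambda> * Ew2 / \<rho>\<^sup>2 / K) * ((1 + \<gamma>) / \<gamma>) = Q / K" by (simp add: Q_def)
      finally have "prob (\<Union>k. Bk k) \<le> Q / K" by (intro prob_countable_union_le[OF Bm Bp])
      then have PB: "prob (\<Union>k. Bk k) \<le> p" using K by linarith
      have good: "\<bar>A n \<omega> r - real n * r * c\<bar> \<le> \<rho> * (real n * r)"
        if \<omega>: "\<omega> \<in> space M - (\<Union>k. Bk k)" and r: "K / real n \<le> r" "r \<le> s1" for \<omega> r
      proof -
        have r0: "0 < r" using r K n by (smt (verit) divide_pos_pos of_nat_0_less_iff)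
        have "1 \<le> r * real n / K" using r K n by (simp add: field_simps)
        from ex_power_between[OF _ this, of "1 + \<gamma>"] \<gamma> obtain k where k: "(1 + \<gamma>) ^ k \<le> r * real n / K" "r * real n / K < (1 + \<gamma>) ^ Suc k"
          by auto
        have gr: "g k \<le> r" "r < g (Suc k)" using k K n by (simp_all add: g_def field_simps)
        have gSuc: "g (Suc k) = (1 + \<gamma>) * g k" by (simp add: g_def)
        have gS: "g (Suc k) \<le> (1 + \<gamma>) * r" unfolding gSuc using gr(1) \<gamma>(1) by (intro mult_left_mono) auto
        also have "\<dots> \<le> s" using r \<gamma> by (simp add: s1_def field_simps)
        finally have gSs: "g (Suc k) \<le> s" .
        have gk: "g k \<le> s" using gr gSs by linarith
        have est: "\<bar>A n \<omega> (g j) - real n * g j * c\<bar> \<le> \<rho> / 4 * (real n * g j)" if j: "g j \<le> s" for j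
        proof -
          have "\<omega> \<notin> Bk j" using \<omega> by auto
          then have 1: "\<bar>A n \<omega> (g j) - real n * (prob {\<omega>\<in>space M. X 0 \<omega> \<in> win d (\<sigma> * g j)} * Ew)\<bar> \<le> \<rho> / 8 * (real n * g j)"
            using \<omega> j by (auto simp: Bk_def)
          have "\<bar>prob {\<omega>\<in>space M. X 0 \<omega> \<in> win d (\<sigma> * g j)} * Ew - lam d * g j * Ew\<bar> \<le> \<epsilon> * g j * Ew"
            unfolding left_diff_distrib[symmetric] abs_mult using pw[of "g j" 0] g[of j] j Ew by (simp add: mult_right_mono)
          also have "\<dots> \<le> \<rho> / 8 * g j" using \<epsilon>(2) g[of j] mult_right_mono[of "\<epsilon> * Ew" "\<rho> / 8" "g j"] by (simp add: mult_ac)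
          finally have "real n * \<bar>prob {\<omega>\<in>space M. X 0 \<omega> \<in> win d (\<sigma> * g j)} * Ew - lam d * g j * Ew\<bar> \<le> real n * (\<rho> / 8 * g j)"
            by (intro mult_left_mono) auto
          then have 2: "\<bar>real n * (prob {\<omega>\<in>space M. X 0 \<omega> \<in> win d (\<sigma> * g j)} * Ew) - real n * g j * c\<bar> \<le> \<rho> / 8 * (real n * g j)"
            by (subst (asm) abs_of_nat[symmetric], subst (asm) abs_mult[symmetric]) (simp add: c_def algebra_simps)
          show ?thesis using 1 2 by linarith
        qed
        have nr: "0 < real n * r" using n r0 by simp
        have "A n \<omega> r \<le> A n \<omega> (g (Suc k))" using r0 gr by (intro A_mono) auto
        also have "\<dots> \<le> real n * g (Suc k) * c + \<rho> / 4 * (real n * g (Suc k))" using est[OF gSs] by linarith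
        also have "\<dots> = real n * g (Suc k) * (c + \<rho> / 4)" by (simp add: algebra_simps)
        also have "\<dots> \<le> real n * ((1 + \<gamma>) * r) * (c + \<rho> / 4)" using gS c \<rho> by (intro mult_right_mono mult_left_mono) auto
        also have "\<dots> = real n * r * ((1 + \<gamma>) * (c + \<rho> / 4))" by simp
        also have "\<dots> \<le> real n * r * (c + \<rho>)"
        proof (rule mult_left_mono)
          have "\<gamma> * (c + \<rho> / 4) \<le> \<gamma> * (c + \<rho>)" using \<gamma>(1) \<rho> by (intro mult_left_mono) auto
          then have "\<gamma> * (c + \<rho> / 4) \<le> \<rho> / 2" unfolding \<gamma>(2) .
          moreover have "(1 + \<gamma>) * (c + \<rho> / 4) = c + \<rho> / 4 + \<gamma> * (c + \<rho> / 4)" by (simp add: distrib_right)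
          ultimately show "(1 + \<gamma>) * (c + \<rho> / 4) \<le> c + \<rho>" using \<rho> by linarith
        qed (use nr in simp)
        finally have up: "A n \<omega> r \<le> real n * r * (c + \<rho>)" .
        have "(1 - \<gamma>) * r \<le> g k"
        proof -
          have "r < (1 + \<gamma>) * g k" using gr(2) by (simp only: gSuc)
          then have "(1 - \<gamma>) * r \<le> g k \<or> 1 - \<gamma> < 0" 
          proof (cases "1 - \<gamma> < 0")
            case False
            then have "(1 - \<gamma>) * r \<le> (1 - \<gamma>) * ((1 + \<gamma>) * g k)" using \<open>r < (1 + \<gamma>) * g k\<close> by (intro mult_left_mono) auto
            also have "\<dots> = g k - \<gamma>\<^sup>2 * g k" by (simp add: algebra_simps power2_eq_square)
            also have "\<dots> \<le> g k" using g[of k] by simp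
            finally show ?thesis by simp
          qed simp
          then show ?thesis using r0 g[of k] by (smt (verit) mult_nonneg_nonneg mult_less_0_iff)
        qed
        then have "real n * ((1 - \<gamma>) * r) * c \<le> real n * g k * c" using c by (intro mult_right_mono mult_left_mono) auto
        moreover have "real n * g k * c - \<rho> / 4 * (real n * g k) \<le> A n \<omega> (g k)" using est[OF gk] by linarith
        moreover have "A n \<omega> (g k) \<le> A n \<omega> r" using g[of k] gr by (intro A_mono) auto
        moreover have "\<rho> / 4 * (real n * g k) \<le> \<rho> / 4 * (real n * r)" using gr \<rho> by (intro mult_left_mono) auto
        moreover have "real n * ((1 - \<gamma>) * r) * c \<ge> real n * r * c - \<rho> / 2 * (real n * r)"
        proof -
          have "\<gamma> * c \<le> \<gamma> * (c + \<rho>)" using \<gamma>(1) \<rho> by (intro mult_left_mono) auto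
          then have "\<gamma> * c \<le> \<rho> / 2" unfolding \<gamma>(2) .
          then have "real n * r * (\<gamma> * c) \<le> real n * r * (\<rho> / 2)" using nr by (intro mult_left_mono) auto
          then show ?thesis by (simp add: algebra_simps)
        qed
        moreover have "\<rho> / 4 * (real n * r) + \<rho> / 2 * (real n * r) \<le> \<rho> * (real n * r)"
          unfolding distrib_right[symmetric] using nr \<rho> by (intro mult_right_mono) auto
        ultimately have "real n * r * c - \<rho> * (real n * r) \<le> A n \<omega> r" by linarith
        moreover have "A n \<omega> r \<le> real n * r * c + \<rho> * (real n * r)" using up by (simp add: algebra_simps)
        ultimately show ?thesis by linarith
      qed
      show "\<exists>B\<in>events. prob B \<le> p \<and> (\<forall>\<omega>\<in>space M - B. \<forall>r. K / real n \<le> r \<longrightarrow> r \<le> s1 \<longrightarrow>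
       \<bar>(\<Sum>i<n. indicator (win d (\<sigma> * r)) (X i \<omega>) * w (Z i \<omega>)) - real n * r * (lam d * expectation (\<lambda>\<omega>. w (Z 0 \<omega>)))\<bar> \<le> \<rho> * (real n * r))"
      proof (intro bexI[of _ "\<Union>k. Bk k"] conjI ballI allI impI PB)
        fix \<omega> r assume "\<omega> \<in> space M - (\<Union>k. Bk k)" "K / real n \<le> r" "r \<le> s1"
        from good[OF this] show "\<bar>(\<Sum>i<n. indicator (win d (\<sigma> * r)) (X i \<omega>) * w (Z i \<omega>)) - real n * r * (lam d * expectation (\<lambda>\<omega>. w (Z 0 \<omega>)))\<bar> \<le> \<rho> * (real n * r)"
          by (simp only: A_def c_def Ew_def)
      qed (intro sets.countable_UN, use Bm in auto)
    qed (rule K)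
  qed
qed

text \<open>Increments of the smooth part are centred iid sums with second moment at most
  \<open>n\<close> times a multiple of \<open>|s - t| powr (2 * \<alpha>)\<close>, which is exactly
  the input of \<open>chaining\<close>.\<close>

lemma smooth_part_chaining:
  obtains K where "0 < K"
    "\<And>n \<sigma> T e. \<sigma> = 1 \<or> \<sigma> = -1 \<Longrightarrow> 0 < T \<Longrightarrow> 0 < e \<Longrightarrow>
       \<exists>A\<in>events. prob A \<le> K * real n * T powr (2 * \<alpha>) / e\<^sup>2 \<and> (\<forall>\<omega>\<in>space M - A. \<forall>r\<in>{0..T}. \<bar>smooth_part n \<omega> (\<sigma> * r)\<bar> \<le> e)"
proof -
  obtain K where K: "0 < K" and chain: "\<And>U T A e. (\<And>s. (\<lambda>\<omega>. U \<omega> s) \<in> borel_measurable M) \<Longrightarrow> (\<And>\<omega>. \<omega> \<in> space M \<Longrightarrow> U \<omega> 0 = 0) \<Longrightarrow>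
      (\<And>\<omega>. \<omega> \<in> space M \<Longrightarrow> continuous_on UNIV (U \<omega>)) \<Longrightarrow>
      (\<And>s t. integrable M (\<lambda>\<omega>. (U \<omega> s - U \<omega> t)\<^sup>2)) \<Longrightarrow>
      (\<And>s t. expectation (\<lambda>\<omega>. (U \<omega> s - U \<omega> t)\<^sup>2) \<le> A * \<bar>s - t\<bar> powr (2 * \<alpha>)) \<Longrightarrow>
      0 < T \<Longrightarrow> 0 < e \<Longrightarrow> 0 \<le> A \<Longrightarrow>
      \<exists>B\<in>events. prob B \<le> K * A * T powr (2 * \<alpha>) / e\<^sup>2 \<and> (\<forall>\<omega>\<in>space M - B. \<forall>s\<in>{0..T}. \<bar>U \<omega> s\<bar> \<le> e)"
    using chaining[OF alpha(1)] by blast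
  define E2 where "E2 = expectation (\<lambda>\<omega>. (L' (Z 0 \<omega>))\<^sup>2) * H\<^sup>2"
  have E2: "0 \<le> E2" unfolding E2_def by (auto intro!: Bochner_Integration.integral_nonneg)
  show thesis
  proof (rule that[of "K * (E2 + 1)"])
    show "0 < K * (E2 + 1)" using K E2 by simp
    fix n :: nat and \<sigma> T e :: real assume \<sigma>: "\<sigma> = 1 \<or> \<sigma> = -1" and T: "0 < T" and e: "0 < e"
    have "\<exists>B\<in>events. prob B \<le> K * (real n * E2) * T powr (2 * \<alpha>) / e\<^sup>2 \<and>
        (\<forall>\<omega>\<in>space M - B. \<forall>s\<in>{0..T}. \<bar>(\<lambda>\<omega> r. smooth_part n \<omega> (\<sigma> * r)) \<omega> s\<bar> \<le> e)"
    proof (rule chain[OF _ _ _ _ _ T e])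
      show "(\<lambda>\<omega>. smooth_part n \<omega> (\<sigma> * s)) \<in> borel_measurable M" for s unfolding smooth_part_def by measurable
      show "smooth_part n \<omega> (\<sigma> * 0) = 0" for \<omega> by (simp add: smooth_part_def)
      have "continuous_on UNIV (\<lambda>r. G (x - \<sigma> * r))" for x
      proof (rule continuous_on_compose2[of UNIV G])
        show "continuous_on UNIV G" using G_cont by (simp add: continuous_at_imp_continuous_on)
        show "continuous_on UNIV (\<lambda>r. x - \<sigma> * r)" by (intro continuous_intros)
      qed simp
      then show "continuous_on UNIV (\<lambda>r. smooth_part n \<omega> (\<sigma> * r))" for \<omega>
        unfolding smooth_part_def by (intro continuous_intros)
      fix s t :: real
      let ?h = "\<lambda>i \<omega>. L' (Z i \<omega>) * (G (X i \<omega> - \<sigma> * t) - G (X i \<omega> - \<sigma> * s))"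
      have eq: "smooth_part n \<omega> (\<sigma> * s) - smooth_part n \<omega> (\<sigma> * t) = (\<Sum>i<n. ?h i \<omega>)" for \<omega>
        unfolding smooth_part_def sum_subtractf[symmetric] by (intro sum.cong) (auto simp: algebra_simps)
      have Gb: "\<bar>G (x - \<sigma> * t) - G (x - \<sigma> * s)\<bar> \<le> H * \<bar>s - t\<bar> powr \<alpha>" for x
        using G_Holder[of "x - \<sigma> * t" "x - \<sigma> * s"] \<sigma> by (auto simp: abs_minus_commute)
      have Gb2: "(G (x - \<sigma> * t) - G (x - \<sigma> * s))\<^sup>2 \<le> H\<^sup>2 * \<bar>s - t\<bar> powr (2 * \<alpha>)" for x
      proof -
        have "\<bar>G (x - \<sigma> * t) - G (x - \<sigma> * s)\<bar>\<^sup>2 \<le> (H * \<bar>s - t\<bar> powr \<alpha>)\<^sup>2" by (rule power_mono[OF Gb]) simp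
        also have "\<dots> = H\<^sup>2 * \<bar>s - t\<bar> powr (2 * \<alpha>)"
          by (cases "s = t") (simp_all add: power_mult_distrib powr_power mult.commute)
        finally show ?thesis by simp
      qed
      have ind: "indep_vars (\<lambda>_. borel) ?h UNIV" by (rule XZ_functions_indep) measurable
      have h2: "(?h i \<omega>)\<^sup>2 \<le> (L' (Z i \<omega>))\<^sup>2 * (H\<^sup>2 * \<bar>s - t\<bar> powr (2 * \<alpha>))" for i \<omega>
        unfolding power_mult_distrib by (rule mult_left_mono[OF Gb2]) simp
      have int: "integrable M (\<lambda>\<omega>. (?h i \<omega>)\<^sup>2)" for i
      proof (rule Bochner_Integration.integrable_bound)
        show "integrable M (\<lambda>\<omega>. (L' (Z i \<omega>))\<^sup>2 * (H\<^sup>2 * \<bar>s - t\<bar> powr (2 * \<alpha>)))" using L'_square_integrable by simp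
        show "AE \<omega> in M. norm ((?h i \<omega>)\<^sup>2) \<le> norm ((L' (Z i \<omega>))\<^sup>2 * (H\<^sup>2 * \<bar>s - t\<bar> powr (2 * \<alpha>)))"
          using h2 by (intro AE_I2) (smt (verit) real_norm_def zero_le_power2)
      qed measurable
      have mean: "expectation (?h i) = 0" for i
      proof -
        have iv: "indep_var borel (\<lambda>\<omega>. G (X i \<omega> - \<sigma> * t) - G (X i \<omega> - \<sigma> * s)) borel (\<lambda>\<omega>. L' (Z i \<omega>))"
          using indep_var_compose[OF XZ_pair[of i], of "\<lambda>x. G (x - \<sigma> * t) - G (x - \<sigma> * s)" borel L' borel] by (simp add: comp_def)
        have "integrable M (\<lambda>\<omega>. G (X i \<omega> - \<sigma> * t) - G (X i \<omega> - \<sigma> * s))"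
          by (rule integrable_const_bound[where B="H * \<bar>s - t\<bar> powr \<alpha>"]) (use Gb in auto)
        from indep_var_lebesgue_integral[OF iv this L'_integrable]
        show ?thesis by (simp add: L'_mean mult.commute)
      qed
      have sq: "expectation (\<lambda>\<omega>. (?h i \<omega>)\<^sup>2) \<le> E2 * \<bar>s - t\<bar> powr (2 * \<alpha>)" for i
      proof -
        have "expectation (\<lambda>\<omega>. (?h i \<omega>)\<^sup>2) \<le> expectation (\<lambda>\<omega>. (L' (Z i \<omega>))\<^sup>2 * (H\<^sup>2 * \<bar>s - t\<bar> powr (2 * \<alpha>)))"
          using int L'_square_integrable h2 by (intro integral_mono) auto
        also have "\<dots> = E2 * \<bar>s - t\<bar> powr (2 * \<alpha>)"
          using Z_expectation[of "\<lambda>z. (L' z)\<^sup>2" i] by (simp add: E2_def)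
        finally show ?thesis .
      qed
      show "integrable M (\<lambda>\<omega>. (smooth_part n \<omega> (\<sigma> * s) - smooth_part n \<omega> (\<sigma> * t))\<^sup>2)"
        unfolding eq by (rule second_moment_iid_sum(1)[OF ind int mean sq])
      show "expectation (\<lambda>\<omega>. (smooth_part n \<omega> (\<sigma> * s) - smooth_part n \<omega> (\<sigma> * t))\<^sup>2) \<le> real n * E2 * \<bar>s - t\<bar> powr (2 * \<alpha>)"
        unfolding eq using second_moment_iid_sum(2)[OF ind int mean sq, of n] by simp
    qed (use E2 in simp)
    then obtain B where B: "B \<in> events" "prob B \<le> K * (real n * E2) * T powr (2 * \<alpha>) / e\<^sup>2"
      "\<forall>\<omega>\<in>space M - B. \<forall>s\<in>{0..T}. \<bar>smooth_part n \<omega> (\<sigma> * s)\<bar> \<le> e" by auto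
    have "K * (real n * E2) * T powr (2 * \<alpha>) / e\<^sup>2 \<le> K * (E2 + 1) * real n * T powr (2 * \<alpha>) / e\<^sup>2"
      using K by (intro divide_right_mono mult_right_mono) (auto simp: algebra_simps)
    then show "\<exists>A\<in>events. prob A \<le> K * (E2 + 1) * real n * T powr (2 * \<alpha>) / e\<^sup>2 \<and> (\<forall>\<omega>\<in>space M - A. \<forall>r\<in>{0..T}. \<bar>smooth_part n \<omega> (\<sigma> * r)\<bar> \<le> e)"
      using B by (intro bexI[of _ B]) auto
  qed
qed

end

lemma small_powr:
  fixes a e K :: real
  assumes "0 < a" "0 < e" "0 \<le> K"
  obtains s where "0 < s" "\<And>r. 0 < r \<Longrightarrow> r \<le> s \<Longrightarrow> K * r powr a \<le> e"
proof (rule that[of "(e / (K + 1)) powr (1 / a)"])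
  show "0 < (e / (K + 1)) powr (1 / a)" using assms by simp
  fix r :: real assume r: "0 < r" "r \<le> (e / (K + 1)) powr (1 / a)"
  then have "r powr a \<le> ((e / (K + 1)) powr (1 / a)) powr a" using assms by (intro powr_mono2) auto
  also have "\<dots> = e / (K + 1)" using assms by (simp add: powr_powr)
  finally have "K * r powr a \<le> K * (e / (K + 1))" using assms by (intro mult_left_mono) auto
  also have "\<dots> \<le> e" using assms by (simp add: field_simps)
  finally show "K * r powr a \<le> e" .
qed

lemma tendsto_scaled_powr:
  fixes a K :: real
  assumes "0 < a" "0 < K"
  shows "(\<lambda>n. (K / real n) powr a) \<longlonglongrightarrow> 0"
proof -
  have "(\<lambda>n. K / real n) \<longlonglongrightarrow> 0" by (rule lim_const_over_n)
  then show ?thesis using assms by (intro tendsto_zero_powrI[where b=a] tendsto_const) auto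
qed

context template_sample begin

text \<open>The upper end \<open>s\<close> is chosen before the error \<open>p\<close>, while only
  \<open>K\<close> may depend on \<open>p\<close>. This order of quantifiers yields a fixed
  neighbourhood of the true shift, which consistency then has to reach, and it allows finite
  conjunctions.\<close>

definition holds_beyond :: "(nat \<Rightarrow> 'a \<Rightarrow> real \<Rightarrow> bool) \<Rightarrow> bool" where
  "holds_beyond \<Phi> \<longleftrightarrow> (\<exists>s>0. \<forall>p>0. \<exists>K>0. \<forall>n>0. \<exists>A\<in>events. prob A \<le> p \<and>
     (\<forall>\<omega>\<in>space M - A. \<forall>r. K / real n \<le> r \<longrightarrow> r \<le> s \<longrightarrow> \<Phi> n \<omega> r))"

lemma holds_beyond_conj:
  assumes "holds_beyond \<Phi>" "holds_beyond \<Psi>" shows "holds_beyond (\<lambda>n \<omega> r. \<Phi> n \<omega> r \<and> \<Psi> n \<omega> r)"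
proof -
  obtain s where s: "0 < s" "\<And>p. 0 < p \<Longrightarrow> \<exists>K>0. \<forall>n>0. \<exists>A\<in>events. prob A \<le> p \<and>
     (\<forall>\<omega>\<in>space M - A. \<forall>r. K / real n \<le> r \<longrightarrow> r \<le> s \<longrightarrow> \<Phi> n \<omega> r)"
    using assms(1) unfolding holds_beyond_def by blast
  obtain t where t: "0 < t" "\<And>p. 0 < p \<Longrightarrow> \<exists>K>0. \<forall>n>0. \<exists>A\<in>events. prob A \<le> p \<and>
     (\<forall>\<omega>\<in>space M - A. \<forall>r. K / real n \<le> r \<longrightarrow> r \<le> t \<longrightarrow> \<Psi> n \<omega> r)"
    using assms(2) unfolding holds_beyond_def by blast
  show ?thesis unfolding holds_beyond_def
  proof (rule exI[of _ "min s t"], intro conjI allI impI)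
    fix p :: real assume p: "0 < p"
    obtain K1 where K1: "0 < K1" "\<And>n. 0 < n \<Longrightarrow> \<exists>A\<in>events. prob A \<le> p / 2 \<and>
       (\<forall>\<omega>\<in>space M - A. \<forall>r. K1 / real n \<le> r \<longrightarrow> r \<le> s \<longrightarrow> \<Phi> n \<omega> r)" using s(2)[of "p / 2"] p by auto
    obtain K2 where K2: "0 < K2" "\<And>n. 0 < n \<Longrightarrow> \<exists>A\<in>events. prob A \<le> p / 2 \<and>
       (\<forall>\<omega>\<in>space M - A. \<forall>r. K2 / real n \<le> r \<longrightarrow> r \<le> t \<longrightarrow> \<Psi> n \<omega> r)" using t(2)[of "p / 2"] p by auto
    show "\<exists>K>0. \<forall>n>0. \<exists>A\<in>events. prob A \<le> p \<and>
     (\<forall>\<omega>\<in>space M - A. \<forall>r. K / real n \<le> r \<longrightarrow> r \<le> min s t \<longrightarrow> \<Phi> n \<omega> r \<and> \<Psi> n \<omega> r)"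
    proof (rule exI[of _ "max K1 K2"], intro conjI allI impI)
      fix n :: nat assume n: "0 < n"
      obtain A1 where A1: "A1 \<in> events" "prob A1 \<le> p / 2" "\<And>\<omega> r. \<omega> \<in> space M - A1 \<Longrightarrow> K1 / real n \<le> r \<Longrightarrow> r \<le> s \<Longrightarrow> \<Phi> n \<omega> r"
        using K1(2)[OF n] by blast
      obtain A2 where A2: "A2 \<in> events" "prob A2 \<le> p / 2" "\<And>\<omega> r. \<omega> \<in> space M - A2 \<Longrightarrow> K2 / real n \<le> r \<Longrightarrow> r \<le> t \<Longrightarrow> \<Psi> n \<omega> r"
        using K2(2)[OF n] by blast
      have m: "K1 / real n \<le> max K1 K2 / real n" "K2 / real n \<le> max K1 K2 / real n" using n by (auto intro!: divide_right_mono)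
      show "\<exists>A\<in>events. prob A \<le> p \<and>
        (\<forall>\<omega>\<in>space M - A. \<forall>r. max K1 K2 / real n \<le> r \<longrightarrow> r \<le> min s t \<longrightarrow> \<Phi> n \<omega> r \<and> \<Psi> n \<omega> r)"
      proof (intro bexI[of _ "A1 \<union> A2"] conjI ballI allI impI)
        show "prob (A1 \<union> A2) \<le> p" using measure_Un_le[OF A1(1) A2(1)] A1(2) A2(2) by linarith
      qed (use A1 A2 m in \<open>auto intro: order_trans\<close>)
    qed (use K1 K2 in auto)
  qed (use s t in auto)
qed

lemma holds_beyond_ball:
  assumes "finite I" "\<And>i. i \<in> I \<Longrightarrow> holds_beyond (\<Phi> i)"
  shows "holds_beyond (\<lambda>n \<omega> r. \<forall>i\<in>I. \<Phi> i n \<omega> r)"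
  using assms
proof (induction I rule: finite_induct)
  case empty
  show ?case unfolding holds_beyond_def by (auto intro!: exI[of _ 1] bexI[of _ "{}"])
next
  case (insert i I)
  then have "holds_beyond (\<lambda>n \<omega> r. \<Phi> i n \<omega> r \<and> (\<forall>i\<in>I. \<Phi> i n \<omega> r))" by (intro holds_beyond_conj) auto
  then show ?case by simp
qed

lemma holds_beyond_mono:
  assumes "holds_beyond \<Phi>" "0 < t" and imp: "\<And>n \<omega> r. 0 < n \<Longrightarrow> 0 < r \<Longrightarrow> r \<le> t \<Longrightarrow> \<Phi> n \<omega> r \<Longrightarrow> \<Psi> n \<omega> r"
  shows "holds_beyond \<Psi>"
proof -
  obtain s where s: "0 < s" "\<And>p. 0 < p \<Longrightarrow> \<exists>K>0. \<forall>n>0. \<exists>A\<in>events. prob A \<le> p \<and>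
     (\<forall>\<omega>\<in>space M - A. \<forall>r. K / real n \<le> r \<longrightarrow> r \<le> s \<longrightarrow> \<Phi> n \<omega> r)"
    using assms(1) unfolding holds_beyond_def by blast
  show ?thesis unfolding holds_beyond_def
  proof (rule exI[of _ "min s t"], intro conjI allI impI)
    fix p :: real assume p: "0 < p"
    obtain K where K: "0 < K" "\<And>n. 0 < n \<Longrightarrow> \<exists>A\<in>events. prob A \<le> p \<and>
       (\<forall>\<omega>\<in>space M - A. \<forall>r. K / real n \<le> r \<longrightarrow> r \<le> s \<longrightarrow> \<Phi> n \<omega> r)" using s(2)[OF p] by auto
    show "\<exists>K>0. \<forall>n>0. \<exists>A\<in>events. prob A \<le> p \<and>
       (\<forall>\<omega>\<in>space M - A. \<forall>r. K / real n \<le> r \<longrightarrow> r \<le> min s t \<longrightarrow> \<Psi> n \<omega> r)"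
    proof (rule exI[of _ K], intro conjI allI impI)
      fix n :: nat assume n: "0 < n"
      obtain A where A: "A \<in> events" "prob A \<le> p" "\<And>\<omega> r. \<omega> \<in> space M - A \<Longrightarrow> K / real n \<le> r \<Longrightarrow> r \<le> s \<Longrightarrow> \<Phi> n \<omega> r"
        using K(2)[OF n] by blast
      have Kn: "0 < K / real n" using K n by simp
      show "\<exists>A\<in>events. prob A \<le> p \<and> (\<forall>\<omega>\<in>space M - A. \<forall>r. K / real n \<le> r \<longrightarrow> r \<le> min s t \<longrightarrow> \<Psi> n \<omega> r)"
      proof (intro bexI[OF _ A(1)] conjI ballI allI impI A(2))
        fix \<omega> r assume "\<omega> \<in> space M - A" "K / real n \<le> r" "r \<le> min s t"
        then show "\<Psi> n \<omega> r" using A(3)[of \<omega> r] Kn by (intro imp[OF n]) auto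
      qed
    qed (rule K)
  qed (use s assms in auto)
qed

text \<open>Peeling over dyadic ranges of \<open>r\<close>. On the range ending at \<open>T\<close>,
  chaining bounds the failure by a multiple of
  \<open>T powr (2 * \<alpha>) / (n * T\<^sup>2)\<close>, hence of \<open>1 / (n * T)\<close> since
  \<open>T \<le> 1\<close> and \<open>2 * \<alpha> > 1\<close>; these bounds sum
  geometrically.\<close>

lemma smooth_part_rate:
  assumes \<sigma>: "\<sigma> = 1 \<or> \<sigma> = -1" and \<rho>: "0 < \<rho>"
  shows "holds_beyond (\<lambda>n \<omega> r. \<bar>smooth_part n \<omega> (\<sigma> * r)\<bar> \<le> \<rho> * (real n * r))"
proof -
  obtain Kc where Kc: "0 < Kc" and chain: "\<And>n T e. 0 < T \<Longrightarrow> 0 < e \<Longrightarrow>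
       \<exists>A\<in>events. prob A \<le> Kc * real n * T powr (2 * \<alpha>) / e\<^sup>2 \<and> (\<forall>\<omega>\<in>space M - A. \<forall>r\<in>{0..T}. \<bar>smooth_part n \<omega> (\<sigma> * r)\<bar> \<le> e)"
    using smooth_part_chaining \<sigma> by metis
  show ?thesis unfolding holds_beyond_def
  \<comment> \<open>The restriction \<open>r \<le> 1/2\<close> keeps the enclosing dyadic range, at
    most twice as long, below \<open>1\<close>.\<close>
  proof (rule exI[of _ "1/2"], intro conjI allI impI)
    fix p :: real assume p: "0 < p"
    define Q where "Q = 4 * Kc / \<rho>\<^sup>2"
    have Q: "0 < Q" using Kc \<rho> by (simp add: Q_def)
    \<comment> \<open>The geometric series sums to \<open>2 * Q / K\<close>, which becomes
      \<open>p\<close>.\<close>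
    define K where "K = 2 * Q / p"
    have K: "0 < K" using Q p by (simp add: K_def)
    show "\<exists>K>0. \<forall>n>0. \<exists>A\<in>events. prob A \<le> p \<and>
       (\<forall>\<omega>\<in>space M - A. \<forall>r. K / real n \<le> r \<longrightarrow> r \<le> 1/2 \<longrightarrow> \<bar>smooth_part n \<omega> (\<sigma> * r)\<bar> \<le> \<rho> * (real n * r))"
    proof (rule exI[of _ K], intro conjI allI impI)
      fix n :: nat assume n: "0 < n"
      define T where "T k = K / real n * 2 ^ k" for k :: nat
      have T: "0 < T k" for k using K n by (simp add: T_def)
      have "\<exists>A\<in>events. prob A \<le> Q / K * (1/2) ^ k \<and> (T k \<le> 1 \<longrightarrow> (\<forall>\<omega>\<in>space M - A. \<forall>r\<in>{0..T k}. \<bar>smooth_part n \<omega> (\<sigma> * r)\<bar> \<le> \<rho> / 2 * (real n * T k)))" for k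
      proof (cases "T k \<le> 1")
        case True
        have e: "0 < \<rho> / 2 * (real n * T k)" using \<rho> n T[of k] by simp
        obtain A where A: "A \<in> events" "prob A \<le> Kc * real n * T k powr (2 * \<alpha>) / (\<rho> / 2 * (real n * T k))\<^sup>2"
          "\<forall>\<omega>\<in>space M - A. \<forall>r\<in>{0..T k}. \<bar>smooth_part n \<omega> (\<sigma> * r)\<bar> \<le> \<rho> / 2 * (real n * T k)"
          using chain[OF T e] by blast
        have "T k powr (2 * \<alpha>) = T k * T k powr (2 * \<alpha> - 1)" using T[of k] by (simp add: powr_diff)
        also have "\<dots> \<le> T k * 1" using T[of k] True alpha by (intro mult_left_mono powr_le1) auto
        finally have "T k powr (2 * \<alpha>) \<le> T k" by simp
        then have "Kc * real n * T k powr (2 * \<alpha>) / (\<rho> / 2 * (real n * T k))\<^sup>2 \<le> Kc * real n * T k / (\<rho> / 2 * (real n * T k))\<^sup>2"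
          using Kc by (intro divide_right_mono mult_left_mono) auto
        also have "\<dots> = Q / (real n * T k)" using n T[of k] \<rho> by (simp add: Q_def field_simps power2_eq_square)
        finally have "prob A \<le> Q / (real n * T k)" using A(2) by linarith
        also have "real n * T k = K * 2 ^ k" using n by (simp add: T_def)
        finally have "prob A \<le> Q / K * (1/2) ^ k" by (simp add: power_divide)
        then show ?thesis using A by blast
      next
        case False
        then show ?thesis using Q K by (intro bexI[of _ "{}"]) auto
      qed
      then obtain A where A: "\<And>k. A k \<in> events" "\<And>k. prob (A k) \<le> Q / K * (1/2) ^ k"
        "\<And>k \<omega> r. T k \<le> 1 \<Longrightarrow> \<omega> \<in> space M - A k \<Longrightarrow> r \<in> {0..T k} \<Longrightarrow> \<bar>smooth_part n \<omega> (\<sigma> * r)\<bar> \<le> \<rho> / 2 * (real n * T k)"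
        by metis
      have "(\<lambda>k. Q / K * (1/2) ^ k) sums (Q / K * (1 / (1 - 1/2)))" by (intro sums_mult geometric_sums) auto
      from prob_countable_union_le[OF A(1,2) this] have "prob (\<Union>k. A k) \<le> Q / K * 2" by simp
      also have "Q / K * 2 = p" using Q p by (simp add: K_def)
      finally have PA: "prob (\<Union>k. A k) \<le> p" .
      show "\<exists>A\<in>events. prob A \<le> p \<and>
       (\<forall>\<omega>\<in>space M - A. \<forall>r. K / real n \<le> r \<longrightarrow> r \<le> 1/2 \<longrightarrow> \<bar>smooth_part n \<omega> (\<sigma> * r)\<bar> \<le> \<rho> * (real n * r))"
      proof (intro bexI[of _ "\<Union>k. A k"] conjI ballI allI impI PA)
        fix \<omega> r assume \<omega>: "\<omega> \<in> space M - (\<Union>k. A k)" and r: "K / real n \<le> r" "r \<le> 1/2"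
        have r0: "0 < r" using r K n by (smt (verit) divide_pos_pos of_nat_0_less_iff)
        have "1 \<le> r * real n / K" using r K n by (simp add: field_simps)
        from ex_power_between[OF _ this, of 2] obtain k where k: "2 ^ k \<le> r * real n / K" "r * real n / K < 2 ^ Suc k" by auto
        have TS: "T (Suc k) = 2 * T k" by (simp add: T_def)
        have Tk: "T k \<le> r" "r < T (Suc k)" using k K n by (simp_all add: T_def field_simps)
        have "\<bar>smooth_part n \<omega> (\<sigma> * r)\<bar> \<le> \<rho> / 2 * (real n * T (Suc k))"
          using \<omega> Tk r r0 by (intro A(3)) (auto simp: TS)
        also have "\<dots> = \<rho> * (real n * T k)" by (simp add: TS)
        also have "\<dots> \<le> \<rho> * (real n * r)" using Tk \<rho> by (intro mult_left_mono) auto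
        finally show "\<bar>smooth_part n \<omega> (\<sigma> * r)\<bar> \<le> \<rho> * (real n * r)" .
      qed (intro sets.countable_UN, use A in auto)
    qed (rule K)
  qed simp
qed

lemma hits_eq: "hits n \<omega> s = (\<Sum>d\<in>D. \<Sum>i<n. indicator (win d s) (X i \<omega>) * 1)"
  unfolding hits_def by (subst sum.swap) simp

text \<open>Positive and negative parts of the marks are separated because the uniform law of large
  numbers relies on nonnegative weights.\<close>

lemma jump_part_eq: "jump_part n \<omega> s = (\<Sum>d\<in>D.
    (\<Sum>i<n. indicator (win d s) (X i \<omega>) * max 0 (mark d (sgn s) (Z i \<omega>))) -
    (\<Sum>i<n. indicator (win d s) (X i \<omega>) * max 0 (- mark d (sgn s) (Z i \<omega>))))"
  unfolding jump_part_def sum_subtractf[symmetric] right_diff_distrib[symmetric]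
  by (subst sum.swap) (intro sum.cong refl arg_cong2[where f="(*)"], simp add: max_def)

end

section \<open>Linear growth of the risk near the true shift\<close>

locale drifting_template_sample = template_sample +
  assumes drift: "0 < (\<Sum>d\<in>D. lam d * expectation (\<lambda>\<omega>. L (Z 0 \<omega> + \<delta> d) - L (Z 0 \<omega>)))"
begin

text \<open>The jump part grows like \<open>c * n * r\<close> with the positive drift
  \<open>c\<close>. Of this slope a quarter is spent on the fluctuations together with the smooth
  part, two quarters on the two remainder terms, and a quarter survives.\<close>

lemma risk_positive_side:
  assumes \<sigma>: "\<sigma> = 1 \<or> \<sigma> = -1"
  shows "holds_beyond (\<lambda>n \<omega> r. 0 < risk n \<omega> (\<sigma> * r))"
proof -
  define c where "c = (\<Sum>d\<in>D. lam d * expectation (\<lambda>\<omega>. mark d \<sigma> (Z 0 \<omega>)))"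
  have mean: "expectation (\<lambda>\<omega>. mark d \<sigma> (Z 0 \<omega>)) = expectation (\<lambda>\<omega>. L (Z 0 \<omega> + \<delta> d) - L (Z 0 \<omega>))" for d
  proof -
    have "expectation (\<lambda>\<omega>. mark d \<sigma> (Z 0 \<omega>)) = (\<integral>x. x \<partial>distr M borel (\<lambda>\<omega>. mark d \<sigma> (Z 0 \<omega>)))"
      by (subst integral_distr) auto
    also have "\<dots> = (\<integral>x. x \<partial>distr M borel (\<lambda>\<omega>. L (Z 0 \<omega> + \<delta> d) - L (Z 0 \<omega>)))" by (simp only: mark_sym_distr[OF \<sigma>])
    also have "\<dots> = expectation (\<lambda>\<omega>. L (Z 0 \<omega> + \<delta> d) - L (Z 0 \<omega>))" by (subst integral_distr) auto
    finally show ?thesis .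
  qed
  have c: "0 < c" using drift by (simp add: c_def mean)
  define N where "N = real (card D)"
  \<comment> \<open>Two window sums per jump and the smooth part err by \<open>\<rho>\<close> each,
    in total \<open>c / 4\<close>.\<close>
  define \<rho> where "\<rho> = c / (4 * (2 * N + 1))"
  have N: "0 \<le> N" by (simp add: N_def)
  have \<rho>: "0 < \<rho>" "(2 * N + 1) * \<rho> = c / 4" using c N by (auto simp: \<rho>_def field_simps add_pos_nonneg)
  let ?A = "\<lambda>d w n \<omega> r. \<Sum>i<n. indicator (win d (\<sigma> * r)) (X i \<omega>) * w (Z i \<omega>)"
  have ctl: "holds_beyond (\<lambda>n \<omega> r. \<bar>?A d w n \<omega> r - real n * r * (lam d * expectation (\<lambda>\<omega>. w (Z 0 \<omega>)))\<bar> \<le> \<rho> * (real n * r))"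
    if dw: "d \<in> D" "w \<in> borel_measurable borel" "\<And>z. 0 \<le> w z" "integrable M (\<lambda>\<omega>. (w (Z 0 \<omega>))\<^sup>2)" for d w
  proof -
    obtain s1 where "0 < s1" "\<And>p. 0 < p \<Longrightarrow> \<exists>K>0. \<forall>n>0. \<exists>A\<in>events. prob A \<le> p \<and> (\<forall>\<omega>\<in>space M - A. \<forall>r. K / real n \<le> r \<longrightarrow> r \<le> s1 \<longrightarrow>
       \<bar>?A d w n \<omega> r - real n * r * (lam d * expectation (\<lambda>\<omega>. w (Z 0 \<omega>)))\<bar> \<le> \<rho> * (real n * r))"
      using window_sum_uniform_LLN[OF dw(1) \<sigma> dw(2,3,4) \<rho>(1)] by blast
    then show ?thesis unfolding holds_beyond_def by blast
  qed
  let ?p = "\<lambda>d z. max 0 (mark d \<sigma> z)" and ?m = "\<lambda>d z. max 0 (- mark d \<sigma> z)"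
  have mark_sq: "integrable M (\<lambda>\<omega>. (mark d \<sigma> (Z 0 \<omega>))\<^sup>2)" for d
    unfolding mark_def by (rule increment_square_integrable)
  have mark_int: "integrable M (\<lambda>\<omega>. mark d \<sigma> (Z 0 \<omega>))" for d
    by (rule square_integrable_imp_integrable[OF _ mark_sq]) measurable
  have sqp: "integrable M (\<lambda>\<omega>. (?p d (Z 0 \<omega>))\<^sup>2)" "integrable M (\<lambda>\<omega>. (?m d (Z 0 \<omega>))\<^sup>2)" for d
    by (rule Bochner_Integration.integrable_bound[OF mark_sq[of d]]; auto simp: max_def intro!: AE_I2)+
  have Epm: "expectation (\<lambda>\<omega>. ?p d (Z 0 \<omega>)) - expectation (\<lambda>\<omega>. ?m d (Z 0 \<omega>)) = expectation (\<lambda>\<omega>. mark d \<sigma> (Z 0 \<omega>))" for d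
  proof -
    have "expectation (\<lambda>\<omega>. ?p d (Z 0 \<omega>)) - expectation (\<lambda>\<omega>. ?m d (Z 0 \<omega>)) = expectation (\<lambda>\<omega>. ?p d (Z 0 \<omega>) - ?m d (Z 0 \<omega>))"
      using mark_int[of d] by (intro Bochner_Integration.integral_diff[symmetric]) auto
    also have "\<dots> = expectation (\<lambda>\<omega>. mark d \<sigma> (Z 0 \<omega>))" by (intro Bochner_Integration.integral_cong) (auto simp: max_def)
    finally show ?thesis .
  qed
  have all: "holds_beyond (\<lambda>n \<omega> r. (\<forall>d\<in>D.
      \<bar>?A d (?p d) n \<omega> r - real n * r * (lam d * expectation (\<lambda>\<omega>. ?p d (Z 0 \<omega>)))\<bar> \<le> \<rho> * (real n * r) \<and>
      \<bar>?A d (?m d) n \<omega> r - real n * r * (lam d * expectation (\<lambda>\<omega>. ?m d (Z 0 \<omega>)))\<bar> \<le> \<rho> * (real n * r) \<and>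
      \<bar>?A d (\<lambda>_. 1) n \<omega> r - real n * r * (lam d * expectation (\<lambda>\<omega>. 1))\<bar> \<le> \<rho> * (real n * r)) \<and>
      \<bar>smooth_part n \<omega> (\<sigma> * r)\<bar> \<le> \<rho> * (real n * r))"
    by (intro holds_beyond_conj holds_beyond_ball D_fin smooth_part_rate[OF \<sigma> \<rho>(1)] ctl) (use sqp in auto)
  obtain s0 K1 K2 where s0: "0 < s0" "0 \<le> K1" "0 \<le> K2"
    and approx: "\<And>n \<omega> s. \<bar>s\<bar> < s0 \<Longrightarrow> \<bar>risk n \<omega> s - jump_part n \<omega> s - smooth_part n \<omega> s\<bar> \<le>
       K1 * \<bar>s\<bar> powr \<alpha> * hits n \<omega> s + K2 * real n * \<bar>s\<bar> powr (2 * \<alpha>)"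
    using sample_approximation by blast
  define \<Lambda> where "\<Lambda> = (\<Sum>d\<in>D. lam d) + N * \<rho>"
  have \<Lambda>: "0 \<le> \<Lambda>" using N \<rho> lam_nonneg by (auto simp: \<Lambda>_def intro!: add_nonneg_nonneg sum_nonneg)
  obtain t1 where t1: "0 < t1" "\<And>r. 0 < r \<Longrightarrow> r \<le> t1 \<Longrightarrow> (K1 * \<Lambda>) * r powr \<alpha> \<le> c / 4"
    using small_powr[of \<alpha> "c / 4" "K1 * \<Lambda>"] alpha_pos c s0 \<Lambda> by auto
  \<comment> \<open>Here \<open>2 * \<alpha> - 1 > 0\<close> makes the quadratic remainder
    \<open>n * r powr (2 * \<alpha>)\<close> small compared with \<open>n * r\<close>.\<close>
  obtain t2 where t2: "0 < t2" "\<And>r. 0 < r \<Longrightarrow> r \<le> t2 \<Longrightarrow> K2 * r powr (2 * \<alpha> - 1) \<le> c / 4"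
    using small_powr[of "2 * \<alpha> - 1" "c / 4" K2] alpha c s0 by auto
  define t where "t = min (s0 / 2) (min t1 t2)"
  have t: "0 < t" using s0 t1 t2 by (simp add: t_def)
  show ?thesis
  proof (rule holds_beyond_mono[OF all t])
    fix n :: nat and \<omega> and r :: real
    assume n: "0 < n" and r: "0 < r" "r \<le> t"
      and ctl: "(\<forall>d\<in>D. \<bar>?A d (?p d) n \<omega> r - real n * r * (lam d * expectation (\<lambda>\<omega>. ?p d (Z 0 \<omega>)))\<bar> \<le> \<rho> * (real n * r) \<and>
      \<bar>?A d (?m d) n \<omega> r - real n * r * (lam d * expectation (\<lambda>\<omega>. ?m d (Z 0 \<omega>)))\<bar> \<le> \<rho> * (real n * r) \<and>
      \<bar>?A d (\<lambda>_. 1) n \<omega> r - real n * r * (lam d * expectation (\<lambda>\<omega>. 1))\<bar> \<le> \<rho> * (real n * r)) \<and>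
      \<bar>smooth_part n \<omega> (\<sigma> * r)\<bar> \<le> \<rho> * (real n * r)"
    define y where "y = real n * r"
    have y: "0 < y" using n r by (simp add: y_def)
    have sg: "sgn (\<sigma> * r) = \<sigma>" "\<bar>\<sigma> * r\<bar> = r" using \<sigma> r by (auto simp: sgn_mult)
    have "(\<Sum>d\<in>D. y * (lam d * expectation (\<lambda>\<omega>. mark d \<sigma> (Z 0 \<omega>))) - 2 * \<rho> * y) \<le> jump_part n \<omega> (\<sigma> * r)"
      unfolding jump_part_eq sg
    proof (rule sum_mono)
      fix d assume "d \<in> D"
      then have "y * (lam d * expectation (\<lambda>\<omega>. ?p d (Z 0 \<omega>))) - \<rho> * y \<le> ?A d (?p d) n \<omega> r"
        "?A d (?m d) n \<omega> r \<le> y * (lam d * expectation (\<lambda>\<omega>. ?m d (Z 0 \<omega>))) + \<rho> * y"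
        using ctl unfolding y_def[symmetric] by (auto simp: abs_le_iff)
      moreover have "y * (lam d * expectation (\<lambda>\<omega>. mark d \<sigma> (Z 0 \<omega>))) =
          y * (lam d * expectation (\<lambda>\<omega>. ?p d (Z 0 \<omega>))) - y * (lam d * expectation (\<lambda>\<omega>. ?m d (Z 0 \<omega>)))"
        unfolding Epm[symmetric] by (simp add: algebra_simps)
      ultimately show "y * (lam d * expectation (\<lambda>\<omega>. mark d \<sigma> (Z 0 \<omega>))) - 2 * \<rho> * y \<le> ?A d (?p d) n \<omega> r - ?A d (?m d) n \<omega> r" by linarith
    qed
    moreover have "(\<Sum>d\<in>D. y * (lam d * expectation (\<lambda>\<omega>. mark d \<sigma> (Z 0 \<omega>))) - 2 * \<rho> * y) = y * c - 2 * N * \<rho> * y"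
      by (simp add: sum_subtractf sum_distrib_left[symmetric] c_def N_def)
    ultimately have jp: "y * c - 2 * N * \<rho> * y \<le> jump_part n \<omega> (\<sigma> * r)" by simp
    have "hits n \<omega> (\<sigma> * r) \<le> (\<Sum>d\<in>D. y * lam d + \<rho> * y)"
      unfolding hits_eq
    proof (rule sum_mono)
      fix d assume "d \<in> D"
      then have "\<bar>?A d (\<lambda>_. 1) n \<omega> r - y * (lam d * 1)\<bar> \<le> \<rho> * y" using ctl unfolding y_def[symmetric] by (simp add: prob_space)
      then show "?A d (\<lambda>_. 1) n \<omega> r \<le> y * lam d + \<rho> * y" by linarith
    qed
    also have "\<dots> = y * \<Lambda>" by (simp add: sum.distrib sum_distrib_left[symmetric] \<Lambda>_def N_def algebra_simps)
    finally have hits: "hits n \<omega> (\<sigma> * r) \<le> y * \<Lambda>" .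
    have sm: "\<bar>smooth_part n \<omega> (\<sigma> * r)\<bar> \<le> \<rho> * y" using ctl by (simp add: y_def)
    have "K1 * r powr \<alpha> * hits n \<omega> (\<sigma> * r) \<le> K1 * r powr \<alpha> * (y * \<Lambda>)" using hits s0 by (intro mult_left_mono) auto
    also have "\<dots> = y * ((K1 * \<Lambda>) * r powr \<alpha>)" by simp
    also have "\<dots> \<le> y * (c / 4)" using t1(2)[of r] r y by (intro mult_left_mono) (auto simp: t_def)
    finally have e1: "K1 * r powr \<alpha> * hits n \<omega> (\<sigma> * r) \<le> y * (c / 4)" .
    have "K2 * real n * r powr (2 * \<alpha>) = y * (K2 * r powr (2 * \<alpha> - 1))" using r by (simp add: y_def powr_diff)
    also have "\<dots> \<le> y * (c / 4)" using t2(2)[of r] r y by (intro mult_left_mono) (auto simp: t_def)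
    finally have e2: "K2 * real n * r powr (2 * \<alpha>) \<le> y * (c / 4)" .
    have "\<bar>\<sigma> * r\<bar> < s0" using r s0 by (simp add: sg t_def)
    from approx[OF this, of n \<omega>] have ap: "\<bar>risk n \<omega> (\<sigma> * r) - jump_part n \<omega> (\<sigma> * r) - smooth_part n \<omega> (\<sigma> * r)\<bar> \<le> y * (c / 4) + y * (c / 4)"
      unfolding sg using e1 e2 by linarith
    have "2 * N * \<rho> * y + \<rho> * y = y * (c / 4)" using \<rho>(2) by (metis distrib_right mult.commute mult_1)
    then have "y * c - y * (c / 4) - (y * (c / 4) + y * (c / 4)) \<le> risk n \<omega> (\<sigma> * r)" using jp sm ap by linarith
    moreover have "y * c - y * (c / 4) - (y * (c / 4) + y * (c / 4)) = y * (c / 4)" by simp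
    ultimately show "0 < risk n \<omega> (\<sigma> * r)" using y c by (smt (verit) mult_pos_pos divide_pos_pos)
  qed
qed

lemma risk_positive:
  obtains \<eta> where "0 < \<eta>"
    "\<And>p. 0 < p \<Longrightarrow> \<exists>K>0. \<forall>n>0. \<exists>A\<in>events. prob A \<le> p \<and> (\<forall>\<omega>\<in>space M - A. \<forall>s. K / real n \<le> \<bar>s\<bar> \<longrightarrow> \<bar>s\<bar> \<le> \<eta> \<longrightarrow> 0 < risk n \<omega> s)"
proof -
  have "holds_beyond (\<lambda>n \<omega> r. 0 < risk n \<omega> (1 * r) \<and> 0 < risk n \<omega> (- 1 * r))"
    by (intro holds_beyond_conj risk_positive_side) auto
  then obtain \<eta> where \<eta>: "0 < \<eta>" "\<And>p. 0 < p \<Longrightarrow> \<exists>K>0. \<forall>n>0. \<exists>A\<in>events. prob A \<le> p \<and>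
     (\<forall>\<omega>\<in>space M - A. \<forall>r. K / real n \<le> r \<longrightarrow> r \<le> \<eta> \<longrightarrow> 0 < risk n \<omega> (1 * r) \<and> 0 < risk n \<omega> (- 1 * r))"
    unfolding holds_beyond_def by blast
  have abs: "s = 1 * \<bar>s\<bar> \<or> s = - 1 * \<bar>s\<bar>" for s :: real by auto
  show thesis
  proof (rule that[OF \<eta>(1)])
    fix p :: real assume "0 < p"
    then obtain K where K: "0 < K" "\<forall>n>0. \<exists>A\<in>events. prob A \<le> p \<and>
     (\<forall>\<omega>\<in>space M - A. \<forall>r. K / real n \<le> r \<longrightarrow> r \<le> \<eta> \<longrightarrow> 0 < risk n \<omega> (1 * r) \<and> 0 < risk n \<omega> (- 1 * r))"
      using \<eta>(2) by blast
    show "\<exists>K>0. \<forall>n>0. \<exists>A\<in>events. prob A \<le> p \<and> (\<forall>\<omega>\<in>space M - A. \<forall>s. K / real n \<le> \<bar>s\<bar> \<longrightarrow> \<bar>s\<bar> \<le> \<eta> \<longrightarrow> 0 < risk n \<omega> s)"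
      using K(2) abs by (intro exI[of _ K] conjI K(1)) metis
  qed
qed

end

section \<open>Approximation of the risk on windows of order 1/n\<close>

context template_sample begin

lemma hits_expectation:
  obtains s1 \<Lambda> where "0 < s1" "0 \<le> \<Lambda>"
    "\<And>n r \<sigma>. \<sigma> = 1 \<or> \<sigma> = -1 \<Longrightarrow> 0 \<le> r \<Longrightarrow> r \<le> s1 \<Longrightarrow>
       integrable M (\<lambda>\<omega>. hits n \<omega> (\<sigma> * r)) \<and> expectation (\<lambda>\<omega>. hits n \<omega> (\<sigma> * r)) \<le> real n * r * \<Lambda>"
proof -
  obtain s where s: "0 < s" and prob_win: "\<And>d a b i. d \<in> D \<Longrightarrow> d - s \<le> a \<Longrightarrow> a \<le> b \<Longrightarrow> b \<le> d + s \<Longrightarrow>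
      \<bar>prob {\<omega>\<in>space M. X i \<omega> \<in> {a..<b}} - lam d * (b - a)\<bar> \<le> 1 * (b - a)"
    using window_probability[of 1] by auto
  show thesis
  proof (rule that[OF s, of "\<Sum>d\<in>D. lam d + 1"])
    show "0 \<le> (\<Sum>d\<in>D. lam d + 1)" using lam_nonneg by (intro sum_nonneg) (simp add: add_nonneg_nonneg)
    fix n :: nat and r \<sigma> :: real assume \<sigma>: "\<sigma> = 1 \<or> \<sigma> = -1" and r: "0 \<le> r" "r \<le> s"
    have int: "integrable M (\<lambda>\<omega>. indicator (win d (\<sigma> * r)) (X i \<omega>) :: real)" for d i
      by (rule integrable_const_bound[where B=1]) (auto simp: indicator_def)
    have le: "expectation (\<lambda>\<omega>. indicator (win d (\<sigma> * r)) (X i \<omega>) :: real) \<le> (lam d + 1) * r" if d: "d \<in> D" for d i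
    proof -
      have "expectation (\<lambda>\<omega>. indicator (win d (\<sigma> * r)) (X i \<omega>) :: real) = expectation (indicator {\<omega>\<in>space M. X i \<omega> \<in> win d (\<sigma> * r)})"
        by (rule Bochner_Integration.integral_cong) (auto simp: indicator_def)
      also have "\<dots> = prob {\<omega>\<in>space M. X i \<omega> \<in> win d (\<sigma> * r)}" by (simp add: Int_absorb2 subset_eq)
      also have "\<dots> \<le> (lam d + 1) * r"
      proof (cases "\<sigma> = 1")
        case True
        then show ?thesis using prob_win[OF d, of d "d + r" i] r s by (simp add: win_def algebra_simps abs_le_iff)
      next
        case False
        then show ?thesis using prob_win[OF d, of "d - r" d i] r s \<sigma> by (simp add: win_def algebra_simps abs_le_iff)
      qed
      finally show ?thesis .
    qed
    have "expectation (\<lambda>\<omega>. hits n \<omega> (\<sigma> * r)) = (\<Sum>i<n. \<Sum>d\<in>D. expectation (\<lambda>\<omega>. indicator (win d (\<sigma> * r)) (X i \<omega>) :: real))"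
      unfolding hits_def by (subst Bochner_Integration.integral_sum)
        (auto intro!: sum.cong Bochner_Integration.integral_sum Bochner_Integration.integrable_sum int)
    also have "\<dots> \<le> (\<Sum>i<n. \<Sum>d\<in>D. (lam d + 1) * r)" by (intro sum_mono le)
    also have "\<dots> = real n * r * (\<Sum>d\<in>D. lam d + 1)" by (simp add: sum_distrib_left mult_ac)
    finally have "expectation (\<lambda>\<omega>. hits n \<omega> (\<sigma> * r)) \<le> real n * r * (\<Sum>d\<in>D. lam d + 1)" .
    moreover have "integrable M (\<lambda>\<omega>. hits n \<omega> (\<sigma> * r))"
      unfolding hits_def by (intro Bochner_Integration.integrable_sum int)
    ultimately show "integrable M (\<lambda>\<omega>. hits n \<omega> (\<sigma> * r)) \<and> expectation (\<lambda>\<omega>. hits n \<omega> (\<sigma> * r)) \<le> real n * r * (\<Sum>d\<in>D. lam d + 1)" by simp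
  qed
qed

lemma hits_mono: "0 \<le> r \<Longrightarrow> r \<le> r' \<Longrightarrow> \<sigma> = 1 \<or> \<sigma> = -1 \<Longrightarrow> hits n \<omega> (\<sigma> * r) \<le> hits n \<omega> (\<sigma> * r')"
  unfolding hits_def using win_mono[of r r' \<sigma>]
  by (intro sum_mono) (auto simp: indicator_def)

lemma hits_nonneg: "0 \<le> hits n \<omega> s"
  unfolding hits_def by (intro sum_nonneg) auto

lemma hits_meas[measurable]: "(\<lambda>\<omega>. hits n \<omega> s) \<in> borel_measurable M"
  unfolding hits_def by measurable

text \<open>For \<open>r \<le> K / n\<close> the variance of the smooth part and the quadratic
  remainder are at most multiples of \<open>n * (K / n) powr (2 * \<alpha>)\<close>, which tends to
  zero. The cross term is \<open>(K / n) powr \<alpha>\<close> times a number of hits with bounded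
  mean, small by Markov's inequality.\<close>

lemma risk_local_side:
  assumes \<sigma>: "\<sigma> = 1 \<or> \<sigma> = -1" and K: "0 < K" and e: "0 < e" and p: "0 < p"
  shows "\<forall>\<^sub>F n in sequentially. \<exists>A\<in>events. prob A \<le> p \<and>
    (\<forall>\<omega>\<in>space M - A. \<forall>t\<in>{0..K}. \<bar>risk n \<omega> (\<sigma> * (t / real n)) - jump_part n \<omega> (\<sigma> * (t / real n))\<bar> \<le> e)"
proof -
  obtain Kc where Kc: "0 < Kc" and chain: "\<And>n T e. 0 < T \<Longrightarrow> 0 < e \<Longrightarrow>
       \<exists>A\<in>events. prob A \<le> Kc * real n * T powr (2 * \<alpha>) / e\<^sup>2 \<and> (\<forall>\<omega>\<in>space M - A. \<forall>r\<in>{0..T}. \<bar>smooth_part n \<omega> (\<sigma> * r)\<bar> \<le> e)"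
    using smooth_part_chaining \<sigma> by metis
  obtain s0 K1 K2 where s0: "0 < s0" "0 \<le> K1" "0 \<le> K2"
    and approx: "\<And>n \<omega> s. \<bar>s\<bar> < s0 \<Longrightarrow> \<bar>risk n \<omega> s - jump_part n \<omega> s - smooth_part n \<omega> s\<bar> \<le>
       K1 * \<bar>s\<bar> powr \<alpha> * hits n \<omega> s + K2 * real n * \<bar>s\<bar> powr (2 * \<alpha>)"
    using sample_approximation by blast
  obtain s1 \<Lambda> where s1: "0 < s1" "0 \<le> \<Lambda>"
    and hitsE: "\<And>n r. 0 \<le> r \<Longrightarrow> r \<le> s1 \<Longrightarrow>
       integrable M (\<lambda>\<omega>. hits n \<omega> (\<sigma> * r)) \<and> expectation (\<lambda>\<omega>. hits n \<omega> (\<sigma> * r)) \<le> real n * r * \<Lambda>"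
    using hits_expectation \<sigma> by metis
  have lim0: "(\<lambda>n. K / real n) \<longlonglongrightarrow> 0" by (rule lim_const_over_n)
  have limA: "(\<lambda>n. (K / real n) powr \<alpha>) \<longlonglongrightarrow> 0" by (rule tendsto_scaled_powr[OF alpha_pos K])
  have limB: "(\<lambda>n. (K / real n) powr (2 * \<alpha> - 1)) \<longlonglongrightarrow> 0" using alpha by (intro tendsto_scaled_powr K) auto
  have eqB: "real n * (K / real n) powr (2 * \<alpha>) = K * (K / real n) powr (2 * \<alpha> - 1)" if "0 < n" for n
    using that K by (simp add: powr_diff)
  have ev1: "\<forall>\<^sub>F n in sequentially. K / real n < s0" by (rule order_tendstoD(2)[OF lim0 s0(1)])
  have ev2: "\<forall>\<^sub>F n in sequentially. K / real n < s1" by (rule order_tendstoD(2)[OF lim0 s1(1)])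
  have "(\<lambda>n. Kc * (K * (K / real n) powr (2 * \<alpha> - 1)) / (e / 3)\<^sup>2) \<longlonglongrightarrow> Kc * (K * 0) / (e / 3)\<^sup>2"
    using e by (intro tendsto_intros limB) auto
  then have ev3: "\<forall>\<^sub>F n in sequentially. Kc * (K * (K / real n) powr (2 * \<alpha> - 1)) / (e / 3)\<^sup>2 < p / 2"
    using p by (intro order_tendstoD(2)) auto
  have "(\<lambda>n. K2 * (K * (K / real n) powr (2 * \<alpha> - 1))) \<longlonglongrightarrow> K2 * (K * 0)" by (intro tendsto_intros limB)
  then have ev4: "\<forall>\<^sub>F n in sequentially. K2 * (K * (K / real n) powr (2 * \<alpha> - 1)) < e / 3"
    using e by (intro order_tendstoD(2)) auto
  have "(\<lambda>n. K1 * (K / real n) powr \<alpha> * (K * \<Lambda>)) \<longlonglongrightarrow> K1 * 0 * (K * \<Lambda>)" by (intro tendsto_intros limA)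
  \<comment> \<open>The target \<open>e / 3 * (p / 2)\<close> is the mean for which Markov's
    inequality at level \<open>e / 3\<close> yields \<open>p / 2\<close>.\<close>
  then have ev5: "\<forall>\<^sub>F n in sequentially. K1 * (K / real n) powr \<alpha> * (K * \<Lambda>) < e / 3 * (p / 2)"
    using e p by (intro order_tendstoD(2)) auto
  show ?thesis
    using ev1 ev2 ev3 ev4 ev5 eventually_gt_at_top[of 0]
  proof eventually_elim
    case (elim n)
    define T where "T = K / real n"
    have T: "0 < T" using K elim by (simp add: T_def)
    have e3: "0 < e / 3" using e by simp
    obtain A1 where A1: "A1 \<in> events" "prob A1 \<le> Kc * real n * T powr (2 * \<alpha>) / (e / 3)\<^sup>2"
      "\<forall>\<omega>\<in>space M - A1. \<forall>r\<in>{0..T}. \<bar>smooth_part n \<omega> (\<sigma> * r)\<bar> \<le> e / 3" using chain[OF T e3] by blast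
    have "prob A1 \<le> Kc * (K * (K / real n) powr (2 * \<alpha> - 1)) / (e / 3)\<^sup>2"
      using A1(2) unfolding eqB[OF elim(6), symmetric] T_def by (simp only: mult.assoc)
    then have PA1: "prob A1 \<le> p / 2" using elim(3) by linarith
    define h where "h \<omega> = K1 * T powr \<alpha> * hits n \<omega> (\<sigma> * T)" for \<omega>
    define A2 where "A2 = {\<omega>\<in>space M. e / 3 \<le> h \<omega>}"
    have h_meas[measurable]: "h \<in> borel_measurable M" unfolding h_def[abs_def] by measurable
    have A2m: "A2 \<in> events" unfolding A2_def by measurable
    have hi: "integrable M h" "expectation h \<le> K1 * T powr \<alpha> * (K * \<Lambda>)"
    proof -
      have "integrable M (\<lambda>\<omega>. hits n \<omega> (\<sigma> * T))" "expectation (\<lambda>\<omega>. hits n \<omega> (\<sigma> * T)) \<le> K * \<Lambda>"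
        using hitsE[of T n] T elim(2,6) by (auto simp: T_def)
      then show "integrable M h" "expectation h \<le> K1 * T powr \<alpha> * (K * \<Lambda>)"
        unfolding h_def[abs_def] using s0 by (auto intro!: mult_left_mono)
    qed
    have "prob A2 \<le> expectation h / (e / 3)"
    proof -
      have "0 \<le> h \<omega>" for \<omega> using hits_nonneg s0 by (simp add: h_def)
      then show ?thesis unfolding A2_def using e3 hi(1)
        by (intro integral_Markov_inequality_measure[where A="space M"]) auto
    qed
    also have "\<dots> \<le> (e / 3 * (p / 2)) / (e / 3)"
      using hi(2) elim(5) e3 by (intro divide_right_mono) (auto simp: T_def)
    also have "\<dots> = p / 2" using e by simp
    finally have PA2: "prob A2 \<le> p / 2" .
    show ?case
    proof (intro bexI[of _ "A1 \<union> A2"] conjI ballI)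
      show "prob (A1 \<union> A2) \<le> p" using measure_Un_le[OF A1(1) A2m] PA1 PA2 by linarith
      show "A1 \<union> A2 \<in> events" using A1 A2m by auto
      fix \<omega> t assume \<omega>: "\<omega> \<in> space M - (A1 \<union> A2)" and t: "t \<in> {0..K}"
      define r where "r = t / real n"
      have r: "0 \<le> r" "r \<le> T" using t elim by (auto simp: r_def T_def divide_right_mono)
      have ar: "\<bar>\<sigma> * r\<bar> = r" using \<sigma> r by auto
      have "\<bar>\<sigma> * r\<bar> < s0" using ar r elim(1) by (simp add: T_def)
      note ap = approx[OF this, of n \<omega>, unfolded ar]
      have sm: "\<bar>smooth_part n \<omega> (\<sigma> * r)\<bar> \<le> e / 3" using A1(3) \<omega> r by auto
      have "K1 * r powr \<alpha> * hits n \<omega> (\<sigma> * r) \<le> K1 * T powr \<alpha> * hits n \<omega> (\<sigma> * T)"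
        using s0 r alpha_pos hits_nonneg hits_mono[OF r \<sigma>] by (intro mult_mono powr_mono2) auto
      also have "\<dots> \<le> e / 3" using \<omega> by (auto simp: A2_def h_def)
      finally have b1: "K1 * r powr \<alpha> * hits n \<omega> (\<sigma> * r) \<le> e / 3" .
      have "K2 * real n * r powr (2 * \<alpha>) \<le> K2 * real n * T powr (2 * \<alpha>)"
        using s0 r alpha_pos by (intro mult_left_mono powr_mono2) auto
      also have "\<dots> \<le> e / 3" using elim(4) eqB[OF elim(6)] by (simp add: T_def mult.assoc)
      finally have b2: "K2 * real n * r powr (2 * \<alpha>) \<le> e / 3" .
      have "\<bar>risk n \<omega> (\<sigma> * r) - jump_part n \<omega> (\<sigma> * r)\<bar> \<le> e" using ap sm b1 b2 by linarith
      then show "\<bar>risk n \<omega> (\<sigma> * (t / real n)) - jump_part n \<omega> (\<sigma> * (t / real n))\<bar> \<le> e" by (simp add: r_def)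
    qed
  qed
qed

lemma risk_local:
  assumes K: "0 < K" and e: "0 < e" and p: "0 < p"
  shows "\<forall>\<^sub>F n in sequentially. \<exists>A\<in>events. prob A \<le> p \<and>
    (\<forall>\<omega>\<in>space M - A. \<forall>t. \<bar>t\<bar> \<le> K \<longrightarrow> \<bar>risk n \<omega> (t / real n) - jump_part n \<omega> (t / real n)\<bar> \<le> e)"
proof -
  have p2: "0 < p / 2" using p by simp
  show ?thesis
    using risk_local_side[OF disjI1[OF refl] K e p2] risk_local_side[OF disjI2[OF refl] K e p2]
  proof eventually_elim
    case (elim n)
    from elim(1) obtain A1 where A1: "A1 \<in> events" "prob A1 \<le> p / 2"
      "\<forall>\<omega>\<in>space M - A1. \<forall>t\<in>{0..K}. \<bar>risk n \<omega> (1 * (t / real n)) - jump_part n \<omega> (1 * (t / real n))\<bar> \<le> e"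
      by blast
    from elim(2) obtain A2 where A2: "A2 \<in> events" "prob A2 \<le> p / 2"
      "\<forall>\<omega>\<in>space M - A2. \<forall>t\<in>{0..K}. \<bar>risk n \<omega> (- 1 * (t / real n)) - jump_part n \<omega> (- 1 * (t / real n))\<bar> \<le> e"
      by blast
    show ?case
    proof (intro bexI[of _ "A1 \<union> A2"] conjI ballI allI impI)
      show "prob (A1 \<union> A2) \<le> p" using measure_Un_le[OF A1(1) A2(1)] A1(2) A2(2) by linarith
      show "A1 \<union> A2 \<in> events" using A1 A2 by auto
      fix \<omega> t assume \<omega>: "\<omega> \<in> space M - (A1 \<union> A2)" and t: "\<bar>t\<bar> \<le> K"
      show "\<bar>risk n \<omega> (t / real n) - jump_part n \<omega> (t / real n)\<bar> \<le> e"
      proof (cases "0 \<le> t")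
        case True
        then show ?thesis using A1(3)[rule_format, of \<omega> t] \<omega> t by simp
      next
        case False
        then show ?thesis using A2(3)[rule_format, of \<omega> "- t"] \<omega> t by simp
      qed
    qed
  qed
qed

lemma lam_meas[measurable]: "lam \<in> borel_measurable borel"
proof -
  have "(\<lambda>x. enn2real (ennreal (lam x))) \<in> borel_measurable borel"
    using distributed_borel_measurable[OF X_dist[of 0]] by measurable
  then show ?thesis using lam_nonneg by simp
qed

text \<open>Uniform absolute continuity of the design law: cutting the integrable \<open>lam\<close>
  at a large height \<open>N\<close> leaves mass below \<open>e / 2\<close>, and under the cut a
  short interval contributes at most \<open>N\<close> times its length. Consistency uses this at
  every location, not only near the jumps.\<close>

lemma small_interval_probability:
  assumes e: "0 < e"
  obtains g where "0 < g" "\<And>a b i. a \<le> b \<Longrightarrow> b - a \<le> g \<Longrightarrow> prob {\<omega>\<in>space M. X i \<omega> \<in> {a..<b}} \<le> e"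
proof -
  have tot: "(\<integral>\<^sup>+x. ennreal (lam x) \<partial>lborel) = 1"
    using distributed_emeasure[OF X_dist[of 0], of UNIV] by (simp add: emeasure_space_1)
  have int: "integrable lborel lam"
    by (rule integrableI_nonneg) (auto simp: lam_nonneg tot)
  have "(\<lambda>N. \<integral>x. max 0 (lam x - real N) \<partial>lborel) \<longlonglongrightarrow> (\<integral>x. (0::real) \<partial>(lborel :: real measure))"
  proof (rule integral_dominated_convergence[where w=lam])
    show "AE x in lborel. (\<lambda>N. max 0 (lam x - real N)) \<longlonglongrightarrow> 0"
    proof (rule AE_I2)
      fix x
      obtain N where "lam x \<le> real N" using real_arch_simple by blast
      then have "\<forall>\<^sub>F n in sequentially. max 0 (lam x - real n) = 0"
        by (intro eventually_sequentiallyI[of N]) auto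
      then show "(\<lambda>N. max 0 (lam x - real N)) \<longlonglongrightarrow> 0" by (rule tendsto_eventually)
    qed
  qed (use int lam_nonneg in \<open>auto simp: max_def\<close>)
  then have "(\<lambda>N. \<integral>x. max 0 (lam x - real N) \<partial>lborel) \<longlonglongrightarrow> 0" by simp
  from order_tendstoD(2)[OF this, of "e / 2"] e obtain N where N: "(\<integral>x. max 0 (lam x - real N) \<partial>lborel) < e / 2"
    by (auto simp: eventually_sequentially)
  have imax: "integrable lborel (\<lambda>x. max 0 (lam x - real N))"
    by (rule Bochner_Integration.integrable_bound[OF int]) (use lam_nonneg in \<open>auto simp: max_def\<close>)
  show thesis
  proof (rule that[of "e / (2 * (real N + 1))"])
    show "0 < e / (2 * (real N + 1))" using e by simp
    fix a b :: real and i assume ab: "a \<le> b" "b - a \<le> e / (2 * (real N + 1))"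
    have "ennreal (prob {\<omega>\<in>space M. X i \<omega> \<in> {a..<b}}) = (\<integral>\<^sup>+x. ennreal (lam x) * indicator {a..<b} x \<partial>lborel)"
      using distributed_emeasure[OF X_dist[of i], of "{a..<b}"]
      by (simp add: emeasure_eq_measure vimage_def Int_def conj_commute)
    also have "\<dots> \<le> (\<integral>\<^sup>+x. ennreal (max 0 (lam x - real N)) + ennreal (real N) * indicator {a..<b} x \<partial>lborel)"
      using lam_nonneg by (intro nn_integral_mono) (auto simp: indicator_def max_def ennreal_plus[symmetric] intro!: ennreal_leI simp del: ennreal_plus)
    also have "\<dots> = ennreal (\<integral>x. max 0 (lam x - real N) \<partial>lborel) + ennreal (real N * (b - a))"
    proof -
      have 1: "(\<integral>\<^sup>+x. ennreal (max 0 (lam x - real N)) \<partial>lborel) = ennreal (\<integral>x. max 0 (lam x - real N) \<partial>lborel)"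
        by (rule nn_integral_eq_integral[OF imax]) simp
      have 2: "(\<integral>\<^sup>+x. ennreal (real N) * indicator {a..<b} x \<partial>lborel) = ennreal (real N * (b - a))"
        using ab by (simp add: nn_integral_cmult_indicator ennreal_mult)
      show ?thesis unfolding 1[symmetric] 2[symmetric] by (rule nn_integral_add) measurable
    qed
    also have "\<dots> = ennreal ((\<integral>x. max 0 (lam x - real N) \<partial>lborel) + real N * (b - a))"
      using ab by (subst ennreal_plus) (auto intro!: Bochner_Integration.integral_nonneg)
    finally have "prob {\<omega>\<in>space M. X i \<omega> \<in> {a..<b}} \<le> (\<integral>x. max 0 (lam x - real N) \<partial>lborel) + real N * (b - a)"
      using ab by (subst (asm) ennreal_le_iff) (auto intro!: add_nonneg_nonneg Bochner_Integration.integral_nonneg)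
    also have "real N * (b - a) \<le> real N * (e / (2 * (real N + 1)))" using ab by (intro mult_left_mono) auto
    also have "\<dots> \<le> e / 2" using e by (simp add: field_simps)
    finally show "prob {\<omega>\<in>space M. X i \<omega> \<in> {a..<b}} \<le> e" using N by linarith
  qed
qed

end

section \<open>Consistency and tightness\<close>

context template_sample begin

lemma X_ident: "distr M borel (X i) = distr M borel (X 0)"
proof -
  have "distr M borel (X i) = density lborel (\<lambda>x. ennreal (lam x))" for i
    using distributed_distr_eq_density[OF X_dist[of i]] by (metis distr_cong sets_lborel)
  then show ?thesis by metis
qed

lemma XZ_ident: "distr M (borel \<Otimes>\<^sub>M borel) (\<lambda>\<omega>. (X i \<omega>, Z i \<omega>)) = distr M (borel \<Otimes>\<^sub>M borel) (\<lambda>\<omega>. (X 0 \<omega>, Z 0 \<omega>))"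
  using XZ_pair[of i] XZ_pair[of 0] X_ident[of i] Z_ident[of i] unfolding indep_var_distribution_eq by metis

lemma XZ_expectation:
  assumes [measurable]: "case_prod h \<in> borel_measurable (borel \<Otimes>\<^sub>M borel)"
  shows "expectation (\<lambda>\<omega>. h (X i \<omega>) (Z i \<omega>) :: real) = expectation (\<lambda>\<omega>. h (X 0 \<omega>) (Z 0 \<omega>))"
proof -
  have "expectation (\<lambda>\<omega>. h (X i \<omega>) (Z i \<omega>)) = (\<integral>y. case_prod h y \<partial>distr M (borel \<Otimes>\<^sub>M borel) (\<lambda>\<omega>. (X i \<omega>, Z i \<omega>)))" for i
    by (subst integral_distr) auto
  then show ?thesis using XZ_ident[of i] by simp
qed

text \<open>A finite net of shifts is handled by Chebyshev's inequality. Between net points the loss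
  varies by at most an envelope with small mean, which is controlled in the same way, and beyond
  \<open>S\<close> the shifted template misses the design, so all larger shifts give the same
  risk.\<close>

lemma consistency:
  assumes F_supp: "\<And>x. a < \<bar>x\<bar> \<Longrightarrow> F x = 0" and X_supp: "\<And>i. AE \<omega> in M. \<bar>X i \<omega>\<bar> \<le> a" and a: "0 < a"
    and sep: "\<And>r. 0 < r \<Longrightarrow> \<exists>\<kappa>>0. \<forall>s. r \<le> \<bar>s\<bar> \<longrightarrow>
        \<kappa> \<le> expectation (\<lambda>\<omega>. L (Z 0 \<omega> + (F (X 0 \<omega>) - F (X 0 \<omega> - s))) - L (Z 0 \<omega>))"
    and r: "0 < r" and p: "0 < p"
  shows "\<forall>\<^sub>F n in sequentially. \<exists>A\<in>events. prob A \<le> p \<and> (\<forall>\<omega>\<in>space M - A. \<forall>s. r \<le> \<bar>s\<bar> \<longrightarrow> 0 < risk n \<omega> s)"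
proof -
  obtain \<kappa> where \<kappa>: "0 < \<kappa>" "\<And>s. r / 2 \<le> \<bar>s\<bar> \<Longrightarrow>
        \<kappa> \<le> expectation (\<lambda>\<omega>. L (Z 0 \<omega> + (F (X 0 \<omega>) - F (X 0 \<omega> - s))) - L (Z 0 \<omega>))"
    using sep[of "r / 2"] r by auto
  have B: "0 \<le> B" using F_bdd[of 0] by linarith
  \<comment> \<open>Bounds loss increments per unit of template difference. Such differences are at
    most \<open>2 * B\<close>, which enters once through the moved argument of \<open>L'\<close> and
    once through the quadratic term.\<close>
  define q where "q z = \<bar>L' z\<bar> + 4 * B * C" for z
  have q_meas[measurable]: "q \<in> borel_measurable borel" unfolding q_def[abs_def] by measurable
  have q_nn: "0 \<le> q z" for z using B C_pos by (simp add: q_def)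
  have q_sq: "integrable M (\<lambda>\<omega>. (q (Z i \<omega>))\<^sup>2)" for i
    unfolding q_def power2_sum using L'_square_integrable[of i] L'_integrable[of i]
    by (auto intro!: Bochner_Integration.integrable_add)
  have q_int: "integrable M (\<lambda>\<omega>. q (Z i \<omega>))" for i by (rule square_integrable_imp_integrable[OF _ q_sq]) measurable
  define Eq where "Eq = expectation (\<lambda>\<omega>. q (Z 0 \<omega>))"
  define Eq2 where "Eq2 = expectation (\<lambda>\<omega>. (q (Z 0 \<omega>))\<^sup>2)"
  have Eq: "0 \<le> Eq" "0 \<le> Eq2" unfolding Eq_def Eq2_def by (auto intro!: Bochner_Integration.integral_nonneg q_nn)
  define \<Delta> where "\<Delta> = (\<Sum>d\<in>D. \<bar>\<delta> d\<bar>)"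
  have \<Delta>: "0 \<le> \<Delta>" unfolding \<Delta>_def by (intro sum_nonneg) auto
  define \<phi> where "\<phi> s x z = L (z + (F x - F (x - s))) - L z" for s x z
  \<comment> \<open>Envelope for shifts in an interval of length \<open>g\<close> starting at
    \<open>s\<close>: the Hoelder variation of \<open>G\<close> plus the jumps that the design point
    may cross.\<close>
  define h where "h g s x z = H * g powr \<alpha> * q z + (\<Sum>d\<in>D. \<bar>\<delta> d\<bar> * (indicator {d + s..<d + s + g} x * q z))" for g s x z :: real
  have \<phi>_meas[measurable]: "case_prod (\<phi> s) \<in> borel_measurable (borel \<Otimes>\<^sub>M borel)" for s
    unfolding \<phi>_def[abs_def] by measurable
  have h_meas[measurable]: "case_prod (h g s) \<in> borel_measurable (borel \<Otimes>\<^sub>M borel)" for g s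
    unfolding h_def[abs_def] by measurable
  have \<phi>_le: "\<bar>\<phi> s x z\<bar> \<le> 2 * B * q z" for s x z
  proof -
    let ?b = "F x - F (x - s)"
    have b: "\<bar>?b\<bar> \<le> 2 * B" using F_bdd[of x] F_bdd[of "x - s"] by linarith
    have "\<bar>\<phi> s x z\<bar> \<le> \<bar>L' z\<bar> * \<bar>?b\<bar> + C * ?b\<^sup>2" unfolding \<phi>_def by (rule increment_le)
    also have "C * ?b\<^sup>2 = C * \<bar>?b\<bar> * \<bar>?b\<bar>" by (simp add: power2_eq_square abs_mult_self_eq mult.assoc)
    also have "\<dots> \<le> C * (2 * B) * \<bar>?b\<bar>" using b C_pos by (intro mult_right_mono mult_left_mono) auto
    also have "\<bar>L' z\<bar> * \<bar>?b\<bar> + C * (2 * B) * \<bar>?b\<bar> = (\<bar>L' z\<bar> + 2 * B * C) * \<bar>?b\<bar>" by (simp add: algebra_simps)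
    also have "\<dots> \<le> q z * (2 * B)" using b B C_pos by (intro mult_mono) (auto simp: q_def)
    finally show ?thesis by (simp add: mult_ac)
  qed
  have \<phi>_diff: "\<bar>\<phi> s x z - \<phi> t x z\<bar> \<le> h g t x z" if st: "t \<le> s" "s \<le> t + g" for s t g x z
  proof -
    let ?u = "F x - F (x - s)" and ?v = "F x - F (x - t)"
    have v: "\<bar>?v\<bar> \<le> 2 * B" "\<bar>?u - ?v\<bar> \<le> 2 * B"
      using F_bdd[of x] F_bdd[of "x - s"] F_bdd[of "x - t"] by linarith+
    have uv: "\<bar>?u - ?v\<bar> \<le> H * g powr \<alpha> + (\<Sum>d\<in>D. \<bar>\<delta> d\<bar> * indicator {d + t..<d + t + g} x)"
    proof -
      have "?u - ?v = (G (x - t) - G (x - s)) + (\<Sum>d\<in>D. \<delta> d * (indicator {d..} (x - t) - indicator {d..} (x - s)))"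
        unfolding F_eq by (simp add: sum_subtractf right_diff_distrib)
      also have "\<bar>\<dots>\<bar> \<le> \<bar>G (x - t) - G (x - s)\<bar> + (\<Sum>d\<in>D. \<bar>\<delta> d * (indicator {d..} (x - t) - indicator {d..} (x - s))\<bar>)"
        by (rule order_trans[OF abs_triangle_ineq]) (intro add_mono order_refl sum_abs)
      also have "\<bar>G (x - t) - G (x - s)\<bar> \<le> H * \<bar>s - t\<bar> powr \<alpha>" using G_Holder[of "x - t" "x - s"] by simp
      also have "\<dots> \<le> H * g powr \<alpha>" using st H_pos alpha_pos by (intro mult_left_mono powr_mono2) auto
      also have "(\<Sum>d\<in>D. \<bar>\<delta> d * (indicator {d..} (x - t) - indicator {d..} (x - s))\<bar>) \<le>
          (\<Sum>d\<in>D. \<bar>\<delta> d\<bar> * indicator {d + t..<d + t + g} x)"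
        using st unfolding abs_mult by (intro sum_mono mult_left_mono) (auto simp: indicator_def)
      finally show ?thesis by simp
    qed
    have "\<phi> s x z - \<phi> t x z = L ((z + ?v) + (?u - ?v)) - L (z + ?v)" by (simp add: \<phi>_def)
    also have "\<bar>\<dots>\<bar> \<le> \<bar>L' (z + ?v)\<bar> * \<bar>?u - ?v\<bar> + C * (?u - ?v)\<^sup>2" by (rule increment_le)
    also have "C * (?u - ?v)\<^sup>2 = C * \<bar>?u - ?v\<bar> * \<bar>?u - ?v\<bar>" by (simp add: power2_eq_square abs_mult_self_eq mult.assoc)
    also have "\<dots> \<le> C * (2 * B) * \<bar>?u - ?v\<bar>" using v C_pos by (intro mult_right_mono mult_left_mono) auto
    also have "\<bar>L' (z + ?v)\<bar> * \<bar>?u - ?v\<bar> \<le> (\<bar>L' z\<bar> + C * (2 * B)) * \<bar>?u - ?v\<bar>"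
    proof (rule mult_right_mono)
      have "\<bar>L' (z + ?v) - L' z\<bar> \<le> C * \<bar>?v\<bar>" using L'_lip[of "z + ?v" z] by simp
      also have "\<dots> \<le> C * (2 * B)" using v C_pos by (intro mult_left_mono) auto
      finally show "\<bar>L' (z + ?v)\<bar> \<le> \<bar>L' z\<bar> + C * (2 * B)" by linarith
    qed simp
    also have "(\<bar>L' z\<bar> + C * (2 * B)) * \<bar>?u - ?v\<bar> + C * (2 * B) * \<bar>?u - ?v\<bar> = q z * \<bar>?u - ?v\<bar>"
      by (simp add: q_def algebra_simps)
    also have "\<dots> \<le> q z * (H * g powr \<alpha> + (\<Sum>d\<in>D. \<bar>\<delta> d\<bar> * indicator {d + t..<d + t + g} x))"
      using uv q_nn by (intro mult_left_mono) auto
    also have "\<dots> = h g t x z" by (simp add: h_def distrib_left sum_distrib_left mult_ac)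
    finally show ?thesis by simp
  qed
  obtain g1 where g1: "0 < g1" "\<And>g. 0 < g \<Longrightarrow> g \<le> g1 \<Longrightarrow> (H * Eq) * g powr \<alpha> \<le> \<kappa> / 16"
    using small_powr[of \<alpha> "\<kappa> / 16" "H * Eq"] alpha_pos \<kappa> H_pos Eq by auto
  \<comment> \<open>The \<open>+ 1\<close> avoids division by zero. The mean of the envelope then
    stays below \<open>\<kappa> / 16 + \<kappa> / 16\<close>.\<close>
  define \<epsilon> where "\<epsilon> = \<kappa> / (16 * (\<Delta> * Eq + 1))"
  have \<epsilon>: "0 < \<epsilon>" "\<Delta> * Eq * \<epsilon> \<le> \<kappa> / 16" 
  proof -
    have y: "0 < \<Delta> * Eq + 1" using \<Delta> Eq(1) by (simp add: add_nonneg_pos)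
    then show pos: "0 < \<epsilon>" using \<kappa>(1) by (simp add: \<epsilon>_def)
    have "\<Delta> * Eq * \<epsilon> \<le> (\<Delta> * Eq + 1) * \<epsilon>" using pos by (intro mult_right_mono) auto
    also have "\<dots> = \<kappa> / 16"
    proof -
      have "x * (\<kappa> / (16 * x)) = \<kappa> / 16" if "0 < x" for x using that by simp
      from this[OF y] show ?thesis by (simp only: \<epsilon>_def)
    qed
    finally show "\<Delta> * Eq * \<epsilon> \<le> \<kappa> / 16" .
  qed
  obtain g2 where g2: "0 < g2" "\<And>a b i. a \<le> b \<Longrightarrow> b - a \<le> g2 \<Longrightarrow> prob {\<omega>\<in>space M. X i \<omega> \<in> {a..<b}} \<le> \<epsilon>"
    using small_interval_probability[OF \<epsilon>(1)] by blast
  define g where "g = min (r / 2) (min g1 g2)"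
  have g: "0 < g" "g \<le> r / 2" "g \<le> g1" "g \<le> g2" using r g1 g2 by (auto simp: g_def)
  have Eh: "expectation (\<lambda>\<omega>. h g s (X 0 \<omega>) (Z 0 \<omega>)) \<le> \<kappa> / 8" for s
  proof -
    have wi: "integrable M (\<lambda>\<omega>. indicator {d + s..<d + s + g} (X 0 \<omega>) * q (Z 0 \<omega>))" for d
      by (rule square_integrable_imp_integrable[OF _ window_weight_moments(1)[OF _ q_meas q_sq[of 0], of _ 0]]) auto
    have "expectation (\<lambda>\<omega>. h g s (X 0 \<omega>) (Z 0 \<omega>)) = H * g powr \<alpha> * Eq +
        (\<Sum>d\<in>D. \<bar>\<delta> d\<bar> * (prob {\<omega>\<in>space M. X 0 \<omega> \<in> {d + s..<d + s + g}} * Eq))"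
      unfolding h_def using q_int[of 0] wi window_weight_moments(2)[OF _ q_meas q_sq[of 0], of _ 0]
      by (subst Bochner_Integration.integral_add)
        (auto simp: Eq_def Bochner_Integration.integral_sum intro!: Bochner_Integration.integrable_sum)
    also have "(\<Sum>d\<in>D. \<bar>\<delta> d\<bar> * (prob {\<omega>\<in>space M. X 0 \<omega> \<in> {d + s..<d + s + g}} * Eq)) \<le> (\<Sum>d\<in>D. \<bar>\<delta> d\<bar> * (\<epsilon> * Eq))"
      using g Eq by (intro sum_mono mult_left_mono mult_right_mono g2(2)) auto
    also have "\<dots> = \<Delta> * Eq * \<epsilon>" by (simp add: \<Delta>_def sum_distrib_right sum_distrib_left mult_ac)
    also have "H * g powr \<alpha> * Eq = (H * Eq) * g powr \<alpha>" by simp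
    also have "\<dots> \<le> \<kappa> / 16" using g by (intro g1(2)) auto
    finally show ?thesis using \<epsilon>(2) by simp
  qed
  \<comment> \<open>Beyond \<open>2 * a\<close> every shift moves the template off the design; the
    added \<open>1 + r\<close> keeps \<open>S\<close> strictly beyond and makes it an admissible
    shift of size at least \<open>r\<close>.\<close>
  define S where "S = 2 * a + 1 + r"
  define m where "m = nat \<lceil>2 * S / g\<rceil> + 1"
  define pt where "pt k = - S + real k * g" for k :: nat
  \<comment> \<open>One second-moment bound serving the loss increments and the envelope
    alike.\<close>
  define v where "v = ((2 * B)\<^sup>2 + (H * g powr \<alpha> + \<Delta>)\<^sup>2) * Eq2"
  define w where "w = 64 * v / \<kappa>\<^sup>2"
  have v: "0 \<le> v" using Eq by (simp add: v_def)
  have bounded_sq: "integrable M (\<lambda>\<omega>. (f (X i \<omega>) (Z i \<omega>))\<^sup>2) \<and> expectation (\<lambda>\<omega>. (f (X i \<omega>) (Z i \<omega>))\<^sup>2) \<le> v"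
    if [measurable]: "case_prod f \<in> borel_measurable (borel \<Otimes>\<^sub>M borel)"
      and fb: "\<And>x z. \<bar>f x z\<bar> \<le> c * q z" and c: "c\<^sup>2 \<le> (2 * B)\<^sup>2 + (H * g powr \<alpha> + \<Delta>)\<^sup>2" for f :: "real \<Rightarrow> real \<Rightarrow> real" and c i
  proof -
    have le: "(f x z)\<^sup>2 \<le> c\<^sup>2 * (q z)\<^sup>2" for x z
      using power_mono[OF fb, of x z 2] by (simp add: power_mult_distrib)
    have int: "integrable M (\<lambda>\<omega>. (f (X i \<omega>) (Z i \<omega>))\<^sup>2)"
    proof (rule Bochner_Integration.integrable_bound)
      show "integrable M (\<lambda>\<omega>. c\<^sup>2 * (q (Z i \<omega>))\<^sup>2)" using q_sq by simp
    qed (use le in auto)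
    have "expectation (\<lambda>\<omega>. (f (X i \<omega>) (Z i \<omega>))\<^sup>2) \<le> expectation (\<lambda>\<omega>. c\<^sup>2 * (q (Z i \<omega>))\<^sup>2)"
      using int le q_sq by (intro integral_mono) auto
    also have "\<dots> = c\<^sup>2 * Eq2" using Z_expectation[of "\<lambda>z. (q z)\<^sup>2" i] by (simp add: Eq2_def)
    also have "\<dots> \<le> v" unfolding v_def using c Eq by (intro mult_right_mono) auto
    finally show ?thesis using int by simp
  qed
  have cheb: "prob {\<omega>\<in>space M. real n * (\<kappa> / 8) \<le> \<bar>(\<Sum>i<n. f (X i \<omega>) (Z i \<omega>)) - real n * expectation (\<lambda>\<omega>. f (X 0 \<omega>) (Z 0 \<omega>))\<bar>} \<le> w / real n"
    if n: "0 < n" and [measurable]: "case_prod f \<in> borel_measurable (borel \<Otimes>\<^sub>M borel)"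
      and fb: "\<And>x z. \<bar>f x z\<bar> \<le> c * q z" and c: "c\<^sup>2 \<le> (2 * B)\<^sup>2 + (H * g powr \<alpha> + \<Delta>)\<^sup>2" for f :: "real \<Rightarrow> real \<Rightarrow> real" and c n
  proof -
    have ind: "indep_vars (\<lambda>_. borel) (\<lambda>i \<omega>. f (X i \<omega>) (Z i \<omega>)) UNIV" by (rule XZ_functions_indep) measurable
    have "prob {\<omega>\<in>space M. real n * (\<kappa> / 8) \<le> \<bar>(\<Sum>i<n. f (X i \<omega>) (Z i \<omega>)) - real n * expectation (\<lambda>\<omega>. f (X 0 \<omega>) (Z 0 \<omega>))\<bar>}
        \<le> real n * v / (real n * (\<kappa> / 8))\<^sup>2"
      using n \<kappa> bounded_sq[OF that(2) fb c] by (intro Chebyshev_iid[OF ind] XZ_expectation) auto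
    also have "\<dots> = w / real n" using n \<kappa> by (simp add: w_def field_simps power2_eq_square)
    finally show ?thesis .
  qed
  have h_le: "\<bar>h g s x z\<bar> \<le> (H * g powr \<alpha> + \<Delta>) * q z" for s x z
  proof -
    have "0 \<le> h g s x z" unfolding h_def using H_pos q_nn by (auto intro!: add_nonneg_nonneg sum_nonneg)
    moreover have "(\<Sum>d\<in>D. \<bar>\<delta> d\<bar> * (indicator {d + s..<d + s + g} x * q z)) \<le> (\<Sum>d\<in>D. \<bar>\<delta> d\<bar> * q z)"
      using q_nn by (intro sum_mono mult_left_mono) (auto simp: indicator_def)
    ultimately show ?thesis by (simp add: h_def \<Delta>_def sum_distrib_right distrib_right)
  qed
  have "AE \<omega> in M. \<forall>i. \<bar>X i \<omega>\<bar> \<le> a" unfolding AE_all_countable using X_supp by blast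
  then obtain N0 where N0: "N0 \<in> events" "prob N0 = 0" "\<And>\<omega> i. \<omega> \<in> space M - N0 \<Longrightarrow> \<bar>X i \<omega>\<bar> \<le> a"
  proof (rule AE_E)
    fix N assume N: "{\<omega> \<in> space M. \<not> (\<forall>i. \<bar>X i \<omega>\<bar> \<le> a)} \<subseteq> N" "emeasure M N = 0" "N \<in> events"
    show thesis
    proof (rule that[OF N(3)])
      show "prob N = 0" using N(2) by (simp add: measure_def)
      fix \<omega> i assume "\<omega> \<in> space M - N"
      then show "\<bar>X i \<omega>\<bar> \<le> a" using N(1) by blast
    qed
  qed
  have "(\<lambda>n. real m * 2 * w / real n) \<longlonglongrightarrow> 0" by (rule lim_const_over_n)
  then have "\<forall>\<^sub>F n in sequentially. real m * 2 * w / real n < p" using p by (rule order_tendstoD(2))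
  then show ?thesis using eventually_gt_at_top[of 0]
  proof eventually_elim
    case (elim n)
    define E1 where "E1 k = {\<omega>\<in>space M. real n * (\<kappa> / 8) \<le> \<bar>(\<Sum>i<n. \<phi> (pt k) (X i \<omega>) (Z i \<omega>)) - real n * expectation (\<lambda>\<omega>. \<phi> (pt k) (X 0 \<omega>) (Z 0 \<omega>))\<bar>}" for k
    define E2 where "E2 k = {\<omega>\<in>space M. real n * (\<kappa> / 8) \<le> \<bar>(\<Sum>i<n. h g (pt k) (X i \<omega>) (Z i \<omega>)) - real n * expectation (\<lambda>\<omega>. h g (pt k) (X 0 \<omega>) (Z 0 \<omega>))\<bar>}" for k
    have Em[measurable]: "E1 k \<in> events" "E2 k \<in> events" for k unfolding E1_def E2_def by measurable
    have pE1: "prob (E1 k) \<le> w / real n" for k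
      unfolding E1_def by (rule cheb[OF elim(2) \<phi>_meas \<phi>_le]) simp
    have pE2: "prob (E2 k) \<le> w / real n" for k
      unfolding E2_def by (rule cheb[OF elim(2) h_meas h_le]) simp
    define A where "A = N0 \<union> (\<Union>k\<in>{..<m}. E1 k \<union> E2 k)"
    have A: "A \<in> events" unfolding A_def using N0(1) by measurable
    have "prob A \<le> prob N0 + prob (\<Union>k\<in>{..<m}. E1 k \<union> E2 k)"
      unfolding A_def using N0(1) by (intro measure_Un_le) auto
    also have "prob (\<Union>k\<in>{..<m}. E1 k \<union> E2 k) \<le> (\<Sum>k<m. prob (E1 k \<union> E2 k))"
      by (rule finite_measure_subadditive_finite) auto
    also have "\<dots> \<le> (\<Sum>k<m. 2 * (w / real n))"
    proof (rule sum_mono)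
      fix k show "prob (E1 k \<union> E2 k) \<le> 2 * (w / real n)"
        using measure_Un_le[OF Em(1,2), of k k] pE1[of k] pE2[of k] by linarith
    qed
    also have "\<dots> = real m * 2 * w / real n" by simp
    finally have pA: "prob A \<le> p" using elim(1) N0(2) by simp
    have bounded_case: "0 < risk n \<omega> s" if \<omega>: "\<omega> \<in> space M - A" and s: "r \<le> \<bar>s\<bar>" "\<bar>s\<bar> \<le> S" for \<omega> s
    proof -
      define k where "k = nat \<lfloor>(s + S) / g\<rfloor>"
      have sS: "0 \<le> (s + S) / g" using s g by auto
      have "(s + S) / g \<le> 2 * S / g" using s g by (intro divide_right_mono) auto
      then have km: "k < m" unfolding k_def m_def using sS by linarith
      have "real k = of_int \<lfloor>(s + S) / g\<rfloor>" using sS by (simp add: k_def)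
      then have "real k \<le> (s + S) / g" "(s + S) / g \<le> real k + 1" by linarith+
      then have pts: "pt k \<le> s" "s \<le> pt k + g" using g by (simp_all add: pt_def field_simps)
      \<comment> \<open>The mesh \<open>g\<close> is at most \<open>r / 2\<close>, so net points
        stay outside radius \<open>r / 2\<close>, where the gap \<open>\<kappa>\<close> was
        taken.\<close>
      have "r / 2 \<le> \<bar>pt k\<bar>" using pts s g by linarith
      then have Mk: "\<kappa> \<le> expectation (\<lambda>\<omega>. \<phi> (pt k) (X 0 \<omega>) (Z 0 \<omega>))" unfolding \<phi>_def by (rule \<kappa>(2))
      have nE: "\<omega> \<notin> E1 k" "\<omega> \<notin> E2 k" using \<omega> km by (auto simp: A_def)
      have 1: "real n * expectation (\<lambda>\<omega>. \<phi> (pt k) (X 0 \<omega>) (Z 0 \<omega>)) - real n * (\<kappa> / 8) \<le> (\<Sum>i<n. \<phi> (pt k) (X i \<omega>) (Z i \<omega>))"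
      proof -
        have "\<not> real n * (\<kappa> / 8) \<le> \<bar>(\<Sum>i<n. \<phi> (pt k) (X i \<omega>) (Z i \<omega>)) - real n * expectation (\<lambda>\<omega>. \<phi> (pt k) (X 0 \<omega>) (Z 0 \<omega>))\<bar>"
          using nE(1) \<omega> unfolding E1_def by blast
        then show ?thesis by linarith
      qed
      have 2: "(\<Sum>i<n. h g (pt k) (X i \<omega>) (Z i \<omega>)) \<le> real n * expectation (\<lambda>\<omega>. h g (pt k) (X 0 \<omega>) (Z 0 \<omega>)) + real n * (\<kappa> / 8)"
      proof -
        have "\<not> real n * (\<kappa> / 8) \<le> \<bar>(\<Sum>i<n. h g (pt k) (X i \<omega>) (Z i \<omega>)) - real n * expectation (\<lambda>\<omega>. h g (pt k) (X 0 \<omega>) (Z 0 \<omega>))\<bar>"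
          using nE(2) \<omega> unfolding E2_def by blast
        then show ?thesis by linarith
      qed
      have 3: "real n * expectation (\<lambda>\<omega>. h g (pt k) (X 0 \<omega>) (Z 0 \<omega>)) \<le> real n * (\<kappa> / 8)" by (intro mult_left_mono Eh) simp
      have 4: "real n * \<kappa> \<le> real n * expectation (\<lambda>\<omega>. \<phi> (pt k) (X 0 \<omega>) (Z 0 \<omega>))" by (intro mult_left_mono Mk) simp
      have "(\<Sum>i<n. \<phi> (pt k) (X i \<omega>) (Z i \<omega>) - h g (pt k) (X i \<omega>) (Z i \<omega>)) \<le> (\<Sum>i<n. \<phi> s (X i \<omega>) (Z i \<omega>))"
      proof (rule sum_mono)
        fix i show "\<phi> (pt k) (X i \<omega>) (Z i \<omega>) - h g (pt k) (X i \<omega>) (Z i \<omega>) \<le> \<phi> s (X i \<omega>) (Z i \<omega>)"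
          using \<phi>_diff[OF pts, of "X i \<omega>" "Z i \<omega>"] by linarith
      qed
      then have 5: "(\<Sum>i<n. \<phi> (pt k) (X i \<omega>) (Z i \<omega>)) - (\<Sum>i<n. h g (pt k) (X i \<omega>) (Z i \<omega>)) \<le> risk n \<omega> s"
        by (simp add: sum_subtractf risk_def \<phi>_def)
      have "0 < real n * \<kappa>" using elim(2) \<kappa>(1) by simp
      then show ?thesis using 1 2 3 4 5 by linarith
    qed
    show ?case
    proof (intro bexI[OF _ A] conjI pA ballI allI impI)
      fix \<omega> s assume \<omega>: "\<omega> \<in> space M - A" and s: "r \<le> \<bar>s\<bar>"
      show "0 < risk n \<omega> s"
      proof (cases "\<bar>s\<bar> \<le> S")
        case False
        have "F (X i \<omega> - s) = 0" "F (X i \<omega> - S) = 0" for i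
        proof -
          have "\<bar>X i \<omega>\<bar> \<le> a" using N0(3)[of \<omega> i] \<omega> by (auto simp: A_def)
          then show "F (X i \<omega> - s) = 0" "F (X i \<omega> - S) = 0"
            using False a r by (auto intro!: F_supp simp: S_def)
        qed
        then have "risk n \<omega> s = risk n \<omega> S" by (simp add: risk_def)
        then show ?thesis using bounded_case[OF \<omega>, of S] a r by (simp add: S_def)
      qed (use bounded_case[OF \<omega> s] in auto)
    qed
  qed
qed

end

text \<open>Deviations between \<open>K / n\<close> and \<open>\<eta>\<close> are covered by the
  linear growth of the risk, those beyond the fixed \<open>\<eta>\<close> by consistency.\<close>

lemma (in drifting_template_sample) tightness:
  assumes F_supp: "\<And>x. a < \<bar>x\<bar> \<Longrightarrow> F x = 0" and X_supp: "\<And>i. AE \<omega> in M. \<bar>X i \<omega>\<bar> \<le> a" and a: "0 < a"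
    and sep: "\<And>r. 0 < r \<Longrightarrow> \<exists>\<kappa>>0. \<forall>s. r \<le> \<bar>s\<bar> \<longrightarrow>
        \<kappa> \<le> expectation (\<lambda>\<omega>. L (Z 0 \<omega> + (F (X 0 \<omega>) - F (X 0 \<omega> - s))) - L (Z 0 \<omega>))"
    and p: "0 < p"
  obtains K where "0 < K"
    "\<forall>\<^sub>F n in sequentially. \<exists>A\<in>events. prob A \<le> p \<and> (\<forall>\<omega>\<in>space M - A. \<forall>s. K / real n \<le> \<bar>s\<bar> \<longrightarrow> 0 < risk n \<omega> s)"
proof -
  have p2: "0 < p / 2" using p by simp
  obtain \<eta> where \<eta>: "0 < \<eta>" and pos: "\<And>p. 0 < p \<Longrightarrow> \<exists>K>0. \<forall>n>0. \<exists>A\<in>events. prob A \<le> p \<and>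
      (\<forall>\<omega>\<in>space M - A. \<forall>s. K / real n \<le> \<bar>s\<bar> \<longrightarrow> \<bar>s\<bar> \<le> \<eta> \<longrightarrow> 0 < risk n \<omega> s)"
    using risk_positive by blast
  obtain K where K: "0 < K" "\<And>n. 0 < n \<Longrightarrow> \<exists>A\<in>events. prob A \<le> p / 2 \<and>
      (\<forall>\<omega>\<in>space M - A. \<forall>s. K / real n \<le> \<bar>s\<bar> \<longrightarrow> \<bar>s\<bar> \<le> \<eta> \<longrightarrow> 0 < risk n \<omega> s)"
    using pos[OF p2] by blast
  have cons: "\<forall>\<^sub>F n in sequentially. \<exists>A\<in>events. prob A \<le> p / 2 \<and> (\<forall>\<omega>\<in>space M - A. \<forall>s. \<eta> \<le> \<bar>s\<bar> \<longrightarrow> 0 < risk n \<omega> s)"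
    by (rule consistency[OF F_supp X_supp a sep \<eta> p2])
  have "\<forall>\<^sub>F n in sequentially. \<exists>A\<in>events. prob A \<le> p \<and> (\<forall>\<omega>\<in>space M - A. \<forall>s. K / real n \<le> \<bar>s\<bar> \<longrightarrow> 0 < risk n \<omega> s)"
    using cons eventually_gt_at_top[of 0]
  proof eventually_elim
    case (elim n)
    obtain A1 where A1: "A1 \<in> events" "prob A1 \<le> p / 2" "\<And>\<omega> s. \<omega> \<in> space M - A1 \<Longrightarrow> \<eta> \<le> \<bar>s\<bar> \<Longrightarrow> 0 < risk n \<omega> s"
      using elim(1) by blast
    obtain A2 where A2: "A2 \<in> events" "prob A2 \<le> p / 2"
      "\<And>\<omega> s. \<omega> \<in> space M - A2 \<Longrightarrow> K / real n \<le> \<bar>s\<bar> \<Longrightarrow> \<bar>s\<bar> \<le> \<eta> \<Longrightarrow> 0 < risk n \<omega> s"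
      using K(2)[OF elim(2)] by blast
    show ?case
    proof (intro bexI[of _ "A1 \<union> A2"] conjI ballI allI impI)
      show "prob (A1 \<union> A2) \<le> p" using measure_Un_le[OF A1(1) A2(1)] A1(2) A2(2) by linarith
      show "A1 \<union> A2 \<in> events" using A1 A2 by auto
      fix \<omega> s assume "\<omega> \<in> space M - (A1 \<union> A2)" "K / real n \<le> \<bar>s\<bar>"
      then show "0 < risk n \<omega> s" using A1(3)[of \<omega> s] A2(3)[of \<omega> s] by (cases "\<eta> \<le> \<bar>s\<bar>") auto
    qed
  qed
  then show thesis by (rule that[OF K(1)])
qed

section \<open>Cell sums of the sample\<close>

text \<open>Value at the \<open>j\<close>-th grid time of a path that starts at \<open>0\<close> and
  collects the cell contributions on its way out. The same functional serves the sample and the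
  limit process.\<close>

definition grid_value :: "real set \<Rightarrow> nat \<Rightarrow> (real \<times> nat \<Rightarrow> real) \<Rightarrow> nat \<Rightarrow> real" where
  "grid_value D J y j = (\<Sum>d\<in>D. \<Sum>i\<in>(if j < J then {j..<J} else {J..<j}). y (d, i))"

text \<open>A finite-dimensional event, so that laws of cell sums can be compared on it. The indices
  \<open>{a..b}\<close> encode a half-line within the window, and the tolerance \<open>e\<close>
  absorbs the approximation error of the risk.\<close>

definition near_minimum :: "real set \<Rightarrow> nat \<Rightarrow> nat \<Rightarrow> nat \<Rightarrow> real \<Rightarrow> (real \<times> nat \<Rightarrow> real) set" where
  "near_minimum D J a b e = {y \<in> space (\<Pi>\<^sub>M c\<in>D \<times> {..<2*J}. borel).
     \<exists>j\<in>{a..b}. \<forall>j'\<in>{..2*J}. grid_value D J y j \<le> grid_value D J y j' + e}"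

lemma grid_value_measurable:
  assumes "finite D" "j \<le> 2 * J"
  shows "(\<lambda>y. grid_value D J y j) \<in> borel_measurable (\<Pi>\<^sub>M c\<in>D \<times> {..<2*J}. borel)"
  unfolding grid_value_def using assms
  by (intro borel_measurable_sum measurable_component_singleton) (auto split: if_splits)

lemma near_minimum_sets:
  assumes D: "finite D" and b: "b \<le> 2 * J"
  shows "near_minimum D J a b e \<in> sets (\<Pi>\<^sub>M c\<in>D \<times> {..<2*J}. borel)"
proof -
  let ?M = "\<Pi>\<^sub>M c\<in>D \<times> {..<2*J}. borel :: real measure"
  have "near_minimum D J a b e = (\<Union>j\<in>{a..b}. space ?M \<inter> (\<Inter>j'\<in>{..2*J}. {y\<in>space ?M. grid_value D J y j \<le> grid_value D J y j' + e}))"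
    unfolding near_minimum_def by auto
  also have "\<dots> \<in> sets ?M"
    using grid_value_measurable[OF D] b
    by (intro sets.finite_UN sets.Int sets.top sets.finite_INT borel_measurable_le borel_measurable_add measurable_const) auto
  finally show ?thesis .
qed

context template_sample begin

text \<open>Time cells moved to the jump \<open>fst c\<close> and shrunk by \<open>n\<close>. They
  are left-closed on both sides of the jump, in line with \<open>win\<close>.\<close>

definition cell :: "real \<Rightarrow> nat \<Rightarrow> nat \<Rightarrow> real \<times> nat \<Rightarrow> real set" where
  "cell \<eta> J n c = {fst c + cell_left \<eta> J (snd c) / real n..<fst c + cell_left \<eta> J (Suc (snd c)) / real n}"

text \<open>\<open>None\<close> is also given to points in several cells, which for positive mesh
  happens only while windows of different jumps still overlap; the label is thus defined for every
  \<open>n\<close>.\<close>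

definition label :: "real \<Rightarrow> nat \<Rightarrow> nat \<Rightarrow> real \<Rightarrow> (real \<times> nat) option" where
  "label \<eta> J n x = (if \<exists>!c. c \<in> D \<times> {..<2*J} \<and> x \<in> cell \<eta> J n c
     then Some (THE c. c \<in> D \<times> {..<2*J} \<and> x \<in> cell \<eta> J n c) else None)"

definition cell_mark :: "nat \<Rightarrow> real \<times> nat \<Rightarrow> real \<Rightarrow> real" where
  "cell_mark J c = mark (fst c) (if snd c < J then - 1 else 1)"

definition cell_sums :: "real \<Rightarrow> nat \<Rightarrow> nat \<Rightarrow> 'a \<Rightarrow> real \<times> nat \<Rightarrow> real" where
  "cell_sums \<eta> J n \<omega> = (\<lambda>c\<in>D \<times> {..<2*J}. \<Sum>i<n. if label \<eta> J n (X i \<omega>) = Some c then cell_mark J c (Z i \<omega>) else 0)"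

lemma label_eq_Some_iff:
  "label \<eta> J n x = Some c \<longleftrightarrow> c \<in> D \<times> {..<2*J} \<and> x \<in> cell \<eta> J n c \<and> (\<forall>c'\<in>D \<times> {..<2*J} - {c}. x \<notin> cell \<eta> J n c')"
proof
  assume "label \<eta> J n x = Some c"
  then have ex: "\<exists>!c. c \<in> D \<times> {..<2*J} \<and> x \<in> cell \<eta> J n c"
    and c: "c = (THE c. c \<in> D \<times> {..<2*J} \<and> x \<in> cell \<eta> J n c)" by (auto simp: label_def split: if_splits)
  have "c \<in> D \<times> {..<2*J} \<and> x \<in> cell \<eta> J n c" unfolding c by (rule theI'[OF ex])
  then show "c \<in> D \<times> {..<2*J} \<and> x \<in> cell \<eta> J n c \<and> (\<forall>c'\<in>D \<times> {..<2*J} - {c}. x \<notin> cell \<eta> J n c')" using ex by blast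
next
  assume c: "c \<in> D \<times> {..<2*J} \<and> x \<in> cell \<eta> J n c \<and> (\<forall>c'\<in>D \<times> {..<2*J} - {c}. x \<notin> cell \<eta> J n c')"
  then have "\<exists>!c. c \<in> D \<times> {..<2*J} \<and> x \<in> cell \<eta> J n c" by blast
  moreover have "(THE c. c \<in> D \<times> {..<2*J} \<and> x \<in> cell \<eta> J n c) = c" by (rule the_equality) (use c in blast)+
  ultimately show "label \<eta> J n x = Some c" unfolding label_def by (simp only: if_True)
qed

lemma cell_sets: "cell \<eta> J n c \<in> sets borel" by (simp add: cell_def)

lemma label_measurable: "label \<eta> J n \<in> measurable borel (count_space UNIV)"
proof -
  let ?A = "insert None (Some ` (D \<times> {..<2*J}))"
  have Some: "label \<eta> J n -` {Some c} \<inter> space borel \<in> sets borel" if "c \<in> D \<times> {..<2*J}" for c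
  proof -
    have "label \<eta> J n -` {Some c} \<inter> space borel = cell \<eta> J n c - (\<Union>c'\<in>D \<times> {..<2*J} - {c}. cell \<eta> J n c')"
      using that by (auto simp: label_eq_Some_iff)
    also have "\<dots> \<in> sets borel" using D_fin cell_sets by (intro sets.Diff sets.finite_UN) auto
    finally show ?thesis .
  qed
  have range: "label \<eta> J n x \<in> ?A" for x
    using label_eq_Some_iff[of \<eta> J n x] by (cases "label \<eta> J n x") auto
  have fin_A: "finite ?A" using D_fin by simp
  have "label \<eta> J n \<in> measurable borel (count_space ?A)"
    unfolding measurable_count_space_eq2[OF fin_A]
  proof (intro conjI ballI)
    show "label \<eta> J n \<in> space borel \<rightarrow> ?A" using range by auto
    fix y assume y: "y \<in> ?A"
    show "label \<eta> J n -` {y} \<inter> space borel \<in> sets borel"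
    proof (cases y)
      case None
      have "label \<eta> J n -` {y} \<inter> space borel = space borel - (\<Union>c\<in>D \<times> {..<2*J}. label \<eta> J n -` {Some c} \<inter> space borel)"
        using range None by auto
      also have "\<dots> \<in> sets borel" using Some D_fin by (intro sets.Diff sets.finite_UN sets.top) auto
      finally show ?thesis .
    qed (use Some y in auto)
  qed
  moreover have "(\<lambda>x. x) \<in> measurable (count_space ?A) (count_space UNIV)" by simp
  ultimately show ?thesis by (rule measurable_compose)
qed

lemma cell_mark_measurable: "cell_mark J c \<in> borel_measurable borel"
  unfolding cell_mark_def by (rule mark_meas)

text \<open>Around each jump the cells fill a window of half-width \<open>J * \<eta> / n\<close>,
  which eventually is smaller than half of every gap between jumps.\<close>

lemma cells_separate:
  assumes \<eta>: "0 < \<eta>"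
  shows "\<forall>\<^sub>F n in sequentially. \<forall>x. \<forall>c\<in>D \<times> {..<2*J}. \<forall>c'\<in>D \<times> {..<2*J}. x \<in> cell \<eta> J n c \<longrightarrow> x \<in> cell \<eta> J n c' \<longrightarrow> c = c'"
proof -
  have "\<forall>\<^sub>F n in sequentially. \<forall>d\<in>D. \<forall>d'\<in>D. d \<noteq> d' \<longrightarrow> 2 * (real J * \<eta>) / real n < \<bar>d - d'\<bar>"
  proof (intro eventually_ball_finite D_fin ballI)
    fix d d' assume "d \<in> D" "d' \<in> D"
    have "(\<lambda>n. 2 * (real J * \<eta>) / real n) \<longlonglongrightarrow> 0" by (rule lim_const_over_n)
    then have "d \<noteq> d' \<Longrightarrow> \<forall>\<^sub>F n in sequentially. 2 * (real J * \<eta>) / real n < \<bar>d - d'\<bar>"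
      by (rule order_tendstoD(2)) simp
    then show "\<forall>\<^sub>F n in sequentially. d \<noteq> d' \<longrightarrow> 2 * (real J * \<eta>) / real n < \<bar>d - d'\<bar>" by (cases "d = d'") auto
  qed
  then show ?thesis using eventually_gt_at_top[of 0]
  proof eventually_elim
    case (elim n)
    show ?case
    proof (intro allI ballI impI)
      fix x c c' assume c: "c \<in> D \<times> {..<2*J}" "c' \<in> D \<times> {..<2*J}" and x: "x \<in> cell \<eta> J n c" "x \<in> cell \<eta> J n c'"
      have rng: "- (real J * \<eta>) / real n \<le> x - fst c" "x - fst c < (real J * \<eta>) / real n"
        if "c \<in> D \<times> {..<2*J}" "x \<in> cell \<eta> J n c" for c
      proof -
        have bnd: "- (real J * \<eta>) \<le> cell_left \<eta> J (snd c)" "cell_left \<eta> J (Suc (snd c)) \<le> real J * \<eta>"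
          using cell_left_mono[OF \<eta>, of 0 "snd c" J] cell_left_mono[OF \<eta>, of "Suc (snd c)" "2 * J" J] that(1)
          by (auto simp: cell_left_def algebra_simps)
        then have "- (real J * \<eta>) / real n \<le> cell_left \<eta> J (snd c) / real n" "cell_left \<eta> J (Suc (snd c)) / real n \<le> (real J * \<eta>) / real n"
          using divide_right_mono[OF bnd(1), of "real n"] divide_right_mono[OF bnd(2), of "real n"] by simp_all
        then show "- (real J * \<eta>) / real n \<le> x - fst c" "x - fst c < (real J * \<eta>) / real n"
          using that(2) unfolding cell_def by auto
      qed
      have gen: "\<bar>a - b\<bar> \<le> 2 * y" if "- y \<le> x - a" "x - a < y" "- y \<le> x - b" "x - b < y" for a b y
        using that by linarith
      have "\<bar>fst c - fst c'\<bar> \<le> 2 * (real J * \<eta> / real n)"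
        using rng[OF c(1) x(1)] rng[OF c(2) x(2)] by (intro gen) simp_all
      then have "\<bar>fst c - fst c'\<bar> \<le> 2 * (real J * \<eta>) / real n" by simp
      then have d: "fst c = fst c'" using elim(1) c by (metis SigmaE fst_conv not_less)
      have "snd c = snd c'"
      proof (rule ccontr)
        assume "snd c \<noteq> snd c'"
        have "False" if "Suc (snd b) \<le> snd b'" "fst b = fst b'" "x \<in> cell \<eta> J n b" "x \<in> cell \<eta> J n b'" for b b'
        proof -
          have "cell_left \<eta> J (Suc (snd b)) / real n \<le> cell_left \<eta> J (snd b') / real n"
            using cell_left_mono[OF \<eta> that(1)] by (intro divide_right_mono) auto
          then show False using that unfolding cell_def by auto
        qed
        from this[of c c'] this[of c' c] d x \<open>snd c \<noteq> snd c'\<close> show False by linarith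
      qed
      with d show "c = c'" by (rule prod_eqI)
    qed
  qed
qed

lemma cell_probability:
  assumes \<eta>: "0 < \<eta>" and c: "c \<in> D \<times> {..<2*J}"
  shows "(\<lambda>n. real n * prob {\<omega>\<in>space M. X i \<omega> \<in> cell \<eta> J n c}) \<longlonglongrightarrow> lam (fst c) * \<eta>"
proof (rule LIMSEQ_I)
  fix e :: real assume e: "0 < e"
  obtain s where s: "0 < s" and w: "\<And>d a b i. d \<in> D \<Longrightarrow> d - s \<le> a \<Longrightarrow> a \<le> b \<Longrightarrow> b \<le> d + s \<Longrightarrow>
      \<bar>prob {\<omega>\<in>space M. X i \<omega> \<in> {a..<b}} - lam d * (b - a)\<bar> \<le> e / (2 * \<eta>) * (b - a)"
    using window_probability[of "e / (2 * \<eta>)"] e \<eta> by auto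
  have "(\<lambda>n. real J * \<eta> / real n) \<longlonglongrightarrow> 0" by (rule lim_const_over_n)
  then have "\<forall>\<^sub>F n in sequentially. real J * \<eta> / real n < s" using s by (rule order_tendstoD(2))
  then have "\<forall>\<^sub>F n in sequentially. norm (real n * prob {\<omega>\<in>space M. X i \<omega> \<in> cell \<eta> J n c} - lam (fst c) * \<eta>) < e"
    using eventually_gt_at_top[of 0]
  proof eventually_elim
    case (elim n)
    let ?a = "fst c + cell_left \<eta> J (snd c) / real n" and ?b = "fst c + cell_left \<eta> J (Suc (snd c)) / real n"
    have bnd: "- (real J * \<eta>) \<le> cell_left \<eta> J (snd c)" "cell_left \<eta> J (Suc (snd c)) \<le> real J * \<eta>"
      using cell_left_mono[OF \<eta>, of 0 "snd c" J] cell_left_mono[OF \<eta>, of "Suc (snd c)" "2 * J" J] c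
      by (auto simp: cell_left_def algebra_simps)
    then have "- (real J * \<eta>) / real n \<le> cell_left \<eta> J (snd c) / real n" "cell_left \<eta> J (Suc (snd c)) / real n \<le> (real J * \<eta>) / real n"
      using divide_right_mono[OF bnd(1), of "real n"] divide_right_mono[OF bnd(2), of "real n"] by simp_all
    then have rng: "fst c - s \<le> ?a" "?b \<le> fst c + s" using elim(1) by auto
    have ba: "?b - ?a = \<eta> / real n" by (simp add: cell_left_Suc diff_divide_distrib[symmetric])
    then have "?a \<le> ?b" using \<eta> elim(2) by (smt (verit) divide_pos_pos of_nat_0_less_iff)
    from w[OF _ rng(1) this rng(2), of i] c
    have "\<bar>prob {\<omega>\<in>space M. X i \<omega> \<in> cell \<eta> J n c} - lam (fst c) * (\<eta> / real n)\<bar> \<le> e / (2 * \<eta>) * (\<eta> / real n)"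
      unfolding ba cell_def by auto
    then have "real n * \<bar>prob {\<omega>\<in>space M. X i \<omega> \<in> cell \<eta> J n c} - lam (fst c) * (\<eta> / real n)\<bar> \<le> real n * (e / (2 * \<eta>) * (\<eta> / real n))"
      by (intro mult_left_mono) auto
    also have "real n * (e / (2 * \<eta>) * (\<eta> / real n)) = e / 2" using \<eta> elim(2) by simp
    also have "real n * \<bar>prob {\<omega>\<in>space M. X i \<omega> \<in> cell \<eta> J n c} - lam (fst c) * (\<eta> / real n)\<bar> =
        \<bar>real n * (prob {\<omega>\<in>space M. X i \<omega> \<in> cell \<eta> J n c} - lam (fst c) * (\<eta> / real n))\<bar>" by (simp add: abs_mult)
    also have "real n * (prob {\<omega>\<in>space M. X i \<omega> \<in> cell \<eta> J n c} - lam (fst c) * (\<eta> / real n)) =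
        real n * prob {\<omega>\<in>space M. X i \<omega> \<in> cell \<eta> J n c} - lam (fst c) * \<eta>" using elim(2) by (simp add: right_diff_distrib)
    finally show ?case using e by simp
  qed
  then show "\<exists>N. \<forall>n\<ge>N. norm (real n * prob {\<omega>\<in>space M. X i \<omega> \<in> cell \<eta> J n c} - lam (fst c) * \<eta>) < e"
    by (simp add: eventually_sequentially)
qed

text \<open>Eventually the label just decides membership in a cell, so \<open>n\<close> times its
  probability tends to \<open>lam (fst c) * \<eta>\<close>. Symmetry of the marks gives the same
  mark law on both sides of the jump.\<close>

lemma cell_sums_limit:
  assumes \<eta>: "0 < \<eta>" and J: "0 < J" and b: "b \<le> 2 * J" and p: "0 < p"
  shows "\<forall>\<^sub>F n in sequentially. prob {\<omega>\<in>space M. cell_sums \<eta> J n \<omega> \<in> near_minimum D J a b e} \<le>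
     measure (\<Pi>\<^sub>M c\<in>D \<times> {..<2*J}. compound_Poisson (lam (fst c) * \<eta>)
        (distr M borel (\<lambda>\<omega>. L (Z 0 \<omega> + \<delta> (fst c)) - L (Z 0 \<omega>)))) (near_minimum D J a b e) + p"
  unfolding cell_sums_def
proof (rule cell_sums_limsup[where p="\<lambda>n c. prob {\<omega>\<in>space M. label \<eta> J n (X 0 \<omega>) = Some c}", OF XZ_indep])
  show "finite (D \<times> {..<2*J})" "D \<times> {..<2*J} \<noteq> {}" using D_fin D_ne J by (auto simp: lessThan_empty_iff)
  show "label \<eta> J n \<in> measurable borel (count_space UNIV)" for n by (rule label_measurable)
  show "label \<eta> J n x = Some c \<Longrightarrow> c \<in> D \<times> {..<2*J}" for n x c by (simp only: label_eq_Some_iff)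
  show "cell_mark J c \<in> borel_measurable borel" for c by (rule cell_mark_measurable)
  show "distr M borel (\<lambda>\<omega>. cell_mark J c (Z i \<omega>)) = distr M borel (\<lambda>\<omega>. L (Z 0 \<omega> + \<delta> (fst c)) - L (Z 0 \<omega>))" for i c
    unfolding cell_mark_def by (rule mark_sym_distr) auto
  show "near_minimum D J a b e \<in> sets (\<Pi>\<^sub>M c\<in>D \<times> {..<2*J}. borel)" by (rule near_minimum_sets[OF D_fin b])
  show "0 < p" by fact
  show "prob {\<omega>\<in>space M. label \<eta> J n (X i \<omega>) = Some c} = prob {\<omega>\<in>space M. label \<eta> J n (X 0 \<omega>) = Some c}" for n i c
  proof -
    have "label \<eta> J n -` {Some c} \<in> sets borel" using measurable_sets[OF label_measurable, of "{Some c}" \<eta> J n] by simp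
    then have "prob (X i -` (label \<eta> J n -` {Some c}) \<inter> space M) = measure (distr M borel (X i)) (label \<eta> J n -` {Some c})" for i
      by (simp add: measure_distr)
    then have "prob (X i -` (label \<eta> J n -` {Some c}) \<inter> space M) = prob (X 0 -` (label \<eta> J n -` {Some c}) \<inter> space M)"
      by (simp only: X_ident[of i])
    moreover have "{\<omega>\<in>space M. label \<eta> J n (X i \<omega>) = Some c} = X i -` (label \<eta> J n -` {Some c}) \<inter> space M" for i by auto
    ultimately show ?thesis by simp
  qed
  fix c assume c: "c \<in> D \<times> {..<2*J}"
  show "(\<lambda>n. real n * prob {\<omega>\<in>space M. label \<eta> J n (X 0 \<omega>) = Some c}) \<longlonglongrightarrow> lam (fst c) * \<eta>"
  proof (rule Lim_transform_eventually[OF cell_probability[OF \<eta> c, of 0]])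
    show "\<forall>\<^sub>F n in sequentially. real n * prob {\<omega>\<in>space M. X 0 \<omega> \<in> cell \<eta> J n c} = real n * prob {\<omega>\<in>space M. label \<eta> J n (X 0 \<omega>) = Some c}"
      using cells_separate[OF \<eta>, of J]
    proof eventually_elim
      case (elim n)
      then have "label \<eta> J n x = Some c \<longleftrightarrow> x \<in> cell \<eta> J n c" for x using c unfolding label_eq_Some_iff by blast
      then show ?case by simp
    qed
  qed
qed

end

section \<open>From the sample risk to grid values\<close>

context template_sample begin

text \<open>One extra unit per jump turns the asymptotic cell intensities into strict bounds for
  large \<open>n\<close>.\<close>

definition intensity_bound :: real where
  "intensity_bound = (\<Sum>d\<in>D. lam d + 1)"

text \<open>Union bound over the \<open>2 * J\<close> time cells and at most \<open>n * n\<close>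
  ordered pairs of points, each pair colliding with probability at most
  \<open>(intensity_bound * \<eta> / n)\<^sup>2\<close>. Points at different jumps count as
  colliding when their time indices agree, since both would move the risk within one time
  cell.\<close>

lemma no_collision:
  assumes \<eta>: "0 < \<eta>"
  shows "\<forall>\<^sub>F n in sequentially. \<exists>A\<in>events. prob A \<le> 2 * real J * (intensity_bound * \<eta>)\<^sup>2 \<and>
    (\<forall>\<omega>\<in>space M - A. \<forall>i<2*J. \<forall>k<n. \<forall>k'<n. \<forall>d\<in>D. \<forall>d'\<in>D. X k \<omega> \<in> cell \<eta> J n (d, i) \<longrightarrow> X k' \<omega> \<in> cell \<eta> J n (d', i) \<longrightarrow> k = k')"
proof -
  have "\<forall>\<^sub>F n in sequentially. \<forall>c\<in>D \<times> {..<2*J}. real n * prob {\<omega>\<in>space M. X 0 \<omega> \<in> cell \<eta> J n c} < (lam (fst c) + 1) * \<eta>"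
  proof (intro eventually_ball_finite ballI)
    fix c assume c: "c \<in> D \<times> {..<2*J}"
    show "\<forall>\<^sub>F n in sequentially. real n * prob {\<omega>\<in>space M. X 0 \<omega> \<in> cell \<eta> J n c} < (lam (fst c) + 1) * \<eta>"
      using \<eta> by (intro order_tendstoD(2)[OF cell_probability[OF \<eta> c]]) (simp add: distrib_right)
  qed (use D_fin in simp)
  then show ?thesis using eventually_gt_at_top[of 0]
  proof eventually_elim
    case (elim n)
    define S where "S i = (\<Union>d\<in>D. cell \<eta> J n (d, i))" for i
    have S[measurable]: "S i \<in> sets borel" for i unfolding S_def by (rule sets.finite_UN) (use D_fin cell_sets in auto)
    have pS: "prob {\<omega>\<in>space M. X k \<omega> \<in> S i} \<le> intensity_bound * \<eta> / real n" if i: "i < 2 * J" for i k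
    proof -
      have "{\<omega>\<in>space M. X k \<omega> \<in> S i} = X k -` S i \<inter> space M" by auto
      then have "prob {\<omega>\<in>space M. X k \<omega> \<in> S i} = measure (distr M borel (X k)) (S i)" by (simp add: measure_distr)
      also have "\<dots> = measure (distr M borel (X 0)) (S i)" by (simp only: X_ident[of k])
      also have "\<dots> = prob (\<Union>d\<in>D. {\<omega>\<in>space M. X 0 \<omega> \<in> cell \<eta> J n (d, i)})"
        by (subst measure_distr[OF X_meas S]) (auto simp: S_def intro!: arg_cong[where f=prob])
      also have "\<dots> \<le> (\<Sum>d\<in>D. prob {\<omega>\<in>space M. X 0 \<omega> \<in> cell \<eta> J n (d, i)})"
        using cell_sets D_fin by (intro finite_measure_subadditive_finite) auto
      also have "\<dots> \<le> (\<Sum>d\<in>D. (lam d + 1) * \<eta> / real n)"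
      proof (rule sum_mono)
        fix d assume "d \<in> D"
        then have "real n * prob {\<omega>\<in>space M. X 0 \<omega> \<in> cell \<eta> J n (d, i)} < (lam d + 1) * \<eta>" using elim(1) i by fastforce
        then show "prob {\<omega>\<in>space M. X 0 \<omega> \<in> cell \<eta> J n (d, i)} \<le> (lam d + 1) * \<eta> / real n"
          using elim(2) by (simp add: field_simps)
      qed
      also have "\<dots> = intensity_bound * \<eta> / real n" by (simp add: intensity_bound_def sum_distrib_right sum_divide_distrib)
      finally show ?thesis .
    qed
    let ?P = "{(k, k'). k < n \<and> k' < n \<and> k \<noteq> k'}"
    have finP: "finite ?P" by (rule finite_subset[of _ "{..<n} \<times> {..<n}"]) auto
    have cardP: "card ?P \<le> n * n"
      using card_mono[of "{..<n} \<times> {..<n}" ?P] by (auto simp: subset_eq)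
    define E where "E i kk = {\<omega>\<in>space M. X (fst kk) \<omega> \<in> S i \<and> X (snd kk) \<omega> \<in> S i}" for i kk
    have E[measurable]: "E i kk \<in> events" for i kk unfolding E_def by measurable
    have pE: "prob (E i kk) \<le> (intensity_bound * \<eta> / real n)\<^sup>2" if i: "i < 2 * J" and kk: "kk \<in> ?P" for i kk
    proof -
      obtain k k' where [simp]: "kk = (k, k')" and ne: "k \<noteq> k'" using kk by auto
      have "E i kk = (\<Inter>j\<in>{k, k'}. X j -` S i \<inter> space M)" by (auto simp: E_def)
      also have "prob \<dots> = (\<Prod>j\<in>{k, k'}. prob (X j -` S i \<inter> space M))"
        by (intro indep_varsD[OF indep_vars_Inl[OF XZ_indep]]) auto
      also have "\<dots> = prob {\<omega>\<in>space M. X k \<omega> \<in> S i} * prob {\<omega>\<in>space M. X k' \<omega> \<in> S i}"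
        using ne by (simp add: vimage_def Int_def conj_commute)
      also have "\<dots> \<le> (intensity_bound * \<eta> / real n) * (intensity_bound * \<eta> / real n)"
        using pS[OF i] by (intro mult_mono) (auto intro: order_trans[OF measure_nonneg])
      finally show ?thesis by (simp add: power2_eq_square)
    qed
    define A where "A = (\<Union>i\<in>{..<2*J}. \<Union>kk\<in>?P. E i kk)"
    have Am: "A \<in> events" unfolding A_def using finP by (intro sets.finite_UN) auto
    have "prob A \<le> (\<Sum>i\<in>{..<2*J}. prob (\<Union>kk\<in>?P. E i kk))"
      unfolding A_def using finP by (intro finite_measure_subadditive_finite) (auto intro!: sets.finite_UN)
    also have "\<dots> \<le> (\<Sum>i\<in>{..<2*J}. (intensity_bound * \<eta>)\<^sup>2)"
    proof (rule sum_mono)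
      fix i assume i: "i \<in> {..<2*J}"
      have "prob (\<Union>kk\<in>?P. E i kk) \<le> (\<Sum>kk\<in>?P. prob (E i kk))"
        using finP by (intro finite_measure_subadditive_finite) auto
      also have "\<dots> \<le> (\<Sum>kk\<in>?P. (intensity_bound * \<eta> / real n)\<^sup>2)" using i by (intro sum_mono pE) auto
      also have "\<dots> = real (card ?P) * (intensity_bound * \<eta> / real n)\<^sup>2" by simp
      also have "\<dots> \<le> real (n * n) * (intensity_bound * \<eta> / real n)\<^sup>2" using cardP by (intro mult_right_mono) (auto simp only: of_nat_le_iff zero_le_power2)
      also have "\<dots> = (intensity_bound * \<eta>)\<^sup>2" using elim(2) by (simp add: power2_eq_square)
      finally show "prob (\<Union>kk\<in>?P. E i kk) \<le> (intensity_bound * \<eta>)\<^sup>2" .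
    qed
    also have "\<dots> = 2 * real J * (intensity_bound * \<eta>)\<^sup>2" by simp
    finally have PA: "prob A \<le> 2 * real J * (intensity_bound * \<eta>)\<^sup>2" .
    show ?case
    proof (intro bexI[OF _ Am] conjI PA ballI allI impI, rule ccontr)
      fix \<omega> i k k' d d' assume *: "\<omega> \<in> space M - A" "i < 2*J" "k < n" "k' < n" "d \<in> D" "d' \<in> D"
        "X k \<omega> \<in> cell \<eta> J n (d, i)" "X k' \<omega> \<in> cell \<eta> J n (d', i)" "k \<noteq> k'"
      then have "\<omega> \<in> E i (k, k')" by (auto simp: E_def S_def)
      then have "\<omega> \<in> A" using * unfolding A_def by blast
      then show False using * by auto
    qed
  qed
qed

lemma jump_part_side:
  assumes "\<sigma> = 1 \<or> \<sigma> = -1" "0 \<le> r"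
  shows "jump_part n \<omega> (\<sigma> * r) = (\<Sum>i<n. \<Sum>d\<in>D. indicator (win d (\<sigma> * r)) (X i \<omega>) * mark d \<sigma> (Z i \<omega>))"
proof (cases "r = 0")
  case True
  then show ?thesis by (simp add: jump_part_def win_def)
next
  case False
  then have "sgn (\<sigma> * r) = \<sigma>" using assms by (auto simp: sgn_mult)
  then show ?thesis by (simp add: jump_part_def)
qed

definition grid_win :: "real \<Rightarrow> nat \<Rightarrow> nat \<Rightarrow> real \<Rightarrow> nat \<Rightarrow> real set" where
  "grid_win \<eta> J n d j = win d (cell_left \<eta> J j / real n)"

lemma indicator_ivl_add:
  fixes a b c x :: real
  shows "a \<le> b \<Longrightarrow> b \<le> c \<Longrightarrow> indicator {a..<b} x + indicator {b..<c} x = (indicator {a..<c} x :: real)"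
  by (auto simp: indicator_def)

lemma sum_indicator_cells:
  assumes \<eta>: "0 < \<eta>"
  shows "(\<Sum>i\<in>(if j < J then {j..<J} else {J..<j}). indicator (cell \<eta> J n (d, i)) x :: real) = indicator (grid_win \<eta> J n d j) x"
proof (cases "j < J")
  case False
  have "J \<le> j \<Longrightarrow> (\<Sum>i\<in>{J..<j}. indicator (cell \<eta> J n (d, i)) x :: real) = indicator {d..<d + cell_left \<eta> J j / real n} x"
  proof (induction j rule: dec_induct)
    case (step j)
    have "0 \<le> cell_left \<eta> J j / real n" "cell_left \<eta> J j / real n \<le> cell_left \<eta> J (Suc j) / real n"
      using cell_left_mono[OF \<eta>, of J j J] cell_left_mono[OF \<eta>, of j "Suc j" J] step by (auto intro!: divide_right_mono)
    moreover have "(\<Sum>i\<in>{J..<Suc j}. indicator (cell \<eta> J n (d, i)) x :: real) =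
        indicator {d..<d + cell_left \<eta> J j / real n} x + indicator (cell \<eta> J n (d, j)) x"
      using step by (simp add: sum.atLeastLessThan_Suc)
    moreover have "d \<le> d + cell_left \<eta> J j / real n" "d + cell_left \<eta> J j / real n \<le> d + cell_left \<eta> J (Suc j) / real n"
      using calculation(1,2) by linarith+
    ultimately show ?case by (simp only: cell_def fst_conv snd_conv indicator_ivl_add)
  qed simp
  moreover have "0 \<le> cell_left \<eta> J j / real n" using cell_left_mono[OF \<eta>, of J j J] False by (intro divide_nonneg_nonneg) auto
  ultimately show ?thesis using False by (simp add: grid_win_def win_def)
next
  case True
  have "j \<le> J \<Longrightarrow> (\<Sum>i\<in>{j..<J}. indicator (cell \<eta> J n (d, i)) x :: real) = indicator {d + cell_left \<eta> J j / real n..<d} x"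
  proof (induction j rule: inc_induct)
    case (step j)
    have "cell_left \<eta> J (Suc j) / real n \<le> 0" "cell_left \<eta> J j / real n \<le> cell_left \<eta> J (Suc j) / real n"
      using cell_left_mono[OF \<eta>, of "Suc j" J J] cell_left_mono[OF \<eta>, of j "Suc j" J] step
      by (auto intro!: divide_right_mono divide_nonpos_nonneg)
    moreover have "(\<Sum>i\<in>{j..<J}. indicator (cell \<eta> J n (d, i)) x :: real) =
        indicator (cell \<eta> J n (d, j)) x + indicator {d + cell_left \<eta> J (Suc j) / real n..<d} x"
      using step by (simp add: sum.atLeast_Suc_lessThan)
    moreover have "d + cell_left \<eta> J (Suc j) / real n \<le> d" "d + cell_left \<eta> J j / real n \<le> d + cell_left \<eta> J (Suc j) / real n"
      using calculation(1,2) by linarith+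
    ultimately show ?case by (simp only: cell_def fst_conv snd_conv indicator_ivl_add)
  qed simp
  moreover have "cell_left \<eta> J j / real n \<le> 0" using cell_left_mono[OF \<eta>, of j J J] True by (auto intro!: divide_nonpos_nonneg)
  ultimately show ?thesis using True by (simp add: grid_win_def win_def)
qed

text \<open>The cells between a jump and a grid time tile the window of that jump, so interchanging
  sums turns cell sums into window indicators.\<close>

lemma jump_part_grid_value:
  assumes \<eta>: "0 < \<eta>" and j: "j \<le> 2 * J"
    and sep: "\<forall>x. \<forall>c\<in>D \<times> {..<2*J}. \<forall>c'\<in>D \<times> {..<2*J}. x \<in> cell \<eta> J n c \<longrightarrow> x \<in> cell \<eta> J n c' \<longrightarrow> c = c'"
  shows "grid_value D J (cell_sums \<eta> J n \<omega>) j =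
    (\<Sum>k<n. \<Sum>d\<in>D. indicator (grid_win \<eta> J n d j) (X k \<omega>) * mark d (if j < J then - 1 else 1) (Z k \<omega>))"
proof -
  let ?I = "if j < J then {j..<J} else {J..<j}"
  let ?\<sigma> = "if j < J then - 1 else 1 :: real"
  have cs: "cell_sums \<eta> J n \<omega> (d, i) = (\<Sum>k<n. indicator (cell \<eta> J n (d, i)) (X k \<omega>) * mark d ?\<sigma> (Z k \<omega>))"
    if "d \<in> D" "i \<in> ?I" for d i
  proof -
    have c: "(d, i) \<in> D \<times> {..<2*J}" using that j by (auto split: if_splits)
    have "label \<eta> J n x = Some (d, i) \<longleftrightarrow> x \<in> cell \<eta> J n (d, i)" for x using sep c unfolding label_eq_Some_iff by blast
    moreover have "cell_mark J (d, i) = mark d ?\<sigma>" using that by (auto simp: cell_mark_def split: if_splits)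
    moreover have "cell_sums \<eta> J n \<omega> (d, i) = (\<Sum>k<n. if label \<eta> J n (X k \<omega>) = Some (d, i) then cell_mark J (d, i) (Z k \<omega>) else 0)"
      unfolding cell_sums_def by (rule restrict_apply'[OF c])
    ultimately show ?thesis by (simp only: indicator_def of_bool_def if_distrib[of "\<lambda>z. z * _"] mult_1_left mult_zero_left cong: if_cong)
  qed
  have "grid_value D J (cell_sums \<eta> J n \<omega>) j =
      (\<Sum>d\<in>D. \<Sum>i\<in>?I. \<Sum>k<n. indicator (cell \<eta> J n (d, i)) (X k \<omega>) * mark d ?\<sigma> (Z k \<omega>))"
    unfolding grid_value_def by (intro sum.cong refl cs) auto
  also have "\<dots> = (\<Sum>d\<in>D. \<Sum>k<n. (\<Sum>i\<in>?I. indicator (cell \<eta> J n (d, i)) (X k \<omega>)) * mark d ?\<sigma> (Z k \<omega>))"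
    unfolding sum_distrib_right by (intro sum.cong refl sum.swap)
  also have "\<dots> = (\<Sum>k<n. \<Sum>d\<in>D. indicator (grid_win \<eta> J n d j) (X k \<omega>) * mark d ?\<sigma> (Z k \<omega>))"
    unfolding sum_indicator_cells[OF \<eta>] by (rule sum.swap)
  finally show ?thesis .
qed

text \<open>With at most one sample point per time cell the jump part takes on that cell only its two grid values.\<close>
lemma jump_part_between_grid:
  assumes \<eta>: "0 < \<eta>" and i: "i < 2 * J" and n: "0 < n"
    and sep: "\<forall>x. \<forall>c\<in>D \<times> {..<2*J}. \<forall>c'\<in>D \<times> {..<2*J}. x \<in> cell \<eta> J n c \<longrightarrow> x \<in> cell \<eta> J n c' \<longrightarrow> c = c'"
    and nc: "\<forall>k<n. \<forall>k'<n. \<forall>d\<in>D. \<forall>d'\<in>D. X k \<omega> \<in> cell \<eta> J n (d, i) \<longrightarrow> X k' \<omega> \<in> cell \<eta> J n (d', i) \<longrightarrow> k = k'"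
    and t: "t \<in> {cell_left \<eta> J i..cell_left \<eta> J (Suc i)}"
  shows "\<exists>j\<in>{i, Suc i}. jump_part n \<omega> (t / real n) = grid_value D J (cell_sums \<eta> J n \<omega>) j"
proof -
  define \<sigma> where "\<sigma> = (if i < J then - 1 else 1 :: real)"
  \<comment> \<open>\<open>lo\<close> and \<open>hi\<close> are the ends of the cell nearer to and
    farther from the origin.\<close>
  define lo where "lo = (if i < J then Suc i else i)"
  define hi where "hi = (if i < J then i else Suc i)"
  let ?T = "\<lambda>d. win d (t / real n)"
  let ?G = "grid_win \<eta> J n"
  have cl: "cell_left \<eta> J i / real n \<le> t / real n" "t / real n \<le> cell_left \<eta> J (Suc i) / real n"
    using t by (auto intro!: divide_right_mono)
  have sgn: "if i < J then cell_left \<eta> J (Suc i) / real n \<le> 0 else 0 \<le> cell_left \<eta> J i / real n"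
    using cell_left_mono[OF \<eta>, of "Suc i" J J] cell_left_mono[OF \<eta>, of J i J] by (auto intro!: divide_nonpos_nonneg)
  have incl: "?G d lo \<subseteq> ?T d" "?T d \<subseteq> ?G d hi" "?G d hi - ?G d lo = cell \<eta> J n (d, i)" for d
    using cl sgn by (auto simp: grid_win_def win_def lo_def hi_def cell_def split: if_splits)
  have jt: "jump_part n \<omega> (t / real n) = (\<Sum>k<n. \<Sum>d\<in>D. indicator (?T d) (X k \<omega>) * mark d \<sigma> (Z k \<omega>))"
  proof -
    have "t / real n = \<sigma> * \<bar>t / real n\<bar>" 
    proof (cases "i < J")
      case True
      then have "cell_left \<eta> J (Suc i) / real n \<le> 0" using sgn by (simp only: if_True)
      then have "t / real n \<le> 0" using cl(2) by (rule order_trans[rotated])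
      then show ?thesis using True by (simp only: \<sigma>_def if_True abs_of_nonpos mult_minus1 minus_minus)
    next
      case False
      then have "0 \<le> cell_left \<eta> J i / real n" using sgn by (simp only: if_False)
      then have "0 \<le> t / real n" using cl(1) by (rule order_trans)
      then show ?thesis using False by (simp only: \<sigma>_def if_False abs_of_nonneg mult_1)
    qed
    then have e: "\<sigma> * \<bar>t / real n\<bar> = t / real n" by (rule sym)
    have "\<sigma> = 1 \<or> \<sigma> = - 1" by (simp add: \<sigma>_def)
    from jump_part_side[OF this abs_ge_zero, of n \<omega> "t / real n"] show ?thesis unfolding e .
  qed
  have gj: "grid_value D J (cell_sums \<eta> J n \<omega>) j = (\<Sum>k<n. \<Sum>d\<in>D. indicator (?G d j) (X k \<omega>) * mark d \<sigma> (Z k \<omega>))"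
    if "j \<in> {lo, hi}" for j
  proof -
    have j2: "j \<le> 2 * J" using that i by (auto simp: lo_def hi_def split: if_splits)
    show ?thesis
    proof (cases "j = J \<and> i < J")
      \<comment> \<open>At the origin the window is empty, so the opposite sign convention of the
        grid value at \<open>J\<close> does no harm.\<close>
      case True
      then have "?G d j = {}" for d by (simp add: grid_win_def win_def)
      then show ?thesis unfolding jump_part_grid_value[OF \<eta> j2 sep] by simp
    next
      case False
      then have "(if j < J then - 1 else 1) = \<sigma>" using that by (auto simp: lo_def hi_def \<sigma>_def split: if_splits)
      then show ?thesis unfolding jump_part_grid_value[OF \<eta> j2 sep] by simp
    qed
  qed
  \<comment> \<open>Whether the only sample point of the time cell, if any, has been passed by time
    \<open>t\<close>; this selects the far or the near grid value.\<close>
  define hit where "hit = (\<exists>k<n. \<exists>d\<in>D. X k \<omega> \<in> cell \<eta> J n (d, i) \<and> X k \<omega> \<in> ?T d)"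
  define j where "j = (if hit then hi else lo)"
  have "X k \<omega> \<in> ?T d \<longleftrightarrow> X k \<omega> \<in> ?G d j" if k: "k < n" and d: "d \<in> D" for k d
  proof (cases "X k \<omega> \<in> cell \<eta> J n (d, i)")
    case False
    then show ?thesis using incl[of d] by (auto simp: j_def)
  next
    case True
    then have "X k \<omega> \<in> ?G d hi" "X k \<omega> \<notin> ?G d lo" using incl(3)[of d] by auto
    moreover have "hit \<longleftrightarrow> X k \<omega> \<in> ?T d"
    proof
      assume hit
      then obtain k' d' where k': "k' < n" "d' \<in> D" "X k' \<omega> \<in> cell \<eta> J n (d', i)" "X k' \<omega> \<in> ?T d'" by (auto simp: hit_def)
      then have "k' = k" using nc True k d by blast
      moreover have "(d', i) = (d, i)" using sep k' d True i \<open>k' = k\<close> by blast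
      ultimately show "X k \<omega> \<in> ?T d" using k'(4) by simp
    qed (use True k d in \<open>auto simp: hit_def\<close>)
    ultimately show ?thesis by (auto simp: j_def)
  qed
  then have "jump_part n \<omega> (t / real n) = grid_value D J (cell_sums \<eta> J n \<omega>) j"
    unfolding jt by (subst gj) (auto simp: j_def indicator_def intro!: sum.cong)
  moreover have "j \<in> {i, Suc i}" by (auto simp: j_def lo_def hi_def)
  ultimately show ?thesis by blast
qed

lemma cell_left_cover:
  assumes \<eta>: "0 < \<eta>" and ab: "a < b" and t: "t \<in> {cell_left \<eta> J a..cell_left \<eta> J b}"
  obtains i where "a \<le> i" "i < b" "t \<in> {cell_left \<eta> J i..cell_left \<eta> J (Suc i)}"
proof -
  have "a < b \<Longrightarrow> t \<le> cell_left \<eta> J b \<Longrightarrow> \<exists>i. a \<le> i \<and> i < b \<and> t \<in> {cell_left \<eta> J i..cell_left \<eta> J (Suc i)}" for b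
  proof (induction b)
    case (Suc b)
    show ?case
    proof (cases "a < b \<and> t \<le> cell_left \<eta> J b")
      case True
      then show ?thesis using Suc.IH by (meson less_SucI)
    next
      case False
      then have "cell_left \<eta> J b \<le> t" using Suc.prems t by (cases "a = b") auto
      then show ?thesis using Suc.prems by (intro exI[of _ b]) auto
    qed
  qed simp
  then show thesis using that ab t by auto
qed

text \<open>A true minimizer beats every grid time; replacing the risk by the jump part costs
  \<open>e\<close> at the minimizer and \<open>e\<close> at the grid time, hence the tolerance
  \<open>2 * e\<close>.\<close>

lemma local_minimum:
  assumes \<eta>: "0 < \<eta>" and J: "0 < J" and ab: "a < b" "b \<le> 2 * J" and e: "0 < e" and p: "0 < p"
  shows "\<forall>\<^sub>F n in sequentially. \<exists>A\<in>events. prob A \<le> p + 2 * real J * (intensity_bound * \<eta>)\<^sup>2 \<and>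
    (\<forall>\<omega>\<in>space M - A. \<forall>t\<in>{cell_left \<eta> J a..cell_left \<eta> J b}.
      (\<forall>s. risk n \<omega> (t / real n) \<le> risk n \<omega> s) \<longrightarrow> cell_sums \<eta> J n \<omega> \<in> near_minimum D J a b (2 * e))"
proof -
  have K: "0 < real J * \<eta>" using \<eta> J by simp
  show ?thesis
    using risk_local[OF K e p] no_collision[OF \<eta>, of J] cells_separate[OF \<eta>, of J] eventually_gt_at_top[of 0]
  proof eventually_elim
    case (elim n)
    obtain A1 where A1: "A1 \<in> events" "prob A1 \<le> p"
      "\<And>\<omega> t. \<omega> \<in> space M - A1 \<Longrightarrow> \<bar>t\<bar> \<le> real J * \<eta> \<Longrightarrow> \<bar>risk n \<omega> (t / real n) - jump_part n \<omega> (t / real n)\<bar> \<le> e"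
      using elim(1) by blast
    obtain A2 where A2: "A2 \<in> events" "prob A2 \<le> 2 * real J * (intensity_bound * \<eta>)\<^sup>2"
      "\<forall>\<omega>\<in>space M - A2. \<forall>i<2*J. \<forall>k<n. \<forall>k'<n. \<forall>d\<in>D. \<forall>d'\<in>D. X k \<omega> \<in> cell \<eta> J n (d, i) \<longrightarrow> X k' \<omega> \<in> cell \<eta> J n (d', i) \<longrightarrow> k = k'"
      using elim(2) by blast
    show ?case
    proof (intro bexI[of _ "A1 \<union> A2"] conjI ballI impI)
      show "prob (A1 \<union> A2) \<le> p + 2 * real J * (intensity_bound * \<eta>)\<^sup>2"
        using measure_Un_le[OF A1(1) A2(1)] A1(2) A2(2) by linarith
      show "A1 \<union> A2 \<in> events" using A1 A2 by auto
      fix \<omega> t assume \<omega>: "\<omega> \<in> space M - (A1 \<union> A2)" and t: "t \<in> {cell_left \<eta> J a..cell_left \<eta> J b}"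
        and min: "\<forall>s. risk n \<omega> (t / real n) \<le> risk n \<omega> s"
      have between: "\<exists>j\<in>{i, Suc i}. jump_part n \<omega> (t / real n) = grid_value D J (cell_sums \<eta> J n \<omega>) j"
        if "i < 2 * J" "t \<in> {cell_left \<eta> J i..cell_left \<eta> J (Suc i)}" for i t
        using A2(3) \<omega> that by (intro jump_part_between_grid[OF \<eta> that(1) elim(4,3) _ that(2)]) blast
      have rng: "\<bar>cell_left \<eta> J j\<bar> \<le> real J * \<eta>" if "j \<le> 2 * J" for j
        using cell_left_mono[OF \<eta>, of 0 j J] cell_left_mono[OF \<eta> that, of J] by (auto simp: cell_left_def abs_le_iff algebra_simps)
      have at_grid: "jump_part n \<omega> (cell_left \<eta> J j / real n) = grid_value D J (cell_sums \<eta> J n \<omega>) j" if "j \<le> 2 * J" for j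
      proof -
        define \<sigma> where "\<sigma> = (if j < J then - 1 else 1 :: real)"
        have "cell_left \<eta> J j / real n = \<sigma> * \<bar>cell_left \<eta> J j / real n\<bar>"
          using cell_left_neg_iff[OF \<eta>, of J j] elim(4) by (auto simp: \<sigma>_def abs_if divide_less_0_iff)
        then show ?thesis
          using jump_part_side[of \<sigma> "\<bar>cell_left \<eta> J j / real n\<bar>" n \<omega>] jump_part_grid_value[OF \<eta> that elim(3)]
          unfolding grid_win_def \<sigma>_def by (simp only:) (cases "j < J"; simp)
      qed
      obtain i where i: "a \<le> i" "i < b" "t \<in> {cell_left \<eta> J i..cell_left \<eta> J (Suc i)}"
        using cell_left_cover[OF \<eta> ab(1) t] by blast
      have i2: "i < 2 * J" using i ab by simp
      obtain j where j: "j \<in> {i, Suc i}" "jump_part n \<omega> (t / real n) = grid_value D J (cell_sums \<eta> J n \<omega>) j"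
        using between[OF i2 i(3)] by blast
      have tK: "\<bar>t\<bar> \<le> real J * \<eta>" using rng[of i] rng[of "Suc i"] i(3) i2 by (auto simp: abs_le_iff)
      have "grid_value D J (cell_sums \<eta> J n \<omega>) j \<le> grid_value D J (cell_sums \<eta> J n \<omega>) j' + 2 * e" if "j' \<le> 2 * J" for j'
      proof -
        have \<omega>1: "\<omega> \<in> space M - A1" using \<omega> by auto
        have "\<bar>risk n \<omega> (t / real n) - jump_part n \<omega> (t / real n)\<bar> \<le> e"
          "\<bar>risk n \<omega> (cell_left \<eta> J j' / real n) - jump_part n \<omega> (cell_left \<eta> J j' / real n)\<bar> \<le> e"
          using A1(3)[OF \<omega>1 tK] A1(3)[OF \<omega>1 rng[OF that]] by auto
        moreover have "risk n \<omega> (t / real n) \<le> risk n \<omega> (cell_left \<eta> J j' / real n)" using min by blast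
        ultimately show ?thesis unfolding at_grid[OF that] j(2) by linarith
      qed
      moreover have "j \<in> {a..b}" using j(1) i by auto
      moreover have "cell_sums \<eta> J n \<omega> \<in> space (\<Pi>\<^sub>M c\<in>D \<times> {..<2*J}. borel)" by (auto simp: cell_sums_def space_PiM)
      ultimately show "cell_sums \<eta> J n \<omega> \<in> near_minimum D J a b (2 * e)" unfolding near_minimum_def by blast
    qed
  qed
qed

lemma cell_sums_measurable: "(\<lambda>\<omega>. cell_sums \<eta> J n \<omega>) \<in> measurable M (\<Pi>\<^sub>M c\<in>D \<times> {..<2*J}. borel)"
proof -
  note [measurable] = label_measurable cell_mark_measurable
  show ?thesis unfolding cell_sums_def by (rule measurable_restrict) measurable
qed

text \<open>Randomness of the minimizer is harmless because the exceptional event in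
  \<open>local_minimum\<close> does not depend on the time \<open>t\<close>.\<close>

lemma minimizer_probability:
  assumes \<eta>: "0 < \<eta>" and J: "0 < J" and ab: "a < b" "b \<le> 2 * J" and e: "0 < e" and p: "0 < p"
    and \<tau>[measurable]: "\<And>n. \<tau> n \<in> borel_measurable M"
    and min: "\<And>n. 0 < n \<Longrightarrow> AE \<omega> in M. \<forall>s. risk n \<omega> (\<tau> n \<omega>) \<le> risk n \<omega> s"
  shows "\<forall>\<^sub>F n in sequentially. prob {\<omega>\<in>space M. real n * \<tau> n \<omega> \<in> {cell_left \<eta> J a..cell_left \<eta> J b}} \<le>
     measure (\<Pi>\<^sub>M c\<in>D \<times> {..<2*J}. compound_Poisson (lam (fst c) * \<eta>)
        (distr M borel (\<lambda>\<omega>. L (Z 0 \<omega> + \<delta> (fst c)) - L (Z 0 \<omega>)))) (near_minimum D J a b (2 * e))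
     + 2 * p + 2 * real J * (intensity_bound * \<eta>)\<^sup>2"
  using local_minimum[OF \<eta> J ab e p] cell_sums_limit[OF \<eta> J ab(2) p, of a "2 * e"] eventually_gt_at_top[of 0]
proof eventually_elim
  case (elim n)
  obtain A where A: "A \<in> events" "prob A \<le> p + 2 * real J * (intensity_bound * \<eta>)\<^sup>2"
    "\<And>\<omega> t. \<omega> \<in> space M - A \<Longrightarrow> t \<in> {cell_left \<eta> J a..cell_left \<eta> J b} \<Longrightarrow>
      (\<forall>s. risk n \<omega> (t / real n) \<le> risk n \<omega> s) \<Longrightarrow> cell_sums \<eta> J n \<omega> \<in> near_minimum D J a b (2 * e)"
    using elim(1) by blast
  let ?S = "{\<omega>\<in>space M. cell_sums \<eta> J n \<omega> \<in> near_minimum D J a b (2 * e)}"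
  have S: "?S \<in> events"
    using measurable_sets[OF cell_sums_measurable near_minimum_sets[OF D_fin ab(2)], of \<eta> n a "2 * e"]
    by (simp add: vimage_def Int_def conj_commute)
  have "prob {\<omega>\<in>space M. real n * \<tau> n \<omega> \<in> {cell_left \<eta> J a..cell_left \<eta> J b}} \<le> prob (A \<union> ?S)"
  proof (rule finite_measure_mono_AE)
    show "AE \<omega> in M. \<omega> \<in> {\<omega>\<in>space M. real n * \<tau> n \<omega> \<in> {cell_left \<eta> J a..cell_left \<eta> J b}} \<longrightarrow> \<omega> \<in> A \<union> ?S"
      using min[OF elim(3)] AE_space
    proof eventually_elim
      case (elim \<omega>)
      then show ?case using A(3)[of \<omega> "real n * \<tau> n \<omega>"] \<open>0 < n\<close> by auto
    qed
  qed (use A S in auto)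
  also have "\<dots> \<le> prob A + prob ?S" by (rule measure_Un_le[OF A(1) S])
  finally show ?case using A(2) elim(2) by linarith
qed

end

section \<open>Minimum points of the limit process\<close>

text \<open>The one-sided constancy points away from the origin: a point of the process takes effect
  at the moment when the path, moving outwards, reaches it.\<close>

definition step_path :: "(real \<Rightarrow> real) \<Rightarrow> bool" where
  "step_path w \<longleftrightarrow> (\<forall>K. finite (w ` {-K..K})) \<and>
    (\<forall>s\<ge>0. \<forall>\<^sub>F s' in at_right s. w s' = w s) \<and> (\<forall>s\<le>0. \<forall>\<^sub>F s' in at_left s. w s' = w s)"

lemma eventually_at_right_avoid:
  fixes T :: "real set"
  assumes "finite (T \<inter> {s..s + 1})"
  shows "\<forall>\<^sub>F s' in at_right s. T \<inter> {s<..s'} = {}"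
proof -
  have "\<forall>\<^sub>F s' in at_right s. \<forall>y\<in>T \<inter> {s..s + 1}. \<not> (s < y \<and> y \<le> s')"
  proof (rule eventually_ball_finite[OF assms], rule ballI)
    fix y assume "y \<in> T \<inter> {s..s + 1}"
    show "\<forall>\<^sub>F s' in at_right s. \<not> (s < y \<and> y \<le> s')"
    proof (cases "s < y")
      case True
      have "((\<lambda>s'. s') \<longlongrightarrow> s) (at_right s)" by (rule tendsto_ident_at)
      from order_tendstoD(2)[OF this True] show ?thesis by eventually_elim simp
    qed simp
  qed
  moreover have "\<forall>\<^sub>F s' in at_right s. s' < s + 1"
    by (rule order_tendstoD(2)[OF tendsto_ident_at]) simp
  ultimately show ?thesis by eventually_elim force
qed

lemma eventually_at_left_avoid:
  fixes T :: "real set"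
  assumes "finite (T \<inter> {s - 1..s})"
  shows "\<forall>\<^sub>F s' in at_left s. T \<inter> {s'..<s} = {}"
proof -
  have "\<forall>\<^sub>F s' in at_left s. \<forall>y\<in>T \<inter> {s - 1..s}. \<not> (y < s \<and> s' \<le> y)"
  proof (rule eventually_ball_finite[OF assms], rule ballI)
    fix y assume "y \<in> T \<inter> {s - 1..s}"
    show "\<forall>\<^sub>F s' in at_left s. \<not> (y < s \<and> s' \<le> y)"
    proof (cases "y < s")
      case True
      have "((\<lambda>s'. s') \<longlongrightarrow> s) (at_left s)" by (rule tendsto_ident_at)
      from order_tendstoD(1)[OF this True] show ?thesis by eventually_elim simp
    qed simp
  qed
  moreover have "\<forall>\<^sub>F s' in at_left s. s - 1 < s'"
    by (rule order_tendstoD(1)[OF tendsto_ident_at]) simp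
  ultimately show ?thesis by eventually_elim force
qed

lemma eventually_at_right_beyond: "\<forall>\<^sub>F s' in at_right (s::real). s < s'"
  by (simp add: eventually_at_filter)

lemma eventually_at_left_below: "\<forall>\<^sub>F s' in at_left (s::real). s' < s"
  by (simp add: eventually_at_filter)

lemma step_path_sum:
  assumes "finite D" and w: "\<And>d. d \<in> D \<Longrightarrow> step_path (w d)"
  shows "step_path (\<lambda>t. \<Sum>d\<in>D. w d t)"
  unfolding step_path_def
proof (intro conjI allI impI)
  fix K :: real
  from assms show "finite ((\<lambda>t. \<Sum>d\<in>D. w d t) ` {-K..K})"
  proof (induction D)
    case (insert d D)
    have "(\<lambda>t. \<Sum>d\<in>insert d D. w d t) ` {-K..K} \<subseteq> (\<lambda>(a, b). a + b) ` (w d ` {-K..K} \<times> (\<lambda>t. \<Sum>d\<in>D. w d t) ` {-K..K})"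
      using insert.hyps by (force simp: image_iff)
    moreover have "finite (w d ` {-K..K})" using insert.prems by (auto simp: step_path_def)
    moreover have "finite ((\<lambda>t. \<Sum>d\<in>D. w d t) ` {-K..K})" using insert by auto
    ultimately show ?case by (meson finite_SigmaI finite_imageI finite_subset)
  qed (simp add: image_constant_conv)
next
  fix s :: real assume "0 \<le> s"
  then have "\<forall>\<^sub>F s' in at_right s. \<forall>d\<in>D. w d s' = w d s"
    using w assms(1) by (intro eventually_ball_finite) (auto simp: step_path_def)
  then show "\<forall>\<^sub>F s' in at_right s. (\<Sum>d\<in>D. w d s') = (\<Sum>d\<in>D. w d s)"
    by eventually_elim simp
next
  fix s :: real assume "s \<le> 0"
  then have "\<forall>\<^sub>F s' in at_left s. \<forall>d\<in>D. w d s' = w d s"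
    using w assms(1) by (intro eventually_ball_finite) (auto simp: step_path_def)
  then show "\<forall>\<^sub>F s' in at_left s. (\<Sum>d\<in>D. w d s') = (\<Sum>d\<in>D. w d s)"
    by eventually_elim simp
qed

context prob_space begin

lemma marked_Poisson_step_path:
  assumes W: "double_sided_marked_Poisson_process \<kappa> \<mu> W" and \<omega>: "\<omega> \<in> space M"
  shows "step_path (W \<omega>)"
proof -
  obtain S \<xi> where S: "homogeneous_Poisson_process \<kappa> S"
    and W_eq: "\<And>\<omega> t. \<omega> \<in> space M \<Longrightarrow> W \<omega> t =
           (if 0 \<le> t then (\<Sum>k=1..card (S \<omega> \<inter> {0<..t}). \<xi> (int k) \<omega>)
            else (\<Sum>k=1..card (S \<omega> \<inter> {t..<0}). \<xi> (- int k) \<omega>))"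
    using W unfolding double_sided_marked_Poisson_process_def by blast
  note fin = homogeneous_Poisson_process_finite[OF S \<omega>]
  let ?p = "\<lambda>c. \<Sum>k=1..c. \<xi> (int k) \<omega>" and ?q = "\<lambda>c. \<Sum>k=1..c. \<xi> (- int k) \<omega>"
  show ?thesis
    unfolding step_path_def
  proof (intro conjI allI impI)
    fix K :: real
    have "W \<omega> t \<in> ?p ` {..card (S \<omega> \<inter> {0<..K})} \<union> ?q ` {..card (S \<omega> \<inter> {-K..<0})}" if t: "t \<in> {-K..K}" for t
    proof (cases "0 \<le> t")
      case True
      have "card (S \<omega> \<inter> {0<..t}) \<le> card (S \<omega> \<inter> {0<..K})"
        using t by (intro card_mono fin) auto
      then show ?thesis using True by (auto simp: W_eq[OF \<omega>])
    next
      case False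
      have "card (S \<omega> \<inter> {t..<0}) \<le> card (S \<omega> \<inter> {-K..<0})"
        using t by (intro card_mono fin) auto
      then show ?thesis using False by (auto simp: W_eq[OF \<omega>])
    qed
    then have "W \<omega> ` {-K..K} \<subseteq> ?p ` {..card (S \<omega> \<inter> {0<..K})} \<union> ?q ` {..card (S \<omega> \<inter> {-K..<0})}" by blast
    then show "finite (W \<omega> ` {-K..K})" by (rule finite_subset) simp
  next
    fix s :: real assume s: "0 \<le> s"
    have "\<forall>\<^sub>F s' in at_right s. S \<omega> \<inter> {s<..s'} = {}" by (rule eventually_at_right_avoid) (intro fin, simp)
    then show "\<forall>\<^sub>F s' in at_right s. W \<omega> s' = W \<omega> s"
      using eventually_at_right_beyond
    proof eventually_elim
      case (elim s')
      then have "{0<..s'} = {0<..s} \<union> {s<..s'}" using s by auto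
      then have "S \<omega> \<inter> {0<..s'} = S \<omega> \<inter> {0<..s}" using elim by auto
      then show ?case using s elim by (simp add: W_eq[OF \<omega>])
    qed
  next
    fix s :: real assume s: "s \<le> 0"
    have "\<forall>\<^sub>F s' in at_left s. S \<omega> \<inter> {s'..<s} = {}" by (rule eventually_at_left_avoid) (intro fin, simp)
    then show "\<forall>\<^sub>F s' in at_left s. W \<omega> s' = W \<omega> s"
      using eventually_at_left_below
    proof eventually_elim
      case (elim s')
      then have "{s'..<0} = {s..<0} \<union> {s'..<s}" using s by auto
      then have eq: "S \<omega> \<inter> {s'..<0} = S \<omega> \<inter> {s..<0}" using elim by auto
      show ?case
      proof (cases "s = 0")
        case True
        then have "card (S \<omega> \<inter> {s'..<0}) = 0" using eq by simp
        then show ?thesis using True elim by (simp add: W_eq[OF \<omega>])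
      next
        case False
        then show ?thesis using s elim eq by (simp add: W_eq[OF \<omega>])
      qed
    qed
  qed
qed

text \<open>Left of the origin paths are guaranteed to be constant only towards the left, but almost
  surely no point falls on the given \<open>x\<close>. This later excludes that a minimum at
  \<open>x\<close> is the last one.\<close>

lemma marked_Poisson_right_constant:
  assumes W: "double_sided_marked_Poisson_process \<kappa> \<mu> W"
  shows "AE \<omega> in M. \<forall>\<^sub>F s in at_right x. W \<omega> s = W \<omega> x"
proof (cases "0 \<le> x")
  case True
  then show ?thesis using marked_Poisson_step_path[OF W] by (auto simp: step_path_def)
next
  case False
  obtain S \<xi> where S: "homogeneous_Poisson_process \<kappa> S"
    and W_eq: "\<And>\<omega> t. \<omega> \<in> space M \<Longrightarrow> W \<omega> t =
           (if 0 \<le> t then (\<Sum>k=1..card (S \<omega> \<inter> {0<..t}). \<xi> (int k) \<omega>)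
            else (\<Sum>k=1..card (S \<omega> \<inter> {t..<0}). \<xi> (- int k) \<omega>))"
    using W unfolding double_sided_marked_Poisson_process_def by blast
  have "AE \<omega> in M. S \<omega> \<inter> {x} = {}"
    by (rule homogeneous_Poisson_process_null[OF S]) (auto simp: bounded_borel_def)
  then show ?thesis
    using AE_space
  proof eventually_elim
    case (elim \<omega>)
    have "\<forall>\<^sub>F s in at_right x. S \<omega> \<inter> {x<..s} = {}"
      by (rule eventually_at_right_avoid) (intro homogeneous_Poisson_process_finite[OF S elim(2)], simp)
    moreover have "\<forall>\<^sub>F s in at_right x. s < 0"
      using False by (intro order_tendstoD(2)[OF tendsto_ident_at]) simp
    ultimately show ?case
      using eventually_at_right_beyond
    proof eventually_elim
      fix s assume s: "S \<omega> \<inter> {x<..s} = {}" "s < 0" "x < s"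
      then have "{x..<0} = {x} \<union> {x<..<s} \<union> {s..<0}" by auto
      then have "S \<omega> \<inter> {x..<0} = S \<omega> \<inter> {s..<0}" using elim(1) s by auto
      then show "W \<omega> s = W \<omega> x" using s by (simp add: W_eq[OF elim(2)])
    qed
  qed
qed

text \<open>Upper counterpart of \<open>prob_infinitely_often_ge\<close>: the tail unions contain
  the single events and decrease to the event of infinitely many occurrences.\<close>

lemma prob_le_infinitely_often:
  assumes A[measurable]: "\<And>n. A n \<in> events" and e: "0 < e"
  shows "\<forall>\<^sub>F n in sequentially. prob (A n) \<le> prob (\<Inter>N. \<Union>n\<in>{N..}. A n) + e"
proof -
  have "(\<lambda>N. prob (\<Union>n\<in>{N..}. A n)) \<longlonglongrightarrow> prob (\<Inter>N. \<Union>n\<in>{N..}. A n)"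
    by (rule finite_Lim_measure_decseq) (fastforce simp: decseq_def)+
  then have "\<forall>\<^sub>F N in sequentially. prob (\<Union>n\<in>{N..}. A n) < prob (\<Inter>N. \<Union>n\<in>{N..}. A n) + e"
    by (rule order_tendstoD(2)) (use e in simp)
  then show ?thesis
  proof eventually_elim
    case (elim N)
    have "prob (A N) \<le> prob (\<Union>n\<in>{N..}. A n)" by (rule finite_measure_mono) auto
    then show ?case using elim by simp
  qed
qed

end

lemma cell_left_ends: "cell_left \<eta> J 0 = - (real J * \<eta>)" "cell_left \<eta> J (2 * J) = real J * \<eta>"
  by (simp_all add: cell_left_def algebra_simps)

lemma cell_left_approx_nonneg:
  assumes \<eta>: "0 < \<eta>" and s: "0 \<le> s" "s \<le> real J * \<eta>"
  obtains j where "j \<le> 2 * J" "s \<le> cell_left \<eta> J j" "cell_left \<eta> J j < s + \<eta>"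
proof
  let ?c = "nat \<lceil>s / \<eta>\<rceil>"
  have c: "s / \<eta> \<le> real ?c" "real ?c < s / \<eta> + 1"
    using s \<eta> by (auto simp: of_nat_nat divide_nonneg_pos ceiling_correct) linarith?
  have "s / \<eta> \<le> real J" using s \<eta> by (simp add: field_simps)
  then have "?c \<le> J" by (simp add: nat_le_iff ceiling_le_iff)
  then show "J + ?c \<le> 2 * J" by simp
  show "s \<le> cell_left \<eta> J (J + ?c)" "cell_left \<eta> J (J + ?c) < s + \<eta>"
    using c \<eta> by (simp_all add: cell_left_def field_simps del: of_nat_nat)
qed

lemma cell_left_approx_nonpos:
  assumes \<eta>: "0 < \<eta>" and s: "s \<le> 0" "- s \<le> real J * \<eta>"
  obtains j where "j \<le> 2 * J" "cell_left \<eta> J j \<le> s" "s - \<eta> < cell_left \<eta> J j"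
proof -
  obtain j where j: "j \<le> 2 * J" "- s \<le> cell_left \<eta> J j" "cell_left \<eta> J j < - s + \<eta>"
    using cell_left_approx_nonneg[OF \<eta>, of "- s" J] s by auto
  then have "cell_left \<eta> J (2 * J - j) = - cell_left \<eta> J j" by (simp add: cell_left_def of_nat_diff algebra_simps)
  then show ?thesis using j by (intro that[of "2 * J - j"]) auto
qed

text \<open>On a bounded window the path takes finitely many values, so a tolerance below the gap
  between the two smallest forces exact minimality. The smallest value persists for a while beyond a
  minimizer in the outward direction, so a fine grid attains it.\<close>

lemma step_path_grid_minimum:
  assumes w: "step_path w" and u: "0 < u"
  shows "\<forall>\<^sub>F m in sequentially. \<forall>j\<le>2 * (N * m).
    (\<forall>j'\<le>2 * (N * m). w (cell_left (u / real m) (N * m) j) \<le> w (cell_left (u / real m) (N * m) j') + 1 / real m) \<longrightarrow>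
    (\<forall>s\<in>{- (real N * u)..real N * u}. w (cell_left (u / real m) (N * m) j) \<le> w s)"
proof -
  let ?I = "{- (real N * u)..real N * u}"
  have fin: "finite (w ` ?I)" and ne: "?I \<noteq> {}" using w u by (auto simp: step_path_def)
  define v where "v = Min (w ` ?I)"
  have v_le: "v \<le> w s" if "s \<in> ?I" for s unfolding v_def using fin that by (intro Min_le) auto
  have "v \<in> w ` ?I" unfolding v_def using fin ne by (intro Min_in) auto
  then obtain s0 where s0: "s0 \<in> ?I" "w s0 = v" by auto
  obtain \<epsilon> where \<epsilon>: "0 < \<epsilon>" "\<And>y. y \<in> w ` ?I \<Longrightarrow> y \<noteq> v \<Longrightarrow> \<epsilon> \<le> dist v y"
    using finite_set_avoid[OF fin, of v] by auto
  have lim: "(\<lambda>m. c / real m) \<longlonglongrightarrow> 0" for c :: real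
    by (rule tendsto_divide_0[OF tendsto_const]) (intro filterlim_at_top_imp_at_infinity filterlim_real_sequentially)
  obtain \<rho> where \<rho>: "0 < \<rho>" and right: "0 \<le> s0 \<Longrightarrow> s0 \<le> s \<Longrightarrow> s < s0 + \<rho> \<Longrightarrow> w s = v"
    and left: "\<not> 0 \<le> s0 \<Longrightarrow> s \<le> s0 \<Longrightarrow> s0 - \<rho> < s \<Longrightarrow> w s = v" for s
  proof (cases "0 \<le> s0")
    case True
    then have "\<forall>\<^sub>F s in at_right s0. w s = v" using w s0 by (auto simp: step_path_def)
    then obtain b where b: "s0 < b" "\<And>y. s0 < y \<Longrightarrow> y < b \<Longrightarrow> w y = v"
      by (auto simp: eventually_at_right_field)
    show ?thesis
    proof (rule that[of "b - s0"])
      show "w s = v" if "0 \<le> s0" "s0 \<le> s" "s < s0 + (b - s0)" for s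
        using that b s0 by (cases "s = s0") auto
    qed (use b True in auto)
  next
    case False
    then have "\<forall>\<^sub>F s in at_left s0. w s = v" using w s0 by (auto simp: step_path_def)
    then obtain b where b: "b < s0" "\<And>y. b < y \<Longrightarrow> y < s0 \<Longrightarrow> w y = v"
      by (auto simp: eventually_at_left_field)
    show ?thesis
    proof (rule that[of "s0 - b"])
      show "w s = v" if "\<not> 0 \<le> s0" "s \<le> s0" "s0 - (s0 - b) < s" for s
        using that b s0 by (cases "s = s0") auto
    qed (use b False in auto)
  qed
  have "\<forall>\<^sub>F m in sequentially. 1 / real m < \<epsilon>" by (rule order_tendstoD(2)[OF lim \<epsilon>(1)])
  moreover have "\<forall>\<^sub>F m in sequentially. u / real m < \<rho>" by (rule order_tendstoD(2)[OF lim \<rho>])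
  ultimately show ?thesis
    using eventually_gt_at_top[of 0]
  proof eventually_elim
    case (elim m)
    let ?c = "cell_left (u / real m) (N * m)"
    have \<eta>: "0 < u / real m" and K: "real (N * m) * (u / real m) = real N * u" using u elim by auto
    have rng: "?c j \<in> ?I" if "j \<le> 2 * (N * m)" for j
      using cell_left_mono[OF \<eta>, of 0 j "N * m"] cell_left_mono[OF \<eta> that, of "N * m"]
      unfolding cell_left_ends K by simp
    obtain j0 where j0: "j0 \<le> 2 * (N * m)" "w (?c j0) = v"
    proof (cases "0 \<le> s0")
      case True
      obtain j where j: "j \<le> 2 * (N * m)" "s0 \<le> ?c j" "?c j < s0 + u / real m"
        using cell_left_approx_nonneg[OF \<eta> True, of "N * m"] s0(1) K by auto
      then show ?thesis using elim right[OF True, of "?c j"] by (intro that[of j]) auto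
    next
      case False
      obtain j where j: "j \<le> 2 * (N * m)" "?c j \<le> s0" "s0 - u / real m < ?c j"
        using cell_left_approx_nonpos[OF \<eta>, of s0 "N * m"] s0(1) K False by auto
      then show ?thesis using elim left[OF False, of "?c j"] by (intro that[of j]) auto
    qed
    show ?case
    proof (intro allI impI ballI)
      fix j s assume j: "j \<le> 2 * (N * m)" and le: "\<forall>j'\<le>2 * (N * m). w (?c j) \<le> w (?c j') + 1 / real m" and s: "s \<in> ?I"
      have "w (?c j) \<le> v + 1 / real m" using le j0 by auto
      moreover have "v \<le> w (?c j)" by (rule v_le[OF rng[OF j]])
      ultimately have "dist v (w (?c j)) < \<epsilon>" using elim(1) by (auto simp: dist_real_def)
      then have "w (?c j) = v" using \<epsilon>(2)[of "w (?c j)"] rng[OF j] by force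
      then show "w (?c j) \<le> w s" using v_le[OF s] by simp
    qed
  qed
qed

lemma grid_value_increments:
  assumes \<eta>: "0 < \<eta>" and j: "j \<le> 2 * J" and zero: "\<And>d. d \<in> D \<Longrightarrow> w d 0 = 0"
  shows "grid_value D J (\<lambda>c\<in>D \<times> {..<2*J}. cell_increment \<eta> J (w (fst c)) (snd c)) j = (\<Sum>d\<in>D. w d (cell_left \<eta> J j))"
  unfolding grid_value_def
proof (rule sum.cong[OF refl])
  fix d assume d: "d \<in> D"
  have "(\<Sum>i\<in>(if j < J then {j..<J} else {J..<j}). (\<lambda>c\<in>D \<times> {..<2*J}. cell_increment \<eta> J (w (fst c)) (snd c)) (d, i)) =
      (\<Sum>i\<in>(if j < J then {j..<J} else {J..<j}). cell_increment \<eta> J (w d) i)"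
    using d j by (intro sum.cong) (auto split: if_splits)
  also have "\<dots> = w d (cell_left \<eta> J j)"
  proof (cases "j < J")
    case True
    then have "(\<Sum>i\<in>{j..<J}. cell_increment \<eta> J (w d) i) = (\<Sum>i\<in>{j..<J}. - (w d (cell_left \<eta> J (Suc i)) - w d (cell_left \<eta> J i)))"
      by (intro sum.cong) (auto simp: cell_increment_def)
    also have "\<dots> = - (w d (cell_left \<eta> J J) - w d (cell_left \<eta> J j))"
      unfolding sum_negf using True by (subst sum_Suc_diff') auto
    finally show ?thesis using True zero[OF d] by simp
  next
    case False
    then have "(\<Sum>i\<in>{J..<j}. cell_increment \<eta> J (w d) i) = (\<Sum>i\<in>{J..<j}. w d (cell_left \<eta> J (Suc i)) - w d (cell_left \<eta> J i))"
      by (intro sum.cong) (auto simp: cell_increment_def)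
    also have "\<dots> = w d (cell_left \<eta> J j) - w d (cell_left \<eta> J J)"
      using False by (subst sum_Suc_diff') auto
    finally show ?thesis using False zero[OF d] by simp
  qed
  finally show "(\<Sum>i\<in>(if j < J then {j..<J} else {J..<j}). (\<lambda>c\<in>D \<times> {..<2*J}. cell_increment \<eta> J (w (fst c)) (snd c)) (d, i)) =
      w d (cell_left \<eta> J j)" .
qed

text \<open>Carries the finite-dimensional event back to paths of the superposition: the grid values
  of its increments telescope to its values at the grid times.\<close>

lemma (in prob_space) superposed_near_minimum:
  fixes a b :: nat and e :: real
  assumes D: "finite D" "D \<noteq> {}"
    and ind: "indep_vars (\<lambda>_. \<Pi>\<^sub>M t\<in>UNIV. borel) Wd D"
    and W: "\<And>d. d \<in> D \<Longrightarrow> double_sided_marked_Poisson_process (\<kappa> d) (\<mu> d) (Wd d)"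
    and \<kappa>: "\<And>d. d \<in> D \<Longrightarrow> 0 \<le> \<kappa> d" and \<mu>: "\<And>d. d \<in> D \<Longrightarrow> mark_distribution (\<mu> d)"
    and \<eta>: "0 < \<eta>" and J: "0 < J" and b: "b \<le> 2 * J"
  defines "E \<equiv> {\<omega>\<in>space M. \<exists>j\<in>{a..b}. \<forall>j'\<in>{..2*J}.
      (\<Sum>d\<in>D. Wd d \<omega> (cell_left \<eta> J j)) \<le> (\<Sum>d\<in>D. Wd d \<omega> (cell_left \<eta> J j')) + e}"
  shows "E \<in> events"
    and "measure (\<Pi>\<^sub>M c\<in>D \<times> {..<2*J}. compound_Poisson (\<kappa> (fst c) * \<eta>) (\<mu> (fst c))) (near_minimum D J a b e) = prob E"
proof -
  let ?B = "\<Pi>\<^sub>M c\<in>D \<times> {..<2*J}. borel :: real measure"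
  let ?Y = "\<lambda>\<omega>. \<lambda>c\<in>D \<times> {..<2*J}. cell_increment \<eta> J (Wd (fst c) \<omega>) (snd c)"
  have Wm: "(\<lambda>\<omega>. Wd d \<omega> t) \<in> borel_measurable M" if "d \<in> D" for d t
  proof -
    have "Wd d \<in> measurable M (\<Pi>\<^sub>M t\<in>UNIV. borel)" using ind that by (auto simp: indep_vars_def2)
    then show ?thesis by (rule measurable_compose) (rule measurable_component_singleton, simp)
  qed
  have Y: "?Y \<in> measurable M ?B"
  proof (rule measurable_restrict)
    fix c assume "c \<in> D \<times> {..<2*J}"
    then have [measurable]: "\<And>t. (\<lambda>\<omega>. Wd (fst c) \<omega> t) \<in> borel_measurable M" by (intro Wm) auto
    show "(\<lambda>\<omega>. cell_increment \<eta> J (Wd (fst c) \<omega>) (snd c)) \<in> borel_measurable M"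
      unfolding cell_increment_def by measurable
  qed
  have g: "grid_value D J (?Y \<omega>) j = (\<Sum>d\<in>D. Wd d \<omega> (cell_left \<eta> J j))" if "\<omega> \<in> space M" "j \<le> 2 * J" for \<omega> j
    using that marked_Poisson_zero[OF W that(1)] by (intro grid_value_increments[OF \<eta>]) auto
  have iff: "?Y \<omega> \<in> near_minimum D J a b e \<longleftrightarrow> \<omega> \<in> E" if \<omega>: "\<omega> \<in> space M" for \<omega>
  proof -
    have "?Y \<omega> \<in> space ?B" using measurable_space[OF Y \<omega>] .
    then have "?Y \<omega> \<in> near_minimum D J a b e \<longleftrightarrow> (\<exists>j\<in>{a..b}. \<forall>j'\<in>{..2*J}. grid_value D J (?Y \<omega>) j \<le> grid_value D J (?Y \<omega>) j' + e)"
      unfolding near_minimum_def by simp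
    also have "\<dots> \<longleftrightarrow> (\<exists>j\<in>{a..b}. \<forall>j'\<in>{..2*J}.
      (\<Sum>d\<in>D. Wd d \<omega> (cell_left \<eta> J j)) \<le> (\<Sum>d\<in>D. Wd d \<omega> (cell_left \<eta> J j')) + e)"
      using b by (intro bex_cong ball_cong refl) (simp add: g[OF \<omega>])
    finally show ?thesis unfolding E_def using \<omega> by simp
  qed
  have pre: "?Y -` near_minimum D J a b e \<inter> space M = E"
  proof (intro set_eqI iffI)
    fix \<omega> assume "\<omega> \<in> ?Y -` near_minimum D J a b e \<inter> space M"
    then show "\<omega> \<in> E" using iff[of \<omega>] by blast
  next
    fix \<omega> assume "\<omega> \<in> E"
    moreover from this have "\<omega> \<in> space M" by (simp add: E_def)
    ultimately show "\<omega> \<in> ?Y -` near_minimum D J a b e \<inter> space M" using iff[of \<omega>] by blast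
  qed
  show "E \<in> events" using measurable_sets[OF Y near_minimum_sets[OF D(1) b], of a e] unfolding pre .
  show "measure (\<Pi>\<^sub>M c\<in>D \<times> {..<2*J}. compound_Poisson (\<kappa> (fst c) * \<eta>) (\<mu> (fst c))) (near_minimum D J a b e) = prob E"
  proof -
    have "distr M ?B ?Y = (\<Pi>\<^sub>M c\<in>D \<times> {..<2*J}. compound_Poisson (\<kappa> (fst c) * \<eta>) (\<mu> (fst c)))"
      by (rule superposed_increments[OF D ind W \<kappa> \<mu> \<eta> J])
    then show ?thesis using measure_distr[OF Y near_minimum_sets[OF D(1) b], of a e] unfolding pre by (simp only:)
  qed
qed

text \<open>The mesh is refined before the window grows, so that grid minimizers are first identified with
  minimizers over a fixed window and only then with global ones.\<close>
lemma (in prob_space) near_minimum_limit: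
  fixes a b :: "nat \<Rightarrow> nat \<Rightarrow> nat"
  assumes D: "finite D" "D \<noteq> {}"
    and ind: "indep_vars (\<lambda>_. \<Pi>\<^sub>M t\<in>UNIV. borel) Wd D"
    and W: "\<And>d. d \<in> D \<Longrightarrow> double_sided_marked_Poisson_process (\<kappa> d) (\<mu> d) (Wd d)"
    and \<kappa>: "\<And>d. d \<in> D \<Longrightarrow> 0 \<le> \<kappa> d" and \<mu>: "\<And>d. d \<in> D \<Longrightarrow> mark_distribution (\<mu> d)"
    and u: "0 < u" and b: "\<And>N m. 0 < N \<Longrightarrow> 0 < m \<Longrightarrow> b N m \<le> 2 * (N * m)"
    and I: "\<And>N m j. 0 < N \<Longrightarrow> 0 < m \<Longrightarrow> j \<in> {a N m..b N m} \<Longrightarrow> cell_left (u / real m) (N * m) j \<in> I"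
    and ne: "AE \<omega> in M. minimum_points (\<lambda>t. \<Sum>d\<in>D. Wd d \<omega> t) \<noteq> {}"
    and E: "E \<in> events" "AE \<omega> in M. minimum_points (\<lambda>t. \<Sum>d\<in>D. Wd d \<omega> t) \<inter> I \<noteq> {} \<longrightarrow> \<omega> \<in> E"
    and e: "0 < e"
  shows "\<forall>\<^sub>F N in sequentially. \<forall>\<^sub>F m in sequentially.
    measure (\<Pi>\<^sub>M c\<in>D \<times> {..<2*(N*m)}. compound_Poisson (\<kappa> (fst c) * (u / real m)) (\<mu> (fst c)))
      (near_minimum D (N * m) (a N m) (b N m) (1 / real m)) \<le> prob E + e"
proof -
  define w where "w \<omega> t = (\<Sum>d\<in>D. Wd d \<omega> t)" for \<omega> t
  define A where "A N m = (if 0 < N \<and> 0 < m then {\<omega>\<in>space M. \<exists>j\<in>{a N m..b N m}. \<forall>j'\<in>{..2*(N*m)}.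
      w \<omega> (cell_left (u / real m) (N * m) j) \<le> w \<omega> (cell_left (u / real m) (N * m) j') + 1 / real m} else {})" for N m
  have A: "A N m \<in> events" "0 < N \<Longrightarrow> 0 < m \<Longrightarrow>
    measure (\<Pi>\<^sub>M c\<in>D \<times> {..<2*(N*m)}. compound_Poisson (\<kappa> (fst c) * (u / real m)) (\<mu> (fst c)))
      (near_minimum D (N * m) (a N m) (b N m) (1 / real m)) = prob (A N m)" for N m
  proof -
    have *: "A N m \<in> events" "measure (\<Pi>\<^sub>M c\<in>D \<times> {..<2*(N*m)}. compound_Poisson (\<kappa> (fst c) * (u / real m)) (\<mu> (fst c)))
      (near_minimum D (N * m) (a N m) (b N m) (1 / real m)) = prob (A N m)" if "0 < N" "0 < m"
    proof -
      have "0 < u / real m" "0 < N * m" using u that by auto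
      note S = superposed_near_minimum[OF D ind W \<kappa> \<mu> this b[OF that], of "a N m" "1 / real m"]
      have A_eq: "A N m = {\<omega>\<in>space M. \<exists>j\<in>{a N m..b N m}. \<forall>j'\<in>{..2*(N*m)}.
          (\<Sum>d\<in>D. Wd d \<omega> (cell_left (u / real m) (N * m) j)) \<le> (\<Sum>d\<in>D. Wd d \<omega> (cell_left (u / real m) (N * m) j')) + 1 / real m}"
        unfolding A_def w_def using that by (simp only: simp_thms if_True)
      show "A N m \<in> events" unfolding A_eq by (rule S(1))
      show "measure (\<Pi>\<^sub>M c\<in>D \<times> {..<2*(N*m)}. compound_Poisson (\<kappa> (fst c) * (u / real m)) (\<mu> (fst c)))
        (near_minimum D (N * m) (a N m) (b N m) (1 / real m)) = prob (A N m)"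
        unfolding A_eq by (rule S(2))
    qed
    show "A N m \<in> events"
    proof (cases "0 < N \<and> 0 < m")
      case True
      then show ?thesis by (intro *(1)) auto
    next
      case False
      then have "A N m = {}" unfolding A_def by (rule if_not_P)
      then show ?thesis by simp
    qed
    show "0 < N \<Longrightarrow> 0 < m \<Longrightarrow> measure (\<Pi>\<^sub>M c\<in>D \<times> {..<2*(N*m)}. compound_Poisson (\<kappa> (fst c) * (u / real m)) (\<mu> (fst c)))
      (near_minimum D (N * m) (a N m) (b N m) (1 / real m)) = prob (A N m)" by (rule *(2))
  qed
  \<comment> \<open>Near-minimality for infinitely many meshes on the window of \<open>N\<close>
    units; the mesh limit is taken path by path.\<close>
  define B where "B N = (\<Inter>k. \<Union>m\<in>{k..}. A N m)" for N
  have B: "B N \<in> events" for N unfolding B_def using A(1) by auto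
  have "AE \<omega> in M. \<omega> \<in> (\<Inter>k. \<Union>N\<in>{k..}. B N) \<longrightarrow> \<omega> \<in> E"
    using ne E(2) AE_space
  proof eventually_elim
    case (elim \<omega>)
    have step: "step_path (w \<omega>)"
      unfolding w_def using marked_Poisson_step_path[OF W elim(3)] by (intro step_path_sum[OF D(1)])
    obtain t0 where t0: "\<And>s. w \<omega> t0 \<le> w \<omega> s" using elim(1) by (auto simp: minimum_points_def w_def)
    show ?case
    proof
      assume io: "\<omega> \<in> (\<Inter>k. \<Union>N\<in>{k..}. B N)"
      \<comment> \<open>The window is taken large enough to contain one global minimizer
        \<open>t0\<close>; minimality over the window is then global minimality.\<close>
      obtain k where k: "\<bar>t0\<bar> / u \<le> real k" using real_arch_simple by blast
      obtain N where N: "Suc k \<le> N" "\<omega> \<in> B N" using io by blast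
      have t0N: "t0 \<in> {- (real N * u)..real N * u}"
      proof -
        have "\<bar>t0\<bar> / u \<le> real N" using k N(1) by simp
        then have "\<bar>t0\<bar> \<le> real N * u" using u by (simp add: field_simps)
        then show ?thesis by (auto simp: abs_le_iff)
      qed
      obtain m0 where m0: "\<And>m j. m0 \<le> m \<Longrightarrow> j \<le> 2 * (N * m) \<Longrightarrow>
          (\<forall>j'\<le>2 * (N * m). w \<omega> (cell_left (u / real m) (N * m) j) \<le> w \<omega> (cell_left (u / real m) (N * m) j') + 1 / real m) \<Longrightarrow>
          (\<forall>s\<in>{- (real N * u)..real N * u}. w \<omega> (cell_left (u / real m) (N * m) j) \<le> w \<omega> s)"
        using step_path_grid_minimum[OF step u, of N] unfolding eventually_sequentially by blast
      obtain m where m: "m0 \<le> m" "\<omega> \<in> A N m" using N(2) unfolding B_def by blast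
      have pos: "0 < N" "0 < m" using m(2) by (auto simp: A_def split: if_splits)
      then obtain j where j: "j \<in> {a N m..b N m}" "\<forall>j'\<in>{..2*(N*m)}.
          w \<omega> (cell_left (u / real m) (N * m) j) \<le> w \<omega> (cell_left (u / real m) (N * m) j') + 1 / real m"
        using m(2) unfolding A_def by auto
      have j2: "j \<le> 2 * (N * m)" using j(1) b[OF pos] by simp
      have "w \<omega> (cell_left (u / real m) (N * m) j) \<le> w \<omega> t0"
        using m0[OF m(1) j2] j(2) t0N by blast
      then have "cell_left (u / real m) (N * m) j \<in> minimum_points (\<lambda>t. \<Sum>d\<in>D. Wd d \<omega> t)"
        using t0 unfolding minimum_points_def w_def by (auto intro: order_trans)
      then show "\<omega> \<in> E" using elim(2) I[OF pos j(1)] by blast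
    qed
  qed
  then have BE: "prob (\<Inter>k. \<Union>N\<in>{k..}. B N) \<le> prob E"
    using E(1) by (rule finite_measure_mono_AE)
  have e2: "0 < e / 2" using e by simp
  have "\<forall>\<^sub>F N in sequentially. prob (B N) \<le> prob (\<Inter>k. \<Union>N\<in>{k..}. B N) + e / 2"
    by (rule prob_le_infinitely_often[OF B e2])
  then show ?thesis
    using eventually_gt_at_top[of 0]
  proof eventually_elim
    case (elim N)
    have "\<forall>\<^sub>F m in sequentially. prob (A N m) \<le> prob (B N) + e / 2"
      unfolding B_def by (rule prob_le_infinitely_often[OF A(1) e2])
    then show ?case
      using eventually_gt_at_top[of 0]
    proof eventually_elim
      case (elim m)
      then show ?case using A(2)[OF \<open>0 < N\<close> elim(2)] \<open>prob (B N) \<le> _\<close> BE by linarith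
    qed
  qed
qed

section \<open>Convergence of the minimizers\<close>

lemma limsup_ereal_le:
  fixes a :: "nat \<Rightarrow> real"
  assumes "\<And>e. 0 < e \<Longrightarrow> \<forall>\<^sub>F n in sequentially. a n \<le> c + e"
  shows "limsup (\<lambda>n. ereal (a n)) \<le> ereal c"
proof (rule ereal_le_epsilon2)
  fix e :: real assume "0 < e"
  from assms[OF this] show "limsup (\<lambda>n. ereal (a n)) \<le> ereal c + ereal e"
    by (intro Limsup_bounded) simp
qed

lemma liminf_ereal_ge:
  fixes a :: "nat \<Rightarrow> real"
  assumes "\<And>e. 0 < e \<Longrightarrow> \<forall>\<^sub>F n in sequentially. c \<le> a n + e"
  shows "ereal c \<le> liminf (\<lambda>n. ereal (a n))"
proof (rule ereal_le_epsilon2)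
  fix e :: real assume "0 < e"
  from assms[OF this] have "\<forall>\<^sub>F n in sequentially. ereal (c - e) \<le> ereal (a n)" by eventually_elim auto
  then have "ereal (c - e) \<le> liminf (\<lambda>n. ereal (a n))" by (rule Liminf_bounded)
  then have "ereal (c - e) + ereal e \<le> liminf (\<lambda>n. ereal (a n)) + ereal e" by (rule add_right_mono)
  then show "ereal c \<le> liminf (\<lambda>n. ereal (a n)) + ereal e" by simp
qed

lemma (in prob_space) mark_distribution_distr:
  "Y \<in> borel_measurable M \<Longrightarrow> mark_distribution (distr M borel Y)"
  by (simp add: mark_distribution_def mark_distribution_axioms_def prob_space_distr)

text \<open>The tolerance is spent in fifths: one for tightness, one for the passage from near
  minima to minima of the limit process, two for \<open>minimizer_probability\<close>, one for
  collisions. \<open>N\<close> is fixed first so that the window covers the tightness range, then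
  \<open>m\<close>; \<open>a'\<close> and \<open>b'\<close> describe the half-line \<open>I\<close>
  by index ranges of the grid.\<close>

lemma (in drifting_template_sample) minimizer_limit:
  fixes Q :: "'b measure" and a' b' :: "nat \<Rightarrow> nat \<Rightarrow> nat" and I :: "real set"
  assumes F_supp: "\<And>x. a < \<bar>x\<bar> \<Longrightarrow> F x = 0" and X_supp: "\<And>i. AE \<omega> in M. \<bar>X i \<omega>\<bar> \<le> a" and a: "0 < a"
    and sep: "\<And>r. 0 < r \<Longrightarrow> \<exists>\<kappa>>0. \<forall>s. r \<le> \<bar>s\<bar> \<longrightarrow>
        \<kappa> \<le> expectation (\<lambda>\<omega>. L (Z 0 \<omega> + (F (X 0 \<omega>) - F (X 0 \<omega> - s))) - L (Z 0 \<omega>))"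
    and \<tau>[measurable]: "\<And>n. \<tau> n \<in> borel_measurable M"
    and min: "\<And>n. 0 < n \<Longrightarrow> AE \<omega> in M. \<forall>s. risk n \<omega> (\<tau> n \<omega>) \<le> risk n \<omega> s"
    and Q: "prob_space Q"
    and ind: "prob_space.indep_vars Q (\<lambda>_. \<Pi>\<^sub>M t\<in>UNIV. borel) Wd D"
    and W: "\<And>d. d \<in> D \<Longrightarrow> prob_space.double_sided_marked_Poisson_process Q (lam d)
              (distr M borel (\<lambda>\<omega>. L (Z 0 \<omega> + \<delta> d) - L (Z 0 \<omega>))) (Wd d)"
    and u: "0 < u" and I[measurable]: "I \<in> sets borel"
    and b: "\<And>N m. 0 < N \<Longrightarrow> 0 < m \<Longrightarrow> b' N m \<le> 2 * (N * m)"
    and ab: "\<And>N m. 1 < N \<Longrightarrow> 0 < m \<Longrightarrow> a' N m < b' N m"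
    and cells: "\<And>N m j. 0 < N \<Longrightarrow> 0 < m \<Longrightarrow> j \<in> {a' N m..b' N m} \<Longrightarrow> cell_left (u / real m) (N * m) j \<in> I"
    and cover: "\<And>N m s. 1 < N \<Longrightarrow> 0 < m \<Longrightarrow> s \<in> I \<Longrightarrow> \<bar>s\<bar> \<le> real N * u \<Longrightarrow>
        s \<in> {cell_left (u / real m) (N * m) (a' N m)..cell_left (u / real m) (N * m) (b' N m)}"
    and ne: "AE \<omega> in Q. minimum_points (\<lambda>t. \<Sum>d\<in>D. Wd d \<omega> t) \<noteq> {}"
    and E: "E \<in> sets Q" "AE \<omega> in Q. minimum_points (\<lambda>t. \<Sum>d\<in>D. Wd d \<omega> t) \<inter> I \<noteq> {} \<longrightarrow> \<omega> \<in> E"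
    and e: "0 < e"
  shows "\<forall>\<^sub>F n in sequentially. prob {\<omega>\<in>space M. real n * \<tau> n \<omega> \<in> I} \<le> measure Q E + e"
proof -
  interpret Q: prob_space Q by fact
  let ?\<mu> = "\<lambda>d. distr M borel (\<lambda>\<omega>. L (Z 0 \<omega> + \<delta> d) - L (Z 0 \<omega>))"
  have e5: "0 < e / 5" using e by simp
  obtain K where K: "0 < K" "\<forall>\<^sub>F n in sequentially. \<exists>A\<in>events. prob A \<le> e / 5 \<and>
      (\<forall>\<omega>\<in>space M - A. \<forall>s. K / real n \<le> \<bar>s\<bar> \<longrightarrow> 0 < risk n \<omega> s)"
  proof (rule tightness[OF F_supp X_supp a sep e5])
    fix K assume "0 < K" "\<forall>\<^sub>F n in sequentially. \<exists>A\<in>events. prob A \<le> e / 5 \<and>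
      (\<forall>\<omega>\<in>space M - A. \<forall>s. K / real n \<le> \<bar>s\<bar> \<longrightarrow> 0 < risk n \<omega> s)"
    then show thesis by (rule that)
  qed
  have \<mu>: "mark_distribution (?\<mu> d)" for d by (rule mark_distribution_distr) measurable
  have lim: "\<forall>\<^sub>F N in sequentially. \<forall>\<^sub>F m in sequentially.
    measure (\<Pi>\<^sub>M c\<in>D \<times> {..<2*(N*m)}. compound_Poisson (lam (fst c) * (u / real m)) (?\<mu> (fst c)))
      (near_minimum D (N * m) (a' N m) (b' N m) (1 / real m)) \<le> measure Q E + e / 5"
    by (rule Q.near_minimum_limit[where I=I, OF D_fin D_ne ind W lam_nonneg \<mu> u b cells ne E e5])
  have "\<forall>\<^sub>F N in sequentially. K / u \<le> real N"
    using filterlim_real_sequentially unfolding filterlim_at_top by blast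
  with lim eventually_gt_at_top[of 1] have "\<forall>\<^sub>F N in sequentially. (\<forall>\<^sub>F m in sequentially.
    measure (\<Pi>\<^sub>M c\<in>D \<times> {..<2*(N*m)}. compound_Poisson (lam (fst c) * (u / real m)) (?\<mu> (fst c)))
      (near_minimum D (N * m) (a' N m) (b' N m) (1 / real m)) \<le> measure Q E + e / 5) \<and> 1 < N \<and> K / u \<le> real N"
    by eventually_elim blast
  then obtain N where N: "\<forall>\<^sub>F m in sequentially.
    measure (\<Pi>\<^sub>M c\<in>D \<times> {..<2*(N*m)}. compound_Poisson (lam (fst c) * (u / real m)) (?\<mu> (fst c)))
      (near_minimum D (N * m) (a' N m) (b' N m) (1 / real m)) \<le> measure Q E + e / 5" "1 < N" "K / u \<le> real N"
    using eventually_happens'[OF sequentially_bot] by blast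
  have "(\<lambda>m. (2 * real N * (intensity_bound * u)\<^sup>2) / real m) \<longlonglongrightarrow> 0"
    by (rule tendsto_divide_0[OF tendsto_const]) (intro filterlim_at_top_imp_at_infinity filterlim_real_sequentially)
  then have "\<forall>\<^sub>F m in sequentially. (2 * real N * (intensity_bound * u)\<^sup>2) / real m < e / 5"
    by (rule order_tendstoD(2)) (rule e5)
  with N(1) eventually_gt_at_top[of 0] have "\<forall>\<^sub>F m in sequentially.
    measure (\<Pi>\<^sub>M c\<in>D \<times> {..<2*(N*m)}. compound_Poisson (lam (fst c) * (u / real m)) (?\<mu> (fst c)))
      (near_minimum D (N * m) (a' N m) (b' N m) (1 / real m)) \<le> measure Q E + e / 5 \<and> 0 < m \<and>
    (2 * real N * (intensity_bound * u)\<^sup>2) / real m < e / 5"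
    by eventually_elim blast
  then obtain m where m:
    "measure (\<Pi>\<^sub>M c\<in>D \<times> {..<2*(N*m)}. compound_Poisson (lam (fst c) * (u / real m)) (?\<mu> (fst c)))
      (near_minimum D (N * m) (a' N m) (b' N m) (1 / real m)) \<le> measure Q E + e / 5" "0 < m"
    "(2 * real N * (intensity_bound * u)\<^sup>2) / real m < e / 5"
    using eventually_happens'[OF sequentially_bot] by blast
  have N0: "0 < N" using N(2) by simp
  have \<eta>: "0 < u / real m" and J: "0 < N * m" using u m(2) N0 by auto
  \<comment> \<open>With \<open>N\<close> fixed the number of cells grows like \<open>m\<close>
    while the collision bound per cell falls like \<open>1 / m\<^sup>2\<close>.\<close>
  have "2 * real (N * m) * (intensity_bound * (u / real m))\<^sup>2 = (2 * real N * (intensity_bound * u)\<^sup>2) / real m"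
    using m(2) by (simp add: power2_eq_square)
  then have coll: "2 * real (N * m) * (intensity_bound * (u / real m))\<^sup>2 < e / 5" using m(3) by simp
  \<comment> \<open>Half the grid tolerance, since two approximations of the risk are
    compared.\<close>
  have half: "0 < 1 / (2 * real m)" "2 * (1 / (2 * real m)) = 1 / real m" using m(2) by auto
  have "\<forall>\<^sub>F n in sequentially. prob {\<omega>\<in>space M. real n * \<tau> n \<omega> \<in>
        {cell_left (u / real m) (N * m) (a' N m)..cell_left (u / real m) (N * m) (b' N m)}} \<le>
      measure (\<Pi>\<^sub>M c\<in>D \<times> {..<2*(N*m)}. compound_Poisson (lam (fst c) * (u / real m)) (?\<mu> (fst c)))
        (near_minimum D (N * m) (a' N m) (b' N m) (2 * (1 / (2 * real m)))) + 2 * (e / 5) +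
      2 * real (N * m) * (intensity_bound * (u / real m))\<^sup>2"
    by (rule minimizer_probability[OF \<eta> J ab[OF N(2) m(2)] b[OF N0 m(2)] half(1) e5 \<tau> min])
  then show ?thesis
    using K(2) eventually_gt_at_top[of 0]
  proof eventually_elim
    case (elim n)
    let ?R = "{\<omega>\<in>space M. real n * \<tau> n \<omega> \<in> {cell_left (u / real m) (N * m) (a' N m)..cell_left (u / real m) (N * m) (b' N m)}}"
    obtain A where A: "A \<in> events" "prob A \<le> e / 5" "\<And>\<omega> s. \<omega> \<in> space M - A \<Longrightarrow> K / real n \<le> \<bar>s\<bar> \<Longrightarrow> 0 < risk n \<omega> s"
      using elim(2) by blast
    have R: "?R \<in> events" by measurable
    have "prob {\<omega>\<in>space M. real n * \<tau> n \<omega> \<in> I} \<le> prob (A \<union> ?R)"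
    proof (rule finite_measure_mono_AE)
      show "AE \<omega> in M. \<omega> \<in> {\<omega>\<in>space M. real n * \<tau> n \<omega> \<in> I} \<longrightarrow> \<omega> \<in> A \<union> ?R"
        using min[OF elim(3)]
      proof eventually_elim
        fix \<omega> assume min: "\<forall>s. risk n \<omega> (\<tau> n \<omega>) \<le> risk n \<omega> s"
        show "\<omega> \<in> {\<omega>\<in>space M. real n * \<tau> n \<omega> \<in> I} \<longrightarrow> \<omega> \<in> A \<union> ?R"
        proof (rule impI, rule ccontr)
          assume *: "\<omega> \<in> {\<omega>\<in>space M. real n * \<tau> n \<omega> \<in> I}" "\<omega> \<notin> A \<union> ?R"
          \<comment> \<open>Off \<open>A\<close> the risk is positive outside the window, whereas a
            minimizer cannot exceed the value \<open>0\<close> at the true shift.\<close>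
          have "\<not> \<bar>real n * \<tau> n \<omega>\<bar> \<le> real N * u"
            using cover[OF N(2) m(2), of "real n * \<tau> n \<omega>"] * by blast
          moreover have "K \<le> real N * u" using N(3) u by (simp add: field_simps)
          ultimately have "K \<le> real n * \<bar>\<tau> n \<omega>\<bar>" by (simp add: abs_mult)
          then have "K / real n \<le> \<bar>\<tau> n \<omega>\<bar>" using elim(3) by (simp add: field_simps)
          then have "0 < risk n \<omega> (\<tau> n \<omega>)" using A(3)[of \<omega>] * by auto
          moreover have "risk n \<omega> 0 = 0" by (simp add: risk_def)
          ultimately show False using min[rule_format, of 0] by simp
        qed
      qed
    qed (use A R in auto)
    also have "\<dots> \<le> prob A + prob ?R" by (rule measure_Un_le[OF A(1) R])
    finally show ?case using A(2) elim(1) m(1) coll unfolding half(2) by linarith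
  qed
qed

lemma compactly_supported_vanishes:
  assumes "compactly_supported g" obtains r where "0 < r" "\<And>x. r < \<bar>x\<bar> \<Longrightarrow> g x = 0"
proof -
  have "bounded {x. g x \<noteq> 0}"
    using assms unfolding compactly_supported_def by (meson bounded_subset closure_subset compact_imp_bounded)
  then obtain r where r: "0 < r" "\<forall>x\<in>{x. g x \<noteq> 0}. norm x \<le> r" unfolding bounded_pos by blast
  show thesis by (rule that[OF r(1)]) (use r(2) in force)
qed

lemma (in prob_space) distr_eq_density:
  fixes X :: "'a \<Rightarrow> real"
  assumes "distributed M lborel X (\<lambda>x. ennreal (g x))"
  shows "distr M borel X = density lborel (\<lambda>x. ennreal (g x))"
proof -
  have "distr M borel X = distr M lborel X" by (rule distr_cong) auto
  then show ?thesis using distributed_distr_eq_density[OF assms] by simp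
qed

lemma (in prob_space) even_density_symmetric:
  fixes Z :: "'a \<Rightarrow> real"
  assumes Z: "distributed M lborel Z (\<lambda>z. ennreal (\<phi> z))" and even: "\<And>z. \<phi> (- z) = \<phi> z"
  shows "distr M borel (\<lambda>\<omega>. - Z \<omega>) = distr M borel Z"
proof -
  have "distributed M lborel (\<lambda>\<omega>. 0 + (- 1) * Z \<omega>) (\<lambda>x. ennreal (\<phi> ((x - 0) / (- 1))) / ennreal \<bar>- 1\<bar>)"
    by (rule distributed_affine[OF Z]) simp
  then have "distributed M lborel (\<lambda>\<omega>. - Z \<omega>) (\<lambda>x. ennreal (\<phi> x))" by (simp add: even divide_ennreal_def)
  then show ?thesis using distr_eq_density[OF Z] distr_eq_density by simp
qed

lemma (in prob_space) density_support_bound: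
  fixes X :: "'a \<Rightarrow> real"
  assumes X: "distributed M lborel X (\<lambda>x. ennreal (g x))" and g: "\<And>x. r < \<bar>x\<bar> \<Longrightarrow> g x = 0"
  shows "AE \<omega> in M. \<bar>X \<omega>\<bar> \<le> r"
proof -
  have [measurable]: "X \<in> borel_measurable M" using distributed_measurable[OF X] by simp
  have [measurable]: "(\<lambda>x. ennreal (g x)) \<in> borel_measurable lborel" by (rule distributed_borel_measurable[OF X])
  have "AE x in distr M borel X. \<bar>x\<bar> \<le> r"
    unfolding distr_eq_density[OF X] using g by (subst AE_density) (auto intro!: AE_I2 simp: not_less[symmetric])
  then show ?thesis by (subst (asm) AE_distr_iff) auto
qed

theorem theorem4p13:
  fixes P :: "'a measure" and X Z Y :: "nat \<Rightarrow> 'a \<Rightarrow> real"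
    and f L lam \<phi> :: "real \<Rightarrow> real" and \<theta>s \<alpha> :: real
    and \<theta>h :: "nat \<Rightarrow> 'a \<Rightarrow> real"
    and Q :: "'b measure" and Wd :: "real \<Rightarrow> 'b \<Rightarrow> real \<Rightarrow> real"
    and W :: "'b \<Rightarrow> real \<Rightarrow> real" and tlow thigh :: "'b \<Rightarrow> real"
    and D :: "real set" and \<delta> :: "real \<Rightarrow> real"
  \<comment> \<open>model\<close>
  assumes P: "prob_space P"
    and lam_nonneg: "\<And>x. 0 \<le> lam x" and phi_nonneg: "\<And>z. 0 \<le> \<phi> z"
    and X_density: "\<And>i. distributed P lborel (X i) (\<lambda>x. ennreal (lam x))"
    and Z_density: "\<And>i. distributed P lborel (Z i) (\<lambda>z. ennreal (\<phi> z))"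
    and XZ_indep: "prob_space.indep_vars P (\<lambda>_. borel) (case_sum X Z) UNIV"
    and Y_def: "\<And>i \<omega>. Y i \<omega> = f (X i \<omega> - \<theta>s) + Z i \<omega>"
  \<comment> \<open>basic assumption (1)\<close>
    and f_supp: "compactly_supported f" and f_cadlag: "cadlag f"
    and f_finite: "finite (discontinuities f)"
    and f_ident: "\<And>\<theta>. \<theta> \<noteq> \<theta>s \<Longrightarrow>
          0 < (\<integral>x. (f (x - \<theta>s) - f (x - \<theta>))\<^sup>2 * lam x \<partial>lborel)"
  \<comment> \<open>basic assumption (2)\<close>
    and lam_supp: "compactly_supported lam"
  \<comment> \<open>basic assumption (3)\<close>
    and phi_even: "\<And>z. \<phi> (- z) = \<phi> z"
  \<comment> \<open>basic assumption (4)\<close>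
    and L_nonneg: "\<And>z. 0 \<le> L z" and L_even: "\<And>z. L (- z) = L z"
    and L_mono: "mono_on {0..} L" and L_nonconst: "\<not> L constant_on UNIV"
    and L_Lip: "(\<exists>C. C-lipschitz_on UNIV L) \<or> has_Lipschitz_derivative L"
  \<comment> \<open>basic assumption (5)\<close>
    and M_finite: "\<And>\<theta>. integrable P (\<lambda>\<omega>. m_loss L f \<theta> (X 0 \<omega>) (Y 0 \<omega>))"
    and M_unique: "\<And>\<theta>. \<theta> \<noteq> \<theta>s \<Longrightarrow>
          pop_risk P L f (X 0) (Y 0) \<theta>s < pop_risk P L f (X 0) (Y 0) \<theta>"
    and M_separated: "\<And>r. 0 < r \<Longrightarrow>
          pop_risk P L f (X 0) (Y 0) \<theta>s
            < (INF \<theta>\<in>{\<theta>. r \<le> \<bar>\<theta> - \<theta>s\<bar>}. pop_risk P L f (X 0) (Y 0) \<theta>)"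
  \<comment> \<open>M-estimator\<close>
    and est_meas: "\<And>n. \<theta>h n \<in> borel_measurable P"
    and est_min: "\<And>n. 1 \<le> n \<Longrightarrow>
          AE \<omega> in P. \<theta>h n \<omega> \<in> minimum_points (emp_risk L f X Y n \<omega>)"
  \<comment> \<open>assumptions specific to the theorem\<close>
    and L_second: "bounded_ae_continuous_second_derivative L"
    and D_def: "D = discontinuities (\<lambda>x. f (x - \<theta>s))"
    and f_disc: "discontinuities f \<noteq> {}"
    and alpha: "1/2 < \<alpha>" "\<alpha> \<le> 1" and f_Holder: "piecewise_Holder \<alpha> f"
    and lam_bounded: "\<And>d. d \<in> D \<Longrightarrow> \<exists>C. eventually (\<lambda>x. lam x \<le> C) (nhds d)"
    and lam_cont: "\<And>d. d \<in> D \<Longrightarrow> isCont lam d"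
    and lam_pos: "\<exists>d\<in>D. 0 < lam d"
  \<comment> \<open>limit process\<close>
    and delta_def: "\<And>d. \<delta> d = jump (\<lambda>x. f (x - \<theta>s)) d"
    and Q: "prob_space Q"
    and Wd_Poisson: "\<And>d. d \<in> D \<Longrightarrow>
          prob_space.double_sided_marked_Poisson_process Q (lam d)
            (distr P borel (\<lambda>\<omega>. L (Z 0 \<omega> + \<delta> d) - L (Z 0 \<omega>))) (Wd d)"
    and Wd_indep: "prob_space.indep_vars Q (\<lambda>_. \<Pi>\<^sub>M t\<in>UNIV. borel) Wd D"
    and W_def: "\<And>\<omega> t. W \<omega> t = (\<Sum>d\<in>D. Wd d \<omega> t)"
    and t_meas: "tlow \<in> borel_measurable Q" "thigh \<in> borel_measurable Q"
    and t_ends: "AE \<omega> in Q. tlow \<omega> \<in> closure (minimum_points (W \<omega>)) \<and>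
                   thigh \<omega> \<in> closure (minimum_points (W \<omega>)) \<and>
                   closure (minimum_points (W \<omega>)) \<subseteq> {tlow \<omega>..thigh \<omega>}"
  shows "\<forall>x::real.
      ereal (measure Q {\<omega>\<in>space Q. thigh \<omega> \<le> x})
        \<le> liminf (\<lambda>n. ereal (measure P {\<omega>\<in>space P. real n * (\<theta>h n \<omega> - \<theta>s) \<le> x})) \<and>
      liminf (\<lambda>n. ereal (measure P {\<omega>\<in>space P. real n * (\<theta>h n \<omega> - \<theta>s) \<le> x}))
        \<le> limsup (\<lambda>n. ereal (measure P {\<omega>\<in>space P. real n * (\<theta>h n \<omega> - \<theta>s) \<le> x})) \<and>
      limsup (\<lambda>n. ereal (measure P {\<omega>\<in>space P. real n * (\<theta>h n \<omega> - \<theta>s) \<le> x}))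
        \<le> ereal (measure Q {\<omega>\<in>space Q. tlow \<omega> \<le> x})"
proof (intro allI)
  fix x :: real
  interpret P: prob_space P by fact
  interpret Q: prob_space Q by fact
  define F where "F x = f (x - \<theta>s)" for x
  have D_F: "D = discontinuities F" unfolding D_def F_def[abs_def] ..
  have \<delta>_F: "\<delta> d = jump F d" for d unfolding delta_def F_def[abs_def] ..
  have D_shift: "D = (\<lambda>x. x + \<theta>s) ` discontinuities f" unfolding D_def by (rule discontinuities_shift)
  have D_fin: "finite D" and D_ne: "D \<noteq> {}" using f_finite f_disc by (auto simp: D_shift)
  have "cadlag F" "piecewise_Holder \<alpha> F" "finite (discontinuities F)" "0 < \<alpha>"
    using cadlag_shift[OF f_cadlag] piecewise_Holder_shift[OF f_Holder] D_fin alpha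
    by (auto simp: F_def[abs_def] D_def)
  from piecewise_Holder_continuous_part[OF this(1,3,2,4)]
  obtain H where H: "0 < H" "\<And>x y. \<bar>(F x - (\<Sum>d\<in>D. \<delta> d * indicator {d..} x)) - (F y - (\<Sum>d\<in>D. \<delta> d * indicator {d..} y))\<bar>
      \<le> H * \<bar>x - y\<bar> powr \<alpha>"
    unfolding D_F[symmetric] \<delta>_F[symmetric] by blast
  define G where "G x = F x - (\<Sum>d\<in>D. \<delta> d * indicator {d..} x)" for x
  have G: "\<bar>G x - G y\<bar> \<le> H * \<bar>x - y\<bar> powr \<alpha>" for x y unfolding G_def by (rule H(2))
  obtain L' C0 where L_der: "\<And>z. (L has_real_derivative L' z) (at z)" and C0: "C0-lipschitz_on UNIV L'"
    using L_second unfolding bounded_ae_continuous_second_derivative_def by blast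
  \<comment> \<open>Makes the Lipschitz constant positive, as the bound on the square of
    \<open>L'\<close> divides by it.\<close>
  define C where "C = max C0 1"
  have L'_lip: "\<bar>L' x - L' y\<bar> \<le> C * \<bar>x - y\<bar>" for x y
  proof -
    have "\<bar>L' x - L' y\<bar> \<le> C0 * \<bar>x - y\<bar>" using lipschitz_onD[OF C0, of x y] by (simp add: dist_real_def)
    also have "\<dots> \<le> C * \<bar>x - y\<bar>" by (intro mult_right_mono) (auto simp: C_def)
    finally show ?thesis .
  qed
  obtain rf where rf: "0 < rf" "\<And>x. rf < \<bar>x\<bar> \<Longrightarrow> f x = 0" by (rule compactly_supported_vanishes[OF f_supp]) blast
  obtain rl where rl: "0 < rl" "\<And>x. rl < \<bar>x\<bar> \<Longrightarrow> lam x = 0" by (rule compactly_supported_vanishes[OF lam_supp]) blast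
  \<comment> \<open>One radius for the support of \<open>F\<close>, which is \<open>f\<close> moved
    by \<open>\<theta>s\<close>, and for the design.\<close>
  define a where "a = rf + \<bar>\<theta>s\<bar> + rl"
  have a: "0 < a" using rf rl by (simp add: a_def)
  have F_supp: "F x = 0" if "a < \<bar>x\<bar>" for x unfolding F_def using that rl by (intro rf(2)) (auto simp: a_def)
  have X_supp: "AE \<omega> in P. \<bar>X i \<omega>\<bar> \<le> a" for i
    by (rule P.density_support_bound[OF X_density]) (rule rl(2), use rf in \<open>auto simp: a_def\<close>)
  define B where "B = \<bar>G 0\<bar> + H * a powr \<alpha> + (\<Sum>d\<in>D. \<bar>\<delta> d\<bar>)"
  have F_bdd: "\<bar>F x\<bar> \<le> B" for x
  proof (cases "a < \<bar>x\<bar>")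
    case True
    then show ?thesis using F_supp[OF True] H(1) by (simp add: B_def sum_nonneg)
  next
    case False
    have "\<bar>G x - G 0\<bar> \<le> H * \<bar>x\<bar> powr \<alpha>" using G[of x 0] by simp
    also have "\<dots> \<le> H * a powr \<alpha>" using False H(1) alpha by (intro mult_left_mono powr_mono2) auto
    finally have "\<bar>G x\<bar> \<le> \<bar>G 0\<bar> + H * a powr \<alpha>" by linarith
    moreover have "\<bar>\<Sum>d\<in>D. \<delta> d * indicator {d..} x\<bar> \<le> (\<Sum>d\<in>D. \<bar>\<delta> d\<bar>)"
      by (rule order_trans[OF sum_abs]) (intro sum_mono, auto simp: indicator_def)
    moreover have "F x = G x + (\<Sum>d\<in>D. \<delta> d * indicator {d..} x)" by (simp add: G_def)
    ultimately show ?thesis unfolding B_def by linarith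
  qed
  have loss: "m_loss L f (\<theta>s + s) (X i \<omega>) (Y i \<omega>) = L (Z i \<omega> + (F (X i \<omega>) - F (X i \<omega> - s)))" for s i \<omega>
    by (simp add: m_loss_def Y_def F_def algebra_simps)
  have L_int: "integrable P (\<lambda>\<omega>. L (Z 0 \<omega> + (F (X 0 \<omega>) - F (X 0 \<omega> - s))))" for s
    using M_finite[of "\<theta>s + s"] unfolding loss .
  interpret T: template_sample P X Z lam F G L L' D \<delta> C H B \<alpha>
  proof unfold_locales
    show "P.indep_vars (\<lambda>_. borel) (case_sum X Z) UNIV" by (rule XZ_indep)
    show "distr P borel (Z i) = distr P borel (Z 0)" for i
      unfolding P.distr_eq_density[OF Z_density] ..
    show "distr P borel (\<lambda>\<omega>. - Z 0 \<omega>) = distr P borel (Z 0)"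
      by (rule P.even_density_symmetric[OF Z_density phi_even])
    show "integrable P (\<lambda>\<omega>. L (Z 0 \<omega>))" using L_int[of 0] by simp
    show "isCont lam d" if "d \<in> D" for d by (rule lam_cont[OF that])
  qed (use X_density lam_nonneg L_der L'_lip L_nonneg L_even G H(1) alpha D_fin D_ne F_bdd in \<open>auto simp: C_def G_def\<close>)
  let ?\<mu> = "\<lambda>d. distr P borel (\<lambda>\<omega>. L (Z 0 \<omega> + \<delta> d) - L (Z 0 \<omega>))"
  note [measurable] = T.L_meas
  have mark_meas: "(\<lambda>\<omega>. L (Z 0 \<omega> + \<delta> d) - L (Z 0 \<omega>)) \<in> borel_measurable P" for d by measurable
  have W_eq: "W \<omega> = (\<lambda>t. \<Sum>d\<in>D. Wd d \<omega> t)" for \<omega> by (intro ext W_def)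
  \<comment> \<open>The endpoints \<open>tlow\<close> and \<open>thigh\<close> make the set of
    minimum points nonempty and bounded almost surely, from which positivity of the drift is
    drawn.\<close>
  have ends: "AE \<omega> in Q. minimum_points (\<lambda>t. \<Sum>d\<in>D. Wd d \<omega> t) \<noteq> {} \<and>
      minimum_points (\<lambda>t. \<Sum>d\<in>D. Wd d \<omega> t) \<subseteq> {tlow \<omega>..thigh \<omega>}"
    using t_ends
  proof eventually_elim
    case (elim \<omega>)
    let ?m = "minimum_points (\<lambda>t. \<Sum>d\<in>D. Wd d \<omega> t)"
    have m: "tlow \<omega> \<in> closure ?m" "closure ?m \<subseteq> {tlow \<omega>..thigh \<omega>}" using elim unfolding W_eq by simp_all
    then have "?m \<noteq> {}" by (metis closure_empty empty_iff)
    moreover have "?m \<subseteq> {tlow \<omega>..thigh \<omega>}" using closure_subset m(2) by (rule subset_trans)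
    ultimately show ?case by (rule conjI)
  qed
  have ne: "AE \<omega> in Q. minimum_points (\<lambda>t. \<Sum>d\<in>D. Wd d \<omega> t) \<noteq> {}" using ends by eventually_elim blast
  interpret drifting_template_sample P X Z lam F G L L' D \<delta> C H B \<alpha>
  proof unfold_locales
    have "0 < (\<Sum>d\<in>D. lam d * (\<integral>x. x \<partial>?\<mu> d))"
    proof (rule Q.drift_positive[OF D_fin D_ne Wd_indep Wd_Poisson lam_nonneg])
      show "mark_distribution (?\<mu> d)" for d by (rule P.mark_distribution_distr[OF mark_meas])
      show "integrable (?\<mu> d) (\<lambda>x. x\<^sup>2)" for d
        using T.increment_square_integrable[of 0 "\<delta> d"] by (subst integrable_distr_eq[OF mark_meas]) auto
      show "AE \<omega> in Q. minimum_points (\<lambda>t. \<Sum>d\<in>D. Wd d \<omega> t) \<noteq> {} \<and> bounded (minimum_points (\<lambda>t. \<Sum>d\<in>D. Wd d \<omega> t))"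
        using ends by eventually_elim (auto intro: bounded_subset[OF bounded_closed_interval])
    qed auto
    then show "0 < (\<Sum>d\<in>D. lam d * P.expectation (\<lambda>\<omega>. L (Z 0 \<omega> + \<delta> d) - L (Z 0 \<omega>)))"
      by (subst (asm) integral_distr[OF mark_meas]) auto
  qed
  \<comment> \<open>The separation of the population risk, rewritten as a uniform positive gap for
    the mean increments of the loss.\<close>
  have sep: "\<exists>\<kappa>>0. \<forall>s. r \<le> \<bar>s\<bar> \<longrightarrow>
        \<kappa> \<le> P.expectation (\<lambda>\<omega>. L (Z 0 \<omega> + (F (X 0 \<omega>) - F (X 0 \<omega> - s))) - L (Z 0 \<omega>))" if r: "0 < r" for r
  proof (intro exI conjI allI impI)
    let ?p = "pop_risk P L f (X 0) (Y 0)"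
    let ?I = "INF \<theta>\<in>{\<theta>. r \<le> \<bar>\<theta> - \<theta>s\<bar>}. ?p \<theta>"
    show "0 < ?I - ?p \<theta>s" using M_separated[OF r] by simp
    fix s :: real assume s: "r \<le> \<bar>s\<bar>"
    have pop: "?p (\<theta>s + s) = P.expectation (\<lambda>\<omega>. L (Z 0 \<omega> + (F (X 0 \<omega>) - F (X 0 \<omega> - s))))" for s
      unfolding pop_risk_def loss ..
    have "bdd_below (?p ` {\<theta>. r \<le> \<bar>\<theta> - \<theta>s\<bar>})"
      by (rule bdd_belowI2[of _ 0]) (simp add: pop_risk_def m_loss_def L_nonneg)
    then have "?I \<le> ?p (\<theta>s + s)" by (rule cINF_lower) (use s in simp)
    then have "?I - ?p \<theta>s \<le> ?p (\<theta>s + s) - ?p (\<theta>s + 0)" by simp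
    also have "\<dots> = P.expectation (\<lambda>\<omega>. L (Z 0 \<omega> + (F (X 0 \<omega>) - F (X 0 \<omega> - s))) - L (Z 0 \<omega>))"
      unfolding pop using L_int[of s] L_int[of 0] by simp
    finally show "?I - ?p \<theta>s \<le> P.expectation (\<lambda>\<omega>. L (Z 0 \<omega> + (F (X 0 \<omega>) - F (X 0 \<omega> - s))) - L (Z 0 \<omega>))" .
  qed
  define \<tau> where "\<tau> n \<omega> = \<theta>h n \<omega> - \<theta>s" for n \<omega>
  have \<tau>[measurable]: "\<tau> n \<in> borel_measurable P" for n
    using est_meas[of n] unfolding \<tau>_def[abs_def] by measurable
  have min: "AE \<omega> in P. \<forall>s. T.risk n \<omega> (\<tau> n \<omega>) \<le> T.risk n \<omega> s" if n: "0 < n" for n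
  proof -
    have risk_eq: "T.risk n \<omega> s = real n * (emp_risk L f X Y n \<omega> (\<theta>s + s) - emp_risk L f X Y n \<omega> (\<theta>s + 0))" for \<omega> s
      unfolding T.risk_def emp_risk_def loss using n by (simp add: sum_subtractf right_diff_distrib)
    have "1 \<le> n" using n by simp
    from est_min[OF this] show ?thesis
    proof eventually_elim
      case (elim \<omega>)
      then have "emp_risk L f X Y n \<omega> (\<theta>h n \<omega>) \<le> emp_risk L f X Y n \<omega> (\<theta>s + s)" for s by (simp add: minimum_points_def)
      then show ?case unfolding risk_eq \<tau>_def by (auto intro!: mult_left_mono)
    qed
  qed
  \<comment> \<open>With unit \<open>|x|\<close> the point \<open>x\<close> is one unit away from
    the origin and hence a grid time for every mesh; for \<open>x = 0\<close> any unit will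
    do.\<close>
  define u where "u = (if x = 0 then 1 else \<bar>x\<bar>)"
  have u: "0 < u" by (simp add: u_def)
  \<comment> \<open>Index of \<open>x\<close>: the origin has index \<open>N * m\<close> and one
    unit contains \<open>m\<close> cells.\<close>
  define jx where "jx N m = (if x = 0 then N * m else if 0 < x then N * m + m else N * m - m)" for N m :: nat
  have m_le: "m \<le> N * m" if "0 < N" for N m :: nat using that by simp
  have m_less: "m < N * m" if "1 < N" "0 < m" for N m :: nat using that by simp
  have jx_le: "jx N m \<le> 2 * (N * m)" if "0 < N" for N m using m_le[OF that, of m] unfolding jx_def by auto
  have jx_pos: "0 < jx N m" "jx N m < 2 * (N * m)" if N: "1 < N" and m: "0 < m" for N m
  proof -
    have "m < N * m" using N m by (rule m_less)
    then obtain k where k: "N * m = m + k" "0 < k" using less_imp_add_positive by metis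
    show "0 < jx N m" "jx N m < 2 * (N * m)" unfolding jx_def k(1) using k(2) m by auto
  qed
  have jx: "cell_left (u / real m) (N * m) (jx N m) = x" if "0 < N" "0 < m" for N m
    using m_le[OF that(1), of m] that(2) by (simp add: cell_left_def jx_def u_def of_nat_diff)
  have \<eta>: "0 < u / real m" if "0 < m" for m :: nat using u that by simp
  have ends_at: "cell_left (u / real m) (N * m) 0 = - (real N * u)" "cell_left (u / real m) (N * m) (2 * (N * m)) = real N * u"
    if "0 < m" for N m using that unfolding cell_left_ends by auto
  note limit = minimizer_limit[OF F_supp X_supp a sep \<tau> min Q Wd_indep Wd_Poisson u]
  \<comment> \<open>A minimum point in \<open>{..x}\<close> forces \<open>tlow \<le> x\<close>; the
    index range starts at the left end of the window.\<close>
  have left: "\<forall>\<^sub>F n in sequentially. P.prob {\<omega>\<in>space P. real n * \<tau> n \<omega> \<in> {..x}} \<le> Q.prob {\<omega>\<in>space Q. tlow \<omega> \<le> x} + e"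
    if "0 < e" for e
  proof (rule limit[where a'="\<lambda>_ _. 0" and b'=jx])
    show "cell_left (u / real m) (N * m) j \<in> {..x}" if "0 < N" "0 < m" "j \<in> {0..jx N m}" for N m j
      using cell_left_mono[OF \<eta>[OF that(2)], of j "jx N m" "N * m"] that jx[OF that(1,2)] by simp
    show "s \<in> {cell_left (u / real m) (N * m) 0..cell_left (u / real m) (N * m) (jx N m)}"
      if "1 < N" "0 < m" "s \<in> {..x}" "\<bar>s\<bar> \<le> real N * u" for N m s
      using that jx[of N m] ends_at[OF that(2), of N] by (simp add: abs_le_iff)
    show "AE \<omega> in Q. minimum_points (\<lambda>t. \<Sum>d\<in>D. Wd d \<omega> t) \<inter> {..x} \<noteq> {} \<longrightarrow> \<omega> \<in> {\<omega> \<in> space Q. tlow \<omega> \<le> x}"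
      using ends AE_space by eventually_elim fastforce
    show "{\<omega> \<in> space Q. tlow \<omega> \<le> x} \<in> Q.events" using t_meas by measurable
  qed (use that ne jx_le jx_pos in auto)
  have right: "\<forall>\<^sub>F n in sequentially. P.prob {\<omega>\<in>space P. real n * \<tau> n \<omega> \<in> {x..}} \<le> Q.prob {\<omega>\<in>space Q. x < thigh \<omega>} + e"
    if "0 < e" for e
  proof (rule limit[where a'=jx and b'="\<lambda>N m. 2 * (N * m)"])
    show "cell_left (u / real m) (N * m) j \<in> {x..}" if "0 < N" "0 < m" "j \<in> {jx N m..2 * (N * m)}" for N m j
      using cell_left_mono[OF \<eta>[OF that(2)], of "jx N m" j "N * m"] that jx[OF that(1,2)] by simp
    show "s \<in> {cell_left (u / real m) (N * m) (jx N m)..cell_left (u / real m) (N * m) (2 * (N * m))}"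
      if "1 < N" "0 < m" "s \<in> {x..}" "\<bar>s\<bar> \<le> real N * u" for N m s
      using that jx[of N m] ends_at[OF that(2), of N] by (simp add: abs_le_iff)
    have "AE \<omega> in Q. \<forall>d\<in>D. \<forall>\<^sub>F s in at_right x. Wd d \<omega> s = Wd d \<omega> x"
      by (rule AE_finite_allI[OF D_fin]) (rule Q.marked_Poisson_right_constant[OF Wd_Poisson])
    with ends AE_space
    show "AE \<omega> in Q. minimum_points (\<lambda>t. \<Sum>d\<in>D. Wd d \<omega> t) \<inter> {x..} \<noteq> {} \<longrightarrow> \<omega> \<in> {\<omega> \<in> space Q. x < thigh \<omega>}"
    proof eventually_elim
      case (elim \<omega>)
      let ?m = "minimum_points (\<lambda>t. \<Sum>d\<in>D. Wd d \<omega> t)"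
      have "x < thigh \<omega>" if t: "t \<in> ?m" "x \<le> t" for t
      proof (cases "t = x")
        case False
        then show ?thesis using t elim(1) by fastforce
      next
        \<comment> \<open>The minimum value at \<open>x\<close> persists immediately to the right,
          which yields a minimum point beyond \<open>x\<close> and hence the strict
          inequality.\<close>
        case True
        have "\<forall>\<^sub>F s in at_right x. \<forall>d\<in>D. Wd d \<omega> s = Wd d \<omega> x"
          using elim(3) by (intro eventually_ball_finite[OF D_fin]) blast
        then have "\<forall>\<^sub>F s in at_right x. x < s \<and> (\<forall>d\<in>D. Wd d \<omega> s = Wd d \<omega> x)"
          using eventually_at_right_beyond by eventually_elim blast
        then obtain s where s: "x < s" "\<forall>d\<in>D. Wd d \<omega> s = Wd d \<omega> x"
          using eventually_happens'[OF trivial_limit_at_right_real] by blast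
        then have "s \<in> ?m" using t(1) True by (simp add: minimum_points_def)
        then show ?thesis using elim(1) s(1) by fastforce
      qed
      then show ?case using elim(2) by auto
    qed
    show "{\<omega> \<in> space Q. x < thigh \<omega>} \<in> Q.events" using t_meas by measurable
  qed (use that ne jx_le jx_pos in auto)
  let ?p = "\<lambda>n. P.prob {\<omega>\<in>space P. real n * (\<theta>h n \<omega> - \<theta>s) \<le> x}"
  have "ereal (Q.prob {\<omega>\<in>space Q. thigh \<omega> \<le> x}) \<le> liminf (\<lambda>n. ereal (?p n))"
  \<comment> \<open>Passage to complements; strictness in \<open>x < thigh\<close> is what makes the
    complement exactly \<open>thigh \<le> x\<close>.\<close>
  proof (rule liminf_ereal_ge)
    fix e :: real assume "0 < e"
    from right[OF this] show "\<forall>\<^sub>F n in sequentially. Q.prob {\<omega>\<in>space Q. thigh \<omega> \<le> x} \<le> ?p n + e"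
    proof eventually_elim
      case (elim n)
      have "Q.prob {\<omega>\<in>space Q. \<not> thigh \<omega> \<le> x} = 1 - Q.prob {\<omega>\<in>space Q. thigh \<omega> \<le> x}"
        using t_meas by (intro Q.prob_neg) measurable
      moreover have "P.prob {\<omega>\<in>space P. \<not> real n * \<tau> n \<omega> \<le> x} = 1 - P.prob {\<omega>\<in>space P. real n * \<tau> n \<omega> \<le> x}"
        by (intro P.prob_neg) measurable
      moreover have "P.prob {\<omega>\<in>space P. \<not> real n * \<tau> n \<omega> \<le> x} \<le> P.prob {\<omega>\<in>space P. real n * \<tau> n \<omega> \<in> {x..}}"
        by (rule P.finite_measure_mono) auto
      ultimately show ?case using elim by (simp add: not_le \<tau>_def)
    qed
  qed
  moreover have "limsup (\<lambda>n. ereal (?p n)) \<le> ereal (Q.prob {\<omega>\<in>space Q. tlow \<omega> \<le> x})"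
    using left by (intro limsup_ereal_le) (simp add: \<tau>_def)
  moreover have "liminf (\<lambda>n. ereal (?p n)) \<le> limsup (\<lambda>n. ereal (?p n))"
    by (rule Liminf_le_Limsup) simp
  ultimately show "ereal (Q.prob {\<omega>\<in>space Q. thigh \<omega> \<le> x}) \<le> liminf (\<lambda>n. ereal (?p n)) \<and>
      liminf (\<lambda>n. ereal (?p n)) \<le> limsup (\<lambda>n. ereal (?p n)) \<and>
      limsup (\<lambda>n. ereal (?p n)) \<le> ereal (Q.prob {\<omega>\<in>space Q. tlow \<omega> \<le> x})" by blast
qed


end
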